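(* The assignments $F$ described in the context (sending an orbifold atlas $\mathcal U$ to the groupoid object $F(\mathcal U)=(R\rightrightarrows U)$, a compatible system $\tilde f$ to the morphism $F(\tilde f)=(\psi,\Psi)$, and a natural transformation $\delta$ of compatible systems to the natural transformation $F(\delta)=\alpha$) define a (strict) 2-functor $F$ from the 2-category $(\textbf{Pre-Orb})$ to the 2-category $(\textbf{Grp})$.
   Context: 2-categories and 2-functors are meant in the strict sense (composition of 1-morphisms and horizontal composition of 2-morphisms are strictly associative and unital, and a 2-functor preserves all compositions and identities strictly and is a functor on each hom-category). ATLASES. Let $X$ be a paracompact second countable Hausdorff space and $U\subseteq X$ open and non-empty. A (reduced complex) uniformizing system of dimension $n$ for $U$ is a triple $(\widetilde U,G,\pi)$ where $\widetilde U\subseteq\mathbb C^n$ is a non-empty connected open set, $G$ is a finite group of holomorphic automorphisms of $\widetilde U$ ($G$ is a set of maps), and $\pi:\widetilde U\to U$ is continuous, surjective, $G$-invariant and induces a homeomorphism $\widetilde U/G\to U$. An embedding from $(\widetilde U,G,\pi)$ (for $U$) to $(\widetilde V,H,\phi)$ (for $V$, with $U\subseteq V$) is a holomorphic embedding $\lambda:\widetilde U\to\widetilde V$ with $\phi\circ\lambda=\pi$. A (reduced complex) orbifold atlas of dimension $n$ on $X$ is a family $\mathcal U=\{(\widetilde U_i,G_i,\pi_i)\}_{i\in I}$ of uniformizing systems of dimension $n$ for open sets $U_i=\pi_i(\widetilde U_i)$ of $X$ such that (i) the $U_i$ cover $X$; (ii) for all $i,j\in I$ and $x\in U_i\cap U_j$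 there are an open neighborhood $U_k\subseteq U_i\cap U_j$ of $x$, a uniformizing system $(\widetilde U_k,G_k,\pi_k)\in\mathcal U$ for $U_k$, and embeddings $\lambda_{ki}$, $\lambda_{kj}$ of it into $(\widetilde U_i,G_i,\pi_i)$ and $(\widetilde U_j,G_j,\pi_j)$. An atlas is also regarded as a category: objects are its uniformizing systems, morphisms are all embeddings between them. THE 2-CATEGORY $(\textbf{Pre-Orb})$. Objects: all orbifold atlases. Let $\mathcal U$, $\mathcal V$ be atlases on $X$, $Y$ and $f:X\to Y$ continuous. A compatible system $\tilde f:\mathcal U\to\mathcal V$ for $f$ consists of (1) a functor $\tilde f:\mathcal U\to\mathcal V$ such that, writing $(\widetilde V_i,H_i,\phi_i)$ for the image of $(\widetilde U_i,G_i,\pi_i)$, one has $f(\pi_i(\widetilde U_i))\subseteq\phi_i(\widetilde V_i)$; (2) for each $(\widetilde U_i,G_i,\pi_i)\in\mathcal U$ a holomorphic map $\tilde f_{\widetilde U_i,\widetilde V_i}:\widetilde U_i\to\widetilde V_i$ with $\phi_i\circ\tilde f_{\widetilde U_i,\widetilde V_i}=f\circ\pi_i$; such that $\tilde f_{\widetilde U_j,\widetilde V_j}\circ\lambda_{ij}=\tilde f(\lambda_{ij})\circ\tilde f_{\widetilde U_i,\widetilde V_i}$ for every embedding $\lambda_{ij}:(\widetilde U_i,G_i,\pi_i)\to(\widetilde U_j,G_j,\pi_j)$ in $\mathcal U$. Morphisms $\mathcal U\to\mathcal V$: all compatible systems for all continuous $f$. Composition $\tilde g\circ\tilde f$: composite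 functor with liftings $\tilde g_{\widetilde V_i,\widetilde W_i}\circ\tilde f_{\widetilde U_i,\widetilde V_i}$. Identity $1_{\mathcal U}$: identity functor with liftings $1_{\widetilde U_i}$. For compatible systems $\tilde f_1,\tilde f_2:\mathcal U\to\mathcal V$ for the same $f$, write $(\widetilde V_i^m,H_i^m,\phi_i^m)=\tilde f_m(\widetilde U_i,G_i,\pi_i)$ and $\lambda_{ij}^m=\tilde f_m(\lambda_{ij})$, $m=1,2$. A natural transformation $\delta:\tilde f_1\Rightarrow\tilde f_2$ is a family of embeddings $\delta_{\widetilde U_i}:(\widetilde V_i^1,H_i^1,\phi_i^1)\to(\widetilde V_i^2,H_i^2,\phi_i^2)$ in $\mathcal V$ with (i) $(\tilde f_2)_{\widetilde U_i,\widetilde V_i^2}=\delta_{\widetilde U_i}\circ(\tilde f_1)_{\widetilde U_i,\widetilde V_i^1}$ for all $i$; (ii) $\lambda_{ij}^2\circ\delta_{\widetilde U_i}=\delta_{\widetilde U_j}\circ\lambda_{ij}^1$ for every embedding $\lambda_{ij}$ in $\mathcal U$. 2-morphisms are these (none if the underlying continuous maps differ). Vertical composition: $(\sigma\odot\delta)_{\widetilde U_i}=\sigma_{\widetilde U_i}\circ\delta_{\widetilde U_i}$. Identities: $(i_{\tilde f})_{\widetilde U_i}=1_{\widetilde V_i}$ and $i_{\mathcal U}=i_{1_{\mathcal U}}$. Horizontal composition of $\delta:\tilde f_1\Rightarrow\tilde f_2:\mathcal U\to\mathcal V$ and $\eta:\tilde g_1\Rightarrow\tilde g_2:\mathcal V\to\mathcal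 W$: $(\eta\ast\delta)_{\widetilde U_i}=\eta_{\widetilde V_i^2}\circ\tilde g_1(\delta_{\widetilde U_i})$. THE 2-CATEGORY $(\textbf{Grp})$. A groupoid object in a category consists of objects $R,U$ and morphisms $s,t:R\to U$ (with the fiber product ${R}\,_t\times_s R$ existing), $m:{R}\,_t\times_s R\to R$, $i:R\to R$, $e:U\to R$ with: $s\circ e=1_U=t\circ e$; $s\circ m=s\circ pr_1$, $t\circ m=t\circ pr_2$; $m\circ(1_R\times m)=m\circ(m\times 1_R)$; $m\circ(e\circ s,1_R)=1_R=m\circ(1_R,e\circ t)$; $i\circ i=1_R$, $s\circ i=t$, $t\circ i=s$, $m\circ(1_R,i)=e\circ s$, $m\circ(i,1_R)=e\circ t$. It is denoted $R\rightrightarrows U$. In the category of complex manifolds and holomorphic maps it is étale if $s,t$ are local biholomorphisms, proper if $(s,t):R\to U\times U$ is proper, and (étale proper) effective if for every $x\in U$ the map sending $g\in R_x:=(s,t)^{-1}(x,x)$ to the germ at $x$ of $t\circ(s|_{W_g})^{-1}$ ($W_g$ a small open neighborhood of $g$ on which $s,t$ are invertible) is injective. Objects of $(\textbf{Grp})$: proper étale effective groupoid objects in complex manifolds. A morphism $(\psi,\Psi):(R\rightrightarrows U)\to(R'\rightrightarrows U')$ is a pair of holomorphic maps $\psi:U\to U'$, $\Psi:R\to R'$ with $s'\Psi=\psi s$, $t'\Psi=\psi t$, $\Psi e=e'\psi$, $\Psi m=m'(\Psi\times\Psi)$, $\Psi i=i'\Psi$; composition and identities are componentwise. A natural transformation $\alpha:(\psi,\Psi)\Rightarrow(\phi,\Phi)$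 between such morphisms is a holomorphic $\alpha:U\to R'$ with $s'\alpha=\psi$, $t'\alpha=\phi$ and $m'\circ(\alpha\circ s,\Phi)=m'\circ(\Psi,\alpha\circ t)$. Vertical composition: $\beta\odot\alpha=m'\circ(\alpha,\beta)$; identity: $i_{(\psi,\Psi)}=e'\circ\psi$; horizontal composition of $\alpha:(\psi_1,\Psi_1)\Rightarrow(\psi_2,\Psi_2)$ and $\beta:(\phi_1,\Phi_1)\Rightarrow(\phi_2,\Phi_2)$ (with values in $R''\rightrightarrows U''$): $\beta\ast\alpha=m''\circ(\Phi_1\circ\alpha,\beta\circ\psi_2)$. THE ASSIGNMENT $F$ ON OBJECTS. Given an atlas $\mathcal U=\{(\widetilde U_i,G_i,\pi_i)\}_{i\in I}$, let $U=\coprod_{i\in I}\widetilde U_i$ (points written $(\tilde x_i,\widetilde U_i)$ with $\tilde x_i\in\widetilde U_i$). Let $\hat R=\coprod\widetilde U_k^{\lambda_{ki},\lambda_{kj}}$, the disjoint union over all pairs of embeddings $\lambda_{ki},\lambda_{kj}$ in $\mathcal U$ with common source $(\widetilde U_k,G_k,\pi_k)$ and targets $(\widetilde U_i,G_i,\pi_i)$, $(\widetilde U_j,G_j,\pi_j)$, of a copy of $\widetilde U_k$; its points are written $(\lambda_{ki},\tilde x_k,\lambda_{kj})$. Put $(\lambda_{ki},\tilde x_k,\lambda_{kj})\sim(\lambda_{li},\tilde x_l,\lambda_{lj})$ iff there are $(\widetilde U_m,G_m,\pi_m)\in\mathcal U$, $\tilde x_m\in\widetilde U_m$ and embeddings $\lambda_{mk},\lambda_{ml}$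 into $\widetilde U_k$, $\widetilde U_l$ with $\lambda_{ki}\lambda_{mk}=\lambda_{li}\lambda_{ml}$, $\lambda_{kj}\lambda_{mk}=\lambda_{lj}\lambda_{ml}$, $\lambda_{mk}(\tilde x_m)=\tilde x_k$, $\lambda_{ml}(\tilde x_m)=\tilde x_l$. Let $R=\hat R/\sim$ with quotient map $q$, quotient topology, classes $[\lambda_{ki},\tilde x_k,\lambda_{kj}]$, and complex manifold charts $q(\widetilde U_k^{\lambda_{ki},\lambda_{kj}})\to\widetilde U_k$, $[\lambda_{ki},\tilde x_k,\lambda_{kj}]\mapsto\tilde x_k$. Structure maps: $s[\lambda_{ki},\tilde x_k,\lambda_{kj}]=(\lambda_{ki}(\tilde x_k),\widetilde U_i)$, $t[\lambda_{ki},\tilde x_k,\lambda_{kj}]=(\lambda_{kj}(\tilde x_k),\widetilde U_j)$, $e(\tilde x_i,\widetilde U_i)=[1_{\widetilde U_i},\tilde x_i,1_{\widetilde U_i}]$, $i[\lambda_{ki},\tilde x_k,\lambda_{kj}]=[\lambda_{kj},\tilde x_k,\lambda_{ki}]$, and, when $\lambda_{ij}(\tilde x_i)=\lambda_{kj}(\tilde x_k)$, $m([\lambda_{ih},\tilde x_i,\lambda_{ij}],[\lambda_{kj},\tilde x_k,\lambda_{kl}])=[\lambda_{ih}\lambda_{fi},\tilde x_f,\lambda_{kl}\lambda_{fk}]$ for any $(\widetilde U_f,G_f,\pi_f)\in\mathcal U$, $\tilde x_f\in\widetilde U_f$ and embeddings $\lambda_{fi},\lambda_{fk}$ with $\lambda_{ij}\lambda_{fi}=\lambda_{kj}\lambda_{fk}$,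 $\lambda_{fi}(\tilde x_f)=\tilde x_i$, $\lambda_{fk}(\tilde x_f)=\tilde x_k$. Then $F(\mathcal U)=(R\rightrightarrows U)$. $F$ ON MORPHISMS AND 2-MORPHISMS. For a compatible system $\tilde f:\mathcal U\to\mathcal V$ with $F(\mathcal U)=(R\rightrightarrows U)$, $F(\mathcal V)=(R'\rightrightarrows U')$, $F(\tilde f)=(\psi,\Psi)$ where $\psi|_{\widetilde U_i}=\tilde f_{\widetilde U_i,\widetilde V_i}:\widetilde U_i\to\widetilde V_i\subseteq U'$ and $\Psi([\lambda_{ki},\tilde x_k,\lambda_{kj}])=[\tilde f(\lambda_{ki}),\tilde f_{\widetilde U_k,\widetilde V_k}(\tilde x_k),\tilde f(\lambda_{kj})]$. For a natural transformation $\delta:\tilde f_1\Rightarrow\tilde f_2$, $F(\delta)=\alpha:U\to R'$ with $\alpha(\tilde x_i,\widetilde U_i)=[1_{\widetilde V_i^1},(\tilde f_1)_{\widetilde U_i,\widetilde V_i^1}(\tilde x_i),\delta_{\widetilde U_i}]$. *)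

theory Defs
  imports "HOL-Analysis.Analysis" "HOL-Analysis.Finite_Function_Topology" "HOL-Algebra.Bij"
begin

section \<open>Strict 2-categories and strict 2-functors\<close>

text \<open>
  The operations take the boundary of the composed cells as explicit arguments, so that a
  1- or 2-morphism need not carry its own source and target:
  \<open>Comp C X Y Z g f\<close> is \<open>g \<circ> f : X \<rightarrow> Y \<rightarrow> Z\<close>;
  \<open>VComp C X Y f g h \<tau> \<sigma>\<close> is \<open>\<tau> \<odot> \<sigma> : f \<Rightarrow> g \<Rightarrow> h\<close>, with \<open>f, g, h : X \<rightarrow> Y\<close>;
  \<open>HComp C X Y Z f\<^sub>1 f\<^sub>2 g\<^sub>1 g\<^sub>2 \<eta> \<delta>\<close> is \<open>\<eta> \<star> \<delta>\<close>, with \<open>\<delta> : f\<^sub>1 \<Rightarrow> f\<^sub>2 : X \<rightarrow> Y\<close> and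
  \<open>\<eta> : g\<^sub>1 \<Rightarrow> g\<^sub>2 : Y \<rightarrow> Z\<close>.
\<close>

record ('o, 'm, 'c) two_cat =
  Obj :: "'o set"
  Hom :: "'o \<Rightarrow> 'o \<Rightarrow> 'm set"
  Cell :: "'o \<Rightarrow> 'o \<Rightarrow> 'm \<Rightarrow> 'm \<Rightarrow> 'c set"
  Id1 :: "'o \<Rightarrow> 'm"
  Comp :: "'o \<Rightarrow> 'o \<Rightarrow> 'o \<Rightarrow> 'm \<Rightarrow> 'm \<Rightarrow> 'm"
  Id2 :: "'o \<Rightarrow> 'o \<Rightarrow> 'm \<Rightarrow> 'c"
  VComp :: "'o \<Rightarrow> 'o \<Rightarrow> 'm \<Rightarrow> 'm \<Rightarrow> 'm \<Rightarrow> 'c \<Rightarrow> 'c \<Rightarrow> 'c"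
  HComp :: "'o \<Rightarrow> 'o \<Rightarrow> 'o \<Rightarrow> 'm \<Rightarrow> 'm \<Rightarrow> 'm \<Rightarrow> 'm \<Rightarrow> 'c \<Rightarrow> 'c \<Rightarrow> 'c"

locale strict_two_category =
  fixes C :: "('o, 'm, 'c) two_cat"
  assumes Id1_in: "\<And>X. X \<in> Obj C \<Longrightarrow> Id1 C X \<in> Hom C X X"
    and Comp_in: "\<And>X Y Z f g. \<lbrakk>X \<in> Obj C; Y \<in> Obj C; Z \<in> Obj C; f \<in> Hom C X Y; g \<in> Hom C Y Z\<rbrakk>
          \<Longrightarrow> Comp C X Y Z g f \<in> Hom C X Z"
    and Comp_assoc: "\<And>W X Y Z f g h. \<lbrakk>W \<in> Obj C; X \<in> Obj C; Y \<in> Obj C; Z \<in> Obj C;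
            f \<in> Hom C W X; g \<in> Hom C X Y; h \<in> Hom C Y Z\<rbrakk>
          \<Longrightarrow> Comp C W X Z (Comp C X Y Z h g) f = Comp C W Y Z h (Comp C W X Y g f)"
    and Comp_Id1_left: "\<And>X Y f. \<lbrakk>X \<in> Obj C; Y \<in> Obj C; f \<in> Hom C X Y\<rbrakk>
          \<Longrightarrow> Comp C X Y Y (Id1 C Y) f = f"
    and Comp_Id1_right: "\<And>X Y f. \<lbrakk>X \<in> Obj C; Y \<in> Obj C; f \<in> Hom C X Y\<rbrakk>
          \<Longrightarrow> Comp C X X Y f (Id1 C X) = f"
    and Id2_in: "\<And>X Y f. \<lbrakk>X \<in> Obj C; Y \<in> Obj C; f \<in> Hom C X Y\<rbrakk> \<Longrightarrow> Id2 C X Y f \<in> Cell C X Y f f"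
    and VComp_in: "\<And>X Y f g h \<sigma> \<tau>. \<lbrakk>X \<in> Obj C; Y \<in> Obj C; f \<in> Hom C X Y; g \<in> Hom C X Y; h \<in> Hom C X Y;
            \<sigma> \<in> Cell C X Y f g; \<tau> \<in> Cell C X Y g h\<rbrakk>
          \<Longrightarrow> VComp C X Y f g h \<tau> \<sigma> \<in> Cell C X Y f h"
    and VComp_assoc: "\<And>X Y f g h k \<sigma> \<tau> \<upsilon>. \<lbrakk>X \<in> Obj C; Y \<in> Obj C;
            f \<in> Hom C X Y; g \<in> Hom C X Y; h \<in> Hom C X Y; k \<in> Hom C X Y;
            \<sigma> \<in> Cell C X Y f g; \<tau> \<in> Cell C X Y g h; \<upsilon> \<in> Cell C X Y h k\<rbrakk>
          \<Longrightarrow> VComp C X Y f g k (VComp C X Y g h k \<upsilon> \<tau>) \<sigma>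
              = VComp C X Y f h k \<upsilon> (VComp C X Y f g h \<tau> \<sigma>)"
    and VComp_Id2_left: "\<And>X Y f g \<sigma>. \<lbrakk>X \<in> Obj C; Y \<in> Obj C; f \<in> Hom C X Y; g \<in> Hom C X Y;
            \<sigma> \<in> Cell C X Y f g\<rbrakk> \<Longrightarrow> VComp C X Y f g g (Id2 C X Y g) \<sigma> = \<sigma>"
    and VComp_Id2_right: "\<And>X Y f g \<sigma>. \<lbrakk>X \<in> Obj C; Y \<in> Obj C; f \<in> Hom C X Y; g \<in> Hom C X Y;
            \<sigma> \<in> Cell C X Y f g\<rbrakk> \<Longrightarrow> VComp C X Y f f g \<sigma> (Id2 C X Y f) = \<sigma>"
    and HComp_in: "\<And>X Y Z f1 f2 g1 g2 \<delta> \<eta>. \<lbrakk>X \<in> Obj C; Y \<in> Obj C; Z \<in> Obj C;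
            f1 \<in> Hom C X Y; f2 \<in> Hom C X Y; g1 \<in> Hom C Y Z; g2 \<in> Hom C Y Z;
            \<delta> \<in> Cell C X Y f1 f2; \<eta> \<in> Cell C Y Z g1 g2\<rbrakk>
          \<Longrightarrow> HComp C X Y Z f1 f2 g1 g2 \<eta> \<delta> \<in> Cell C X Z (Comp C X Y Z g1 f1) (Comp C X Y Z g2 f2)"
    and HComp_Id2: "\<And>X Y Z f g. \<lbrakk>X \<in> Obj C; Y \<in> Obj C; Z \<in> Obj C; f \<in> Hom C X Y; g \<in> Hom C Y Z\<rbrakk>
          \<Longrightarrow> HComp C X Y Z f f g g (Id2 C Y Z g) (Id2 C X Y f) = Id2 C X Z (Comp C X Y Z g f)"
    and interchange: "\<And>X Y Z f1 f2 f3 g1 g2 g3 \<sigma> \<sigma>' \<tau> \<tau>'. \<lbrakk>X \<in> Obj C; Y \<in> Obj C; Z \<in> Obj C;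
            f1 \<in> Hom C X Y; f2 \<in> Hom C X Y; f3 \<in> Hom C X Y;
            g1 \<in> Hom C Y Z; g2 \<in> Hom C Y Z; g3 \<in> Hom C Y Z;
            \<sigma> \<in> Cell C X Y f1 f2; \<sigma>' \<in> Cell C X Y f2 f3; \<tau> \<in> Cell C Y Z g1 g2; \<tau>' \<in> Cell C Y Z g2 g3\<rbrakk>
          \<Longrightarrow> HComp C X Y Z f1 f3 g1 g3 (VComp C Y Z g1 g2 g3 \<tau>' \<tau>) (VComp C X Y f1 f2 f3 \<sigma>' \<sigma>)
              = VComp C X Z (Comp C X Y Z g1 f1) (Comp C X Y Z g2 f2) (Comp C X Y Z g3 f3)
                  (HComp C X Y Z f2 f3 g2 g3 \<tau>' \<sigma>') (HComp C X Y Z f1 f2 g1 g2 \<tau> \<sigma>)"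
    and HComp_assoc: "\<And>W X Y Z f1 f2 g1 g2 h1 h2 \<sigma> \<tau> \<upsilon>.
          \<lbrakk>W \<in> Obj C; X \<in> Obj C; Y \<in> Obj C; Z \<in> Obj C;
            f1 \<in> Hom C W X; f2 \<in> Hom C W X; g1 \<in> Hom C X Y; g2 \<in> Hom C X Y;
            h1 \<in> Hom C Y Z; h2 \<in> Hom C Y Z;
            \<sigma> \<in> Cell C W X f1 f2; \<tau> \<in> Cell C X Y g1 g2; \<upsilon> \<in> Cell C Y Z h1 h2\<rbrakk>
          \<Longrightarrow> HComp C W X Z f1 f2 (Comp C X Y Z h1 g1) (Comp C X Y Z h2 g2)
                (HComp C X Y Z g1 g2 h1 h2 \<upsilon> \<tau>) \<sigma>
              = HComp C W Y Z (Comp C W X Y g1 f1) (Comp C W X Y g2 f2) h1 h2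
                  \<upsilon> (HComp C W X Y f1 f2 g1 g2 \<tau> \<sigma>)"
    and HComp_Id1_left: "\<And>X Y f g \<sigma>. \<lbrakk>X \<in> Obj C; Y \<in> Obj C; f \<in> Hom C X Y; g \<in> Hom C X Y;
            \<sigma> \<in> Cell C X Y f g\<rbrakk>
          \<Longrightarrow> HComp C X Y Y f g (Id1 C Y) (Id1 C Y) (Id2 C Y Y (Id1 C Y)) \<sigma> = \<sigma>"
    and HComp_Id1_right: "\<And>X Y f g \<sigma>. \<lbrakk>X \<in> Obj C; Y \<in> Obj C; f \<in> Hom C X Y; g \<in> Hom C X Y;
            \<sigma> \<in> Cell C X Y f g\<rbrakk>
          \<Longrightarrow> HComp C X X Y (Id1 C X) (Id1 C X) f g \<sigma> (Id2 C X X (Id1 C X)) = \<sigma>"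

locale strict_two_functor = C: strict_two_category C + D: strict_two_category D
  for C :: "('o, 'm, 'c) two_cat" and D :: "('p, 'n, 'd) two_cat" +
  fixes F0 :: "'o \<Rightarrow> 'p"
    and F1 :: "'o \<Rightarrow> 'o \<Rightarrow> 'm \<Rightarrow> 'n"
    and F2 :: "'o \<Rightarrow> 'o \<Rightarrow> 'm \<Rightarrow> 'm \<Rightarrow> 'c \<Rightarrow> 'd"
  assumes F0_in: "\<And>X. X \<in> Obj C \<Longrightarrow> F0 X \<in> Obj D"
    and F1_in: "\<And>X Y f. \<lbrakk>X \<in> Obj C; Y \<in> Obj C; f \<in> Hom C X Y\<rbrakk> \<Longrightarrow> F1 X Y f \<in> Hom D (F0 X) (F0 Y)"
    and F2_in: "\<And>X Y f g \<sigma>. \<lbrakk>X \<in> Obj C; Y \<in> Obj C; f \<in> Hom C X Y; g \<in> Hom C X Y; \<sigma> \<in> Cell C X Y f g\<rbrakk>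
          \<Longrightarrow> F2 X Y f g \<sigma> \<in> Cell D (F0 X) (F0 Y) (F1 X Y f) (F1 X Y g)"
    and F1_Id1: "\<And>X. X \<in> Obj C \<Longrightarrow> F1 X X (Id1 C X) = Id1 D (F0 X)"
    and F1_Comp: "\<And>X Y Z f g. \<lbrakk>X \<in> Obj C; Y \<in> Obj C; Z \<in> Obj C; f \<in> Hom C X Y; g \<in> Hom C Y Z\<rbrakk>
          \<Longrightarrow> F1 X Z (Comp C X Y Z g f) = Comp D (F0 X) (F0 Y) (F0 Z) (F1 Y Z g) (F1 X Y f)"
    and F2_Id2: "\<And>X Y f. \<lbrakk>X \<in> Obj C; Y \<in> Obj C; f \<in> Hom C X Y\<rbrakk>
          \<Longrightarrow> F2 X Y f f (Id2 C X Y f) = Id2 D (F0 X) (F0 Y) (F1 X Y f)"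
    and F2_VComp: "\<And>X Y f g h \<sigma> \<tau>. \<lbrakk>X \<in> Obj C; Y \<in> Obj C;
            f \<in> Hom C X Y; g \<in> Hom C X Y; h \<in> Hom C X Y;
            \<sigma> \<in> Cell C X Y f g; \<tau> \<in> Cell C X Y g h\<rbrakk>
          \<Longrightarrow> F2 X Y f h (VComp C X Y f g h \<tau> \<sigma>)
              = VComp D (F0 X) (F0 Y) (F1 X Y f) (F1 X Y g) (F1 X Y h) (F2 X Y g h \<tau>) (F2 X Y f g \<sigma>)"
    and F2_HComp: "\<And>X Y Z f1 f2 g1 g2 \<delta> \<eta>. \<lbrakk>X \<in> Obj C; Y \<in> Obj C; Z \<in> Obj C;
            f1 \<in> Hom C X Y; f2 \<in> Hom C X Y; g1 \<in> Hom C Y Z; g2 \<in> Hom C Y Z;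
            \<delta> \<in> Cell C X Y f1 f2; \<eta> \<in> Cell C Y Z g1 g2\<rbrakk>
          \<Longrightarrow> F2 X Z (Comp C X Y Z g1 f1) (Comp C X Y Z g2 f2) (HComp C X Y Z f1 f2 g1 g2 \<eta> \<delta>)
              = HComp D (F0 X) (F0 Y) (F0 Z) (F1 X Y f1) (F1 X Y f2) (F1 Y Z g1) (F1 Y Z g2)
                  (F2 Y Z g1 g2 \<eta>) (F2 X Y f1 f2 \<delta>)"


section \<open>Topological preliminaries\<close>

definition paracompact_space :: "'a topology \<Rightarrow> bool" where
  "paracompact_space X \<longleftrightarrow>
     (\<forall>\<U>. (\<forall>U\<in>\<U>. openin X U) \<and> \<Union>\<U> = topspace X \<longrightarrow>
        (\<exists>\<V>. (\<forall>V\<in>\<V>. openin X V) \<and> \<Union>\<V> = topspace X \<and>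
              (\<forall>V\<in>\<V>. \<exists>U\<in>\<U>. V \<subseteq> U) \<and> locally_finite_in X \<V>))"

definition quotient_topology :: "'a topology \<Rightarrow> ('a \<Rightarrow> 'b) \<Rightarrow> 'b topology" where
  "quotient_topology X q =
     topology (\<lambda>V. V \<subseteq> q ` topspace X \<and> openin X {x \<in> topspace X. q x \<in> V})"

lemma istopology_quotient:
  "istopology (\<lambda>V. V \<subseteq> q ` topspace X \<and> openin X {x \<in> topspace X. q x \<in> V})"
proof -
  have 1: "{x \<in> topspace X. q x \<in> S \<inter> T} = {x \<in> topspace X. q x \<in> S} \<inter> {x \<in> topspace X. q x \<in> T}"
    for S T by blast
  have 2: "{x \<in> topspace X. q x \<in> \<Union>\<K>} = (\<Union>K\<in>\<K>. {x \<in> topspace X. q x \<in> K})" for \<K>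
    by blast
  show ?thesis
    unfolding istopology_def 1 2 by blast
qed

lemma openin_quotient_topology:
  "openin (quotient_topology X q) V \<longleftrightarrow>
     V \<subseteq> q ` topspace X \<and> openin X {x \<in> topspace X. q x \<in> V}"
  unfolding quotient_topology_def
  by (subst topology_inverse'[OF istopology_quotient]) simp

lemma quotient_map_quotient_topology: "quotient_map X (quotient_topology X q) q"
proof -
  have "openin (quotient_topology X q) (q ` topspace X)"
    by (simp add: openin_quotient_topology) (metis (no_types, lifting) Collect_cong Collect_mem_eq imageI openin_topspace)
  then have "topspace (quotient_topology X q) = q ` topspace X"
    by (metis openin_quotient_topology openin_subset openin_topspace subset_antisym)
  then show ?thesis
    by (simp add: quotient_map_def openin_quotient_topology)
qed


section \<open>Holomorphic maps between open subsets of \<open>\<complex>\<^sup>n\<close>\<close>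

text \<open>
  \<open>\<complex>\<^sup>n\<close> is the subspace of vectors supported on \<open>{..<n}\<close> in the space of finitely supported
  complex sequences. The norm of that type is the \<open>\<ell>\<^sup>1\<close>-norm, so on \<open>\<complex>\<^sup>n\<close> it induces the usual
  topology and the usual notion of Frechet derivative.
\<close>

type_synonym cvec = "nat \<Rightarrow>\<^sub>0 complex"

definition Cn :: "nat \<Rightarrow> cvec set" where
  "Cn n = {v. Poly_Mapping.keys v \<subseteq> {..<n}}"

definition cscale :: "complex \<Rightarrow> cvec \<Rightarrow> cvec" where
  "cscale c v = Poly_Mapping.map ((*) c) v"

text \<open>
  \<open>D\<close> is a complex linear Frechet derivative of \<open>f\<close> at \<open>x\<close>. Only the values of \<open>D\<close> on \<open>\<complex>\<^sup>n\<close> are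
  meaningful, and they are unique because \<open>S\<close> will always be open in \<open>\<complex>\<^sup>n\<close>.
\<close>

definition has_complex_derivative ::
    "nat \<Rightarrow> cvec set \<Rightarrow> (cvec \<Rightarrow> cvec) \<Rightarrow> (cvec \<Rightarrow> cvec) \<Rightarrow> cvec \<Rightarrow> bool" where
  "has_complex_derivative n S f D x \<longleftrightarrow>
     (f has_derivative D) (at x within S) \<and> (\<forall>c. \<forall>v\<in>Cn n. D (cscale c v) = cscale c (D v))"

definition holomorphic_between :: "nat \<Rightarrow> cvec set \<Rightarrow> cvec set \<Rightarrow> (cvec \<Rightarrow> cvec) \<Rightarrow> bool" where
  "holomorphic_between n S T f \<longleftrightarrow>
     f \<in> S \<rightarrow> T \<and> (\<forall>x\<in>S. \<exists>D. has_complex_derivative n S f D x)"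

definition holomorphic_embedding :: "nat \<Rightarrow> cvec set \<Rightarrow> cvec set \<Rightarrow> (cvec \<Rightarrow> cvec) \<Rightarrow> bool" where
  "holomorphic_embedding n S T f \<longleftrightarrow>
     holomorphic_between n S T f \<and>
     (\<forall>x\<in>S. \<forall>D. has_complex_derivative n S f D x \<longrightarrow> inj_on D (Cn n)) \<and>
     embedding_map (top_of_set S) (top_of_set T) f"


section \<open>Orbifold atlases\<close>

text \<open>
  From here on every map is represented by the function that is \<^const>\<open>undefined\<close> outside its
  domain (\<^const>\<open>extensional\<close>), so that equality of maps is equality of HOL functions.
\<close>

record 'x unif_system =
  udom :: "cvec set"
  ugrp :: "(cvec \<Rightarrow> cvec) set"
  uproj :: "cvec \<Rightarrow> 'x"

definition unif_orbit :: "'x unif_system \<Rightarrow> cvec \<Rightarrow> cvec set" where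
  "unif_orbit S x = {g x | g. g \<in> ugrp S}"

definition uniformizing_system :: "'x topology \<Rightarrow> nat \<Rightarrow> 'x set \<Rightarrow> 'x unif_system \<Rightarrow> bool" where
  "uniformizing_system X n U S \<longleftrightarrow>
     openin X U \<and> U \<noteq> {} \<and>
     openin (top_of_set (Cn n)) (udom S) \<and> connected (udom S) \<and> udom S \<noteq> {} \<and>
     finite (ugrp S) \<and> subgroup (ugrp S) (BijGroup (udom S)) \<and>
     (\<forall>g\<in>ugrp S. holomorphic_between n (udom S) (udom S) g) \<and>
     uproj S \<in> extensional (udom S) \<and>
     continuous_map (top_of_set (udom S)) (subtopology X U) (uproj S) \<and> uproj S ` udom S = U \<and>
     (\<forall>g\<in>ugrp S. \<forall>x\<in>udom S. uproj S (g x) = uproj S x) \<and>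
     (\<exists>h. homeomorphic_map (quotient_topology (top_of_set (udom S)) (unif_orbit S)) (subtopology X U) h \<and>
          (\<forall>x\<in>udom S. h (unif_orbit S x) = uproj S x))"

definition unif_embedding :: "nat \<Rightarrow> 'x unif_system \<Rightarrow> 'x unif_system \<Rightarrow> (cvec \<Rightarrow> cvec) \<Rightarrow> bool" where
  "unif_embedding n S T l \<longleftrightarrow>
     l \<in> extensional (udom S) \<and> holomorphic_embedding n (udom S) (udom T) l \<and>
     (\<forall>x\<in>udom S. uproj T (l x) = uproj S x)"

record ('x, 'i) atlas =
  aspace :: "'x topology"
  cdim :: nat
  idx :: "'i set"
  usys :: "'i \<Rightarrow> 'x unif_system"

abbreviation Dom :: "('x, 'i) atlas \<Rightarrow> 'i \<Rightarrow> cvec set" where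
  "Dom A i \<equiv> udom (usys A i)"

abbreviation Proj :: "('x, 'i) atlas \<Rightarrow> 'i \<Rightarrow> cvec \<Rightarrow> 'x" where
  "Proj A i \<equiv> uproj (usys A i)"

abbreviation Supp :: "('x, 'i) atlas \<Rightarrow> 'i \<Rightarrow> 'x set" where
  "Supp A i \<equiv> Proj A i ` Dom A i"

definition orbifold_atlas :: "('x, 'i) atlas \<Rightarrow> bool" where
  "orbifold_atlas A \<longleftrightarrow>
     paracompact_space (aspace A) \<and> second_countable (aspace A) \<and> Hausdorff_space (aspace A) \<and>
     usys A \<in> extensional (idx A) \<and>
     (\<forall>i\<in>idx A. uniformizing_system (aspace A) (cdim A) (Supp A i) (usys A i)) \<and>
     (\<Union>i\<in>idx A. Supp A i) = topspace (aspace A) \<and>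
     (\<forall>i\<in>idx A. \<forall>j\<in>idx A. \<forall>x \<in> Supp A i \<inter> Supp A j.
        \<exists>k\<in>idx A. x \<in> Supp A k \<and> Supp A k \<subseteq> Supp A i \<inter> Supp A j \<and>
          (\<exists>l. unif_embedding (cdim A) (usys A k) (usys A i) l) \<and>
          (\<exists>l. unif_embedding (cdim A) (usys A k) (usys A j) l))"

text \<open>
  The category attached to an atlas. An embedding, as a morphism, remembers its source and target.
\<close>

datatype 'i emb = Emb (esrc: 'i) (emap: "cvec \<Rightarrow> cvec") (etgt: 'i)

definition embs :: "('x, 'i) atlas \<Rightarrow> 'i emb set" where
  "embs A = {l. esrc l \<in> idx A \<and> etgt l \<in> idx A \<and>
                unif_embedding (cdim A) (usys A (esrc l)) (usys A (etgt l)) (emap l)}"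

definition emb_id :: "('x, 'i) atlas \<Rightarrow> 'i \<Rightarrow> 'i emb" where
  "emb_id A i = Emb i (\<lambda>x\<in>Dom A i. x) i"

text \<open>\<open>emb_comp A l k\<close> is \<open>l \<circ> k\<close>, meaningful if the target of \<open>k\<close> is the source of \<open>l\<close>.\<close>

definition emb_comp :: "('x, 'i) atlas \<Rightarrow> 'i emb \<Rightarrow> 'i emb \<Rightarrow> 'i emb" where
  "emb_comp A l k = Emb (esrc k) (compose (Dom A (esrc k)) (emap l) (emap k)) (etgt l)"


section \<open>The 2-category (Pre-Orb)\<close>

record ('x, 'i) comp_sys =
  base :: "'x \<Rightarrow> 'x"
  fobj :: "'i \<Rightarrow> 'i"
  fmor :: "'i emb \<Rightarrow> 'i emb"
  lift :: "'i \<Rightarrow> cvec \<Rightarrow> cvec"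

definition atlas_functor :: "('x, 'i) atlas \<Rightarrow> ('x, 'i) atlas \<Rightarrow> ('i \<Rightarrow> 'i) \<Rightarrow> ('i emb \<Rightarrow> 'i emb) \<Rightarrow> bool" where
  "atlas_functor A B F0 F1 \<longleftrightarrow>
     F0 \<in> idx A \<rightarrow>\<^sub>E idx B \<and> F1 \<in> embs A \<rightarrow>\<^sub>E embs B \<and>
     (\<forall>l\<in>embs A. esrc (F1 l) = F0 (esrc l) \<and> etgt (F1 l) = F0 (etgt l)) \<and>
     (\<forall>i\<in>idx A. F1 (emb_id A i) = emb_id B (F0 i)) \<and>
     (\<forall>k\<in>embs A. \<forall>l\<in>embs A. etgt k = esrc l \<longrightarrow>
        F1 (emb_comp A l k) = emb_comp B (F1 l) (F1 k))"

definition compatible_system :: "('x, 'i) atlas \<Rightarrow> ('x, 'i) atlas \<Rightarrow> ('x, 'i) comp_sys \<Rightarrow> bool" where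
  "compatible_system A B f \<longleftrightarrow>
     base f \<in> extensional (topspace (aspace A)) \<and>
     continuous_map (aspace A) (aspace B) (base f) \<and>
     atlas_functor A B (fobj f) (fmor f) \<and>
     (\<forall>i\<in>idx A. base f ` Supp A i \<subseteq> Supp B (fobj f i)) \<and>
     lift f \<in> extensional (idx A) \<and>
     (\<forall>i\<in>idx A. lift f i \<in> extensional (Dom A i) \<and>
        holomorphic_between (cdim A) (Dom A i) (Dom B (fobj f i)) (lift f i) \<and>
        (\<forall>x\<in>Dom A i. Proj B (fobj f i) (lift f i x) = base f (Proj A i x))) \<and>
     (\<forall>l\<in>embs A. \<forall>x\<in>Dom A (esrc l).
        lift f (etgt l) (emap l x) = emap (fmor f l) (lift f (esrc l) x))"

definition cs_id :: "('x, 'i) atlas \<Rightarrow> ('x, 'i) comp_sys" where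
  "cs_id A = \<lparr>base = \<lambda>x\<in>topspace (aspace A). x, fobj = \<lambda>i\<in>idx A. i, fmor = \<lambda>l\<in>embs A. l,
              lift = \<lambda>i\<in>idx A. \<lambda>x\<in>Dom A i. x\<rparr>"

definition cs_comp :: "('x, 'i) atlas \<Rightarrow> ('x, 'i) comp_sys \<Rightarrow> ('x, 'i) comp_sys \<Rightarrow> ('x, 'i) comp_sys" where
  "cs_comp A g f =
     \<lparr>base = compose (topspace (aspace A)) (base g) (base f),
      fobj = compose (idx A) (fobj g) (fobj f),
      fmor = compose (embs A) (fmor g) (fmor f),
      lift = \<lambda>i\<in>idx A. compose (Dom A i) (lift g (fobj f i)) (lift f i)\<rparr>"

definition cs_nat_trans ::
    "('x, 'i) atlas \<Rightarrow> ('x, 'i) atlas \<Rightarrow> ('x, 'i) comp_sys \<Rightarrow> ('x, 'i) comp_sys \<Rightarrow> ('i \<Rightarrow> 'i emb) \<Rightarrow> bool" where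
  "cs_nat_trans A B f1 f2 \<delta> \<longleftrightarrow>
     base f1 = base f2 \<and>
     \<delta> \<in> idx A \<rightarrow>\<^sub>E embs B \<and>
     (\<forall>i\<in>idx A. esrc (\<delta> i) = fobj f1 i \<and> etgt (\<delta> i) = fobj f2 i) \<and>
     (\<forall>i\<in>idx A. \<forall>x\<in>Dom A i. lift f2 i x = emap (\<delta> i) (lift f1 i x)) \<and>
     (\<forall>l\<in>embs A. emb_comp B (fmor f2 l) (\<delta> (esrc l)) = emb_comp B (\<delta> (etgt l)) (fmor f1 l))"

definition PreOrb :: "(('x, 'i) atlas, ('x, 'i) comp_sys, 'i \<Rightarrow> 'i emb) two_cat" where
  "PreOrb =
     \<lparr>Obj = {A. orbifold_atlas A},
      Hom = \<lambda>A B. {f. compatible_system A B f},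
      Cell = \<lambda>A B f1 f2. {\<delta>. cs_nat_trans A B f1 f2 \<delta>},
      Id1 = cs_id,
      Comp = \<lambda>A B C g f. cs_comp A g f,
      Id2 = \<lambda>A B f. \<lambda>i\<in>idx A. emb_id B (fobj f i),
      VComp = \<lambda>A B f1 f2 f3 \<sigma> \<delta>. \<lambda>i\<in>idx A. emb_comp B (\<sigma> i) (\<delta> i),
      HComp = \<lambda>A B C f1 f2 g1 g2 \<eta> \<delta>. \<lambda>i\<in>idx A. emb_comp C (\<eta> (fobj f2 i)) (fmor g1 (\<delta> i))\<rparr>"


section \<open>Complex manifolds\<close>

text \<open>
  Complex manifolds of pure dimension, Hausdorff and paracompact, presented by a not necessarily
  maximal holomorphic atlas. Second countability is not required: the disjoint union of the
  charts of an orbifold atlas with an uncountable index set is not second countable.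
\<close>

record 'a cmanifold =
  mtop :: "'a topology"
  mdim :: nat
  mcharts :: "('a set \<times> ('a \<Rightarrow> cvec)) set"

abbreviation pts :: "'a cmanifold \<Rightarrow> 'a set" where
  "pts M \<equiv> topspace (mtop M)"

definition complex_manifold :: "'a cmanifold \<Rightarrow> bool" where
  "complex_manifold M \<longleftrightarrow>
     Hausdorff_space (mtop M) \<and> paracompact_space (mtop M) \<and>
     (\<Union>(W, \<phi>)\<in>mcharts M. W) = pts M \<and>
     (\<forall>(W, \<phi>)\<in>mcharts M. openin (mtop M) W \<and> openin (top_of_set (Cn (mdim M))) (\<phi> ` W) \<and>
        homeomorphic_map (subtopology (mtop M) W) (top_of_set (\<phi> ` W)) \<phi>) \<and>
     (\<forall>(W, \<phi>)\<in>mcharts M. \<forall>(W', \<phi>')\<in>mcharts M.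
        holomorphic_between (mdim M) (\<phi> ` (W \<inter> W')) (\<phi>' ` (W \<inter> W')) (\<phi>' \<circ> inv_into W \<phi>))"

definition holomorphic_maps :: "'a cmanifold \<Rightarrow> 'b cmanifold \<Rightarrow> ('a \<Rightarrow> 'b) set" where
  "holomorphic_maps M N =
     {f \<in> extensional (pts M). continuous_map (mtop M) (mtop N) f \<and>
        (\<forall>(W, \<phi>)\<in>mcharts M. \<forall>(W', \<phi>')\<in>mcharts N.
           holomorphic_between (mdim M) (\<phi> ` {x \<in> W. f x \<in> W'}) (\<phi>' ` W')
             (\<phi>' \<circ> f \<circ> inv_into W \<phi>))}"

definition open_submanifold :: "'a cmanifold \<Rightarrow> 'a set \<Rightarrow> 'a cmanifold" where
  "open_submanifold M V =
     \<lparr>mtop = subtopology (mtop M) V, mdim = mdim M,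
      mcharts = {(W \<inter> V, \<phi>) | W \<phi>. (W, \<phi>) \<in> mcharts M}\<rparr>"

definition biholomorphic_map :: "'a cmanifold \<Rightarrow> 'b cmanifold \<Rightarrow> ('a \<Rightarrow> 'b) \<Rightarrow> bool" where
  "biholomorphic_map M N f \<longleftrightarrow>
     f \<in> holomorphic_maps M N \<and>
     (\<exists>g\<in>holomorphic_maps N M. (\<forall>x\<in>pts M. g (f x) = x) \<and> (\<forall>y\<in>pts N. f (g y) = y))"

definition local_biholomorphism :: "'a cmanifold \<Rightarrow> 'b cmanifold \<Rightarrow> ('a \<Rightarrow> 'b) \<Rightarrow> bool" where
  "local_biholomorphism M N f \<longleftrightarrow>
     f \<in> holomorphic_maps M N \<and>
     (\<forall>x\<in>pts M. \<exists>W. openin (mtop M) W \<and> x \<in> W \<and> openin (mtop N) (f ` W) \<and>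
        biholomorphic_map (open_submanifold M W) (open_submanifold N (f ` W)) (restrict f W))"

text \<open>
  The fiber product of \<open>f : M \<rightarrow> L\<close> and \<open>g : N \<rightarrow> L\<close> when \<open>g\<close> is a local biholomorphism. Then the
  first projection to \<open>M\<close> is a local homeomorphism on the topological fiber product, and the
  fiber product manifold carries the complex structure for which it is a local biholomorphism.
\<close>

definition fiber_product :: "'a cmanifold \<Rightarrow> 'b cmanifold \<Rightarrow> ('a \<Rightarrow> 'c) \<Rightarrow> ('b \<Rightarrow> 'c) \<Rightarrow> ('a \<times> 'b) cmanifold" where
  "fiber_product M N f g =
     (let T = subtopology (prod_topology (mtop M) (mtop N)) {(x, y). f x = g y}
      in \<lparr>mtop = T, mdim = mdim M,
          mcharts = {(V, \<phi> \<circ> fst) | V W \<phi>. (W, \<phi>) \<in> mcharts M \<and> openin T V \<and> fst ` V \<subseteq> W \<and>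
                       openin (mtop M) (fst ` V) \<and>
                       homeomorphic_map (subtopology T V) (subtopology (mtop M) (fst ` V)) fst}\<rparr>)"


section \<open>The 2-category (Grp)\<close>

record ('r, 'u) groupoid =
  Arr :: "'r cmanifold"
  Base :: "'u cmanifold"
  gs :: "'r \<Rightarrow> 'u"
  gt :: "'r \<Rightarrow> 'u"
  gm :: "'r \<times> 'r \<Rightarrow> 'r"
  gi :: "'r \<Rightarrow> 'r"
  ge :: "'u \<Rightarrow> 'r"

abbreviation composable :: "('r, 'u) groupoid \<Rightarrow> ('r \<times> 'r) cmanifold" where
  "composable G \<equiv> fiber_product (Arr G) (Arr G) (gt G) (gs G)"

text \<open>
  An etale groupoid object in complex manifolds. Etaleness guarantees the existence of the fiber
  product on which the multiplication is defined.
\<close>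

definition etale_groupoid :: "('r, 'u) groupoid \<Rightarrow> bool" where
  "etale_groupoid G \<longleftrightarrow>
     complex_manifold (Arr G) \<and> complex_manifold (Base G) \<and>
     local_biholomorphism (Arr G) (Base G) (gs G) \<and>
     local_biholomorphism (Arr G) (Base G) (gt G) \<and>
     gm G \<in> holomorphic_maps (composable G) (Arr G) \<and>
     gi G \<in> holomorphic_maps (Arr G) (Arr G) \<and>
     ge G \<in> holomorphic_maps (Base G) (Arr G) \<and>
     (\<forall>x\<in>pts (Base G). gs G (ge G x) = x \<and> gt G (ge G x) = x) \<and>
     (\<forall>g\<in>pts (Arr G). \<forall>h\<in>pts (Arr G). gt G g = gs G h \<longrightarrow>
        gs G (gm G (g, h)) = gs G g \<and> gt G (gm G (g, h)) = gt G h) \<and>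
     (\<forall>g\<in>pts (Arr G). \<forall>h\<in>pts (Arr G). \<forall>k\<in>pts (Arr G). gt G g = gs G h \<and> gt G h = gs G k \<longrightarrow>
        gm G (g, gm G (h, k)) = gm G (gm G (g, h), k)) \<and>
     (\<forall>g\<in>pts (Arr G).
        gm G (ge G (gs G g), g) = g \<and> gm G (g, ge G (gt G g)) = g \<and>
        gi G (gi G g) = g \<and> gs G (gi G g) = gt G g \<and> gt G (gi G g) = gs G g \<and>
        gm G (g, gi G g) = ge G (gs G g) \<and> gm G (gi G g, g) = ge G (gt G g))"

definition proper_groupoid :: "('r, 'u) groupoid \<Rightarrow> bool" where
  "proper_groupoid G \<longleftrightarrow>
     proper_map (mtop (Arr G)) (prod_topology (mtop (Base G)) (mtop (Base G))) (\<lambda>g. (gs G g, gt G g))"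

text \<open>
  The germ at \<open>s g\<close> of \<open>t \<circ> (s|W)\<inverse>\<close>, for a small open neighborhood \<open>W\<close> of \<open>g\<close>, as the set of all
  functions that represent it.
\<close>

definition arrow_germ :: "('r, 'u) groupoid \<Rightarrow> 'r \<Rightarrow> ('u \<Rightarrow> 'u) set" where
  "arrow_germ G g =
     {\<tau>. \<exists>W N. openin (mtop (Arr G)) W \<and> g \<in> W \<and> inj_on (gs G) W \<and> inj_on (gt G) W \<and>
            openin (mtop (Base G)) N \<and> gs G g \<in> N \<and> N \<subseteq> gs G ` W \<and>
            (\<forall>y\<in>N. \<tau> y = gt G (inv_into W (gs G) y))}"

definition effective_groupoid :: "('r, 'u) groupoid \<Rightarrow> bool" where
  "effective_groupoid G \<longleftrightarrow>
     (\<forall>x\<in>pts (Base G). inj_on (arrow_germ G) {g \<in> pts (Arr G). gs G g = x \<and> gt G g = x})"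

definition groupoid_morphism ::
    "('r, 'u) groupoid \<Rightarrow> ('r, 'u) groupoid \<Rightarrow> ('u \<Rightarrow> 'u) \<times> ('r \<Rightarrow> 'r) \<Rightarrow> bool" where
  "groupoid_morphism G H = (\<lambda>(\<psi>, \<Psi>).
     \<psi> \<in> holomorphic_maps (Base G) (Base H) \<and> \<Psi> \<in> holomorphic_maps (Arr G) (Arr H) \<and>
     (\<forall>g\<in>pts (Arr G). gs H (\<Psi> g) = \<psi> (gs G g) \<and> gt H (\<Psi> g) = \<psi> (gt G g) \<and>
                      \<Psi> (gi G g) = gi H (\<Psi> g)) \<and>
     (\<forall>x\<in>pts (Base G). \<Psi> (ge G x) = ge H (\<psi> x)) \<and>
     (\<forall>g\<in>pts (Arr G). \<forall>h\<in>pts (Arr G). gt G g = gs G h \<longrightarrow> \<Psi> (gm G (g, h)) = gm H (\<Psi> g, \<Psi> h)))"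

definition groupoid_nat_trans ::
    "('r, 'u) groupoid \<Rightarrow> ('r, 'u) groupoid \<Rightarrow>
     ('u \<Rightarrow> 'u) \<times> ('r \<Rightarrow> 'r) \<Rightarrow> ('u \<Rightarrow> 'u) \<times> ('r \<Rightarrow> 'r) \<Rightarrow> ('u \<Rightarrow> 'r) \<Rightarrow> bool" where
  "groupoid_nat_trans G H = (\<lambda>(\<psi>, \<Psi>) (\<phi>, \<Phi>) \<alpha>.
     \<alpha> \<in> holomorphic_maps (Base G) (Arr H) \<and>
     (\<forall>x\<in>pts (Base G). gs H (\<alpha> x) = \<psi> x \<and> gt H (\<alpha> x) = \<phi> x) \<and>
     (\<forall>g\<in>pts (Arr G). gm H (\<alpha> (gs G g), \<Phi> g) = gm H (\<Psi> g, \<alpha> (gt G g))))"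

definition Grp :: "(('r, 'u) groupoid, ('u \<Rightarrow> 'u) \<times> ('r \<Rightarrow> 'r), 'u \<Rightarrow> 'r) two_cat" where
  "Grp =
     \<lparr>Obj = {G. etale_groupoid G \<and> proper_groupoid G \<and> effective_groupoid G},
      Hom = \<lambda>G H. {f. groupoid_morphism G H f},
      Cell = \<lambda>G H f g. {\<alpha>. groupoid_nat_trans G H f g \<alpha>},
      Id1 = \<lambda>G. (\<lambda>x\<in>pts (Base G). x, \<lambda>g\<in>pts (Arr G). g),
      Comp = \<lambda>G H K (\<phi>, \<Phi>) (\<psi>, \<Psi>). (compose (pts (Base G)) \<phi> \<psi>, compose (pts (Arr G)) \<Phi> \<Psi>),
      Id2 = \<lambda>G H (\<psi>, \<Psi>). \<lambda>x\<in>pts (Base G). ge H (\<psi> x),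
      VComp = \<lambda>G H f1 f2 f3 \<beta> \<alpha>. \<lambda>x\<in>pts (Base G). gm H (\<alpha> x, \<beta> x),
      HComp = \<lambda>G H K (\<psi>1, \<Psi>1) (\<psi>2, \<Psi>2) (\<phi>1, \<Phi>1) (\<phi>2, \<Phi>2) \<beta> \<alpha>.
                \<lambda>x\<in>pts (Base G). gm K (\<Phi>1 (\<alpha> x), \<beta> (\<psi>2 x))\<rparr>"


section \<open>The assignment \<open>F\<close>\<close>

text \<open>
  The point \<open>(\<lambda>\<^sub>k\<^sub>i, x\<^sub>k, \<lambda>\<^sub>k\<^sub>j)\<close> of \<open>R_hat\<close> is encoded as \<open>((\<lambda>\<^sub>k\<^sub>i, \<lambda>\<^sub>k\<^sub>j), x\<^sub>k)\<close> and the point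
  \<open>(x\<^sub>i, U\<^sub>i)\<close> of the base as \<open>(i, x\<^sub>i)\<close>, following the conventions of \<^const>\<open>sum_topology\<close>.
\<close>

type_synonym 'i rpoint = "('i emb \<times> 'i emb) \<times> cvec"

definition U_mfd :: "('x, 'i) atlas \<Rightarrow> ('i \<times> cvec) cmanifold" where
  "U_mfd A =
     \<lparr>mtop = sum_topology (\<lambda>i. top_of_set (Dom A i)) (idx A), mdim = cdim A,
      mcharts = {({i} \<times> Dom A i, snd) | i. i \<in> idx A}\<rparr>"

definition emb_pairs :: "('x, 'i) atlas \<Rightarrow> ('i emb \<times> 'i emb) set" where
  "emb_pairs A = {(a, b). a \<in> embs A \<and> b \<in> embs A \<and> esrc a = esrc b}"

definition Rhat_top :: "('x, 'i) atlas \<Rightarrow> 'i rpoint topology" where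
  "Rhat_top A = sum_topology (\<lambda>(a, b). top_of_set (Dom A (esrc a))) (emb_pairs A)"

text \<open>
  That the two points have targets over the same pair \<open>(i, j)\<close> is part of the two equations
  between embeddings, which remember their targets.
\<close>

definition R_rel :: "('x, 'i) atlas \<Rightarrow> ('i rpoint \<times> 'i rpoint) set" where
  "R_rel A = {(((a, b), x), ((a', b'), x')) | a b x a' b' x'.
     ((a, b), x) \<in> topspace (Rhat_top A) \<and> ((a', b'), x') \<in> topspace (Rhat_top A) \<and>
     (\<exists>k\<in>embs A. \<exists>l\<in>embs A. \<exists>z.
        esrc k = esrc l \<and> etgt k = esrc a \<and> etgt l = esrc a' \<and> z \<in> Dom A (esrc k) \<and>
        emb_comp A a k = emb_comp A a' l \<and> emb_comp A b k = emb_comp A b' l \<and>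
        emap k z = x \<and> emap l z = x')}"

definition R_class :: "('x, 'i) atlas \<Rightarrow> 'i rpoint \<Rightarrow> 'i rpoint set" where
  "R_class A p = R_rel A `` {p}"

definition R_mfd :: "('x, 'i) atlas \<Rightarrow> 'i rpoint set cmanifold" where
  "R_mfd A =
     \<lparr>mtop = quotient_topology (Rhat_top A) (R_class A), mdim = cdim A,
      mcharts = {(R_class A ` ({(a, b)} \<times> Dom A (esrc a)), \<lambda>c. the_elem {x. ((a, b), x) \<in> c})
                 | a b. (a, b) \<in> emb_pairs A}\<rparr>"

text \<open>The map induced on equivalence classes by a map that is constant on each class.\<close>

definition on_classes :: "('x, 'i) atlas \<Rightarrow> ('i rpoint \<Rightarrow> 'b) \<Rightarrow> 'i rpoint set \<Rightarrow> 'b" where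
  "on_classes A h = (\<lambda>c\<in>pts (R_mfd A). the_elem (h ` c))"

definition R_s :: "('x, 'i) atlas \<Rightarrow> 'i rpoint set \<Rightarrow> 'i \<times> cvec" where
  "R_s A = on_classes A (\<lambda>((a, b), x). (etgt a, emap a x))"

definition R_t :: "('x, 'i) atlas \<Rightarrow> 'i rpoint set \<Rightarrow> 'i \<times> cvec" where
  "R_t A = on_classes A (\<lambda>((a, b), x). (etgt b, emap b x))"

definition R_i :: "('x, 'i) atlas \<Rightarrow> 'i rpoint set \<Rightarrow> 'i rpoint set" where
  "R_i A = on_classes A (\<lambda>((a, b), x). R_class A ((b, a), x))"

definition R_e :: "('x, 'i) atlas \<Rightarrow> 'i \<times> cvec \<Rightarrow> 'i rpoint set" where
  "R_e A = (\<lambda>(i, x)\<in>pts (U_mfd A). R_class A ((emb_id A i, emb_id A i), x))"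

text \<open>
  All possible values of \<open>m([a, x, b], [a', x', b'])\<close>, over all representatives and all choices of
  the auxiliary embeddings \<open>k, l\<close> and of the point \<open>z\<close>; the product is their common value.
\<close>

definition R_products :: "('x, 'i) atlas \<Rightarrow> 'i rpoint set \<Rightarrow> 'i rpoint set \<Rightarrow> 'i rpoint set set" where
  "R_products A c d =
     {R_class A ((emb_comp A a k, emb_comp A b' l), z) | a b x a' b' x' k l z.
        ((a, b), x) \<in> c \<and> ((a', b'), x') \<in> d \<and> k \<in> embs A \<and> l \<in> embs A \<and>
        esrc k = esrc l \<and> etgt k = esrc b \<and> etgt l = esrc a' \<and> z \<in> Dom A (esrc k) \<and>
        emb_comp A b k = emb_comp A a' l \<and> emap k z = x \<and> emap l z = x'}"

definition R_m :: "('x, 'i) atlas \<Rightarrow> 'i rpoint set \<times> 'i rpoint set \<Rightarrow> 'i rpoint set" where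
  "R_m A = (\<lambda>(c, d)\<in>pts (fiber_product (R_mfd A) (R_mfd A) (R_t A) (R_s A)). the_elem (R_products A c d))"

definition F_obj :: "('x, 'i) atlas \<Rightarrow> ('i rpoint set, 'i \<times> cvec) groupoid" where
  "F_obj A = \<lparr>Arr = R_mfd A, Base = U_mfd A, gs = R_s A, gt = R_t A, gm = R_m A, gi = R_i A, ge = R_e A\<rparr>"

definition F_mor ::
    "('x, 'i) atlas \<Rightarrow> ('x, 'i) atlas \<Rightarrow> ('x, 'i) comp_sys \<Rightarrow>
     ('i \<times> cvec \<Rightarrow> 'i \<times> cvec) \<times> ('i rpoint set \<Rightarrow> 'i rpoint set)" where
  "F_mor A B f =
     (\<lambda>(i, x)\<in>pts (U_mfd A). (fobj f i, lift f i x),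
      on_classes A (\<lambda>((a, b), x). R_class B ((fmor f a, fmor f b), lift f (esrc a) x)))"

definition F_cell ::
    "('x, 'i) atlas \<Rightarrow> ('x, 'i) atlas \<Rightarrow> ('x, 'i) comp_sys \<Rightarrow> ('x, 'i) comp_sys \<Rightarrow> ('i \<Rightarrow> 'i emb) \<Rightarrow>
     ('i \<times> cvec \<Rightarrow> 'i rpoint set)" where
  "F_cell A B f1 f2 \<delta> =
     (\<lambda>(i, x)\<in>pts (U_mfd A). R_class B ((emb_id B (fobj f1 i), \<delta> i), lift f1 i x))"

end

theory Submission
  imports Defs "HOL-Homology.Homology" "HOL-Complex_Analysis.Complex_Analysis"
begin

text \<open>
  The two 2-categories are verified by direct calculation; the content of the theorem is that
  \<open>F\<close> is well defined, and all of it rests on one statement about embeddings of uniformizing systems.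

  Let \<open>l\<close> and \<open>m\<close> be two embeddings with the same source and the same target. At every point their
  values lie in one orbit of the target group, so the source is covered by the finitely many closed
  sets \<open>{m = g \<circ> l}\<close>. One of them has an interior point, and the identity theorem for holomorphic maps
  gives \<open>m = g \<circ> l\<close> for a single group element \<open>g\<close> (\<open>embeddings_differ_by_group\<close>). In the same way, a
  group element \<open>g\<close> of the target that moves a point of the image of \<open>l\<close> to another point of that
  image satisfies \<open>g \<circ> l = l \<circ> h\<close> for an element \<open>h\<close> of the source group
  (\<open>group_element_lifts\<close>); here the image of \<open>l\<close> has to be open, which is invariance of domain.
  Together they show that two embeddings \<open>a\<close>, \<open>b\<close> into the same system with \<open>a x = b y\<close> can be
  completed to a commutative square \<open>a \<circ> c = b \<circ> d\<close> over a third system through that point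
  (\<open>embeddings_pullback\<close>).

  This pullback property makes the relation \<open>\<sim>\<close> transitive. It also brings a pair of composable arrows
  to the form \<open>[p, z, q]\<close>, \<open>[q, z, r]\<close> with product \<open>[p, z, r]\<close>, after which the groupoid laws are
  immediate. Classes may be restricted, \<open>[a, k z, b] = [a \<circ> k, z, b \<circ> k]\<close>, and every identity that
  involves \<open>F\<close> on morphisms and on natural transformations is checked by restricting all arrows that
  occur in it to one source.

  For the geometry of \<open>R\<close>, the quotient map is open, so each pair \<open>(a, b)\<close> of embeddings with a common
  source contributes an open sheet of \<open>R\<close>. In terms of the charts, \<open>s\<close> and \<open>t\<close> are the embeddings \<open>a\<close>
  and \<open>b\<close>, and the remaining structure maps are identities. By \<open>arrow_over_chart\<close>, the arrows whose
  source lies in the image of \<open>a\<close> and whose target has the same index as that of \<open>b\<close> form the finitely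
  many sheets of the pairs \<open>(a, g \<circ> b)\<close>, and two of these sheets are equal or disjoint. This yields
  that \<open>R\<close> is Hausdorff and that \<open>(s, t)\<close> is proper; paracompactness of \<open>R\<close> follows, because \<open>R\<close> is a
  disjoint union of open pieces, each of which is proper over a second countable space. Effectiveness
  is once more the identity theorem: the germ of \<open>[a, z, b]\<close> is that of \<open>b \<circ> a\<inverse>\<close>.
\<close>

section \<open>Holomorphic maps between open subsets of \<open>\<complex>\<^sup>n\<close>\<close>

abbreviation lookup :: "cvec \<Rightarrow> nat \<Rightarrow> complex" where "lookup \<equiv> Poly_Mapping.lookup"

abbreviation Cn_open :: "nat \<Rightarrow> cvec set \<Rightarrow> bool" where "Cn_open n \<equiv> openin (top_of_set (Cn n))"

lemma lookup_scaleR [simp]: "lookup (r *\<^sub>R v) i = r *\<^sub>R lookup v i"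
proof -
  have "finite {i. r *\<^sub>R lookup v i \<noteq> 0}"
    by (rule finite_subset[OF _ finite_keys[of v]]) (auto simp: in_keys_iff)
  then show ?thesis
    by (simp add: scaleR_poly_mapping_def Abs_poly_mapping_inverse)
qed

lemma lookup_cscale [simp]: "lookup (cscale c v) i = c * lookup v i"
  by (simp add: cscale_def map.rep_eq when_def)

lemma norm_cvec: "norm (v::cvec) = (\<Sum>i\<in>Poly_Mapping.keys v. norm (lookup v i))"
  by (simp add: norm_poly_mapping_def dist_poly_mapping_def)

lemma norm_lookup_le: "norm (lookup (v::cvec) i) \<le> norm v"
proof (cases "i \<in> Poly_Mapping.keys v")
  case True
  then show ?thesis
    unfolding norm_cvec by (intro member_le_sum) auto
next
  case False
  then show ?thesis by (simp add: in_keys_iff)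
qed

lemma bounded_linear_lookup: "bounded_linear (\<lambda>v::cvec. lookup v i)"
  by (rule bounded_linear_intro[where K = 1]) (auto simp: lookup_add norm_lookup_le)

lemma bounded_linear_single: "bounded_linear (\<lambda>c. Poly_Mapping.single i c :: cvec)"
proof (rule bounded_linear_intro[where K = 1])
  show "norm (Poly_Mapping.single i x :: cvec) \<le> norm x * 1" for x
    by (cases "x = 0") (auto simp: norm_cvec)
qed (auto simp: single_add intro!: poly_mapping_eqI simp: lookup_single when_def)

lemmas continuous_on_lookup [continuous_intros] =
  bounded_linear.continuous_on[OF bounded_linear_lookup]
lemmas continuous_on_single [continuous_intros] =
  bounded_linear.continuous_on[OF bounded_linear_single]

lemma Cn_iff: "v \<in> Cn n \<longleftrightarrow> (\<forall>i\<ge>n. lookup v i = 0)"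
  by (auto simp: Cn_def in_keys_iff subset_iff not_less) (meson not_less)

lemma subspace_Cn: "subspace (Cn n)"
  by (auto simp: subspace_def Cn_iff lookup_add)

lemma cscale_Cn [simp]: "v \<in> Cn n \<Longrightarrow> cscale c v \<in> Cn n"
  by (auto simp: Cn_iff)

text \<open>The truncation to the first \<open>n\<close> coordinates is a bounded linear projection onto \<open>\<complex>\<^sup>n\<close>. Composing with
  it turns derivatives within \<open>\<complex>\<^sup>n\<close> into derivatives on the whole normed space.\<close>

definition cproj :: "nat \<Rightarrow> cvec \<Rightarrow> cvec" where
  "cproj n v = (\<Sum>i<n. Poly_Mapping.single i (lookup v i))"

lemma lookup_sum_cvec: "lookup (\<Sum>i\<in>I. f i :: cvec) j = (\<Sum>i\<in>I. lookup (f i) j)"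
  by (induction I rule: infinite_finite_induct) (auto simp: lookup_add)

lemma lookup_cproj: "lookup (cproj n v) i = (if i < n then lookup v i else 0)"
  by (simp add: cproj_def lookup_sum_cvec lookup_single when_def)

lemma cproj_in_Cn [simp]: "cproj n v \<in> Cn n"
  by (simp add: Cn_iff lookup_cproj)

lemma cproj_Cn [simp]: "v \<in> Cn n \<Longrightarrow> cproj n v = v"
  by (rule poly_mapping_eqI) (auto simp: Cn_iff lookup_cproj)

lemma range_cproj [simp]: "range (cproj n) = Cn n"
proof
  show "range (cproj n) \<subseteq> Cn n" by auto
  show "Cn n \<subseteq> range (cproj n)" using cproj_Cn by (metis rangeI subsetI)
qed

lemma bounded_linear_cproj: "bounded_linear (cproj n)"
  unfolding cproj_def
  by (intro bounded_linear_sum bounded_linear_compose[OF bounded_linear_single bounded_linear_lookup])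

text \<open>Differentiability at a point of an open subset of \<open>\<complex>\<^sup>n\<close> does not depend on that subset. Stating it
  within \<open>\<complex>\<^sup>n\<close> makes maps with different domains comparable.\<close>

definition hol_at :: "nat \<Rightarrow> (cvec \<Rightarrow> cvec) \<Rightarrow> cvec \<Rightarrow> bool" where
  "hol_at n f x \<longleftrightarrow> (\<exists>D. has_complex_derivative n (Cn n) f D x)"

lemma at_within_open_Cn:
  assumes "Cn_open n S" "x \<in> S"
  shows "at x within S = at x within (Cn n)"
proof -
  obtain T where "open T" "S = Cn n \<inter> T"
    using assms by (auto simp: openin_open)
  then show ?thesis using assms
    by (intro at_within_nhd[of x T]) auto
qed

lemma has_complex_derivative_open:
  assumes "Cn_open n S" "x \<in> S"
  shows "has_complex_derivative n S f D x \<longleftrightarrow> has_complex_derivative n (Cn n) f D x"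
  using at_within_open_Cn[OF assms] by (simp add: has_complex_derivative_def)

lemma holomorphic_between_iff:
  assumes "Cn_open n S"
  shows "holomorphic_between n S T f \<longleftrightarrow> f \<in> S \<rightarrow> T \<and> (\<forall>x\<in>S. hol_at n f x)"
  using has_complex_derivative_open[OF assms] by (auto simp: holomorphic_between_def hol_at_def)

lemma has_derivative_cproj:
  assumes "(f has_derivative D) (at x within Cn n)" "x \<in> Cn n"
  shows "((f \<circ> cproj n) has_derivative (D \<circ> cproj n)) (at x)"
proof (rule diff_chain_within)
  show "(cproj n has_derivative cproj n) (at x)"
    by (rule bounded_linear_imp_has_derivative[OF bounded_linear_cproj])
  show "(f has_derivative D) (at (cproj n x) within range (cproj n))"
    using assms by simp
qed

text \<open>Uniqueness of derivatives holds on the whole space, where the truncation moves the question.\<close>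

lemma has_derivative_Cn_unique:
  assumes "(f has_derivative D) (at x within Cn n)" "(f has_derivative D') (at x within Cn n)"
    and "x \<in> Cn n" "v \<in> Cn n"
  shows "D v = D' v"
proof -
  have "D \<circ> cproj n = D' \<circ> cproj n"
    using assms by (intro has_derivative_unique[OF has_derivative_cproj has_derivative_cproj])
  then show ?thesis
    using assms by (metis comp_apply cproj_Cn)
qed

lemma hol_at_cong:
  assumes "hol_at n f x" "Cn_open n S" "x \<in> S" "\<And>y. y \<in> S \<Longrightarrow> f y = g y"
  shows "hol_at n g x"
proof -
  obtain D where "has_complex_derivative n S f D x"
    using assms(1) unfolding hol_at_def has_complex_derivative_open[OF assms(2,3), symmetric] by blast
  then have "has_complex_derivative n S g D x"
    using assms(3,4) unfolding has_complex_derivative_def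
    by (metis (no_types, lifting) has_derivative_transform)
  then show ?thesis
    unfolding hol_at_def has_complex_derivative_open[OF assms(2,3), symmetric] by blast
qed

text \<open>The coordinates of \<open>f\<close> from \<open>m\<close> on vanish identically on \<open>S\<close>, hence so do those of the derivative.\<close>

lemma has_derivative_maps_Cn:
  assumes f: "(f has_derivative D) (at x within Cn n)"
    and S: "Cn_open n S" "x \<in> S" "f \<in> S \<rightarrow> Cn m" and v: "v \<in> Cn n"
  shows "D v \<in> Cn m"
  unfolding Cn_iff
proof (intro allI impI)
  fix i assume "m \<le> i"
  have x: "x \<in> Cn n" using S openin_imp_subset by blast
  let ?L = "\<lambda>v::cvec. (Poly_Mapping.single 0 (lookup v i)) :: cvec"
  have L: "bounded_linear ?L"
    by (rule bounded_linear_compose[OF bounded_linear_single bounded_linear_lookup])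
  have 1: "((\<lambda>y. ?L (f y)) has_derivative (\<lambda>v. ?L (D v))) (at x within Cn n)"
    by (rule bounded_linear.has_derivative[OF L f])
  have "((\<lambda>y. 0) has_derivative (\<lambda>v. ?L (D v))) (at x within S)"
    by (rule has_derivative_transform[OF S(2) _ 1[folded at_within_open_Cn[OF S(1,2)]]])
      (use S(3) \<open>m \<le> i\<close> in \<open>auto simp: Cn_iff Pi_iff\<close>)
  then have 2: "((\<lambda>y. 0) has_derivative (\<lambda>v. ?L (D v))) (at x within Cn n)"
    by (simp add: at_within_open_Cn[OF S(1,2)])
  have "?L (D v) = 0"
    using has_derivative_Cn_unique[OF 2 has_derivative_const x v] .
  then show "lookup (D v) i = 0"
    by (metis lookup_single_eq lookup_zero)
qed

lemma has_complex_derivative_compose: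
  assumes f: "has_complex_derivative n (Cn n) f D x" and g: "has_complex_derivative m (Cn m) g E (f x)"
    and S: "Cn_open n S" "x \<in> S" "f \<in> S \<rightarrow> Cn m"
  shows "has_complex_derivative n (Cn n) (g \<circ> f) (E \<circ> D) x"
proof -
  have D: "(f has_derivative D) (at x within S)"
    using f by (simp add: has_complex_derivative_def at_within_open_Cn[OF S(1,2)])
  have E: "(g has_derivative E) (at (f x) within f ` S)"
    using g S(3) unfolding has_complex_derivative_def
    by (auto intro: has_derivative_subset)
  have "((g \<circ> f) has_derivative (E \<circ> D)) (at x within S)"
    by (rule diff_chain_within[OF D E])
  moreover have "D v \<in> Cn m" if "v \<in> Cn n" for v
    using has_derivative_maps_Cn[OF _ S that] f by (auto simp: has_complex_derivative_def)
  ultimately show ?thesis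
    using f g by (auto simp: has_complex_derivative_def at_within_open_Cn[OF S(1,2)])
qed

lemma hol_at_compose:
  assumes "hol_at n f x" "hol_at m g (f x)"
    and "Cn_open n S" "x \<in> S" "f \<in> S \<rightarrow> Cn m"
  shows "hol_at n (g \<circ> f) x"
  using assms has_complex_derivative_compose unfolding hol_at_def by blast

lemma has_complex_derivative_id: "has_complex_derivative n (Cn n) (\<lambda>y. y) (\<lambda>v. v) x"
  by (auto simp: has_complex_derivative_def)

lemma hol_at_id: "hol_at n (\<lambda>y. y) x"
  unfolding hol_at_def using has_complex_derivative_id by blast

lemma hol_at_continuous_on:
  assumes "S \<subseteq> Cn n" "\<And>x. x \<in> S \<Longrightarrow> hol_at n f x"
  shows "continuous_on S f"
proof -
  have "continuous (at x within S) f" if "x \<in> S" for x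
    using assms(2)[OF that] assms(1) unfolding hol_at_def has_complex_derivative_def
    by (meson continuous_within_subset has_derivative_continuous)
  then show ?thesis by (simp add: continuous_on_eq_continuous_within)
qed

lemma cscale_add_left: "cscale (a + b) v = cscale a v + cscale b v"
  by (rule poly_mapping_eqI) (simp add: lookup_add algebra_simps)

lemma cscale_scaleR: "cscale (r *\<^sub>R a) v = r *\<^sub>R cscale a v"
  by (rule poly_mapping_eqI) simp

lemma norm_cscale: "norm (cscale c v) = norm c * norm v"
proof -
  have "norm (cscale c v) = (\<Sum>i\<in>Poly_Mapping.keys v. norm (lookup (cscale c v) i))"
    unfolding norm_cvec by (rule sum.mono_neutral_left) (auto simp: in_keys_iff)
  then show ?thesis by (simp add: norm_cvec norm_mult sum_distrib_left)
qed

lemma bounded_linear_cscale_left: "bounded_linear (\<lambda>c. cscale c v)"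
  by (rule bounded_linear_intro[where K = "norm v"]) (auto simp: cscale_add_left cscale_scaleR norm_cscale)

text \<open>The complex line through \<open>y\<close> and \<open>z\<close> meets the ball in a convex set of parameters, on which the
  coordinates of \<open>f\<close> and \<open>g\<close> are holomorphic functions of one variable. The identity theorem in one
  variable carries their agreement near \<open>y\<close> to \<open>z\<close>.\<close>

lemma identity_theorem_ball:
  assumes B: "Cn n \<inter> ball x r \<subseteq> S" and S: "Cn_open n S"
    and f: "\<And>y. y \<in> S \<Longrightarrow> hol_at n f y" and g: "\<And>y. y \<in> S \<Longrightarrow> hol_at n g y"
    and y: "y \<in> Cn n" "y \<in> ball x r" and z: "z \<in> Cn n" "z \<in> ball x r"
    and N: "Cn_open n N" "y \<in> N" "\<And>w. w \<in> N \<Longrightarrow> f w = g w"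
  shows "f z = g z"
proof (rule poly_mapping_eqI)
  fix i
  define p where "p = (\<lambda>t. y + cscale t (z - y))"
  define T where "T = p -` ball x r"
  have zy: "z - y \<in> Cn n" using y z subspace_Cn by (simp add: subspace_diff)
  have pC: "p t \<in> Cn n" for t
    unfolding p_def using y zy subspace_Cn by (auto intro: subspace_add)
  have dp: "(p has_derivative (\<lambda>s. cscale s (z - y))) (at t within A)" for t A
    unfolding p_def
    by (rule has_derivative_eq_rhs[OF has_derivative_add[OF has_derivative_const
            bounded_linear_imp_has_derivative[OF bounded_linear_cscale_left]]]) simp
  have cp: "continuous_on UNIV p"
    by (rule has_derivative_continuous_on[OF dp])
  have openT: "open T" unfolding T_def using cp by (simp add: open_vimage)
  have hol: "(\<lambda>t. lookup (h (p t)) i) holomorphic_on T" if h: "\<And>y. y \<in> S \<Longrightarrow> hol_at n h y" for h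
  proof -
    have "((\<lambda>t. lookup (h (p t)) i) has_field_derivative d) (at t)" if "t \<in> T" and
        D: "has_complex_derivative n (Cn n) h D (p t)" and d: "d = lookup (D (z - y)) i" for t D d
    proof -
      have "(h has_derivative D) (at (p t) within range p)"
        using D pC by (auto simp: has_complex_derivative_def intro: has_derivative_subset)
      then have "((h \<circ> p) has_derivative (D \<circ> (\<lambda>s. cscale s (z - y)))) (at t)"
        by (rule diff_chain_within[OF dp])
      then have "((\<lambda>t. lookup ((h \<circ> p) t) i) has_derivative (\<lambda>s. lookup ((D \<circ> (\<lambda>s. cscale s (z - y))) s) i)) (at t)"
        by (rule bounded_linear.has_derivative[OF bounded_linear_lookup])
      moreover have "(\<lambda>s. lookup ((D \<circ> (\<lambda>s. cscale s (z - y))) s) i) = (*) d"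
        using D zy unfolding has_complex_derivative_def d by (auto simp: fun_eq_iff)
      ultimately show ?thesis by (simp add: has_field_derivative_def)
    qed
    moreover have "p t \<in> S" if "t \<in> T" for t using that B pC T_def by auto
    ultimately show ?thesis
      using h unfolding holomorphic_on_def hol_at_def field_differentiable_def
      by (meson has_field_derivative_at_within)
  qed
  have "convex T"
    unfolding convex_alt
  proof (intro ballI allI impI)
    fix s t u assume "s \<in> T" "t \<in> T" "0 \<le> u \<and> u \<le> (1::real)"
    moreover have "p ((1 - u) *\<^sub>R s + u *\<^sub>R t) = (1 - u) *\<^sub>R p s + u *\<^sub>R p t"
      by (rule poly_mapping_eqI) (simp add: p_def lookup_add lookup_minus algebra_simps scaleR_conv_of_real)
    ultimately show "(1 - u) *\<^sub>R s + u *\<^sub>R t \<in> T"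
      unfolding T_def using convexD_alt[OF convex_ball] by auto
  qed
  then have connT: "connected T" by (rule convex_connected)
  obtain O' where O': "open O'" "N = Cn n \<inter> O'" using N(1) by (auto simp: openin_open)
  define T' where "T' = T \<inter> p -` O'"
  have p0: "p 0 = y" unfolding p_def by (rule poly_mapping_eqI) (simp add: lookup_add)
  have p1: "p 1 = z" unfolding p_def by (rule poly_mapping_eqI) (simp add: lookup_add lookup_minus)
  have "open T'" unfolding T'_def using openT cp O' by (simp add: open_vimage open_Int)
  moreover have "0 \<in> T'" using p0 y N O' by (auto simp: T'_def T_def)
  moreover have "1 \<in> T" using p1 z by (auto simp: T_def)
  ultimately have "lookup (f (p 1)) i = lookup (g (p 1)) i"
  proof (intro analytic_continuation_open[of T' T "\<lambda>t. lookup (f (p t)) i" "\<lambda>t. lookup (g (p t)) i" 1])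
    show "lookup (f (p t)) i = lookup (g (p t)) i" if "t \<in> T'" for t
      using that N(3) O'(2) pC by (auto simp: T'_def)
  qed (use openT connT hol[OF f] hol[OF g] T'_def in auto)
  then show "lookup (f z) i = lookup (g z) i" by (simp add: p1)
qed

text \<open>If \<open>f\<close> and \<open>g\<close> agree near one point of a ball in \<open>S\<close>, they agree on the ball; so the property of
  agreeing near a point propagates through the connected set \<open>S\<close>.\<close>

theorem identity_theorem:
  assumes S: "Cn_open n S" "connected S"
    and f: "\<And>y. y \<in> S \<Longrightarrow> hol_at n f y" and g: "\<And>y. y \<in> S \<Longrightarrow> hol_at n g y"
    and N: "Cn_open n N" "N \<noteq> {}" "N \<subseteq> S" "\<And>w. w \<in> N \<Longrightarrow> f w = g w"
    and x: "x \<in> S"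
  shows "f x = g x"
proof -
  define P :: "cvec \<Rightarrow> bool" where "P x \<longleftrightarrow> (\<exists>N. Cn_open n N \<and> x \<in> N \<and> (\<forall>w\<in>N. f w = g w))" for x
  obtain a where a: "a \<in> N" using N by blast
  have "P x"
  proof (rule connected_induction_simple[OF S(2), where P = P and a = a])
    show "P a" using N a P_def by blast
  next
    fix b assume b: "b \<in> S"
    have sub: "S \<subseteq> Cn n" using S(1) openin_imp_subset by blast
    obtain r where r: "r > 0" "ball b r \<inter> Cn n \<subseteq> S"
      using S(1) b unfolding openin_contains_ball by blast
    let ?T = "Cn n \<inter> ball b r"
    have T: "Cn_open n ?T" by (simp add: openin_open_Int)
    have "P z" if "y \<in> ?T" "z \<in> ?T" "P y" for y z
    proof -
      obtain N where N: "Cn_open n N" "y \<in> N" "\<And>w. w \<in> N \<Longrightarrow> f w = g w"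
        using \<open>P y\<close> P_def by blast
      have "f w = g w" if w: "w \<in> ?T" for w
        by (rule identity_theorem_ball[of n b r S f g y w N]) (use w r S f g N \<open>y \<in> ?T\<close> in auto)
      then show ?thesis using T \<open>z \<in> ?T\<close> P_def by blast
    qed
    moreover have "openin (top_of_set S) ?T"
      using T sub r by (metis inf_commute openin_subset_trans)
    moreover have "b \<in> ?T" using b sub r(1) by auto
    ultimately show "\<exists>T. openin (top_of_set S) T \<and> b \<in> T \<and> (\<forall>x\<in>T. \<forall>y\<in>T. P x \<longrightarrow> P y)"
      by (intro exI[of _ ?T] conjI ballI impI) assumption+
  qed (use a N x in \<open>simp_all add: subset_eq\<close>)
  then show ?thesis using P_def by blast
qed

section \<open>Invariance of domain and inverses of embeddings\<close>

definition to_real_coords :: "cvec \<Rightarrow> nat \<Rightarrow> real" where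
  "to_real_coords v i =
     (if even i then Re (lookup v (i div 2)) else Im (lookup v (i div 2)))"

definition of_real_coords :: "nat \<Rightarrow> (nat \<Rightarrow> real) \<Rightarrow> cvec" where
  "of_real_coords n f = (\<Sum>i<n. Poly_Mapping.single i (Complex (f (2 * i)) (f (2 * i + 1))))"

lemma Euclidean_space_eq: "Euclidean_space n = top_of_set {f. \<forall>m\<ge>n. f m = 0}"
  by (simp add: Euclidean_space_def euclidean_product_topology)

text \<open>The real and imaginary parts identify \<open>\<complex>\<^sup>n\<close> with Euclidean space of dimension \<open>2n\<close>. Second
  countability, local compactness and invariance of domain are transferred along this homeomorphism.\<close>

lemma homeomorphic_maps_real_coords:
  "homeomorphic_maps (top_of_set (Cn n)) (Euclidean_space (2 * n)) to_real_coords (of_real_coords n)"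
  unfolding homeomorphic_maps_def Euclidean_space_eq
proof (intro conjI ballI)
  have "continuous_on (Cn n) to_real_coords"
  proof (rule continuous_on_coordinatewise_then_product)
    show "continuous_on (Cn n) (\<lambda>x. to_real_coords x i)" for i
      by (cases "even i") (auto simp: to_real_coords_def intro!: continuous_intros)
  qed
  moreover have "to_real_coords v i = 0" if "v \<in> Cn n" "2 * n \<le> i" for v i
    using that by (auto simp: to_real_coords_def Cn_iff)
  ultimately show "continuous_map (top_of_set (Cn n)) (top_of_set {f. \<forall>m\<ge>2 * n. f m = 0}) to_real_coords"
    by auto
  have coord: "continuous_on UNIV (\<lambda>f::nat \<Rightarrow> real. f i)" for i
    by (rule continuous_on_product_coordinates)
  have "continuous_on UNIV (of_real_coords n)"
    unfolding of_real_coords_def Complex_eq by (intro continuous_intros coord)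
  moreover have "of_real_coords n f \<in> Cn n" for f
    by (auto simp: of_real_coords_def Cn_iff lookup_sum_cvec lookup_single when_def)
  ultimately show "continuous_map (top_of_set {f. \<forall>m\<ge>2 * n. f m = 0}) (top_of_set (Cn n)) (of_real_coords n)"
    by (auto intro: continuous_on_subset)
next
  fix v assume "v \<in> topspace (top_of_set (Cn n))"
  then show "of_real_coords n (to_real_coords v) = v"
    by (intro poly_mapping_eqI)
      (auto simp: of_real_coords_def to_real_coords_def Cn_iff lookup_sum_cvec lookup_single when_def)
next
  fix f :: "nat \<Rightarrow> real" assume "f \<in> topspace (top_of_set {f. \<forall>m\<ge>2 * n. f m = 0})"
  then have f: "f m = 0" if "m \<ge> 2 * n" for m using that by auto
  show "to_real_coords (of_real_coords n f) = f"
  proof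
    fix i
    have "i div 2 < n" if "i < 2 * n" using that by auto
    then show "to_real_coords (of_real_coords n f) i = f i"
      using f[of i]
      by (cases "i < 2 * n")
        (auto simp: of_real_coords_def to_real_coords_def lookup_sum_cvec lookup_single when_def
            elim!: evenE oddE)
  qed
qed

lemma second_countable_Cn: "second_countable (top_of_set S)" if "S \<subseteq> Cn n"
proof -
  have "second_countable (euclidean :: (nat \<Rightarrow> real) topology)"
    unfolding second_countable_def using ex_countable_basis topological_basis_def
    by (metis (no_types, lifting) Ball_def open_openin topological_basisE)
  then have "second_countable (Euclidean_space (2 * n))"
    unfolding Euclidean_space_eq by (rule second_countable_subtopology)
  then have "second_countable (top_of_set (Cn n))"
    using homeomorphic_maps_real_coords[of n]
    by (auto simp: homeomorphic_maps_map homeomorphic_eq_everything_map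
        intro!: second_countable_open_map_image[of "Euclidean_space (2 * n)" _ "of_real_coords n"])
  then have "second_countable (subtopology (top_of_set (Cn n)) S)"
    by (rule second_countable_subtopology)
  then show ?thesis using that by (simp add: subtopology_subtopology Int_absorb1)
qed

lemma locally_compact_Cn: "locally_compact_space (top_of_set (Cn n))"
  using homeomorphic_maps_real_coords locally_compact_Euclidean_space homeomorphic_locally_compact_space
    homeomorphic_space_def by blast

lemma invariance_of_domain_Cn:
  assumes S: "Cn_open n S" and f: "continuous_on S f" "f \<in> S \<rightarrow> Cn n" "inj_on f S"
  shows "Cn_open n (f ` S)"
proof -
  let ?E = "Euclidean_space (2 * n)" and ?C = "top_of_set (Cn n)"
  note h = homeomorphic_maps_real_coords[of n]
  have h1: "homeomorphic_map ?C ?E to_real_coords" and h2: "homeomorphic_map ?E ?C (of_real_coords n)"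
    using h homeomorphic_maps_map by blast+
  have sub: "S \<subseteq> Cn n" using S openin_imp_subset by blast
  have inv: "of_real_coords n (to_real_coords v) = v" if "v \<in> Cn n" for v
    using h that by (auto simp: homeomorphic_maps_def)
  let ?g = "to_real_coords \<circ> f \<circ> of_real_coords n"
  have ope: "openin ?E (to_real_coords ` S)"
    using homeomorphic_map_openness_eq[OF h1] S by blast
  have "openin ?E (?g ` (to_real_coords ` S))"
  proof (rule invariance_of_domain_Euclidean_space[OF ope])
    have "continuous_map (subtopology ?E (to_real_coords ` S)) (top_of_set S) (of_real_coords n)"
      using h2 inv sub homeomorphic_imp_continuous_map
      by (fastforce simp: continuous_map_in_subtopology intro: continuous_map_from_subtopology)
    moreover have "continuous_map (top_of_set S) ?C f" using f by auto
    moreover have "continuous_map ?C ?E to_real_coords" using h1 homeomorphic_imp_continuous_map by blast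
    ultimately show "continuous_map (subtopology ?E (to_real_coords ` S)) ?E ?g"
      by (metis continuous_map_compose)
    have "inj_on to_real_coords (Cn n)" using inv by (metis inj_on_inverseI)
    then show "inj_on ?g (to_real_coords ` S)"
      using f(2,3) sub inv by (force simp: inj_on_def Pi_iff subset_iff)
  qed
  moreover have "?g ` (to_real_coords ` S) = to_real_coords ` (f ` S)"
    using inv sub by (force simp: image_image)
  moreover have "f ` S \<subseteq> topspace ?C" using f by auto
  ultimately show ?thesis using homeomorphic_map_openness[OF h1] by metis
qed

lemma cproj_expand:
  "cproj n v = (\<Sum>i<n. Re (lookup v i) *\<^sub>R Poly_Mapping.single i 1
                 + Im (lookup v i) *\<^sub>R Poly_Mapping.single i \<i>)"
proof -
  have "Poly_Mapping.single i c = Re c *\<^sub>R Poly_Mapping.single i 1 + Im c *\<^sub>R Poly_Mapping.single i \<i>"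
    for i :: nat and c :: complex
    by (rule poly_mapping_eqI) (auto simp: lookup_add lookup_single when_def complex_eq_iff)
  then show ?thesis unfolding cproj_def by (intro sum.cong refl)
qed

lemma Cn_eq_span: "Cn n = span ((\<lambda>i. Poly_Mapping.single i 1) ` {..<n} \<union> (\<lambda>i. Poly_Mapping.single i \<i>) ` {..<n})"
  (is "_ = span ?B")
proof
  show "span ?B \<subseteq> Cn n"
    by (rule span_minimal[OF _ subspace_Cn]) (auto simp: Cn_iff lookup_single when_def)
  show "Cn n \<subseteq> span ?B"
  proof
    fix v assume "v \<in> Cn n"
    then have "v = cproj n v" by simp
    also have "\<dots> = (\<Sum>i<n. Re (lookup v i) *\<^sub>R Poly_Mapping.single i 1 + Im (lookup v i) *\<^sub>R Poly_Mapping.single i \<i>)"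
      by (rule cproj_expand)
    also have "\<dots> \<in> span ?B"
      by (intro span_sum span_add span_scale span_base) auto
    finally show "v \<in> span ?B" .
  qed
qed

text \<open>A finite basis of \<open>\<complex>\<^sup>n\<close> over the reals has an independent image of the same size, which cannot be
  enlarged within \<open>\<complex>\<^sup>n\<close>.\<close>

lemma linear_inj_Cn_surj:
  assumes D: "linear D" "inj_on D (Cn n)" "\<And>v. v \<in> Cn n \<Longrightarrow> D v \<in> Cn n"
  shows "D ` Cn n = Cn n"
proof -
  obtain B where B: "B \<subseteq> Cn n" "independent B" "Cn n \<subseteq> span B"
    using maximal_independent_subset by blast
  have sp: "span B = Cn n"
    using B subspace_Cn span_minimal by blast
  have finB: "finite B"
    using independent_span_bound[OF _ B(2), of "(\<lambda>i. Poly_Mapping.single i 1) ` {..<n} \<union> (\<lambda>i. Poly_Mapping.single i \<i>) ` {..<n}"] B(1)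
    by (simp add: Cn_eq_span)
  have ind: "independent (D ` B)"
    using D B(2) sp linear_independent_injective_image by metis
  have card: "card (D ` B) = card B"
    using D(2) B(1) by (meson card_image inj_on_subset)
  have "v \<in> span (D ` B)" if v: "v \<in> Cn n" for v
  proof (rule ccontr)
    assume nv: "v \<notin> span (D ` B)"
    then have "independent (insert v (D ` B))" by (simp add: ind independent_insertI)
    moreover have "insert v (D ` B) \<subseteq> span B" using v D(3) B(1) sp by auto
    ultimately have "card (insert v (D ` B)) \<le> card B"
      using independent_span_bound[OF finB] by blast
    moreover have "v \<notin> D ` B" using nv span_base[of v "D ` B"] by blast
    ultimately show False using finB card by simp
  qed
  moreover have "D ` Cn n = span (D ` B)"
    using linear_span_image[OF D(1), of B] sp by simp
  moreover have "D ` Cn n \<subseteq> Cn n" using D(3) by auto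
  ultimately show ?thesis by blast
qed

text \<open>The inverse on \<open>\<complex>\<^sup>n\<close> is extended to all sequences by truncation. The extension depends on finitely
  many coordinates only and is therefore bounded.\<close>

lemma linear_inverse_Cn:
  assumes D: "linear D" "inj_on D (Cn n)" "\<And>v. v \<in> Cn n \<Longrightarrow> D v \<in> Cn n"
  obtains G where "bounded_linear G" "\<And>v. v \<in> Cn n \<Longrightarrow> G v \<in> Cn n"
    "\<And>v. v \<in> Cn n \<Longrightarrow> G (D v) = v" "\<And>v. v \<in> Cn n \<Longrightarrow> D (G v) = v"
proof -
  obtain g where g: "range g \<subseteq> Cn n" "linear g" "\<And>v. v \<in> Cn n \<Longrightarrow> g (D v) = v"
    using linear_exists_left_inverse_on[OF D(1) subspace_Cn D(2)] by blast
  interpret g: linear g by fact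
  have "(\<lambda>v. g (cproj n v)) = (\<lambda>v. \<Sum>i<n. Re (lookup v i) *\<^sub>R g (Poly_Mapping.single i 1) + Im (lookup v i) *\<^sub>R g (Poly_Mapping.single i \<i>))"
  proof
    fix v
    have "cproj n v = (\<Sum>i<n. Re (lookup v i) *\<^sub>R Poly_Mapping.single i 1 + Im (lookup v i) *\<^sub>R Poly_Mapping.single i \<i>)"
      by (rule cproj_expand)
    then show "g (cproj n v) = (\<Sum>i<n. Re (lookup v i) *\<^sub>R g (Poly_Mapping.single i 1) + Im (lookup v i) *\<^sub>R g (Poly_Mapping.single i \<i>))"
      by (simp add: g.sum g.add g.scale)
  qed
  moreover have "bounded_linear (\<lambda>v. \<Sum>i<n. Re (lookup v i) *\<^sub>R g (Poly_Mapping.single i 1) + Im (lookup v i) *\<^sub>R g (Poly_Mapping.single i \<i>))"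
    by (intro bounded_linear_sum bounded_linear_add bounded_linear_scaleR_const
        bounded_linear_compose[OF bounded_linear_Re bounded_linear_lookup]
        bounded_linear_compose[OF bounded_linear_Im bounded_linear_lookup])
  ultimately have bl: "bounded_linear (\<lambda>v. g (cproj n v))" by simp
  show ?thesis
  proof (rule that[OF bl])
    show "D (g (cproj n v)) = v" if v: "v \<in> Cn n" for v
    proof -
      obtain w where "w \<in> Cn n" "v = D w" using linear_inj_Cn_surj[OF D] v by blast
      then show ?thesis using g(3) v by simp
    qed
  qed (use g D(3) in auto)
qed

text \<open>The image is open by invariance of domain. The inverse function rule for derivatives concerns points
  with a full neighbourhood; it is applied to the extensions of \<open>f\<close> and of its inverse that leave the
  coordinates from \<open>n\<close> on unchanged.\<close>

lemma holomorphic_embedding_inverse: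
  assumes S: "Cn_open n S" and T: "T \<subseteq> Cn n" and f: "holomorphic_embedding n S T f"
  shows "Cn_open n (f ` S)" "\<And>x. x \<in> S \<Longrightarrow> hol_at n (inv_into S f) (f x)" "inj_on f S"
proof -
  let ?P = "cproj n" and ?I = "f ` S" and ?g = "inv_into S f"
  have fS: "f \<in> S \<rightarrow> T" and fh: "\<And>x. x \<in> S \<Longrightarrow> hol_at n f x"
    using f holomorphic_between_iff[OF S] by (auto simp: holomorphic_embedding_def)
  have sub: "S \<subseteq> Cn n" using S openin_imp_subset by blast
  have hm: "homeomorphic_map (top_of_set S) (subtopology (top_of_set T) ?I) f"
    using f by (simp add: holomorphic_embedding_def embedding_map_def)
  have "subtopology (top_of_set T) ?I = top_of_set ?I"
    using fS by (auto simp: subtopology_subtopology Int_absorb1 image_subset_iff Pi_iff)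
  then obtain g' where g': "homeomorphic_maps (top_of_set S) (top_of_set ?I) f g'"
    using hm homeomorphic_map_maps by metis
  then have gf: "g' (f x) = x" if "x \<in> S" for x using that by (auto simp: homeomorphic_maps_def)
  show inj: "inj_on f S" using gf by (metis inj_on_inverseI)
  have cg: "continuous_on ?I ?g"
  proof -
    have "continuous_on ?I g'" using g' by (auto simp: homeomorphic_maps_def)
    then show ?thesis by (rule continuous_on_eq) (use gf inj in auto)
  qed
  have cf: "continuous_on S f" by (rule hol_at_continuous_on[OF sub fh])
  show opI: "Cn_open n ?I"
    by (rule invariance_of_domain_Cn[OF S cf _ inj]) (use fS T in auto)
  fix x assume x: "x \<in> S"
  obtain D where D: "has_complex_derivative n (Cn n) f D x" using fh[OF x] hol_at_def by blast
  have Dd: "(f has_derivative D) (at x within Cn n)" and bD: "bounded_linear D"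
    using D has_derivative_bounded_linear unfolding has_complex_derivative_def by blast+
  have DCn: "D v \<in> Cn n" if "v \<in> Cn n" for v
    using has_derivative_maps_Cn[OF Dd S x _ that, of n] fS T by auto
  have injD: "inj_on D (Cn n)"
    using f D x has_complex_derivative_open[OF S x] by (auto simp: holomorphic_embedding_def)
  obtain G where G: "bounded_linear G" "\<And>v. v \<in> Cn n \<Longrightarrow> G v \<in> Cn n"
    "\<And>v. v \<in> Cn n \<Longrightarrow> G (D v) = v" "\<And>v. v \<in> Cn n \<Longrightarrow> D (G v) = v"
    using linear_inverse_Cn[OF bounded_linear.linear[OF bD] injD DCn] by blast
  \<comment> \<open>\<open>f\<close>, its inverse and their derivatives, extended by the identity on the other coordinates\<close>
  let ?F = "\<lambda>w. f (?P w) + (w - ?P w)" and ?F' = "\<lambda>w. D (?P w) + (w - ?P w)"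
  let ?G = "\<lambda>w. ?g (?P w) + (w - ?P w)" and ?G' = "\<lambda>w. G (?P w) + (w - ?P w)"
  obtain O' where O': "open O'" "?I = Cn n \<inter> O'" using opI by (auto simp: openin_open)
  have contP: "continuous_on A ?P" for A using bounded_linear_cproj linear_continuous_on by blast
  have gS: "?g w \<in> S" "f (?g w) = w" if "w \<in> ?I" for w
    using that by (auto simp: inv_into_into f_inv_into_f)
  have P_lin: "?P (a + b) = ?P a + ?P b" "?P (a - b) = ?P a - ?P b" for a b
    using bounded_linear_cproj bounded_linear.linear linear_add linear_diff by blast+
  have PI: "?P w \<in> ?I" if "w \<in> ?P -` O'" for w using that O' by auto
  have fx: "f x \<in> ?I" "f x \<in> Cn n" "?P (f x) = f x" "?P x = x" "?g (f x) = x"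
    using x fS T sub inj by auto
  have "(?G has_derivative ?G') (at (f x))"
  proof (rule has_derivative_inverse_basic[where T = "?P -` O'"])
    have "(?F has_derivative ?F') (at x)"
      using has_derivative_add[OF has_derivative_cproj[OF Dd, unfolded o_def]
          has_derivative_diff[OF has_derivative_ident bounded_linear_imp_has_derivative[OF bounded_linear_cproj]]]
        x sub by auto
    then show "(?F has_derivative ?F') (at (?G (f x)))" using fx by simp
    show "bounded_linear ?G'"
      by (intro bounded_linear_add bounded_linear_sub bounded_linear_compose[OF G(1) bounded_linear_cproj]
          bounded_linear_ident bounded_linear_cproj)
    show "?G' \<circ> ?F' = id"
      using DCn G(3) by (auto simp: fun_eq_iff P_lin)
    have "continuous_on (?P -` O') ?G"
      by (intro continuous_intros continuous_on_compose2[OF cg contP] contP) (use PI in blast)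
    moreover show opT: "open (?P -` O')" using contP O' by (simp add: open_vimage)
    moreover show "f x \<in> ?P -` O'" using fx O' by auto
    ultimately show "continuous (at (f x)) ?G" by (simp add: continuous_on_eq_continuous_at)
    show "?F (?G z) = z" if "z \<in> ?P -` O'" for z
    proof -
      have "?g (?P z) \<in> Cn n" using gS PI[OF that] sub by blast
      then show ?thesis using gS(2)[OF PI[OF that]] by (simp add: P_lin)
    qed
  qed
  then have "(?G has_derivative ?G') (at (f x) within Cn n)" by (rule has_derivative_at_withinI)
  moreover have "?G' (cscale c v) = cscale c (?G' v)" if "v \<in> Cn n" for c v
  proof -
    have "G (cscale c v) = G (cscale c (D (G v)))" using G that by simp
    also have "\<dots> = G (D (cscale c (G v)))" using D G(2) that by (simp add: has_complex_derivative_def)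
    also have "\<dots> = cscale c (G v)" using G(2,3) that by simp
    finally show ?thesis using that by simp
  qed
  ultimately have "hol_at n ?G (f x)" unfolding hol_at_def has_complex_derivative_def by blast
  then show "hol_at n ?g (f x)"
    by (rule hol_at_cong[OF _ opI fx(1)]) (use fS T in auto)
qed

text \<open>Holomorphic embeddings are the holomorphic bijections onto open sets with holomorphic inverse. In this
  form they visibly compose.\<close>

lemma holomorphic_embedding_iff:
  assumes S: "Cn_open n S" and T: "T \<subseteq> Cn n"
  shows "holomorphic_embedding n S T f \<longleftrightarrow>
     f \<in> S \<rightarrow> T \<and> Cn_open n (f ` S) \<and> (\<forall>x\<in>S. hol_at n f x) \<and>
     (\<exists>g. \<forall>x\<in>S. g (f x) = x \<and> hol_at n g (f x))"
    (is "?L \<longleftrightarrow> ?R")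
proof
  assume L: ?L
  note * = holomorphic_embedding_inverse[OF S T L]
  have "f \<in> S \<rightarrow> T \<and> (\<forall>x\<in>S. hol_at n f x)"
    using L holomorphic_between_iff[OF S] by (auto simp: holomorphic_embedding_def)
  moreover have "\<forall>x\<in>S. inv_into S f (f x) = x \<and> hol_at n (inv_into S f) (f x)"
    using * by auto
  ultimately show ?R using *(1) by blast
next
  assume ?R
  then obtain g where fS: "f \<in> S \<rightarrow> T" and op: "Cn_open n (f ` S)"
    and f: "\<And>x. x \<in> S \<Longrightarrow> hol_at n f x" and gf: "\<And>x. x \<in> S \<Longrightarrow> g (f x) = x"
    and g: "\<And>x. x \<in> S \<Longrightarrow> hol_at n g (f x)" by blast
  have sub: "S \<subseteq> Cn n" using S openin_imp_subset by blast
  have "inj_on D (Cn n)" if x: "x \<in> S" and "has_complex_derivative n S f D x" for x D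
  proof -
    have D: "has_complex_derivative n (Cn n) f D x"
      using that has_complex_derivative_open[OF S x] by blast
    obtain E where E: "has_complex_derivative n (Cn n) g E (f x)" using g[OF x] hol_at_def by blast
    have "has_complex_derivative n S (g \<circ> f) (E \<circ> D) x"
      using has_complex_derivative_compose[OF D E S x] fS T has_complex_derivative_open[OF S x] by auto
    then have "((g \<circ> f) has_derivative (E \<circ> D)) (at x within S)" by (simp add: has_complex_derivative_def)
    then have "((\<lambda>y. y) has_derivative (E \<circ> D)) (at x within S)"
      by (rule has_derivative_transform[OF x, rotated]) (use gf in auto)
    then have "((\<lambda>y. y) has_derivative (E \<circ> D)) (at x within Cn n)"
      using at_within_open_Cn[OF S x] by simp
    then have "(E \<circ> D) v = v" if "v \<in> Cn n" for v
      by (rule has_derivative_Cn_unique[OF _ has_derivative_ident]) (use x sub that in auto)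
    then show ?thesis by (metis comp_apply inj_on_inverseI)
  qed
  moreover have "embedding_map (top_of_set S) (top_of_set T) f"
  proof -
    have "continuous_on S f" by (rule hol_at_continuous_on[OF sub f])
    moreover have "continuous_on (f ` S) g"
      by (rule hol_at_continuous_on[OF openin_imp_subset[OF op]]) (use g in auto)
    ultimately have "homeomorphic_maps (top_of_set S) (top_of_set (f ` S)) f g"
      using gf by (auto simp: homeomorphic_maps_def)
    moreover have "subtopology (top_of_set T) (f ` S) = top_of_set (f ` S)"
      using fS by (auto simp: subtopology_subtopology Int_absorb1 image_subset_iff Pi_iff)
    ultimately show ?thesis
      unfolding embedding_map_def using homeomorphic_maps_map by (metis topspace_euclidean_subtopology)
  qed
  ultimately show ?L
    using fS f holomorphic_between_iff[OF S] by (auto simp: holomorphic_embedding_def)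
qed

section \<open>Paracompactness\<close>

text \<open>Countably many open sets \<open>V n\<close>, whose closures lie in members \<open>U n\<close> of the given cover, still cover
  the space. The sets \<open>U n\<close> minus the closures of all earlier \<open>V m\<close> form a refinement, and \<open>V n\<close> meets
  at most the first \<open>n + 1\<close> of them.\<close>

lemma regular_Lindelof_imp_paracompact:
  assumes reg: "regular_space X" and L: "Lindelof_space X"
  shows "paracompact_space X"
  unfolding paracompact_space_def
proof (intro allI impI)
  fix \<U> assume \<U>: "(\<forall>U\<in>\<U>. openin X U) \<and> \<Union>\<U> = topspace X"
  define \<V> where "\<V> = {V. openin X V \<and> (\<exists>U\<in>\<U>. X closure_of V \<subseteq> U)}"
  have "\<Union>\<V> = topspace X"
  proof (intro equalityI subsetI)
    fix x assume x: "x \<in> topspace X"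
    then obtain U where U: "U \<in> \<U>" "x \<in> U" "openin X U" using \<U> by blast
    have "neighbourhood_base_of (closedin X) X" using reg by (simp add: neighbourhood_base_of_closedin)
    then obtain V C where V: "openin X V" "closedin X C" "x \<in> V" "V \<subseteq> C" "C \<subseteq> U"
      using U unfolding neighbourhood_base_of by meson
    then have "X closure_of V \<subseteq> U" by (meson closure_of_minimal order_trans)
    then show "x \<in> \<Union>\<V>" using V U \<V>_def by blast
  qed (use \<V>_def openin_subset in auto)
  then obtain \<V>' where \<V>': "countable \<V>'" "\<V>' \<subseteq> \<V>" "\<Union>\<V>' = topspace X"
    using Lindelof_spaceD[OF L, of \<V>] \<V>_def by blast
  show "\<exists>\<W>. (\<forall>V\<in>\<W>. openin X V) \<and> \<Union>\<W> = topspace X \<and> (\<forall>V\<in>\<W>. \<exists>U\<in>\<U>. V \<subseteq> U) \<and> locally_finite_in X \<W>"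
  proof (cases "\<V>' = {}")
    case True
    then show ?thesis using \<V>' by (intro exI[of _ "{}"]) (auto simp: locally_finite_in_def)
  next
    case False
    define V where "V = from_nat_into \<V>'"
    have V: "range V = \<V>'" using False \<V>'(1) by (simp add: V_def)
    have "\<exists>U\<in>\<U>. X closure_of V n \<subseteq> U" for n using V \<V>'(2) \<V>_def by blast
    then obtain U where U: "\<And>n. U n \<in> \<U>" "\<And>n. X closure_of V n \<subseteq> U n" by metis
    have oV: "openin X (V n)" for n using V \<V>'(2) \<V>_def by blast
    \<comment> \<open>A point lies in \<open>W n\<close> for the least \<open>n\<close> with the point in \<open>U n\<close>, which is why these sets still cover.\<close>
    define W where "W n = U n - (\<Union>m<n. X closure_of V m)" for n
    have oW: "openin X (W n)" for n
      unfolding W_def using U(1) \<U> by (intro openin_diff closedin_Union) auto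
    have VU: "V n \<subseteq> U n" for n using U(2) closure_of_subset[OF openin_subset[OF oV]] by blast
    have cover: "\<Union>(range W) = topspace X"
    proof (intro equalityI subsetI)
      fix x assume x: "x \<in> topspace X"
      then obtain n0 where "x \<in> V n0" using V \<V>'(3) by blast
      then have "x \<in> U n0" using VU by blast
      then have "x \<in> U (LEAST n. x \<in> U n)" by (rule LeastI)
      moreover have "x \<notin> U m" if "m < (LEAST n. x \<in> U n)" for m
        using not_less_Least[OF that] .
      ultimately have "x \<in> W (LEAST n. x \<in> U n)" unfolding W_def using U(2) by blast
      then show "x \<in> \<Union>(range W)" by blast
    qed (use oW openin_subset in blast)
    have "locally_finite_in X (range W)"
      unfolding locally_finite_in_def
    proof (intro conjI ballI)
      fix x assume "x \<in> topspace X"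
      then obtain n where n: "x \<in> V n" using V \<V>'(3) by blast
      have "W m \<inter> V n = {}" if "n < m" for m
        using that closure_of_subset[OF openin_subset[OF oV[of n]]] by (auto simp: W_def)
      then have "{U \<in> range W. U \<inter> V n \<noteq> {}} \<subseteq> W ` {..n}" 
        by (smt (verit, ccfv_threshold) atMost_iff image_iff mem_Collect_eq not_le subsetI)
      then have "finite {U \<in> range W. U \<inter> V n \<noteq> {}}" using finite_subset by blast
      then show "\<exists>V. openin X V \<and> x \<in> V \<and> finite {U \<in> range W. U \<inter> V \<noteq> {}}" using oV n by blast
    qed (use cover in simp)
    moreover have "\<forall>V\<in>range W. \<exists>U\<in>\<U>. V \<subseteq> U" using U(1) W_def by blast
    ultimately show ?thesis using oW cover by (intro exI[of _ "range W"]) auto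
  qed
qed

text \<open>Locally finite refinements on the pieces may be collected, since every point has a neighbourhood that
  lies in a single piece.\<close>

lemma paracompact_space_clopen_partition:
  assumes op: "\<And>k. openin X {x \<in> topspace X. c x = k}"
    and pc: "\<And>k. paracompact_space (subtopology X {x \<in> topspace X. c x = k})"
  shows "paracompact_space X"
  unfolding paracompact_space_def
proof (intro allI impI)
  fix \<U> assume \<U>: "(\<forall>U\<in>\<U>. openin X U) \<and> \<Union>\<U> = topspace X"
  define X' where "X' k = {x \<in> topspace X. c x = k}" for k
  have "\<exists>\<V>. (\<forall>V\<in>\<V>. openin X V \<and> V \<subseteq> X' k) \<and> \<Union>\<V> = X' k \<and> (\<forall>V\<in>\<V>. \<exists>U\<in>\<U>. V \<subseteq> U) \<and>
      locally_finite_in (subtopology X (X' k)) \<V>" for k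
  proof -
    let ?Y = "subtopology X (X' k)" and ?\<U> = "(\<lambda>U. X' k \<inter> U) ` \<U>"
    have top: "topspace ?Y = X' k" by (auto simp: X'_def)
    have opk: "openin ?Y V \<longleftrightarrow> openin X V \<and> V \<subseteq> X' k" for V
      using op[of k] by (simp add: openin_open_subtopology X'_def)
    have "(\<forall>U\<in>?\<U>. openin ?Y U) \<and> \<Union>?\<U> = topspace ?Y"
      using \<U> op[of k] unfolding top opk by (auto simp: X'_def)
    then obtain \<V> where V: "\<forall>V\<in>\<V>. openin ?Y V" "\<Union>\<V> = topspace ?Y" "\<forall>V\<in>\<V>. \<exists>U\<in>?\<U>. V \<subseteq> U"
        "locally_finite_in ?Y \<V>"
      using pc[of k, unfolded paracompact_space_def, rule_format, of ?\<U>] unfolding X'_def by (elim exE conjE impE) (use that in \<open>auto simp: X'_def\<close>)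
    have "\<exists>U\<in>\<U>. V \<subseteq> U" if "V \<in> \<V>" for V
    proof -
      obtain U where "U \<in> \<U>" "V \<subseteq> X' k \<inter> U" using V(3) \<open>V \<in> \<V>\<close> by auto
      then show ?thesis by blast
    qed
    moreover have "\<forall>V\<in>\<V>. openin X V \<and> V \<subseteq> X' k" using V(1) unfolding opk .
    ultimately show ?thesis using V(2,4) unfolding top by (intro exI[of _ \<V>] conjI) auto
  qed
  then obtain \<V> where V: "\<And>k V. V \<in> \<V> k \<Longrightarrow> openin X V \<and> V \<subseteq> X' k" "\<And>k. \<Union>(\<V> k) = X' k"
    "\<And>k V. V \<in> \<V> k \<Longrightarrow> \<exists>U\<in>\<U>. V \<subseteq> U" "\<And>k. locally_finite_in (subtopology X (X' k)) (\<V> k)"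
    by metis
  let ?W = "\<Union>k. \<V> k"
  have "\<Union>?W = (\<Union>k. X' k)" using V(2) by blast
  then have cov: "\<Union>?W = topspace X" by (auto simp: X'_def)
  have "locally_finite_in X ?W"
    unfolding locally_finite_in_def
  proof (intro conjI ballI)
    fix x assume x: "x \<in> topspace X"
    let ?k = "c x"
    have "x \<in> topspace (subtopology X (X' ?k))" using x by (simp add: X'_def)
    then obtain N where N: "openin (subtopology X (X' ?k)) N" "x \<in> N" "finite {U \<in> \<V> ?k. U \<inter> N \<noteq> {}}"
      using V(4)[of ?k] unfolding locally_finite_in_def by blast
    have N': "openin X N" "N \<subseteq> X' ?k"
      using N(1) op[of ?k] by (auto simp: openin_open_subtopology X'_def)
    have "{U \<in> ?W. U \<inter> N \<noteq> {}} \<subseteq> {U \<in> \<V> ?k. U \<inter> N \<noteq> {}}"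
    proof clarify
      fix U k assume "U \<in> \<V> k" "U \<inter> N \<noteq> {}"
      then have "X' k \<inter> X' ?k \<noteq> {}" using V(1) N'(2) by blast
      then have "k = ?k" by (auto simp: X'_def)
      then show "U \<in> \<V> ?k" using \<open>U \<in> \<V> k\<close> by simp
    qed
    then show "\<exists>V. openin X V \<and> x \<in> V \<and> finite {U \<in> ?W. U \<inter> V \<noteq> {}}"
      using N(2) N'(1) finite_subset[OF _ N(3)] by (intro exI[of _ N] conjI) auto
  qed (use cov in simp)
  then show "\<exists>\<V>. (\<forall>V\<in>\<V>. openin X V) \<and> \<Union>\<V> = topspace X \<and> (\<forall>V\<in>\<V>. \<exists>U\<in>\<U>. V \<subseteq> U) \<and> locally_finite_in X \<V>"
    using V(1,3) cov by (intro exI[of _ ?W]) blast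
qed

section \<open>Complex manifolds in charts\<close>

text \<open>A complex manifold up to the separation axioms. In contrast to paracompactness, this passes to open
  submanifolds and to fiber products by arguments on charts alone.\<close>

definition holo_atlas :: "'a cmanifold \<Rightarrow> bool" where
  "holo_atlas M \<longleftrightarrow>
     (\<Union>(W, \<phi>)\<in>mcharts M. W) = pts M \<and>
     (\<forall>(W, \<phi>)\<in>mcharts M. openin (mtop M) W \<and> Cn_open (mdim M) (\<phi> ` W) \<and>
        homeomorphic_map (subtopology (mtop M) W) (top_of_set (\<phi> ` W)) \<phi>) \<and>
     (\<forall>(W, \<phi>)\<in>mcharts M. \<forall>(W', \<phi>')\<in>mcharts M.
        holomorphic_between (mdim M) (\<phi> ` (W \<inter> W')) (\<phi>' ` (W \<inter> W')) (\<phi>' \<circ> inv_into W \<phi>))"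

lemma complex_manifold_iff:
  "complex_manifold M \<longleftrightarrow> Hausdorff_space (mtop M) \<and> paracompact_space (mtop M) \<and> holo_atlas M"
  by (simp add: complex_manifold_def holo_atlas_def)

lemma chart_of_point:
  assumes "holo_atlas M" "x \<in> pts M"
  obtains W \<phi> where "(W, \<phi>) \<in> mcharts M" "x \<in> W"
  using assms unfolding holo_atlas_def by blast

lemma chart_homeo:
  assumes "homeomorphic_map (subtopology X W) (top_of_set (\<phi> ` W)) \<phi>"
    and "openin X W" and "Cn_open n (\<phi> ` W)"
  shows "inj_on \<phi> W" "\<And>V. openin X V \<Longrightarrow> V \<subseteq> W \<Longrightarrow> Cn_open n (\<phi> ` V)"
    "\<And>V. Cn_open n V \<Longrightarrow> openin X {x \<in> W. \<phi> x \<in> V}"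
proof -
  have W: "W \<subseteq> topspace X" by (rule openin_subset[OF assms(2)])
  then have top: "topspace (subtopology X W) = W" by auto
  show "inj_on \<phi> W" using homeomorphic_imp_injective_map[OF assms(1)] unfolding top .
  show "Cn_open n (\<phi> ` V)" if "openin X V" "V \<subseteq> W" for V
  proof -
    have "openin (subtopology X W) V" using that assms(2) by (simp add: openin_open_subtopology)
    then have "openin (top_of_set (\<phi> ` W)) (\<phi> ` V)"
      using homeomorphic_imp_open_map[OF assms(1)] by (simp add: open_map_def)
    then show ?thesis using assms(3) openin_trans by blast
  qed
  show "openin X {x \<in> W. \<phi> x \<in> V}" if V: "Cn_open n V" for V
  proof -
    have "openin (top_of_set (\<phi> ` W)) (\<phi> ` W \<inter> V)"
      using V assms(3) by (meson openin_imp_subset openin_Int openin_subset_trans inf_le1)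
    then have "openin (subtopology X W) {x \<in> topspace (subtopology X W). \<phi> x \<in> \<phi> ` W \<inter> V}"
      using openin_continuous_map_preimage[OF homeomorphic_imp_continuous_map[OF assms(1)]] by blast
    moreover have "{x \<in> topspace (subtopology X W). \<phi> x \<in> \<phi> ` W \<inter> V} = {x \<in> W. \<phi> x \<in> V}"
      unfolding top by auto
    ultimately show ?thesis using openin_trans_full[OF _ assms(2)] by metis
  qed
qed

lemma chart_facts:
  assumes M: "holo_atlas M" and c: "(W, \<phi>) \<in> mcharts M"
  shows "openin (mtop M) W" "W \<subseteq> pts M" "Cn_open (mdim M) (\<phi> ` W)" "\<phi> ` W \<subseteq> Cn (mdim M)"
    "inj_on \<phi> W" "\<And>x. x \<in> W \<Longrightarrow> inv_into W \<phi> (\<phi> x) = x"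
    "\<And>V. openin (mtop M) V \<Longrightarrow> V \<subseteq> W \<Longrightarrow> Cn_open (mdim M) (\<phi> ` V)"
    "\<And>V. Cn_open (mdim M) V \<Longrightarrow> openin (mtop M) {x \<in> W. \<phi> x \<in> V}"
    "homeomorphic_map (subtopology (mtop M) W) (top_of_set (\<phi> ` W)) \<phi>"
proof -
  show 1: "openin (mtop M) W" "Cn_open (mdim M) (\<phi> ` W)"
    and 2: "homeomorphic_map (subtopology (mtop M) W) (top_of_set (\<phi> ` W)) \<phi>"
    using assms unfolding holo_atlas_def by blast+
  show "W \<subseteq> pts M" using 1 openin_subset by blast
  show "\<phi> ` W \<subseteq> Cn (mdim M)" using 1 openin_imp_subset by blast
  show inj: "inj_on \<phi> W" and
    "\<And>V. openin (mtop M) V \<Longrightarrow> V \<subseteq> W \<Longrightarrow> Cn_open (mdim M) (\<phi> ` V)"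
    "\<And>V. Cn_open (mdim M) V \<Longrightarrow> openin (mtop M) {x \<in> W. \<phi> x \<in> V}"
    using chart_homeo[OF 2 1] by blast+
  show "\<And>x. x \<in> W \<Longrightarrow> inv_into W \<phi> (\<phi> x) = x" using inj by simp
qed

lemma chart_transition:
  assumes M: "holo_atlas M" and c: "(W, \<phi>) \<in> mcharts M" "(W', \<phi>') \<in> mcharts M" and x: "x \<in> W" "x \<in> W'"
  shows "hol_at (mdim M) (\<phi>' \<circ> inv_into W \<phi>) (\<phi> x)"
proof -
  have "openin (mtop M) (W \<inter> W')" using chart_facts(1)[OF M c(1)] chart_facts(1)[OF M c(2)] by blast
  then have op: "Cn_open (mdim M) (\<phi> ` (W \<inter> W'))"
    using chart_facts(7)[OF M c(1)] by blast
  have "holomorphic_between (mdim M) (\<phi> ` (W \<inter> W')) (\<phi>' ` (W \<inter> W')) (\<phi>' \<circ> inv_into W \<phi>)"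
    using M c unfolding holo_atlas_def by blast
  then show ?thesis using x unfolding holomorphic_between_iff[OF op] by blast
qed

text \<open>It suffices to know the coordinate changes near each point of the overlap, by any formula \<open>F\<close>.\<close>

lemma holo_atlasI:
  assumes cover: "\<And>x. x \<in> pts M \<Longrightarrow> \<exists>(W, \<phi>)\<in>mcharts M. x \<in> W"
    and op: "\<And>W \<phi>. (W, \<phi>) \<in> mcharts M \<Longrightarrow> openin (mtop M) W"
    and opi: "\<And>W \<phi>. (W, \<phi>) \<in> mcharts M \<Longrightarrow> Cn_open (mdim M) (\<phi> ` W)"
    and hom: "\<And>W \<phi>. (W, \<phi>) \<in> mcharts M \<Longrightarrow> homeomorphic_map (subtopology (mtop M) W) (top_of_set (\<phi> ` W)) \<phi>"
    and trans: "\<And>W \<phi> W' \<phi>' x. \<lbrakk>(W, \<phi>) \<in> mcharts M; (W', \<phi>') \<in> mcharts M; x \<in> W; x \<in> W'\<rbrakk> \<Longrightarrow>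
       \<exists>V F. openin (mtop M) V \<and> x \<in> V \<and> V \<subseteq> W \<and> (\<forall>v\<in>V. \<phi>' v = F (\<phi> v)) \<and> hol_at (mdim M) F (\<phi> x)"
  shows "holo_atlas M"
proof -
  have "(\<Union>(W, \<phi>)\<in>mcharts M. W) = pts M"
  proof (intro equalityI subsetI)
    fix x assume "x \<in> (\<Union>(W, \<phi>)\<in>mcharts M. W)"
    then show "x \<in> pts M" using op openin_subset by blast
  qed (use cover in blast)
  moreover have "holomorphic_between (mdim M) (\<phi> ` (W \<inter> W')) (\<phi>' ` (W \<inter> W')) (\<phi>' \<circ> inv_into W \<phi>)"
    if c: "(W, \<phi>) \<in> mcharts M" "(W', \<phi>') \<in> mcharts M" for W \<phi> W' \<phi>'
  proof -
    note h = chart_homeo[OF hom[OF c(1)] op[OF c(1)] opi[OF c(1)]]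
    have op': "Cn_open (mdim M) (\<phi> ` (W \<inter> W'))"
      using op[OF c(1)] op[OF c(2)] by (intro h(2)) auto
    have "hol_at (mdim M) (\<phi>' \<circ> inv_into W \<phi>) (\<phi> x)" if x: "x \<in> W" "x \<in> W'" for x
    proof -
      obtain V F where V: "openin (mtop M) V" "x \<in> V" "V \<subseteq> W" "\<forall>v\<in>V. \<phi>' v = F (\<phi> v)"
        "hol_at (mdim M) F (\<phi> x)" using trans[OF c x] by blast
      show ?thesis
        by (rule hol_at_cong[OF V(5) h(2)[OF V(1,3)]]) (use V(2,3,4) h(1) in auto)
    qed
    then show ?thesis unfolding holomorphic_between_iff[OF op'] using h(1) by auto
  qed
  ultimately show ?thesis unfolding holo_atlas_def using op opi hom
    by (intro conjI ballI) (auto simp: case_prod_beta)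
qed

lemma continuous_preimage_chart:
  assumes "continuous_map X Y f" "openin X W" "openin Y W'"
  shows "openin X {x \<in> W. f x \<in> W'}"
proof -
  have "{x \<in> W. f x \<in> W'} = W \<inter> {x \<in> topspace X. f x \<in> W'}"
    using openin_subset[OF assms(2)] by blast
  moreover have "openin X {x \<in> topspace X. f x \<in> W'}"
    using assms(1,3) openin_continuous_map_preimage by blast
  ultimately show ?thesis using assms(2) by (simp add: openin_Int)
qed

lemma holomorphic_mapsD:
  assumes M: "holo_atlas M" and N: "holo_atlas N" and f: "f \<in> holomorphic_maps M N"
    and c: "(W, \<phi>) \<in> mcharts M" "(W', \<phi>') \<in> mcharts N" and x: "x \<in> W" "f x \<in> W'"
  shows "hol_at (mdim M) (\<phi>' \<circ> f \<circ> inv_into W \<phi>) (\<phi> x)"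
proof -
  have cf: "continuous_map (mtop M) (mtop N) f" using f by (simp add: holomorphic_maps_def)
  have op: "openin (mtop M) {x \<in> W. f x \<in> W'}"
    by (rule continuous_preimage_chart[OF cf chart_facts(1)[OF M c(1)] chart_facts(1)[OF N c(2)]])
  have op': "Cn_open (mdim M) (\<phi> ` {x \<in> W. f x \<in> W'})"
    by (rule chart_facts(7)[OF M c(1) op]) blast
  have "holomorphic_between (mdim M) (\<phi> ` {x \<in> W. f x \<in> W'}) (\<phi>' ` W') (\<phi>' \<circ> f \<circ> inv_into W \<phi>)"
    using f c unfolding holomorphic_maps_def by blast
  then show ?thesis using x unfolding holomorphic_between_iff[OF op'] by blast
qed

text \<open>\<open>f\<close> has a holomorphic coordinate expression \<open>F\<close> in one pair of charts around \<open>x\<close>.\<close>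

definition hol_near :: "'a cmanifold \<Rightarrow> 'b cmanifold \<Rightarrow> ('a \<Rightarrow> 'b) \<Rightarrow> 'a \<Rightarrow> bool" where
  "hol_near M N f x \<longleftrightarrow> (\<exists>W \<phi> W' \<phi>' V F. (W, \<phi>) \<in> mcharts M \<and> (W', \<phi>') \<in> mcharts N \<and>
       openin (mtop M) V \<and> x \<in> V \<and> V \<subseteq> W \<and> f ` V \<subseteq> W' \<and>
       (\<forall>v\<in>V. \<phi>' (f v) = F (\<phi> v) \<and> hol_at (mdim M) F (\<phi> v)))"

lemma hol_nearI:
  assumes "(W, \<phi>) \<in> mcharts M" "(W', \<phi>') \<in> mcharts N" "openin (mtop M) V" "x \<in> V" "V \<subseteq> W"
    "\<And>v. v \<in> V \<Longrightarrow> f v \<in> W'" "\<And>v. v \<in> V \<Longrightarrow> \<phi>' (f v) = F (\<phi> v)"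
    "\<And>v. v \<in> V \<Longrightarrow> hol_at (mdim M) F (\<phi> v)"
  shows "hol_near M N f x"
  unfolding hol_near_def
  by (rule exI[of _ W], rule exI[of _ \<phi>], rule exI[of _ W'], rule exI[of _ \<phi>'], rule exI[of _ V], rule exI[of _ F])
    (use assms in auto)

lemma hol_nearE:
  assumes "hol_near M N f x"
  obtains W \<phi> W' \<phi>' V F where "(W, \<phi>) \<in> mcharts M" "(W', \<phi>') \<in> mcharts N" "openin (mtop M) V" "x \<in> V" "V \<subseteq> W"
    "f ` V \<subseteq> W'" "\<And>v. v \<in> V \<Longrightarrow> \<phi>' (f v) = F (\<phi> v)" "\<And>v. v \<in> V \<Longrightarrow> hol_at (mdim M) F (\<phi> v)"
  using assms unfolding hol_near_def by (elim exE conjE) (use that in blast)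

text \<open>Since coordinate changes are holomorphic, one pair of charts at each point is enough. Continuity
  follows from that of the coordinate expressions.\<close>

lemma holomorphic_mapsI:
  assumes M: "holo_atlas M" and N: "holo_atlas N" and ext: "f \<in> extensional (pts M)"
    and loc: "\<And>x. x \<in> pts M \<Longrightarrow> hol_near M N f x"
  shows "f \<in> holomorphic_maps M N"
proof -
  let ?m = "mdim M" and ?n = "mdim N"
  have cf: "continuous_map (mtop M) (mtop N) f"
    unfolding continuous_map_def
  proof (intro conjI allI impI)
    show "f \<in> pts M \<rightarrow> pts N" using chart_facts(2)[OF N] by (auto elim!: hol_nearE[OF loc] simp: image_subset_iff) blast
    fix U assume U: "openin (mtop N) U"
    show "openin (mtop M) {x \<in> pts M. f x \<in> U}"
    proof (subst openin_subopen, intro ballI)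
      fix x assume "x \<in> {x \<in> pts M. f x \<in> U}"
      then have x: "x \<in> pts M" "f x \<in> U" by auto
      obtain W \<phi> W' \<phi>' V F where c: "(W, \<phi>) \<in> mcharts M" and c': "(W', \<phi>') \<in> mcharts N"
        and V: "openin (mtop M) V" "x \<in> V" "V \<subseteq> W" "f ` V \<subseteq> W'"
        and F: "\<And>v. v \<in> V \<Longrightarrow> \<phi>' (f v) = F (\<phi> v)" "\<And>v. v \<in> V \<Longrightarrow> hol_at ?m F (\<phi> v)"
        by (rule hol_nearE[OF loc[OF x(1)]]) (use that in blast)
      note cM = chart_facts[OF M c] and cN = chart_facts[OF N c']
      have oV: "Cn_open ?m (\<phi> ` V)" by (rule cM(7)[OF V(1,3)])
      have "openin (mtop N) (U \<inter> W')" using U cN(1) by blast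
      then have oU: "Cn_open ?n (\<phi>' ` (U \<inter> W'))" by (rule cN(7)) blast
      have "continuous_on (\<phi> ` V) F"
        by (rule hol_at_continuous_on[OF openin_imp_subset[OF oV]]) (use F(2) in auto)
      moreover have "F \<in> \<phi> ` V \<rightarrow> Cn ?n" using F(1) V(4) cN(4) by force
      ultimately have "openin (top_of_set (\<phi> ` V)) (\<phi> ` V \<inter> F -` (\<phi>' ` (U \<inter> W')))"
        using oU continuous_openin_preimage by blast
      then have "Cn_open ?m (\<phi> ` V \<inter> F -` (\<phi>' ` (U \<inter> W')))"
        using oV openin_trans by blast
      then have o1: "openin (mtop M) {y \<in> W. \<phi> y \<in> \<phi> ` V \<inter> F -` (\<phi>' ` (U \<inter> W'))}" by (rule cM(8))
      let ?S = "V \<inter> {y \<in> W. \<phi> y \<in> \<phi> ` V \<inter> F -` (\<phi>' ` (U \<inter> W'))}"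
      have "openin (mtop M) ?S" using V(1) o1 by blast
      moreover have "x \<in> ?S"
      proof -
        have "F (\<phi> x) = \<phi>' (f x)" "f x \<in> U \<inter> W'" using F(1) V x by auto
        then show ?thesis using V(2,3) by auto
      qed
      moreover have "?S \<subseteq> {x \<in> pts M. f x \<in> U}"
      proof
        fix y assume y: "y \<in> ?S"
        then have "\<phi>' (f y) \<in> \<phi>' ` (U \<inter> W')" "f y \<in> W'" using F(1) V(4) by auto
        then have "f y \<in> U" using cN(5) by (auto dest: inj_onD)
        then show "y \<in> {x \<in> pts M. f x \<in> U}" using y cM(2) by blast
      qed
      ultimately show "\<exists>T. openin (mtop M) T \<and> x \<in> T \<and> T \<subseteq> {x \<in> pts M. f x \<in> U}" by blast
    qed
  qed
  have "holomorphic_between ?m (\<phi>1 ` {x \<in> W1. f x \<in> W1'}) (\<phi>1' ` W1') (\<phi>1' \<circ> f \<circ> inv_into W1 \<phi>1)"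
    if c1: "(W1, \<phi>1) \<in> mcharts M" and c1': "(W1', \<phi>1') \<in> mcharts N" for W1 \<phi>1 W1' \<phi>1'
  proof -
    note cM1 = chart_facts[OF M c1] and cN1 = chart_facts[OF N c1']
    have op: "openin (mtop M) {x \<in> W1. f x \<in> W1'}"
      by (rule continuous_preimage_chart[OF cf cM1(1) cN1(1)])
    have op': "Cn_open ?m (\<phi>1 ` {x \<in> W1. f x \<in> W1'})"
      by (rule cM1(7)[OF op]) blast
    have "hol_at ?m (\<phi>1' \<circ> f \<circ> inv_into W1 \<phi>1) (\<phi>1 x)" if x: "x \<in> W1" "f x \<in> W1'" for x
    proof -
      have "x \<in> pts M" using x cM1(2) by blast
      then obtain W \<phi> W' \<phi>' V F where c: "(W, \<phi>) \<in> mcharts M" and c': "(W', \<phi>') \<in> mcharts N"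
        and V: "openin (mtop M) V" "x \<in> V" "V \<subseteq> W" "f ` V \<subseteq> W'"
        and F: "\<And>v. v \<in> V \<Longrightarrow> \<phi>' (f v) = F (\<phi> v)" "\<And>v. v \<in> V \<Longrightarrow> hol_at ?m F (\<phi> v)"
        by (rule hol_nearE[OF loc]) (use that in blast)
      note cM = chart_facts[OF M c] and cN = chart_facts[OF N c']
      define S where "S = V \<inter> {x \<in> W1. f x \<in> W1'}"
      have S: "openin (mtop M) S" "x \<in> S" using V op x S_def by auto
      have S1: "Cn_open ?m (\<phi>1 ` S)" by (rule cM1(7)[OF S(1)]) (auto simp: S_def)
      have S0: "Cn_open ?m (\<phi> ` S)" by (rule cM(7)[OF S(1)]) (use S_def V in auto)
      let ?t = "\<phi> \<circ> inv_into W1 \<phi>1" and ?t' = "\<phi>1' \<circ> inv_into W' \<phi>'"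
      have t: "?t (\<phi>1 y) = \<phi> y" if "y \<in> S" for y using that cM1(6) by (simp add: S_def)
      have t': "?t' (\<phi>' (f y)) = \<phi>1' (f y)" if "y \<in> S" for y using that cN(6) V(4) by (auto simp: S_def)
      \<comment> \<open>The expression in the given charts is \<open>F\<close> between two coordinate changes.\<close>
      have A: "hol_at ?m ?t (\<phi>1 x)" by (rule chart_transition[OF M c1 c x(1)]) (use V in blast)
      have B: "hol_at ?m (F \<circ> ?t) (\<phi>1 x)"
        by (rule hol_at_compose[OF A _ S1]) (use t F(2) V(2,3) S cM(4) in \<open>force simp: S_def\<close>)+
      have C: "hol_at ?n ?t' (\<phi>' (f x))" by (rule chart_transition[OF N c' c1' _ x(2)]) (use V in blast)
      have Ft: "(F \<circ> ?t) (\<phi>1 y) = \<phi>' (f y)" if "y \<in> S" for y using t that F(1) S_def by simp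
      have D: "hol_at ?m (?t' \<circ> (F \<circ> ?t)) (\<phi>1 x)"
      proof (rule hol_at_compose[OF B _ S1])
        show "hol_at ?n ?t' ((F \<circ> ?t) (\<phi>1 x))" using C Ft[OF S(2)] by simp
        show "F \<circ> ?t \<in> \<phi>1 ` S \<rightarrow> Cn ?n" using Ft V(4) cN(4) by (fastforce simp: S_def simp del: o_apply)
      qed (use S in blast)
      show ?thesis
      proof (rule hol_at_cong[OF D S1])
        fix w assume "w \<in> \<phi>1 ` S"
        then obtain y where y: "y \<in> S" "w = \<phi>1 y" by blast
        have "(?t' \<circ> (F \<circ> ?t)) (\<phi>1 y) = \<phi>1' (f y)" using Ft[OF y(1)] t'[OF y(1)] by simp
        then show "(?t' \<circ> (F \<circ> ?t)) w = (\<phi>1' \<circ> f \<circ> inv_into W1 \<phi>1) w"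
          using y cM1(6) by (simp add: S_def)
      qed (use S in blast)
    qed
    moreover have "\<phi>1' \<circ> f \<circ> inv_into W1 \<phi>1 \<in> \<phi>1 ` {x \<in> W1. f x \<in> W1'} \<rightarrow> \<phi>1' ` W1'"
      using cM1(6) by auto
    ultimately show ?thesis unfolding holomorphic_between_iff[OF op'] by blast
  qed
  then show ?thesis using ext cf by (auto simp: holomorphic_maps_def)
qed

lemma holomorphic_maps_into: "f \<in> holomorphic_maps M N \<Longrightarrow> x \<in> pts M \<Longrightarrow> f x \<in> pts N"
  by (auto simp: holomorphic_maps_def continuous_map_def Pi_iff)

lemma holomorphic_maps_id: "holo_atlas M \<Longrightarrow> (\<lambda>x\<in>pts M. x) \<in> holomorphic_maps M M"
proof (rule holomorphic_mapsI)
  fix x assume M: "holo_atlas M" and x: "x \<in> pts M"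
  obtain W \<phi> where c: "(W, \<phi>) \<in> mcharts M" "x \<in> W" by (rule chart_of_point[OF M x])
  show "hol_near M M (\<lambda>x\<in>pts M. x) x"
    by (rule hol_nearI[OF c(1) c(1) chart_facts(1)[OF M c(1)] c(2), where F = "\<lambda>y. y"])
      (use chart_facts(2)[OF M c(1)] hol_at_id in auto)
qed auto

lemma holomorphic_maps_compose:
  assumes M: "holo_atlas M" and N: "holo_atlas N" and P: "holo_atlas P"
    and f: "f \<in> holomorphic_maps M N" and g: "g \<in> holomorphic_maps N P"
  shows "compose (pts M) g f \<in> holomorphic_maps M P"
proof (rule holomorphic_mapsI[OF M P])
  fix x assume x: "x \<in> pts M"
  have fx: "f x \<in> pts N" "g (f x) \<in> pts P" using f g x by (auto intro: holomorphic_maps_into)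
  obtain W \<phi> where c: "(W, \<phi>) \<in> mcharts M" "x \<in> W" by (rule chart_of_point[OF M x])
  obtain W' \<phi>' where c': "(W', \<phi>') \<in> mcharts N" "f x \<in> W'" by (rule chart_of_point[OF N fx(1)])
  obtain W'' \<phi>'' where c'': "(W'', \<phi>'') \<in> mcharts P" "g (f x) \<in> W''" by (rule chart_of_point[OF P fx(2)])
  note cM = chart_facts[OF M c(1)] and cN = chart_facts[OF N c'(1)] and cP = chart_facts[OF P c''(1)]
  have cf: "continuous_map (mtop M) (mtop N) f" and cg: "continuous_map (mtop N) (mtop P) g"
    using f g by (simp_all add: holomorphic_maps_def)
  have o1: "openin (mtop N) {y \<in> W'. g y \<in> W''}" by (rule continuous_preimage_chart[OF cg cN(1) cP(1)])
  let ?V = "{y \<in> W. f y \<in> {y \<in> W'. g y \<in> W''}}"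
  have V: "openin (mtop M) ?V" by (rule continuous_preimage_chart[OF cf cM(1) o1])
  have oV: "Cn_open (mdim M) (\<phi> ` ?V)" by (rule cM(7)[OF V]) blast
  let ?F = "\<phi>' \<circ> f \<circ> inv_into W \<phi>" and ?G = "\<phi>'' \<circ> g \<circ> inv_into W' \<phi>'"
  have "hol_at (mdim M) (?G \<circ> ?F) (\<phi> v)" if v: "v \<in> ?V" for v
  proof (rule hol_at_compose[OF _ _ oV])
    show "hol_at (mdim M) ?F (\<phi> v)" by (rule holomorphic_mapsD[OF M N f c(1) c'(1)]) (use v in auto)
    have "hol_at (mdim N) ?G (\<phi>' (f v))" by (rule holomorphic_mapsD[OF N P g c'(1) c''(1)]) (use v in auto)
    then show "hol_at (mdim N) ?G (?F (\<phi> v))" using v cM(6) by simp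
    show "?F \<in> \<phi> ` ?V \<rightarrow> Cn (mdim N)" using cM(6) cN(4) by auto
  qed (use v in auto)
  moreover have "\<phi>'' (compose (pts M) g f v) = (?G \<circ> ?F) (\<phi> v)" if "v \<in> ?V" for v
    using that cM(2,6) cN(6) by (auto simp: compose_def)
  moreover have "compose (pts M) g f v \<in> W''" if "v \<in> ?V" for v using that cM(2) by (auto simp: compose_def)
  ultimately show "hol_near M P (compose (pts M) g f) x"
    by (intro hol_nearI[OF c(1) c''(1) V, where F = "?G \<circ> ?F"]) (use c c' c'' in auto)
qed (simp add: compose_def)

lemma open_submanifold_simps [simp]:
  "mtop (open_submanifold M V) = subtopology (mtop M) V" "mdim (open_submanifold M V) = mdim M"
  "mcharts (open_submanifold M V) = {(W \<inter> V, \<phi>) | W \<phi>. (W, \<phi>) \<in> mcharts M}"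
  by (simp_all add: open_submanifold_def)

lemma homeomorphic_map_restrict_open:
  assumes "homeomorphic_map (subtopology X W) (top_of_set (\<phi> ` W)) \<phi>" "V \<subseteq> W" "V \<subseteq> topspace X"
  shows "homeomorphic_map (subtopology X V) (top_of_set (\<phi> ` V)) \<phi>"
proof -
  have "homeomorphic_map (subtopology (subtopology X W) V) (subtopology (top_of_set (\<phi> ` W)) (\<phi> ` V)) \<phi>"
    by (rule homeomorphic_map_subtopologies[OF assms(1)]) (use assms(2,3) in auto)
  then show ?thesis
    using assms(2) by (simp add: subtopology_subtopology Int_absorb1 image_mono)
qed

lemma holo_atlas_open_submanifold:
  assumes M: "holo_atlas M" and V: "openin (mtop M) V"
  shows "holo_atlas (open_submanifold M V)"
proof (rule holo_atlasI, goal_cases)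
  case (1 x)
  then have x: "x \<in> pts M" "x \<in> V" by auto
  obtain W \<phi> where "(W, \<phi>) \<in> mcharts M" "x \<in> W" using chart_of_point[OF M x(1)] .
  then show ?case using x(2) by (intro bexI[of _ "(W \<inter> V, \<phi>)"]) auto
next
  case (2 W \<phi>)
  then show ?case using chart_facts(1)[OF M] by (auto simp: openin_open_subtopology[OF V] intro!: V)
next
  case (3 W \<phi>)
  then obtain W' where W': "W = W' \<inter> V" "(W', \<phi>) \<in> mcharts M" by auto
  then show ?case using chart_facts(7)[OF M W'(2), of W] chart_facts(1)[OF M W'(2)] V by auto
next
  case (4 W' \<phi>)
  then obtain W where c: "W' = W \<inter> V" "(W, \<phi>) \<in> mcharts M" by auto
  have "homeomorphic_map (subtopology (mtop M) W') (top_of_set (\<phi> ` W')) \<phi>"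
    by (rule homeomorphic_map_restrict_open[OF chart_facts(9)[OF M c(2)]])
      (use c chart_facts(2)[OF M c(2)] in auto)
  then show ?case using c(1) by (simp add: subtopology_subtopology Int_absorb1)
next
  case (5 W1 \<phi> W1' \<phi>' x)
  then obtain W W' where c: "W1 = W \<inter> V" "(W, \<phi>) \<in> mcharts M" "W1' = W' \<inter> V" "(W', \<phi>') \<in> mcharts M" by auto
  have "hol_at (mdim M) (\<phi>' \<circ> inv_into W \<phi>) (\<phi> x)"
    by (rule chart_transition[OF M c(2,4)]) (use 5 c in auto)
  moreover have "\<forall>v\<in>W1. \<phi>' v = (\<phi>' \<circ> inv_into W \<phi>) (\<phi> v)" using c(1) chart_facts(6)[OF M c(2)] by simp
  moreover have "openin (mtop (open_submanifold M V)) W1"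
    using c chart_facts(1)[OF M c(2)] V by (auto simp: openin_open_subtopology)
  ultimately show ?case using 5(3) by (intro exI[of _ W1] exI[of _ "\<phi>' \<circ> inv_into W \<phi>"]) auto
qed

lemma local_biholomorphismI:
  assumes M: "holo_atlas M" and N: "holo_atlas N" and f: "f \<in> holomorphic_maps M N"
    and loc: "\<And>x. x \<in> pts M \<Longrightarrow> \<exists>W g. openin (mtop M) W \<and> x \<in> W \<and> openin (mtop N) (f ` W) \<and>
        g \<in> holomorphic_maps (open_submanifold N (f ` W)) (open_submanifold M W) \<and> (\<forall>y\<in>W. g (f y) = y)"
  shows "local_biholomorphism M N f"
  unfolding local_biholomorphism_def
proof (intro conjI ballI f)
  fix x assume "x \<in> pts M"
  then obtain W g where W: "openin (mtop M) W" "x \<in> W" "openin (mtop N) (f ` W)"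
    and g: "g \<in> holomorphic_maps (open_submanifold N (f ` W)) (open_submanifold M W)" "\<And>y. y \<in> W \<Longrightarrow> g (f y) = y"
    using loc[of x] by metis
  let ?M = "open_submanifold M W" and ?N = "open_submanifold N (f ` W)"
  have Wsub: "W \<subseteq> pts M" "f ` W \<subseteq> pts N" using W openin_subset by blast+
  then have p: "pts ?M = W" "pts ?N = f ` W" by auto
  have "restrict f W \<in> holomorphic_maps ?M ?N"
  proof (rule holomorphic_mapsI[OF holo_atlas_open_submanifold[OF M W(1)] holo_atlas_open_submanifold[OF N W(3)]])
    fix y assume "y \<in> pts ?M"
    then have y: "y \<in> W" "y \<in> pts M" "f y \<in> pts N" using p Wsub by auto
    obtain V \<phi> where c: "(V, \<phi>) \<in> mcharts M" "y \<in> V" by (rule chart_of_point[OF M y(2)])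
    obtain V' \<phi>' where c': "(V', \<phi>') \<in> mcharts N" "f y \<in> V'" by (rule chart_of_point[OF N y(3)])
    let ?S = "{z \<in> V \<inter> W. f z \<in> V' \<inter> f ` W}" and ?F = "\<phi>' \<circ> f \<circ> inv_into V \<phi>"
    have "openin (mtop M) ?S"
      by (rule continuous_preimage_chart[of _ "mtop N"])
        (use f chart_facts(1)[OF M c(1)] chart_facts(1)[OF N c'(1)] W in \<open>auto simp: holomorphic_maps_def\<close>)
    then have S: "openin (mtop ?M) ?S" using W(1) by (auto simp: openin_open_subtopology)
    have "\<forall>v\<in>?S. \<phi>' (restrict f W v) = ?F (\<phi> v) \<and> hol_at (mdim M) ?F (\<phi> v)"
      using chart_facts(6)[OF M c(1)] holomorphic_mapsD[OF M N f c(1) c'(1)] by simp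
    then show "hol_near ?M ?N (restrict f W) y"
      by (intro hol_nearI[of "V \<inter> W" \<phi> _ "V' \<inter> f ` W" \<phi>' _ ?S _ _ ?F]) (use S c c' y in auto)
  qed (use p in auto)
  moreover have "(\<forall>x\<in>pts ?M. g (restrict f W x) = x) \<and> (\<forall>y\<in>pts ?N. restrict f W (g y) = y)"
    using g(2) unfolding p by auto
  ultimately have "biholomorphic_map ?M ?N (restrict f W)"
    unfolding biholomorphic_map_def using g(1) by blast
  then show "\<exists>W. openin (mtop M) W \<and> x \<in> W \<and> openin (mtop N) (f ` W) \<and>
        biholomorphic_map (open_submanifold M W) (open_submanifold N (f ` W)) (restrict f W)"
    using W by blast
qed

lemma fiber_product_simps:
  "mtop (fiber_product M N f g) = subtopology (prod_topology (mtop M) (mtop N)) {(x, y). f x = g y}"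
  "mdim (fiber_product M N f g) = mdim M"
  "pts (fiber_product M N f g) = {(x, y). x \<in> pts M \<and> y \<in> pts N \<and> f x = g y}"
  by (auto simp: fiber_product_def Let_def)

lemma fiber_product_charts:
  "mcharts (fiber_product M N f g) =
     {(V, \<phi> \<circ> fst) | V W \<phi>. (W, \<phi>) \<in> mcharts M \<and> openin (mtop (fiber_product M N f g)) V \<and> fst ` V \<subseteq> W \<and>
                       openin (mtop M) (fst ` V) \<and>
                       homeomorphic_map (subtopology (mtop (fiber_product M N f g)) V) (subtopology (mtop M) (fst ` V)) fst}"
  by (simp add: fiber_product_def Let_def)

lemma local_biholomorphism_local_section:
  assumes g: "local_biholomorphism N L g" and y: "y \<in> pts N"
  obtains Y h where "openin (mtop N) Y" "y \<in> Y" "openin (mtop L) (g ` Y)" "inj_on g Y"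
    "continuous_map (subtopology (mtop L) (g ` Y)) (mtop N) h" "\<And>z. z \<in> Y \<Longrightarrow> h (g z) = z"
proof -
  obtain Y where Y: "openin (mtop N) Y" "y \<in> Y" "openin (mtop L) (g ` Y)"
    "biholomorphic_map (open_submanifold N Y) (open_submanifold L (g ` Y)) (restrict g Y)"
    using g y unfolding local_biholomorphism_def by blast
  then obtain h where h: "h \<in> holomorphic_maps (open_submanifold L (g ` Y)) (open_submanifold N Y)"
    "\<And>z. z \<in> pts (open_submanifold N Y) \<Longrightarrow> h (restrict g Y z) = z"
    unfolding biholomorphic_map_def by blast
  have "Y \<subseteq> pts N" using Y(1) openin_subset by blast
  then have hg: "h (g z) = z" if "z \<in> Y" for z using h(2)[of z] that by auto
  moreover have "continuous_map (subtopology (mtop L) (g ` Y)) (mtop N) h"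
    using h(1) continuous_map_into_fulltopology by (auto simp: holomorphic_maps_def)
  ultimately show ?thesis using that Y by (metis inj_on_inverseI)
qed

text \<open>A local section \<open>h\<close> of \<open>g\<close> through \<open>y\<close> makes the first projection invertible near \<open>(x, y)\<close>, with
  inverse \<open>z \<mapsto> (z, h (f z))\<close>.\<close>

lemma fiber_product_chart_at:
  assumes M: "holo_atlas M" and f: "continuous_map (mtop M) (mtop L) f"
    and g: "local_biholomorphism N L g" and p: "(x, y) \<in> pts (fiber_product M N f g)"
    and c: "(W, \<phi>) \<in> mcharts M" "x \<in> W"
    and O': "openin (mtop (fiber_product M N f g)) O'" "(x, y) \<in> O'"
  obtains V where "(V, \<phi> \<circ> fst) \<in> mcharts (fiber_product M N f g)" "(x, y) \<in> V" "V \<subseteq> O'"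
proof -
  let ?P = "fiber_product M N f g" let ?T = "mtop ?P"
  have xy: "x \<in> pts M" "y \<in> pts N" "f x = g y" using p by (auto simp: fiber_product_simps)
  obtain Y h where Y: "openin (mtop N) Y" "y \<in> Y" "openin (mtop L) (g ` Y)" "inj_on g Y"
    and ch: "continuous_map (subtopology (mtop L) (g ` Y)) (mtop N) h" and h: "\<And>z. z \<in> Y \<Longrightarrow> h (g z) = z"
    using local_biholomorphism_local_section[OF g xy(2)] by blast
  let ?MY = "{z \<in> W. f z \<in> g ` Y}"
  have oM0: "openin (mtop M) ?MY"
    by (rule continuous_preimage_chart[OF f chart_facts(1)[OF M c(1)] Y(3)])
  have M0sub: "?MY \<subseteq> pts M" using chart_facts(2)[OF M c(1)] by blast
  define k where "k = (\<lambda>z. (z, h (f z)))"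
  have ck: "continuous_map (subtopology (mtop M) ?MY) ?T k"
    unfolding fiber_product_simps continuous_map_in_subtopology continuous_map_pairwise o_def
  proof (intro conjI)
    show "continuous_map (subtopology (mtop M) ?MY) (mtop M) (\<lambda>z. fst (k z))"
      by (simp add: k_def continuous_map_from_subtopology)
    have "continuous_map (subtopology (mtop M) ?MY) (subtopology (mtop L) (g ` Y)) f"
      using f by (auto simp: continuous_map_in_subtopology continuous_map_from_subtopology)
    then show "continuous_map (subtopology (mtop M) ?MY) (mtop N) (\<lambda>z. snd (k z))"
      using continuous_map_compose[OF _ ch] by (auto simp: o_def k_def)
    show "k \<in> topspace (subtopology (mtop M) ?MY) \<rightarrow> {(x, y). f x = g y}"
      using h by (auto simp: k_def)
  qed
  let ?VM = "{z \<in> ?MY. k z \<in> O'}"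
  have oVM: "openin (mtop M) ?VM"
  proof -
    have "openin (subtopology (mtop M) ?MY) {z \<in> topspace (subtopology (mtop M) ?MY). k z \<in> O'}"
      using ck O'(1) openin_continuous_map_preimage by blast
    moreover have "{z \<in> topspace (subtopology (mtop M) ?MY). k z \<in> O'} = ?VM" using M0sub by auto
    ultimately show ?thesis using openin_trans_full[OF _ oM0] by simp
  qed
  let ?V = "k ` ?VM"
  have kT: "k ` ?VM \<subseteq> topspace ?T" using openin_subset[OF O'(1)] by auto
  have Veq: "?V = topspace ?T \<inter> (?VM \<times> Y)"
  proof (intro equalityI subsetI)
    fix w assume "w \<in> ?V"
    then obtain z where z: "z \<in> ?VM" "w = k z" by blast
    then have "h (f z) \<in> Y" using h by auto
    then show "w \<in> topspace ?T \<inter> (?VM \<times> Y)" using z kT by (auto simp: k_def)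
  next
    fix w assume "w \<in> topspace ?T \<inter> (?VM \<times> Y)"
    then obtain a b where w: "w = (a, b)" "a \<in> ?VM" "b \<in> Y" "f a = g b" by (auto simp: fiber_product_simps)
    then have "h (f a) = b" using h by simp
    then have "w = k a" using w by (simp add: k_def)
    then show "w \<in> ?V" using w(2) by blast
  qed
  have "openin (prod_topology (mtop M) (mtop N)) (?VM \<times> Y)" using oVM Y(1) by (simp add: openin_prod_Times_iff)
  then have "openin ?T (topspace ?T \<inter> (?VM \<times> Y))"
    unfolding fiber_product_simps(1) openin_subtopology_alt
    by (intro image_eqI[of _ _ "?VM \<times> Y"])
      (use openin_subset[OF oVM] openin_subset[OF Y(1)] in auto)
  then have oV: "openin ?T ?V" unfolding Veq .
  have fV: "fst ` ?V = ?VM" by (auto simp: image_image k_def)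
  have hm: "homeomorphic_map (subtopology ?T ?V) (subtopology (mtop M) (fst ` ?V)) fst"
    unfolding fV homeomorphic_map_maps
  proof (intro exI[of _ k])
    have "continuous_map (subtopology ?T ?V) (mtop M) fst"
      unfolding fiber_product_simps
      by (intro continuous_map_from_subtopology continuous_map_fst)
    moreover have "fst v \<in> ?VM" if "v \<in> ?V" for v using fV that by blast
    ultimately have 1: "continuous_map (subtopology ?T ?V) (subtopology (mtop M) ?VM) fst"
      by (simp add: continuous_map_in_subtopology Pi_iff)
    have "continuous_map (subtopology (mtop M) ?VM) ?T k"
      by (rule continuous_map_from_subtopology_mono[OF ck]) blast
    then have 2: "continuous_map (subtopology (mtop M) ?VM) (subtopology ?T ?V) k"
      by (simp add: continuous_map_in_subtopology Pi_iff)
    show "homeomorphic_maps (subtopology ?T ?V) (subtopology (mtop M) ?VM) fst k"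
      unfolding homeomorphic_maps_def using 1 2 by (auto simp: k_def)
  qed
  have "(?V, \<phi> \<circ> fst) \<in> mcharts ?P"
  proof -
    have "fst ` ?V \<subseteq> W" "openin (mtop M) (fst ` ?V)" unfolding fV using oVM by auto
    then show ?thesis unfolding fiber_product_charts
      by (intro CollectI exI[of _ ?V] exI[of _ W] exI[of _ \<phi>] conjI refl c(1) oV hm)
  qed
  moreover have "(x, y) \<in> ?V"
  proof -
    have "x \<in> ?MY" "k x = (x, y)" using c(2) xy Y(2) h by (auto simp: k_def)
    then show ?thesis using O'(2) by force
  qed
  ultimately show ?thesis using that by blast
qed

lemma holo_atlas_fiber_product:
  assumes M: "holo_atlas M" and f: "continuous_map (mtop M) (mtop L) f" and g: "local_biholomorphism N L g"
  shows "holo_atlas (fiber_product M N f g)"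
proof -
  let ?P = "fiber_product M N f g"
  have facts: "openin (mtop ?P) V" "Cn_open (mdim M) (\<psi> ` V)"
    "homeomorphic_map (subtopology (mtop ?P) V) (top_of_set (\<psi> ` V)) \<psi>"
    if V: "(V, \<psi>) \<in> mcharts ?P" for V \<psi>
  proof -
    obtain W \<phi> where c: "\<psi> = \<phi> \<circ> fst" "(W, \<phi>) \<in> mcharts M" "openin (mtop ?P) V" "fst ` V \<subseteq> W"
      "openin (mtop M) (fst ` V)"
      "homeomorphic_map (subtopology (mtop ?P) V) (subtopology (mtop M) (fst ` V)) fst"
      using V unfolding fiber_product_charts by auto
    show "openin (mtop ?P) V" by fact
    show "Cn_open (mdim M) (\<psi> ` V)"
      using chart_facts(7)[OF M c(2,5,4)] c(1) by (simp add: image_comp)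
    have "homeomorphic_map (subtopology (mtop M) (fst ` V)) (top_of_set (\<phi> ` fst ` V)) \<phi>"
      by (rule homeomorphic_map_restrict_open[OF chart_facts(9)[OF M c(2)] c(4) openin_subset[OF c(5)]])
    then show "homeomorphic_map (subtopology (mtop ?P) V) (top_of_set (\<psi> ` V)) \<psi>"
      using homeomorphic_map_compose[OF c(6)] c(1) by (metis image_comp)
  qed
  show ?thesis
  proof (rule holo_atlasI, goal_cases)
    case (1 p)
    obtain x y where p: "p = (x, y)" by (cases p)
    have "x \<in> pts M" using 1 p by (auto simp: fiber_product_simps)
    then obtain W \<phi> where c: "(W, \<phi>) \<in> mcharts M" "x \<in> W" by (rule chart_of_point[OF M])
    have xy: "(x, y) \<in> pts ?P" using 1 p by simp
    obtain V where "(V, \<phi> \<circ> fst) \<in> mcharts ?P" "(x, y) \<in> V"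
      by (rule fiber_product_chart_at[OF M f g xy c openin_topspace xy])
    then show ?case using p by blast
  next
    case (5 V \<psi> V' \<psi>' p)
    obtain W \<phi> where c: "\<psi> = \<phi> \<circ> fst" "(W, \<phi>) \<in> mcharts M" "openin (mtop ?P) V" "fst ` V \<subseteq> W"
      using 5(1) unfolding fiber_product_charts by auto
    obtain W' \<phi>' where c': "\<psi>' = \<phi>' \<circ> fst" "(W', \<phi>') \<in> mcharts M" "openin (mtop ?P) V'" "fst ` V' \<subseteq> W'"
      using 5(2) unfolding fiber_product_charts by auto
    have "hol_at (mdim M) (\<phi>' \<circ> inv_into W \<phi>) (\<phi> (fst p))"
      by (rule chart_transition[OF M c(2) c'(2)]) (use c(4) c'(4) 5(3,4) in auto)
    moreover have "\<phi>' (fst v) = (\<phi>' \<circ> inv_into W \<phi>) (\<phi> (fst v))" if "v \<in> V" for v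
      using chart_facts(6)[OF M c(2)] c(4) that by (simp add: image_subset_iff)
    ultimately show ?case using c c' 5 by (intro exI[of _ V] exI[of _ "\<phi>' \<circ> inv_into W \<phi>"])
        (auto simp: fiber_product_simps)
  qed (use facts in \<open>auto simp: fiber_product_simps(2)\<close>)
qed

text \<open>The charts of the fiber product are pulled back from \<open>M\<close>, so the coordinate expression of a pair is
  that of its first component.\<close>

lemma holomorphic_maps_pair:
  assumes X: "holo_atlas X" and M: "holo_atlas M" and N: "holo_atlas N"
    and f: "continuous_map (mtop M) (mtop L) f" and g: "local_biholomorphism N L g"
    and a: "a \<in> holomorphic_maps X M" and b: "b \<in> holomorphic_maps X N"
    and eq: "\<And>x. x \<in> pts X \<Longrightarrow> f (a x) = g (b x)"
  shows "(\<lambda>x\<in>pts X. (a x, b x)) \<in> holomorphic_maps X (fiber_product M N f g)"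
proof (rule holomorphic_mapsI[OF X holo_atlas_fiber_product[OF M f g]])
  let ?P = "fiber_product M N f g" and ?h = "\<lambda>x\<in>pts X. (a x, b x)"
  have ca: "continuous_map (mtop X) (mtop M) a" and cb: "continuous_map (mtop X) (mtop N) b"
    using a b by (auto simp: holomorphic_maps_def)
  have ch: "continuous_map (mtop X) (mtop ?P) (\<lambda>x. (a x, b x))"
    unfolding fiber_product_simps continuous_map_in_subtopology continuous_map_pairwise o_def fst_conv snd_conv
    using ca cb eq by auto
  fix x assume x: "x \<in> pts X"
  obtain W \<phi> where c: "(W, \<phi>) \<in> mcharts X" "x \<in> W" by (rule chart_of_point[OF X x])
  have ax: "a x \<in> pts M" "b x \<in> pts N" using a b x by (auto intro: holomorphic_maps_into)
  obtain W' \<phi>' where c': "(W', \<phi>') \<in> mcharts M" "a x \<in> W'" by (rule chart_of_point[OF M ax(1)])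
  have p: "(a x, b x) \<in> pts ?P" using ax eq[OF x] by (auto simp: fiber_product_simps)
  obtain V where V: "(V, \<phi>' \<circ> fst) \<in> mcharts ?P" "(a x, b x) \<in> V"
    by (rule fiber_product_chart_at[OF M f g p c' openin_topspace p])
  let ?S = "{y \<in> {y \<in> W. a y \<in> W'}. (a y, b y) \<in> V}" and ?F = "\<phi>' \<circ> a \<circ> inv_into W \<phi>"
  have S: "openin (mtop X) ?S"
    by (rule continuous_preimage_chart[OF ch continuous_preimage_chart[OF ca chart_facts(1)[OF X c(1)] chart_facts(1)[OF M c'(1)]]
         chart_facts(1)[OF holo_atlas_fiber_product[OF M f g] V(1)]])
  have Ssub: "?S \<subseteq> pts X" using S openin_subset by blast
  have "\<forall>v\<in>?S. (\<phi>' \<circ> fst) (?h v) = ?F (\<phi> v) \<and> hol_at (mdim X) ?F (\<phi> v)"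
    using Ssub chart_facts(6)[OF X c(1)] holomorphic_mapsD[OF X M a c(1) c'(1)] by auto
  moreover have "?h v \<in> V" if "v \<in> ?S" for v using Ssub that by auto
  ultimately show "hol_near X ?P ?h x"
    by (intro hol_nearI[OF c(1) V(1) S, where F = ?F]) (use c c' V in auto)
qed auto

section \<open>The 2-category (Grp)\<close>

locale etale_gpd =
  fixes G :: "('r, 'u) groupoid"
  assumes etale: "etale_groupoid G"
begin

lemma manifolds: "holo_atlas (Arr G)" "holo_atlas (Base G)"
  using etale by (simp_all add: etale_groupoid_def complex_manifold_iff)

lemma structure_maps:
  "gs G \<in> holomorphic_maps (Arr G) (Base G)" "gt G \<in> holomorphic_maps (Arr G) (Base G)"
  "gm G \<in> holomorphic_maps (composable G) (Arr G)"
  "gi G \<in> holomorphic_maps (Arr G) (Arr G)" "ge G \<in> holomorphic_maps (Base G) (Arr G)"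
  using etale by (simp_all add: etale_groupoid_def local_biholomorphism_def)

lemma closed [simp]:
  "g \<in> pts (Arr G) \<Longrightarrow> gs G g \<in> pts (Base G)" "g \<in> pts (Arr G) \<Longrightarrow> gt G g \<in> pts (Base G)"
  "g \<in> pts (Arr G) \<Longrightarrow> gi G g \<in> pts (Arr G)" "x \<in> pts (Base G) \<Longrightarrow> ge G x \<in> pts (Arr G)"
  using structure_maps holomorphic_maps_into by fast+

lemma mult_closed [simp]:
  assumes "g \<in> pts (Arr G)" "h \<in> pts (Arr G)" "gt G g = gs G h"
  shows "gm G (g, h) \<in> pts (Arr G)"
  by (rule holomorphic_maps_into[OF structure_maps(3)]) (use assms in \<open>simp add: fiber_product_simps\<close>)

lemma source_target_mult [simp]:
  assumes "g \<in> pts (Arr G)" "h \<in> pts (Arr G)" "gt G g = gs G h"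
  shows "gs G (gm G (g, h)) = gs G g" "gt G (gm G (g, h)) = gt G h"
  using etale assms by (simp_all add: etale_groupoid_def)

lemma source_target_unit [simp]:
  "x \<in> pts (Base G) \<Longrightarrow> gs G (ge G x) = x" "x \<in> pts (Base G) \<Longrightarrow> gt G (ge G x) = x"
  using etale by (simp_all add: etale_groupoid_def)

lemma mult_assoc:
  assumes "g \<in> pts (Arr G)" "h \<in> pts (Arr G)" "k \<in> pts (Arr G)" "gt G g = gs G h" "gt G h = gs G k"
  shows "gm G (gm G (g, h), k) = gm G (g, gm G (h, k))"
  using etale assms by (simp add: etale_groupoid_def)

lemma mult_unit:
  assumes "g \<in> pts (Arr G)"
  shows "x = gs G g \<Longrightarrow> gm G (ge G x, g) = g" "x = gt G g \<Longrightarrow> gm G (g, ge G x) = g"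
  using etale assms by (simp_all add: etale_groupoid_def)

text \<open>Both sides are the product of \<open>a\<close>, the common value of \<open>b c\<close> and \<open>b' c'\<close>, and \<open>d\<close>. Applied to a
  naturality square this is the interchange law.\<close>

lemma middle_four:
  assumes "a \<in> pts (Arr G)" "b \<in> pts (Arr G)" "c \<in> pts (Arr G)" "d \<in> pts (Arr G)"
    "b' \<in> pts (Arr G)" "c' \<in> pts (Arr G)"
    and "gt G a = gs G b" "gt G b = gs G c" "gt G c = gs G d"
    and "gt G a = gs G b'" "gt G b' = gs G c'" "gt G c' = gs G d"
    and "gm G (b, c) = gm G (b', c')"
  shows "gm G (gm G (a, b), gm G (c, d)) = gm G (gm G (a, b'), gm G (c', d))"
proof -
  have *: "gm G (gm G (a, b), gm G (c, d)) = gm G (a, gm G (gm G (b, c), d))"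
    if "b \<in> pts (Arr G)" "c \<in> pts (Arr G)" "gt G a = gs G b" "gt G b = gs G c" "gt G c = gs G d" for b c
    using that assms(1,4) by (simp add: mult_assoc)
  show ?thesis using *[of b c] *[of b' c'] assms by simp
qed

text \<open>The source of holomorphy for all composites of natural transformations, which are pointwise products.\<close>

lemma holomorphic_mult:
  assumes X: "holo_atlas X" and a: "a \<in> holomorphic_maps X (Arr G)" and b: "b \<in> holomorphic_maps X (Arr G)"
    and eq: "\<And>x. x \<in> pts X \<Longrightarrow> gt G (a x) = gs G (b x)"
  shows "(\<lambda>x\<in>pts X. gm G (a x, b x)) \<in> holomorphic_maps X (Arr G)"
proof -
  have lb: "local_biholomorphism (Arr G) (Base G) (gs G)"
    using etale by (simp add: etale_groupoid_def)
  have ct: "continuous_map (mtop (Arr G)) (mtop (Base G)) (gt G)"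
    using structure_maps(2) by (simp add: holomorphic_maps_def)
  have "compose (pts X) (gm G) (\<lambda>x\<in>pts X. (a x, b x)) \<in> holomorphic_maps X (Arr G)"
    by (intro holomorphic_maps_compose[OF X _ manifolds(1) _ structure_maps(3)]
        holo_atlas_fiber_product holomorphic_maps_pair) (use assms manifolds lb ct in auto)
  moreover have "compose (pts X) (gm G) (\<lambda>x\<in>pts X. (a x, b x)) = (\<lambda>x\<in>pts X. gm G (a x, b x))"
    by (auto simp: compose_def)
  ultimately show ?thesis by simp
qed

end

lemma holomorphic_maps_compose_restrict:
  assumes "holo_atlas M" "holo_atlas N" "holo_atlas P" "f \<in> holomorphic_maps M N" "g \<in> holomorphic_maps N P"
  shows "(\<lambda>x\<in>pts M. g (f x)) \<in> holomorphic_maps M P"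
  using holomorphic_maps_compose[OF assms] by (simp add: compose_def)

lemma holomorphic_maps_ext:
  assumes "f \<in> holomorphic_maps M N" "g \<in> holomorphic_maps M N" "\<And>x. x \<in> pts M \<Longrightarrow> f x = g x"
  shows "f = g"
  using assms by (intro extensionalityI[of _ "pts M"]) (auto simp: holomorphic_maps_def)

locale gpd_morphism = G: etale_gpd G + H: etale_gpd H
  for G H :: "('r, 'u) groupoid" and \<psi> :: "'u \<Rightarrow> 'u" and \<Psi> :: "'r \<Rightarrow> 'r" +
  assumes morphism: "groupoid_morphism G H (\<psi>, \<Psi>)"
begin

lemma holomorphic: "\<psi> \<in> holomorphic_maps (Base G) (Base H)" "\<Psi> \<in> holomorphic_maps (Arr G) (Arr H)"
  using morphism by (simp_all add: groupoid_morphism_def)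

lemma closed [simp]:
  "x \<in> pts (Base G) \<Longrightarrow> \<psi> x \<in> pts (Base H)" "g \<in> pts (Arr G) \<Longrightarrow> \<Psi> g \<in> pts (Arr H)"
  using holomorphic holomorphic_maps_into by fast+

lemma preserves [simp]:
  "g \<in> pts (Arr G) \<Longrightarrow> gs H (\<Psi> g) = \<psi> (gs G g)" "g \<in> pts (Arr G) \<Longrightarrow> gt H (\<Psi> g) = \<psi> (gt G g)"
  "g \<in> pts (Arr G) \<Longrightarrow> \<Psi> (gi G g) = gi H (\<Psi> g)"
  "x \<in> pts (Base G) \<Longrightarrow> \<Psi> (ge G x) = ge H (\<psi> x)"
  "\<lbrakk>g \<in> pts (Arr G); h \<in> pts (Arr G); gt G g = gs G h\<rbrakk> \<Longrightarrow> \<Psi> (gm G (g, h)) = gm H (\<Psi> g, \<Psi> h)"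
  using morphism by (simp_all add: groupoid_morphism_def)

end

lemma groupoid_nat_transD:
  assumes "groupoid_nat_trans G H (\<psi>, \<Psi>) (\<phi>, \<Phi>) \<alpha>"
  shows "\<alpha> \<in> holomorphic_maps (Base G) (Arr H)"
    "\<And>x. x \<in> pts (Base G) \<Longrightarrow> \<alpha> x \<in> pts (Arr H)"
    "\<And>x. x \<in> pts (Base G) \<Longrightarrow> gs H (\<alpha> x) = \<psi> x" "\<And>x. x \<in> pts (Base G) \<Longrightarrow> gt H (\<alpha> x) = \<phi> x"
    "\<And>g. g \<in> pts (Arr G) \<Longrightarrow> gm H (\<alpha> (gs G g), \<Phi> g) = gm H (\<Psi> g, \<alpha> (gt G g))"
  using assms holomorphic_maps_into by (fastforce simp: groupoid_nat_trans_def)+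

lemma gpd_morphism_id:
  assumes "etale_gpd G"
  shows "groupoid_morphism G G (\<lambda>x\<in>pts (Base G). x, \<lambda>g\<in>pts (Arr G). g)"
proof -
  interpret etale_gpd G by fact
  show ?thesis using holomorphic_maps_id[OF manifolds(1)] holomorphic_maps_id[OF manifolds(2)]
    by (auto simp: groupoid_morphism_def)
qed

lemma gpd_morphism_compose:
  assumes "gpd_morphism G H \<psi> \<Psi>" "gpd_morphism H K \<phi> \<Phi>"
  shows "groupoid_morphism G K (compose (pts (Base G)) \<phi> \<psi>, compose (pts (Arr G)) \<Phi> \<Psi>)"
proof -
  interpret f: gpd_morphism G H \<psi> \<Psi> by fact
  interpret g: gpd_morphism H K \<phi> \<Phi> by fact
  show ?thesis
    using holomorphic_maps_compose[OF f.G.manifolds(1) f.H.manifolds(1) g.H.manifolds(1) f.holomorphic(2) g.holomorphic(2)]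
      holomorphic_maps_compose[OF f.G.manifolds(2) f.H.manifolds(2) g.H.manifolds(2) f.holomorphic(1) g.holomorphic(1)]
    by (auto simp: groupoid_morphism_def compose_eq)
qed

lemma nat_trans_id:
  assumes "gpd_morphism G H \<psi> \<Psi>"
  shows "groupoid_nat_trans G H (\<psi>, \<Psi>) (\<psi>, \<Psi>) (\<lambda>x\<in>pts (Base G). ge H (\<psi> x))"
proof -
  interpret gpd_morphism G H \<psi> \<Psi> by fact
  have "(\<lambda>x\<in>pts (Base G). ge H (\<psi> x)) \<in> holomorphic_maps (Base G) (Arr H)"
    by (rule holomorphic_maps_compose_restrict[OF G.manifolds(2) H.manifolds(2,1) holomorphic(1) H.structure_maps(5)])
  then show ?thesis by (auto simp: groupoid_nat_trans_def H.mult_unit)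
qed

text \<open>The naturality squares of \<open>\<alpha>\<close> and \<open>\<beta>\<close> are pasted.\<close>

lemma nat_trans_vcomp:
  assumes "gpd_morphism G H \<psi>1 \<Psi>1" "gpd_morphism G H \<psi>2 \<Psi>2" "gpd_morphism G H \<psi>3 \<Psi>3"
    and \<alpha>: "groupoid_nat_trans G H (\<psi>1, \<Psi>1) (\<psi>2, \<Psi>2) \<alpha>"
    and \<beta>: "groupoid_nat_trans G H (\<psi>2, \<Psi>2) (\<psi>3, \<Psi>3) \<beta>"
  shows "groupoid_nat_trans G H (\<psi>1, \<Psi>1) (\<psi>3, \<Psi>3) (\<lambda>x\<in>pts (Base G). gm H (\<alpha> x, \<beta> x))"
proof -
  interpret f1: gpd_morphism G H \<psi>1 \<Psi>1 by fact
  interpret f2: gpd_morphism G H \<psi>2 \<Psi>2 by fact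
  interpret f3: gpd_morphism G H \<psi>3 \<Psi>3 by fact
  note a = groupoid_nat_transD[OF \<alpha>] and b = groupoid_nat_transD[OF \<beta>]
  have "(\<lambda>x\<in>pts (Base G). gm H (\<alpha> x, \<beta> x)) \<in> holomorphic_maps (Base G) (Arr H)"
    by (rule f1.H.holomorphic_mult[OF f1.G.manifolds(2) a(1) b(1)]) (use a b in auto)
  moreover have "gm H (gm H (\<alpha> (gs G g), \<beta> (gs G g)), \<Psi>3 g) = gm H (\<Psi>1 g, gm H (\<alpha> (gt G g), \<beta> (gt G g)))"
    if g: "g \<in> pts (Arr G)" for g
  proof -
    have "gm H (gm H (\<alpha> (gs G g), \<beta> (gs G g)), \<Psi>3 g) = gm H (\<alpha> (gs G g), gm H (\<beta> (gs G g), \<Psi>3 g))"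
      using g a b by (intro f1.H.mult_assoc) auto
    also have "\<dots> = gm H (\<alpha> (gs G g), gm H (\<Psi>2 g, \<beta> (gt G g)))" using b(5)[OF g] by simp
    also have "\<dots> = gm H (gm H (\<alpha> (gs G g), \<Psi>2 g), \<beta> (gt G g))"
      using g a b by (intro f1.H.mult_assoc[symmetric]) auto
    also have "\<dots> = gm H (gm H (\<Psi>1 g, \<alpha> (gt G g)), \<beta> (gt G g))" using a(5)[OF g] by simp
    also have "\<dots> = gm H (\<Psi>1 g, gm H (\<alpha> (gt G g), \<beta> (gt G g)))"
      using g a b by (intro f1.H.mult_assoc) auto
    finally show ?thesis .
  qed
  ultimately show ?thesis using a b by (auto simp: groupoid_nat_trans_def)
qed

text \<open>The square of the composite at \<open>g\<close> is pasted from the square of \<open>\<beta>\<close> at \<open>\<Psi>2 g\<close> and the image under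
  \<open>\<Phi>1\<close> of the square of \<open>\<alpha>\<close> at \<open>g\<close>.\<close>

lemma nat_trans_hcomp:
  assumes "gpd_morphism G H \<psi>1 \<Psi>1" "gpd_morphism G H \<psi>2 \<Psi>2" "gpd_morphism H K \<phi>1 \<Phi>1" "gpd_morphism H K \<phi>2 \<Phi>2"
    and \<alpha>: "groupoid_nat_trans G H (\<psi>1, \<Psi>1) (\<psi>2, \<Psi>2) \<alpha>"
    and \<beta>: "groupoid_nat_trans H K (\<phi>1, \<Phi>1) (\<phi>2, \<Phi>2) \<beta>"
  shows "groupoid_nat_trans G K (compose (pts (Base G)) \<phi>1 \<psi>1, compose (pts (Arr G)) \<Phi>1 \<Psi>1)
           (compose (pts (Base G)) \<phi>2 \<psi>2, compose (pts (Arr G)) \<Phi>2 \<Psi>2)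
           (\<lambda>x\<in>pts (Base G). gm K (\<Phi>1 (\<alpha> x), \<beta> (\<psi>2 x)))"
proof -
  interpret f1: gpd_morphism G H \<psi>1 \<Psi>1 by fact
  interpret f2: gpd_morphism G H \<psi>2 \<Psi>2 by fact
  interpret g1: gpd_morphism H K \<phi>1 \<Phi>1 by fact
  interpret g2: gpd_morphism H K \<phi>2 \<Phi>2 by fact
  note a = groupoid_nat_transD[OF \<alpha>] and b = groupoid_nat_transD[OF \<beta>]
  have "(\<lambda>x\<in>pts (Base G). gm K ((\<lambda>x\<in>pts (Base G). \<Phi>1 (\<alpha> x)) x, (\<lambda>x\<in>pts (Base G). \<beta> (\<psi>2 x)) x)) \<in> holomorphic_maps (Base G) (Arr K)"
    by (rule g1.H.holomorphic_mult[OF f1.G.manifolds(2)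
          holomorphic_maps_compose_restrict[OF f1.G.manifolds(2) f1.H.manifolds(1) g1.H.manifolds(1) a(1) g1.holomorphic(2)]
          holomorphic_maps_compose_restrict[OF f1.G.manifolds(2) f1.H.manifolds(2) g1.H.manifolds(1) f2.holomorphic(1) b(1)]])
      (use a b in auto)
  then have hol: "(\<lambda>x\<in>pts (Base G). gm K (\<Phi>1 (\<alpha> x), \<beta> (\<psi>2 x))) \<in> holomorphic_maps (Base G) (Arr K)"
    by (simp cong: restrict_cong)
  moreover have "gm K (gm K (\<Phi>1 (\<alpha> (gs G g)), \<beta> (\<psi>2 (gs G g))), \<Phi>2 (\<Psi>2 g)) =
      gm K (\<Phi>1 (\<Psi>1 g), gm K (\<Phi>1 (\<alpha> (gt G g)), \<beta> (\<psi>2 (gt G g))))"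
    if g: "g \<in> pts (Arr G)" for g
  proof -
    have "gm K (gm K (\<Phi>1 (\<alpha> (gs G g)), \<beta> (\<psi>2 (gs G g))), \<Phi>2 (\<Psi>2 g)) =
        gm K (\<Phi>1 (\<alpha> (gs G g)), gm K (\<beta> (\<psi>2 (gs G g)), \<Phi>2 (\<Psi>2 g)))"
      using g a b by (intro g1.H.mult_assoc) auto
    also have "\<dots> = gm K (\<Phi>1 (\<alpha> (gs G g)), gm K (\<Phi>1 (\<Psi>2 g), \<beta> (\<psi>2 (gt G g))))"
      using b(5)[of "\<Psi>2 g"] g by simp
    also have "\<dots> = gm K (gm K (\<Phi>1 (\<alpha> (gs G g)), \<Phi>1 (\<Psi>2 g)), \<beta> (\<psi>2 (gt G g)))"
      using g a b by (intro g1.H.mult_assoc[symmetric]) auto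
    also have "gm K (\<Phi>1 (\<alpha> (gs G g)), \<Phi>1 (\<Psi>2 g)) = \<Phi>1 (gm H (\<alpha> (gs G g), \<Psi>2 g))"
      using g a(2-4) by simp
    also have "\<dots> = \<Phi>1 (gm H (\<Psi>1 g, \<alpha> (gt G g)))" using a(5)[OF g] by simp
    also have "\<dots> = gm K (\<Phi>1 (\<Psi>1 g), \<Phi>1 (\<alpha> (gt G g)))" using g a(2-4) by simp
    also have "gm K (gm K (\<Phi>1 (\<Psi>1 g), \<Phi>1 (\<alpha> (gt G g))), \<beta> (\<psi>2 (gt G g))) =
        gm K (\<Phi>1 (\<Psi>1 g), gm K (\<Phi>1 (\<alpha> (gt G g)), \<beta> (\<psi>2 (gt G g))))"
      using g a b by (intro g1.H.mult_assoc) auto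
    finally show ?thesis .
  qed
  ultimately show ?thesis using a b by (auto simp: groupoid_nat_trans_def compose_eq)
qed

lemma Grp_simps:
  "Obj Grp = {G. etale_groupoid G \<and> proper_groupoid G \<and> effective_groupoid G}"
  "f \<in> Hom Grp G H \<longleftrightarrow> groupoid_morphism G H f"
  "\<alpha> \<in> Cell Grp G H f g \<longleftrightarrow> groupoid_nat_trans G H f g \<alpha>"
  "Id1 Grp G = (\<lambda>x\<in>pts (Base G). x, \<lambda>g\<in>pts (Arr G). g)"
  "Comp Grp G H K (\<phi>, \<Phi>) (\<psi>, \<Psi>) = (compose (pts (Base G)) \<phi> \<psi>, compose (pts (Arr G)) \<Phi> \<Psi>)"
  "Id2 Grp G H (\<psi>, \<Psi>) = (\<lambda>x\<in>pts (Base G). ge H (\<psi> x))"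
  "VComp Grp G H f1 f2 f3 \<beta> \<alpha> = (\<lambda>x\<in>pts (Base G). gm H (\<alpha> x, \<beta> x))"
  "HComp Grp G H K (\<psi>1, \<Psi>1) (\<psi>2, \<Psi>2) (\<phi>1, \<Phi>1) (\<phi>2, \<Phi>2) \<beta> \<alpha> =
     (\<lambda>x\<in>pts (Base G). gm K (\<Phi>1 (\<alpha> x), \<beta> (\<psi>2 x)))"
  by (simp_all add: Grp_def)

lemma Grp_morphismI:
  assumes "G \<in> Obj Grp" "H \<in> Obj Grp" "(\<psi>, \<Psi>) \<in> Hom Grp G H"
  shows "gpd_morphism G H \<psi> \<Psi>"
  using assms by unfold_locales (simp_all add: Grp_simps)

theorem strict_two_category_Grp:
  "strict_two_category (Grp :: (('r, 'u) groupoid, ('u \<Rightarrow> 'u) \<times> ('r \<Rightarrow> 'r), 'u \<Rightarrow> 'r) two_cat)"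
proof (unfold_locales, goal_cases)
  case (1 X)
  then show ?case by (simp add: Grp_simps etale_gpd_def gpd_morphism_id)
next
  case (2 X Y Z f g)
  obtain \<psi> \<Psi> \<phi> \<Phi> where fg: "f = (\<psi>, \<Psi>)" "g = (\<phi>, \<Phi>)" by fastforce
  show ?case
    using gpd_morphism_compose[OF Grp_morphismI Grp_morphismI, of X Y \<psi> \<Psi> Z \<phi> \<Phi>] 2 unfolding fg Grp_simps by blast
next
  case (3 W X Y Z f g h)
  obtain \<psi> \<Psi> where f: "f = (\<psi>, \<Psi>)" by fastforce
  obtain \<phi> \<Phi> \<theta> \<Theta> where gh: "g = (\<phi>, \<Phi>)" "h = (\<theta>, \<Theta>)" by fastforce
  interpret f: gpd_morphism W X \<psi> \<Psi> using 3 f by (intro Grp_morphismI) auto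
  show ?case unfolding f gh Grp_simps by (auto simp: compose_def fun_eq_iff)
next
  case (4 X Y f)
  obtain \<psi> \<Psi> where f: "f = (\<psi>, \<Psi>)" by fastforce
  interpret f: gpd_morphism X Y \<psi> \<Psi> using 4 f by (intro Grp_morphismI) auto
  have "\<psi> \<in> extensional (pts (Base X))" "\<Psi> \<in> extensional (pts (Arr X))"
    using f.holomorphic by (auto simp: holomorphic_maps_def)
  then show ?case unfolding f Grp_simps by (auto simp: compose_def fun_eq_iff extensional_def)
next
  case (5 X Y f)
  obtain \<psi> \<Psi> where f: "f = (\<psi>, \<Psi>)" by fastforce
  interpret f: gpd_morphism X Y \<psi> \<Psi> using 5 f by (intro Grp_morphismI) auto
  have "\<psi> \<in> extensional (pts (Base X))" "\<Psi> \<in> extensional (pts (Arr X))"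
    using f.holomorphic by (auto simp: holomorphic_maps_def)
  then show ?case unfolding f Grp_simps by (auto simp: compose_def fun_eq_iff extensional_def)
next
  case (6 X Y f)
  obtain \<psi> \<Psi> where f: "f = (\<psi>, \<Psi>)" by fastforce
  show ?case using nat_trans_id[OF Grp_morphismI, of X Y \<psi> \<Psi>] 6 unfolding f Grp_simps by blast
next
  case (7 X Y f g h \<sigma> \<tau>)
  obtain \<psi>1 \<Psi>1 \<psi>2 \<Psi>2 where fg: "f = (\<psi>1, \<Psi>1)" "g = (\<psi>2, \<Psi>2)" by fastforce
  obtain \<psi>3 \<Psi>3 where h: "h = (\<psi>3, \<Psi>3)" by fastforce
  show ?case unfolding fg h Grp_simps
    by (rule nat_trans_vcomp[of _ _ _ _ \<psi>2 \<Psi>2]) (use 7 fg h in \<open>auto simp: Grp_simps(3) intro!: Grp_morphismI\<close>)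
next
  case (8 X Y f g h k \<sigma> \<tau> \<upsilon>)
  obtain \<psi>1 \<Psi>1 \<psi>2 \<Psi>2 where fg: "f = (\<psi>1, \<Psi>1)" "g = (\<psi>2, \<Psi>2)" by fastforce
  obtain \<psi>3 \<Psi>3 \<psi>4 \<Psi>4 where hk: "h = (\<psi>3, \<Psi>3)" "k = (\<psi>4, \<Psi>4)" by fastforce
  interpret f: gpd_morphism X Y \<psi>1 \<Psi>1 using 8 fg by (intro Grp_morphismI) auto
  note c = 8(7-9)[unfolded fg hk Grp_simps, THEN groupoid_nat_transD(2)]
    8(7-9)[unfolded fg hk Grp_simps, THEN groupoid_nat_transD(3)]
    8(7-9)[unfolded fg hk Grp_simps, THEN groupoid_nat_transD(4)]
  show ?case unfolding fg hk Grp_simps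
    by (rule restrict_ext) (use c in \<open>simp add: f.H.mult_assoc\<close>)
next
  case (9 X Y f g \<sigma>)
  obtain \<psi>1 \<Psi>1 \<psi>2 \<Psi>2 where fg: "f = (\<psi>1, \<Psi>1)" "g = (\<psi>2, \<Psi>2)" by fastforce
  interpret g: gpd_morphism X Y \<psi>2 \<Psi>2 using 9 fg by (intro Grp_morphismI) auto
  note c = groupoid_nat_transD[OF 9(5)[unfolded fg Grp_simps]]
  have "\<sigma> \<in> extensional (pts (Base X))" using c(1) by (simp add: holomorphic_maps_def)
  then show ?case unfolding fg Grp_simps
    by (intro extensionalityI[of _ "pts (Base X)"]) (use c in \<open>simp_all add: g.H.mult_unit\<close>)
next
  case (10 X Y f g \<sigma>)
  obtain \<psi>1 \<Psi>1 \<psi>2 \<Psi>2 where fg: "f = (\<psi>1, \<Psi>1)" "g = (\<psi>2, \<Psi>2)" by fastforce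
  interpret f: gpd_morphism X Y \<psi>1 \<Psi>1 using 10 fg by (intro Grp_morphismI) auto
  note c = groupoid_nat_transD[OF 10(5)[unfolded fg Grp_simps]]
  have "\<sigma> \<in> extensional (pts (Base X))" using c(1) by (simp add: holomorphic_maps_def)
  then show ?case unfolding fg Grp_simps
    by (intro extensionalityI[of _ "pts (Base X)"]) (use c in \<open>simp_all add: f.H.mult_unit\<close>)
next
  case (11 X Y Z f1 f2 g1 g2 \<delta> \<eta>)
  obtain \<psi>1 \<Psi>1 \<psi>2 \<Psi>2 where f: "f1 = (\<psi>1, \<Psi>1)" "f2 = (\<psi>2, \<Psi>2)" by fastforce
  obtain \<phi>1 \<Phi>1 \<phi>2 \<Phi>2 where g: "g1 = (\<phi>1, \<Phi>1)" "g2 = (\<phi>2, \<Phi>2)" by fastforce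
  show ?case unfolding f g Grp_simps
    by (rule nat_trans_hcomp[of _ Y]) (use 11 f g in \<open>auto simp: Grp_simps(3) intro!: Grp_morphismI\<close>)
next
  case (12 X Y Z f g)
  obtain \<psi> \<Psi> \<phi> \<Phi> where fg: "f = (\<psi>, \<Psi>)" "g = (\<phi>, \<Phi>)" by fastforce
  interpret f: gpd_morphism X Y \<psi> \<Psi> using 12 fg by (intro Grp_morphismI) auto
  interpret g: gpd_morphism Y Z \<phi> \<Phi> using 12 fg by (intro Grp_morphismI) auto
  show ?case unfolding fg Grp_simps by (rule restrict_ext) (simp add: g.H.mult_unit compose_eq)
next
  \<comment> \<open>The interchange law comes from the naturality square of \<open>\<tau>\<close> at the arrow \<open>\<sigma>' x\<close>.\<close>
  case (13 X Y Z f1 f2 f3 g1 g2 g3 \<sigma> \<sigma>' \<tau> \<tau>')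
  obtain \<psi>1 \<Psi>1 \<psi>2 \<Psi>2 where f: "f1 = (\<psi>1, \<Psi>1)" "f2 = (\<psi>2, \<Psi>2)" by fastforce
  obtain \<phi>1 \<Phi>1 \<phi>2 \<Phi>2 where g: "g1 = (\<phi>1, \<Phi>1)" "g2 = (\<phi>2, \<Phi>2)" by fastforce
  obtain \<psi>3 \<Psi>3 \<phi>3 \<Phi>3 where fg: "f3 = (\<psi>3, \<Psi>3)" "g3 = (\<phi>3, \<Phi>3)" by fastforce
  interpret f1: gpd_morphism X Y \<psi>1 \<Psi>1 using 13 f by (intro Grp_morphismI) auto
  interpret f2: gpd_morphism X Y \<psi>2 \<Psi>2 using 13 f by (intro Grp_morphismI) auto
  interpret f3: gpd_morphism X Y \<psi>3 \<Psi>3 using 13 fg by (intro Grp_morphismI) auto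
  interpret g1: gpd_morphism Y Z \<phi>1 \<Phi>1 using 13 g by (intro Grp_morphismI) auto
  interpret g2: gpd_morphism Y Z \<phi>2 \<Phi>2 using 13 g by (intro Grp_morphismI) auto
  interpret g3: gpd_morphism Y Z \<phi>3 \<Phi>3 using 13 fg by (intro Grp_morphismI) auto
  note s = groupoid_nat_transD[OF 13(10)[unfolded f g fg Grp_simps]]
  note s' = groupoid_nat_transD[OF 13(11)[unfolded f g fg Grp_simps]]
  note t = groupoid_nat_transD[OF 13(12)[unfolded f g fg Grp_simps]]
  note t' = groupoid_nat_transD[OF 13(13)[unfolded f g fg Grp_simps]]
  show ?case unfolding f g fg Grp_simps
  proof (rule restrict_ext)
    fix x assume x: "x \<in> pts (Base X)"
    have "gm Z (gm Z (\<Phi>1 (\<sigma> x), \<Phi>1 (\<sigma>' x)), gm Z (\<tau> (\<psi>3 x), \<tau>' (\<psi>3 x))) =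
        gm Z (gm Z (\<Phi>1 (\<sigma> x), \<tau> (\<psi>2 x)), gm Z (\<Phi>2 (\<sigma>' x), \<tau>' (\<psi>3 x)))"
      by (rule g1.H.middle_four) (use x s s' t t' t(5)[of "\<sigma>' x"] in auto)
    then show "gm Z (\<Phi>1 ((\<lambda>x\<in>pts (Base X). gm Y (\<sigma> x, \<sigma>' x)) x),
          (\<lambda>x\<in>pts (Base Y). gm Z (\<tau> x, \<tau>' x)) (\<psi>3 x)) =
        gm Z ((\<lambda>x\<in>pts (Base X). gm Z (\<Phi>1 (\<sigma> x), \<tau> (\<psi>2 x))) x,
          (\<lambda>x\<in>pts (Base X). gm Z (\<Phi>2 (\<sigma>' x), \<tau>' (\<psi>3 x))) x)"
      using x s s' by simp
  qed
next
  case (14 W X Y Z f1 f2 g1 g2 h1 h2 \<sigma> \<tau> \<upsilon>)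
  obtain \<psi>1 \<Psi>1 \<psi>2 \<Psi>2 where f: "f1 = (\<psi>1, \<Psi>1)" "f2 = (\<psi>2, \<Psi>2)" by fastforce
  obtain \<phi>1 \<Phi>1 \<phi>2 \<Phi>2 where g: "g1 = (\<phi>1, \<Phi>1)" "g2 = (\<phi>2, \<Phi>2)" by fastforce
  obtain \<theta>1 \<Theta>1 \<theta>2 \<Theta>2 where h: "h1 = (\<theta>1, \<Theta>1)" "h2 = (\<theta>2, \<Theta>2)" by fastforce
  interpret f1: gpd_morphism W X \<psi>1 \<Psi>1 using 14 f by (intro Grp_morphismI) auto
  interpret f2: gpd_morphism W X \<psi>2 \<Psi>2 using 14 f by (intro Grp_morphismI) auto
  interpret g1: gpd_morphism X Y \<phi>1 \<Phi>1 using 14 g by (intro Grp_morphismI) auto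
  interpret g2: gpd_morphism X Y \<phi>2 \<Phi>2 using 14 g by (intro Grp_morphismI) auto
  interpret h1: gpd_morphism Y Z \<theta>1 \<Theta>1 using 14 h by (intro Grp_morphismI) auto
  interpret h2: gpd_morphism Y Z \<theta>2 \<Theta>2 using 14 h by (intro Grp_morphismI) auto
  note s = groupoid_nat_transD[OF 14(11)[unfolded f g h Grp_simps]]
  note t = groupoid_nat_transD[OF 14(12)[unfolded f g h Grp_simps]]
  note u = groupoid_nat_transD[OF 14(13)[unfolded f g h Grp_simps]]
  show ?case unfolding f g h Grp_simps
    by (rule restrict_ext) (use s t u in \<open>simp add: compose_eq h1.H.mult_assoc\<close>)
next
  case (15 X Y f g \<sigma>)
  obtain \<psi>1 \<Psi>1 \<psi>2 \<Psi>2 where fg: "f = (\<psi>1, \<Psi>1)" "g = (\<psi>2, \<Psi>2)" by fastforce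
  interpret g: gpd_morphism X Y \<psi>2 \<Psi>2 using 15 fg by (intro Grp_morphismI) auto
  note c = groupoid_nat_transD[OF 15(5)[unfolded fg Grp_simps]]
  have "\<sigma> \<in> extensional (pts (Base X))" using c(1) by (simp add: holomorphic_maps_def)
  then show ?case unfolding fg Grp_simps
    by (intro extensionalityI[of _ "pts (Base X)"]) (use c in \<open>simp_all add: g.H.mult_unit\<close>)
next
  case (16 X Y f g \<sigma>)
  obtain \<psi>1 \<Psi>1 \<psi>2 \<Psi>2 where fg: "f = (\<psi>1, \<Psi>1)" "g = (\<psi>2, \<Psi>2)" by fastforce
  interpret f: gpd_morphism X Y \<psi>1 \<Psi>1 using 16 fg by (intro Grp_morphismI) auto
  note c = groupoid_nat_transD[OF 16(5)[unfolded fg Grp_simps]]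
  have "\<sigma> \<in> extensional (pts (Base X))" using c(1) by (simp add: holomorphic_maps_def)
  then show ?case unfolding fg Grp_simps
    by (intro extensionalityI[of _ "pts (Base X)"]) (use c in \<open>simp_all add: f.H.mult_unit\<close>)
qed

section \<open>The 2-category (Pre-Orb)\<close>

lemma Dom_open:
  assumes "orbifold_atlas A" "i \<in> idx A"
  shows "Cn_open (cdim A) (Dom A i)" "Dom A i \<subseteq> Cn (cdim A)" "connected (Dom A i)" "Dom A i \<noteq> {}"
proof -
  show 1: "Cn_open (cdim A) (Dom A i)" "connected (Dom A i)" "Dom A i \<noteq> {}"
    using assms by (simp_all add: orbifold_atlas_def uniformizing_system_def)
  show "Dom A i \<subseteq> Cn (cdim A)" using openin_imp_subset[OF 1(1)] .
qed

lemma embsD: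
  assumes A: "orbifold_atlas A" and l: "l \<in> embs A"
  shows "esrc l \<in> idx A" "etgt l \<in> idx A" "emap l \<in> extensional (Dom A (esrc l))"
    "\<And>x. x \<in> Dom A (esrc l) \<Longrightarrow> emap l x \<in> Dom A (etgt l)"
    "\<And>x. x \<in> Dom A (esrc l) \<Longrightarrow> Proj A (etgt l) (emap l x) = Proj A (esrc l) x"
    "\<And>x. x \<in> Dom A (esrc l) \<Longrightarrow> hol_at (cdim A) (emap l) x"
    "\<And>x. x \<in> Dom A (esrc l) \<Longrightarrow> hol_at (cdim A) (inv_into (Dom A (esrc l)) (emap l)) (emap l x)"
    "inj_on (emap l) (Dom A (esrc l))"
    "Cn_open (cdim A) (emap l ` Dom A (esrc l))"
proof -
  show s: "esrc l \<in> idx A" "etgt l \<in> idx A" and "emap l \<in> extensional (Dom A (esrc l))"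
    and "\<And>x. x \<in> Dom A (esrc l) \<Longrightarrow> Proj A (etgt l) (emap l x) = Proj A (esrc l) x"
    using l by (auto simp: embs_def unif_embedding_def)
  have h: "holomorphic_embedding (cdim A) (Dom A (esrc l)) (Dom A (etgt l)) (emap l)"
    using l by (auto simp: embs_def unif_embedding_def)
  note S = Dom_open(1)[OF A s(1)] and T = Dom_open(2)[OF A s(2)]
  have "emap l \<in> Dom A (esrc l) \<rightarrow> Dom A (etgt l)" "\<forall>x\<in>Dom A (esrc l). hol_at (cdim A) (emap l) x"
    using h unfolding holomorphic_embedding_iff[OF S T] by blast+
  then show "\<And>x. x \<in> Dom A (esrc l) \<Longrightarrow> emap l x \<in> Dom A (etgt l)"
    "\<And>x. x \<in> Dom A (esrc l) \<Longrightarrow> hol_at (cdim A) (emap l) x" by auto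
  show "\<And>x. x \<in> Dom A (esrc l) \<Longrightarrow> hol_at (cdim A) (inv_into (Dom A (esrc l)) (emap l)) (emap l x)"
    "inj_on (emap l) (Dom A (esrc l))"
    "Cn_open (cdim A) (emap l ` Dom A (esrc l))"
    using holomorphic_embedding_inverse[OF S T h] by blast+
qed

text \<open>A holomorphic left inverse is all that has to be exhibited: invariance of domain provides the open image.\<close>

lemma embsI:
  assumes A: "orbifold_atlas A" and ij: "i \<in> idx A" "j \<in> idx A" and ext: "f \<in> extensional (Dom A i)"
    and f: "\<And>x. x \<in> Dom A i \<Longrightarrow> f x \<in> Dom A j" "\<And>x. x \<in> Dom A i \<Longrightarrow> Proj A j (f x) = Proj A i x"
      "\<And>x. x \<in> Dom A i \<Longrightarrow> hol_at (cdim A) f x"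
    and g: "\<And>x. x \<in> Dom A i \<Longrightarrow> g (f x) = x" "\<And>x. x \<in> Dom A i \<Longrightarrow> hol_at (cdim A) g (f x)"
  shows "Emb i f j \<in> embs A"
proof -
  note S = Dom_open(1)[OF A ij(1)] and T = Dom_open(2)[OF A ij(2)]
  have "Cn_open (cdim A) (f ` Dom A i)"
  proof (rule invariance_of_domain_Cn[OF S])
    show "continuous_on (Dom A i) f" by (rule hol_at_continuous_on[OF Dom_open(2)[OF A ij(1)] f(3)])
    show "f \<in> Dom A i \<rightarrow> Cn (cdim A)" using f(1) T by auto
    show "inj_on f (Dom A i)" using g(1) by (rule inj_on_inverseI)
  qed
  then have "holomorphic_embedding (cdim A) (Dom A i) (Dom A j) f"
    unfolding holomorphic_embedding_iff[OF S T] using f g by (intro conjI exI[of _ g]) auto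
  then show ?thesis using ij ext f(2) by (simp add: embs_def unif_embedding_def)
qed

lemma emb_simps [simp]:
  "esrc (emb_id A i) = i" "etgt (emb_id A i) = i" "x \<in> Dom A i \<Longrightarrow> emap (emb_id A i) x = x"
  "esrc (emb_comp A l k) = esrc k" "etgt (emb_comp A l k) = etgt l"
  "x \<in> Dom A (esrc k) \<Longrightarrow> emap (emb_comp A l k) x = emap l (emap k x)"
  by (simp_all add: emb_id_def emb_comp_def compose_eq)

lemma emb_eqI:
  assumes "orbifold_atlas A" "l \<in> embs A" "k \<in> embs A" "esrc l = esrc k" "etgt l = etgt k"
    "\<And>x. x \<in> Dom A (esrc l) \<Longrightarrow> emap l x = emap k x"
  shows "l = k"
proof -
  have "emap l = emap k"
    by (rule extensionalityI[of _ "Dom A (esrc l)"]) (use assms embsD(3) in metis)+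
  then show ?thesis using assms by (metis emb.expand)
qed

lemma emb_id_in [simp]:
  assumes "orbifold_atlas A" "i \<in> idx A"
  shows "emb_id A i \<in> embs A"
  unfolding emb_id_def
proof (rule embsI[OF assms assms(2)])
  show "hol_at (cdim A) (\<lambda>x\<in>Dom A i. x) x" if "x \<in> Dom A i" for x
    by (rule hol_at_cong[OF hol_at_id Dom_open(1)[OF assms] that]) simp
qed (auto intro: hol_at_id)

lemma emb_comp_in [simp]:
  assumes A: "orbifold_atlas A" and k: "k \<in> embs A" and l: "l \<in> embs A" and kl: "etgt k = esrc l"
  shows "emb_comp A l k \<in> embs A"
  unfolding emb_comp_def
proof (rule embsI[OF A embsD(1)[OF A k] embsD(2)[OF A l]])
  let ?S = "Dom A (esrc k)" and ?T = "Dom A (esrc l)"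
  let ?k = "inv_into ?S (emap k)" and ?l = "inv_into ?T (emap l)"
  note K = embsD[OF A k] and L = embsD[OF A l]
  fix x assume x: "x \<in> ?S"
  have kx: "emap k x \<in> ?T" using K(4)[OF x] kl by simp
  show "compose ?S (emap l) (emap k) x \<in> Dom A (etgt l)" using L(4)[OF kx] x by (simp add: compose_eq)
  show "Proj A (etgt l) (compose ?S (emap l) (emap k) x) = Proj A (esrc k) x"
    using x K(5)[OF x] L(5)[OF kx] kl by (simp add: compose_eq)
  have S: "Cn_open (cdim A) ?S" by (rule Dom_open(1)[OF A K(1)])
  have TC: "?T \<subseteq> Cn (cdim A)" by (rule Dom_open(2)[OF A L(1)])
  have SC: "?S \<subseteq> Cn (cdim A)" by (rule Dom_open(2)[OF A K(1)])
  have "hol_at (cdim A) (emap l \<circ> emap k) x"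
    by (rule hol_at_compose[OF K(6)[OF x] L(6)[OF kx] S x]) (use K(4) kl TC in auto)
  then show "hol_at (cdim A) (compose ?S (emap l) (emap k)) x"
    by (rule hol_at_cong[OF _ S x]) (simp add: compose_eq)
  have inv: "?l (emap l y) = y" if "y \<in> ?T" for y using that L(8) by simp
  show "(?k \<circ> ?l) (compose ?S (emap l) (emap k) x) = x" using inv[OF kx] K(8) x by (simp add: compose_eq)
  have "hol_at (cdim A) (?k \<circ> ?l) (emap l (emap k x))"
  proof (rule hol_at_compose[OF L(7)[OF kx] _ L(9)])
    show "hol_at (cdim A) ?k (?l (emap l (emap k x)))" using K(7)[OF x] inv[OF kx] by simp
    show "?l \<in> emap l ` ?T \<rightarrow> Cn (cdim A)" using inv TC by auto
  qed (use kx in auto)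
  then show "hol_at (cdim A) (?k \<circ> ?l) (compose ?S (emap l) (emap k) x)" using x by (simp add: compose_eq)
qed (simp add: compose_def)

lemma emb_comp_assoc:
  assumes "orbifold_atlas A" "k \<in> embs A" "etgt k = esrc l"
  shows "emb_comp A (emb_comp A m l) k = emb_comp A m (emb_comp A l k)"
  using embsD(4)[OF assms(1,2)] assms(3)
  by (simp add: emb_comp_def compose_def restrict_def fun_eq_iff)

lemma emb_comp_id [simp]:
  assumes "orbifold_atlas A" "l \<in> embs A"
  shows "etgt l = i \<Longrightarrow> emb_comp A (emb_id A i) l = l" "esrc l = i \<Longrightarrow> emb_comp A l (emb_id A i) = l"
proof -
  assume "etgt l = i"
  then show "emb_comp A (emb_id A i) l = l"
    using embsD[OF assms] by (intro emb.expand) (auto simp: emb_comp_def emb_id_def compose_def fun_eq_iff extensional_def)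
next
  assume "esrc l = i"
  then show "emb_comp A l (emb_id A i) = l"
    using embsD[OF assms] by (intro emb.expand) (auto simp: emb_comp_def emb_id_def compose_def fun_eq_iff extensional_def)
qed

lemma compatible_systemD:
  assumes "compatible_system A B f"
  shows "base f \<in> extensional (topspace (aspace A))" "continuous_map (aspace A) (aspace B) (base f)"
    "\<And>i. i \<in> idx A \<Longrightarrow> fobj f i \<in> idx B" "\<And>l. l \<in> embs A \<Longrightarrow> fmor f l \<in> embs B"
    "fobj f \<in> extensional (idx A)" "fmor f \<in> extensional (embs A)"
    "\<And>l. l \<in> embs A \<Longrightarrow> esrc (fmor f l) = fobj f (esrc l)" "\<And>l. l \<in> embs A \<Longrightarrow> etgt (fmor f l) = fobj f (etgt l)"
    "\<And>i. i \<in> idx A \<Longrightarrow> fmor f (emb_id A i) = emb_id B (fobj f i)"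
    "\<And>k l. \<lbrakk>k \<in> embs A; l \<in> embs A; etgt k = esrc l\<rbrakk> \<Longrightarrow> fmor f (emb_comp A l k) = emb_comp B (fmor f l) (fmor f k)"
    "\<And>i. i \<in> idx A \<Longrightarrow> base f ` Supp A i \<subseteq> Supp B (fobj f i)"
    "lift f \<in> extensional (idx A)" "\<And>i. i \<in> idx A \<Longrightarrow> lift f i \<in> extensional (Dom A i)"
    "\<And>i. i \<in> idx A \<Longrightarrow> holomorphic_between (cdim A) (Dom A i) (Dom B (fobj f i)) (lift f i)"
    "\<And>i x. \<lbrakk>i \<in> idx A; x \<in> Dom A i\<rbrakk> \<Longrightarrow> lift f i x \<in> Dom B (fobj f i)"
    "\<And>i x. \<lbrakk>i \<in> idx A; x \<in> Dom A i\<rbrakk> \<Longrightarrow> Proj B (fobj f i) (lift f i x) = base f (Proj A i x)"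
    "\<And>l x. \<lbrakk>l \<in> embs A; x \<in> Dom A (esrc l)\<rbrakk> \<Longrightarrow> lift f (etgt l) (emap l x) = emap (fmor f l) (lift f (esrc l) x)"
  using assms unfolding compatible_system_def atlas_functor_def
  by (auto simp: PiE_iff holomorphic_between_def Pi_iff)

lemma cs_nat_transD:
  assumes "cs_nat_trans A B f1 f2 \<delta>"
  shows "base f1 = base f2" "\<delta> \<in> extensional (idx A)" "\<And>i. i \<in> idx A \<Longrightarrow> \<delta> i \<in> embs B"
    "\<And>i. i \<in> idx A \<Longrightarrow> esrc (\<delta> i) = fobj f1 i" "\<And>i. i \<in> idx A \<Longrightarrow> etgt (\<delta> i) = fobj f2 i"
    "\<And>i x. i \<in> idx A \<Longrightarrow> x \<in> Dom A i \<Longrightarrow> lift f2 i x = emap (\<delta> i) (lift f1 i x)"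
    "\<And>l. l \<in> embs A \<Longrightarrow> emb_comp B (fmor f2 l) (\<delta> (esrc l)) = emb_comp B (\<delta> (etgt l)) (fmor f1 l)"
  using assms unfolding cs_nat_trans_def by (auto simp: PiE_iff)

lemma hol_at_lift:
  assumes "orbifold_atlas A" "compatible_system A B f" "i \<in> idx A" "x \<in> Dom A i"
  shows "hol_at (cdim A) (lift f i) x"
  using compatible_systemD(14)[OF assms(2,3)] assms(4) holomorphic_between_iff[OF Dom_open(1)[OF assms(1,3)]] by blast

lemma compatible_system_id:
  assumes A: "orbifold_atlas A"
  shows "compatible_system A A (cs_id A)"
proof -
  note e = embsD[OF A]
  have "holomorphic_between (cdim A) (Dom A i) (Dom A i) (\<lambda>x\<in>Dom A i. x)" if i: "i \<in> idx A" for i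
    unfolding holomorphic_between_iff[OF Dom_open(1)[OF A i]]
    using hol_at_cong[OF hol_at_id Dom_open(1)[OF A i]] by auto
  moreover have "Proj A i x \<in> topspace (aspace A)" if "i \<in> idx A" "x \<in> Dom A i" for i x
    using A that unfolding orbifold_atlas_def by blast
  moreover have "continuous_map (aspace A) (aspace A) (\<lambda>x\<in>topspace (aspace A). x)"
    by (rule continuous_map_eq[OF continuous_map_id]) auto
  ultimately show ?thesis
    using A e(1,2,4) by (auto simp: compatible_system_def atlas_functor_def cs_id_def)
qed

lemma compatible_system_comp:
  assumes A: "orbifold_atlas A" and B: "orbifold_atlas B" and C: "orbifold_atlas C"
    and f: "compatible_system A B f" and g: "compatible_system B C g"
  shows "compatible_system A C (cs_comp A g f)"
proof -
  note F = compatible_systemD[OF f] and G = compatible_systemD[OF g] and e = embsD[OF A]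
  have "holomorphic_between (cdim A) (Dom A i) (Dom C (fobj g (fobj f i))) (compose (Dom A i) (lift g (fobj f i)) (lift f i))"
    if i: "i \<in> idx A" for i
    unfolding holomorphic_between_iff[OF Dom_open(1)[OF A i]]
  proof (intro conjI ballI)
    note D = Dom_open(1)[OF A i]
    fix x assume x: "x \<in> Dom A i"
    have "hol_at (cdim A) (lift g (fobj f i) \<circ> lift f i) x"
      by (rule hol_at_compose[OF hol_at_lift[OF A f i x] hol_at_lift[OF B g F(3)[OF i] F(15)[OF i x]] D x])
        (use F(15)[OF i] Dom_open(2)[OF B F(3)[OF i]] in auto)
    then show "hol_at (cdim A) (compose (Dom A i) (lift g (fobj f i)) (lift f i)) x"
      by (rule hol_at_cong[OF _ D x]) (simp add: compose_eq)
  qed (use i F G in \<open>auto simp: compose_eq\<close>)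
  moreover have "Proj A i x \<in> topspace (aspace A)" if "i \<in> idx A" "x \<in> Dom A i" for i x
    using A that unfolding orbifold_atlas_def by blast
  moreover have "lift g (fobj f (etgt l)) (emap (fmor f l) (lift f (esrc l) x)) =
      emap (fmor g (fmor f l)) (lift g (fobj f (esrc l)) (lift f (esrc l) x))"
    if "l \<in> embs A" "x \<in> Dom A (esrc l)" for l x
    using G(17)[of "fmor f l" "lift f (esrc l) x"] F(4,7,8,15) e(1) that by simp
  moreover have "continuous_map (aspace A) (aspace C) (compose (topspace (aspace A)) (base g) (base f))"
    by (rule continuous_map_eq[OF continuous_map_compose[OF F(2) G(2)]]) (simp add: compose_eq)
  moreover have "base g (base f (Proj A i x)) \<in> Supp C (fobj g (fobj f i))" if "i \<in> idx A" "x \<in> Dom A i" for i x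
    using F(3,11)[of i] G(11)[of "fobj f i"] that by blast
  ultimately show ?thesis
    using A e(1,2,4) F(3,4,7-10,15-17) G(3,4,7-10,15-17)
    by (simp add: compatible_system_def atlas_functor_def cs_comp_def compose_eq compose_extensional PiE_iff image_subset_iff)
qed

lemma comp_sys_eqI:
  assumes "compatible_system A B f" "compatible_system A B g"
    and "\<And>x. x \<in> topspace (aspace A) \<Longrightarrow> base f x = base g x"
    and "\<And>i. i \<in> idx A \<Longrightarrow> fobj f i = fobj g i" "\<And>l. l \<in> embs A \<Longrightarrow> fmor f l = fmor g l"
    and "\<And>i x. i \<in> idx A \<Longrightarrow> x \<in> Dom A i \<Longrightarrow> lift f i x = lift g i x"
  shows "f = g"
proof -
  note F = compatible_systemD[OF assms(1)] and G = compatible_systemD[OF assms(2)]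
  have "lift f i = lift g i" if "i \<in> idx A" for i
    by (rule extensionalityI[of _ "Dom A i"]) (use F(13) G(13) assms(6) that in auto)
  then have "lift f = lift g" by (intro extensionalityI[of _ "idx A"] F G) auto
  moreover have "base f = base g" by (intro extensionalityI[OF F(1) G(1)] assms)
  moreover have "fobj f = fobj g" by (intro extensionalityI[OF F(5) G(5)] assms)
  moreover have "fmor f = fmor g" by (intro extensionalityI[OF F(6) G(6)] assms)
  ultimately show ?thesis by (cases f; cases g) simp
qed

lemma cs_comp_simps [simp]:
  "x \<in> topspace (aspace A) \<Longrightarrow> base (cs_comp A g f) x = base g (base f x)"
  "i \<in> idx A \<Longrightarrow> fobj (cs_comp A g f) i = fobj g (fobj f i)"
  "l \<in> embs A \<Longrightarrow> fmor (cs_comp A g f) l = fmor g (fmor f l)"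
  "i \<in> idx A \<Longrightarrow> v \<in> Dom A i \<Longrightarrow> lift (cs_comp A g f) i v = lift g (fobj f i) (lift f i v)"
  by (simp_all add: cs_comp_def compose_eq)

lemma cs_id_simps [simp]:
  "x \<in> topspace (aspace A) \<Longrightarrow> base (cs_id A) x = x" "i \<in> idx A \<Longrightarrow> fobj (cs_id A) i = i"
  "l \<in> embs A \<Longrightarrow> fmor (cs_id A) l = l" "i \<in> idx A \<Longrightarrow> v \<in> Dom A i \<Longrightarrow> lift (cs_id A) i v = v"
  by (simp_all add: cs_id_def)

lemma PreOrb_simps:
  "Obj PreOrb = {A. orbifold_atlas A}" "f \<in> Hom PreOrb A B \<longleftrightarrow> compatible_system A B f"
  "\<delta> \<in> Cell PreOrb A B f1 f2 \<longleftrightarrow> cs_nat_trans A B f1 f2 \<delta>"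
  "Id1 PreOrb = cs_id" "Comp PreOrb A B C g f = cs_comp A g f"
  "Id2 PreOrb A B f = (\<lambda>i\<in>idx A. emb_id B (fobj f i))"
  "VComp PreOrb A B f1 f2 f3 \<sigma> \<delta> = (\<lambda>i\<in>idx A. emb_comp B (\<sigma> i) (\<delta> i))"
  "HComp PreOrb A B C f1 f2 g1 g2 \<eta> \<delta> = (\<lambda>i\<in>idx A. emb_comp C (\<eta> (fobj f2 i)) (fmor g1 (\<delta> i)))"
  by (simp_all add: PreOrb_def)

lemma cs_nat_trans_id:
  assumes A: "orbifold_atlas A" and B: "orbifold_atlas B" and f: "compatible_system A B f"
  shows "cs_nat_trans A B f f (\<lambda>i\<in>idx A. emb_id B (fobj f i))"
  using compatible_systemD[OF f] embsD(1,2)[OF A] A B by (auto simp: cs_nat_trans_def)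

lemma cs_nat_trans_vcomp:
  assumes A: "orbifold_atlas A" and B: "orbifold_atlas B"
    and f: "compatible_system A B f" and g: "compatible_system A B g" and h: "compatible_system A B h"
    and \<sigma>: "cs_nat_trans A B f g \<sigma>" and \<tau>: "cs_nat_trans A B g h \<tau>"
  shows "cs_nat_trans A B f h (\<lambda>i\<in>idx A. emb_comp B (\<tau> i) (\<sigma> i))"
proof -
  note F = compatible_systemD[OF f] and G = compatible_systemD[OF g] and H = compatible_systemD[OF h]
    and s = cs_nat_transD[OF \<sigma>] and t = cs_nat_transD[OF \<tau>] and e = embsD(1,2)[OF A]
  have "emb_comp B (fmor h l) (emb_comp B (\<tau> (esrc l)) (\<sigma> (esrc l))) =
      emb_comp B (emb_comp B (\<tau> (etgt l)) (\<sigma> (etgt l))) (fmor f l)" if l: "l \<in> embs A" for l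
  proof -
    have "emb_comp B (fmor h l) (emb_comp B (\<tau> (esrc l)) (\<sigma> (esrc l))) =
      emb_comp B (emb_comp B (fmor h l) (\<tau> (esrc l))) (\<sigma> (esrc l))"
      using l s t e B by (intro emb_comp_assoc[symmetric]) auto
    also have "\<dots> = emb_comp B (emb_comp B (\<tau> (etgt l)) (fmor g l)) (\<sigma> (esrc l))" using t(7)[OF l] by simp
    also have "\<dots> = emb_comp B (\<tau> (etgt l)) (emb_comp B (fmor g l) (\<sigma> (esrc l)))"
      using l s t e B G by (intro emb_comp_assoc) auto
    also have "\<dots> = emb_comp B (\<tau> (etgt l)) (emb_comp B (\<sigma> (etgt l)) (fmor f l))" using s(7)[OF l] by simp
    also have "\<dots> = emb_comp B (emb_comp B (\<tau> (etgt l)) (\<sigma> (etgt l))) (fmor f l)"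
      using l s t e B F by (intro emb_comp_assoc[symmetric]) auto
    finally show ?thesis .
  qed
  moreover have "lift h i x = emap (emb_comp B (\<tau> i) (\<sigma> i)) (lift f i x)" if "i \<in> idx A" "x \<in> Dom A i" for i x
    using that s t F(15) by simp
  ultimately show ?thesis using s t B e by (simp add: cs_nat_trans_def PiE_iff)
qed

text \<open>Naturality at \<open>l\<close> combines the naturality of \<open>\<eta>\<close> at \<open>f2 l\<close> with the image under \<open>g1\<close> of that of \<open>\<delta>\<close> at \<open>l\<close>.\<close>

lemma cs_nat_trans_hcomp:
  assumes A: "orbifold_atlas A" and B: "orbifold_atlas B" and C: "orbifold_atlas C"
    and f1: "compatible_system A B f1" and f2: "compatible_system A B f2"
    and g1: "compatible_system B C g1" and g2: "compatible_system B C g2"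
    and \<delta>: "cs_nat_trans A B f1 f2 \<delta>" and \<eta>: "cs_nat_trans B C g1 g2 \<eta>"
  shows "cs_nat_trans A C (cs_comp A g1 f1) (cs_comp A g2 f2) (\<lambda>i\<in>idx A. emb_comp C (\<eta> (fobj f2 i)) (fmor g1 (\<delta> i)))"
proof -
  note F1 = compatible_systemD[OF f1] and F2 = compatible_systemD[OF f2]
    and G1 = compatible_systemD[OF g1] and G2 = compatible_systemD[OF g2]
    and d = cs_nat_transD[OF \<delta>] and n = cs_nat_transD[OF \<eta>] and e = embsD(1,2)[OF A]
  have "emb_comp C (fmor g2 (fmor f2 l)) (emb_comp C (\<eta> (fobj f2 (esrc l))) (fmor g1 (\<delta> (esrc l)))) =
      emb_comp C (emb_comp C (\<eta> (fobj f2 (etgt l))) (fmor g1 (\<delta> (etgt l)))) (fmor g1 (fmor f1 l))"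
    if l: "l \<in> embs A" for l
  proof -
    have n7: "emb_comp C (fmor g2 (fmor f2 l)) (\<eta> (fobj f2 (esrc l))) = emb_comp C (\<eta> (fobj f2 (etgt l))) (fmor g1 (fmor f2 l))"
      using n(7)[OF F2(4)[OF l]] F2(7,8)[OF l] by simp
    have "emb_comp C (fmor g2 (fmor f2 l)) (emb_comp C (\<eta> (fobj f2 (esrc l))) (fmor g1 (\<delta> (esrc l)))) =
        emb_comp C (emb_comp C (fmor g2 (fmor f2 l)) (\<eta> (fobj f2 (esrc l)))) (fmor g1 (\<delta> (esrc l)))"
      using l d n e C F2 G1 by (intro emb_comp_assoc[symmetric]) auto
    also have "\<dots> = emb_comp C (\<eta> (fobj f2 (etgt l))) (emb_comp C (fmor g1 (fmor f2 l)) (fmor g1 (\<delta> (esrc l))))"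
      unfolding n7 using l d n e C F2 G1 by (intro emb_comp_assoc) auto
    also have "emb_comp C (fmor g1 (fmor f2 l)) (fmor g1 (\<delta> (esrc l))) = fmor g1 (emb_comp B (fmor f2 l) (\<delta> (esrc l)))"
      using l d e F2 by (intro G1(10)[symmetric]) auto
    also have "\<dots> = fmor g1 (emb_comp B (\<delta> (etgt l)) (fmor f1 l))" using d(7)[OF l] by simp
    also have "\<dots> = emb_comp C (fmor g1 (\<delta> (etgt l))) (fmor g1 (fmor f1 l))"
      using l d e F1 by (intro G1(10)) auto
    also have "emb_comp C (\<eta> (fobj f2 (etgt l))) (emb_comp C (fmor g1 (\<delta> (etgt l))) (fmor g1 (fmor f1 l))) =
        emb_comp C (emb_comp C (\<eta> (fobj f2 (etgt l))) (fmor g1 (\<delta> (etgt l)))) (fmor g1 (fmor f1 l))"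
      using l d n e C F1 F2 G1 by (intro emb_comp_assoc[symmetric]) auto
    finally show ?thesis .
  qed
  moreover have "lift g2 (fobj f2 i) (lift f2 i x) = emap (\<eta> (fobj f2 i)) (emap (fmor g1 (\<delta> i)) (lift g1 (fobj f1 i) (lift f1 i x)))"
    if i: "i \<in> idx A" "x \<in> Dom A i" for i x
  proof -
    have "lift g2 (fobj f2 i) (lift f2 i x) = emap (\<eta> (fobj f2 i)) (lift g1 (fobj f2 i) (lift f2 i x))"
      by (rule n(6)) (use i F2 in auto)
    also have "lift g1 (fobj f2 i) (lift f2 i x) = emap (fmor g1 (\<delta> i)) (lift g1 (fobj f1 i) (lift f1 i x))"
      using G1(17)[of "\<delta> i" "lift f1 i x"] d i F1 by simp
    finally show ?thesis .
  qed
  moreover have "base (cs_comp A g1 f1) = base (cs_comp A g2 f2)" using d(1) n(1) by (simp add: cs_comp_def)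
  ultimately show ?thesis using d n C e F1 F2 G1 G2
    by (simp add: cs_nat_trans_def PiE_iff)
qed

theorem strict_two_category_PreOrb:
  "strict_two_category (PreOrb :: (('x, 'i) atlas, ('x, 'i) comp_sys, 'i \<Rightarrow> 'i emb) two_cat)"
proof (unfold_locales, unfold PreOrb_simps mem_Collect_eq, goal_cases)
  case (1 X)
  then show ?case by (rule compatible_system_id)
next
  case (2 X Y Z f g)
  then show ?case by (rule compatible_system_comp)
next
  case (3 W X Y Z f g h)
  note F = compatible_systemD[OF 3(5)] and G = compatible_systemD[OF 3(6)]
  have top: "base f x \<in> topspace (aspace X)" if "x \<in> topspace (aspace W)" for x
    using F(2) that by (auto simp: continuous_map_def)
  have c: "compatible_system W Z (cs_comp W (cs_comp X h g) f)" "compatible_system W Z (cs_comp W h (cs_comp W g f))"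
    by (rule compatible_system_comp[OF 3(1,2,4,5) compatible_system_comp[OF 3(2,3,4,6,7)]],
        rule compatible_system_comp[OF 3(1,3,4) compatible_system_comp[OF 3(1,2,3,5,6)] 3(7)])
  show ?case by (rule comp_sys_eqI[OF c]) (use F(3,4,15) top in simp_all)
next
  case (4 X Y f)
  note F = compatible_systemD[OF 4(3)]
  have "base f x \<in> topspace (aspace Y)" if "x \<in> topspace (aspace X)" for x
    using F(2) that by (auto simp: continuous_map_def)
  then show ?case using 4 F
    by (intro comp_sys_eqI[of X Y] compatible_system_comp[of X Y Y] compatible_system_id) auto
next
  case (5 X Y f)
  then show ?case using embsD(1,2)[of X]
    by (intro comp_sys_eqI[of X Y] compatible_system_comp[of X X Y] compatible_system_id) auto
next
  case (6 X Y f)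
  then show ?case by (rule cs_nat_trans_id)
next
  case (7 X Y f g h \<sigma> \<tau>)
  then show ?case by (rule cs_nat_trans_vcomp)
next
  case (8 X Y f g h k \<sigma> \<tau> \<upsilon>)
  note s = cs_nat_transD[OF 8(7)] cs_nat_transD[OF 8(8)] cs_nat_transD[OF 8(9)]
  show ?case by (rule restrict_ext) (use 8(2) s in \<open>simp add: emb_comp_assoc\<close>)
next
  case (9 X Y f g \<sigma>)
  note s = cs_nat_transD[OF 9(5)]
  show ?case by (rule extensionalityI[of _ "idx X"]) (use 9(2) s in simp_all)
next
  case (10 X Y f g \<sigma>)
  note s = cs_nat_transD[OF 10(5)]
  show ?case by (rule extensionalityI[of _ "idx X"]) (use 10(2) s in simp_all)
next
  case (11 X Y Z f1 f2 g1 g2 \<delta> \<eta>)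
  then show ?case by (rule cs_nat_trans_hcomp)
next
  case (12 X Y Z f g)
  note F = compatible_systemD[OF 12(4)] and G = compatible_systemD[OF 12(5)]
  show ?case by (rule restrict_ext) (use 12 F G in simp)
next
  \<comment> \<open>The interchange law comes from the naturality of \<open>\<tau>\<close> at the embedding \<open>\<sigma>' i\<close>.\<close>
  case (13 X Y Z f1 f2 f3 g1 g2 g3 \<sigma> \<sigma>' \<tau> \<tau>')
  note s = cs_nat_transD[OF 13(10)] and s' = cs_nat_transD[OF 13(11)]
    and t = cs_nat_transD[OF 13(12)] and t' = cs_nat_transD[OF 13(13)]
    and F = compatible_systemD(3)[OF 13(4)] compatible_systemD(3)[OF 13(5)] compatible_systemD(3)[OF 13(6)]
    and G1 = compatible_systemD[OF 13(7)] and G2 = compatible_systemD[OF 13(8)]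
  show ?case
  proof (rule restrict_ext)
    fix i assume i: "i \<in> idx X"
    let ?a = "fmor g1 (\<sigma> i)" and ?b = "fmor g1 (\<sigma>' i)" and ?c = "\<tau> (fobj f3 i)" and ?d = "\<tau>' (fobj f3 i)"
    let ?e = "\<tau> (fobj f2 i)" and ?f = "fmor g2 (\<sigma>' i)"
    have nat: "emb_comp Z ?f ?e = emb_comp Z ?c ?b" using t(7)[of "\<sigma>' i"] s' i by simp
    have m: "?a \<in> embs Z" "?b \<in> embs Z" "?c \<in> embs Z" "?d \<in> embs Z" "?e \<in> embs Z" "?f \<in> embs Z"
      "etgt ?a = esrc ?b" "etgt ?b = esrc ?c" "etgt ?c = esrc ?d" "etgt ?a = esrc ?e" "etgt ?e = esrc ?f" "etgt ?f = esrc ?d"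
      using i s(3-5) s'(3-5) t(3-5) t'(3-5) F G1(4,7,8) G2(4,7,8) by simp_all
    have "emb_comp Z (emb_comp Z ?d ?c) (emb_comp Z ?b ?a) = emb_comp Z ?d (emb_comp Z (emb_comp Z ?c ?b) ?a)"
      using m 13(3) by (simp add: emb_comp_assoc)
    also have "\<dots> = emb_comp Z (emb_comp Z ?d ?f) (emb_comp Z ?e ?a)"
      unfolding nat[symmetric] using m 13(3) by (simp add: emb_comp_assoc)
    finally show "emb_comp Z ((\<lambda>i\<in>idx Y. emb_comp Z (\<tau>' i) (\<tau> i)) (fobj f3 i)) (fmor g1 ((\<lambda>i\<in>idx X. emb_comp Y (\<sigma>' i) (\<sigma> i)) i)) =
        emb_comp Z ((\<lambda>i\<in>idx X. emb_comp Z (\<tau>' (fobj f3 i)) (fmor g2 (\<sigma>' i))) i)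
          ((\<lambda>i\<in>idx X. emb_comp Z (\<tau> (fobj f2 i)) (fmor g1 (\<sigma> i))) i)"
      using i s s' F G1(10)[of "\<sigma> i" "\<sigma>' i"] by simp
  qed
next
  case (14 W X Y Z f1 f2 g1 g2 h1 h2 \<sigma> \<tau> \<upsilon>)
  note s = cs_nat_transD[OF 14(11)] and t = cs_nat_transD[OF 14(12)] and u = cs_nat_transD[OF 14(13)]
    and F = compatible_systemD(3)[OF 14(5)] compatible_systemD(3)[OF 14(6)]
    and G1 = compatible_systemD[OF 14(7)] and G2 = compatible_systemD[OF 14(8)] and H1 = compatible_systemD[OF 14(9)]
  show ?case
  proof (rule restrict_ext)
    fix i assume i: "i \<in> idx W"
    have "fmor h1 (emb_comp Y (\<tau> (fobj f2 i)) (fmor g1 (\<sigma> i))) = emb_comp Z (fmor h1 (\<tau> (fobj f2 i))) (fmor h1 (fmor g1 (\<sigma> i)))"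
      by (rule H1(10)) (use i s t F G1 in auto)
    moreover have "emb_comp Z (emb_comp Z (\<upsilon> (fobj g2 (fobj f2 i))) (fmor h1 (\<tau> (fobj f2 i)))) (fmor h1 (fmor g1 (\<sigma> i))) =
      emb_comp Z (\<upsilon> (fobj g2 (fobj f2 i))) (emb_comp Z (fmor h1 (\<tau> (fobj f2 i))) (fmor h1 (fmor g1 (\<sigma> i))))"
      by (rule emb_comp_assoc) (use i s t F G1 H1 14(4) in auto)
    ultimately show "emb_comp Z ((\<lambda>i\<in>idx X. emb_comp Z (\<upsilon> (fobj g2 i)) (fmor h1 (\<tau> i))) (fobj f2 i)) (fmor (cs_comp X h1 g1) (\<sigma> i)) =
      emb_comp Z (\<upsilon> (fobj (cs_comp W g2 f2) i)) (fmor h1 ((\<lambda>i\<in>idx W. emb_comp Y (\<tau> (fobj f2 i)) (fmor g1 (\<sigma> i))) i))"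
      using i s F by simp
  qed
next
  case (15 X Y f g \<sigma>)
  note s = cs_nat_transD[OF 15(5)]
  show ?case
    by (rule extensionalityI[of _ "idx X"]) (use 15(2) s compatible_systemD(3)[OF 15(4)] in simp_all)
next
  case (16 X Y f g \<sigma>)
  note s = cs_nat_transD[OF 16(5)]
  show ?case
    by (rule extensionalityI[of _ "idx X"]) (use 16 s compatible_systemD(9)[OF 16(3)] in simp_all)
qed

section \<open>Embeddings of uniformizing systems\<close>

text \<open>The finite case of Baire's theorem: if \<open>N\<close> is not contained in one of the closed sets, the rest of \<open>N\<close>
  is a nonempty open set that is covered by the others.\<close>

lemma finite_closed_cover_interior:
  assumes "finite I" "openin X N" "N \<noteq> {}" "\<And>g. g \<in> I \<Longrightarrow> closedin X (C g)" "N \<subseteq> (\<Union>g\<in>I. C g)"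
  obtains g V where "g \<in> I" "openin X V" "V \<noteq> {}" "V \<subseteq> N" "V \<subseteq> C g"
proof -
  have "\<exists>g\<in>I. \<exists>V. openin X V \<and> V \<noteq> {} \<and> V \<subseteq> N \<and> V \<subseteq> C g"
    using assms
  proof (induction I arbitrary: N rule: finite_induct)
    case (insert g I)
    show ?case
    proof (cases "N \<subseteq> C g")
      case False
      have "openin X (N - C g)" using insert.prems by (intro openin_diff) auto
      moreover have "N - C g \<subseteq> (\<Union>g\<in>I. C g)" using insert.prems by auto
      ultimately have "\<exists>h\<in>I. \<exists>V. openin X V \<and> V \<noteq> {} \<and> V \<subseteq> N - C g \<and> V \<subseteq> C h"
        using False insert.prems(3) by (intro insert.IH) auto
      then show ?thesis by blast
    qed (use insert.prems in blast)
  qed auto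
  then show ?thesis using that by blast
qed

locale orb =
  fixes A :: "('x, 'i) atlas"
  assumes atlas: "orbifold_atlas A"
begin

abbreviation grp :: "'i \<Rightarrow> (cvec \<Rightarrow> cvec) set" where "grp i \<equiv> ugrp (usys A i)"

text \<open>Elements of the group of a system are embeddings of the system into itself.\<close>

definition gemb :: "'i \<Rightarrow> (cvec \<Rightarrow> cvec) \<Rightarrow> 'i emb" where "gemb i g = Emb i g i"

abbreviation comp (infixl "\<cdot>" 70) where "l \<cdot> k \<equiv> emb_comp A l k"

lemmas emb = embsD[OF atlas]
lemmas dom = Dom_open[OF atlas]
lemmas comp_in [simp] = emb_comp_in[OF atlas]
lemmas id_in [simp] = emb_id_in[OF atlas]
lemmas comp_assoc = emb_comp_assoc[OF atlas]
lemmas comp_id [simp] = emb_comp_id[OF atlas]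
lemmas eqI = emb_eqI[OF atlas]

lemma gemb_simps [simp]: "esrc (gemb i g) = i" "etgt (gemb i g) = i" "emap (gemb i g) = g"
  by (simp_all add: gemb_def)

lemma unif: "i \<in> idx A \<Longrightarrow> uniformizing_system (aspace A) (cdim A) (Supp A i) (usys A i)"
  using atlas by (simp add: orbifold_atlas_def)

lemma finite_grp: "i \<in> idx A \<Longrightarrow> finite (grp i)"
  using unif[of i] by (simp add: uniformizing_system_def)

lemma grp_subgroup: "i \<in> idx A \<Longrightarrow> subgroup (grp i) (BijGroup (Dom A i))"
  using unif[of i] by (simp add: uniformizing_system_def)

lemma grp_Bij: "i \<in> idx A \<Longrightarrow> g \<in> grp i \<Longrightarrow> g \<in> Bij (Dom A i)"
  using subgroup.subset[OF grp_subgroup[of i]] by (auto simp: BijGroup_def)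

lemma grp_one: "i \<in> idx A \<Longrightarrow> (\<lambda>x\<in>Dom A i. x) \<in> grp i"
  using subgroup.one_closed[OF grp_subgroup[of i]] by (simp add: BijGroup_def)

lemma grp_inv:
  assumes "i \<in> idx A" "g \<in> grp i"
  shows "(\<lambda>x\<in>Dom A i. inv_into (Dom A i) g x) \<in> grp i"
  using subgroup.m_inv_closed[OF grp_subgroup[OF assms(1)] assms(2)] inv_BijGroup[OF grp_Bij[OF assms]] by simp

lemma grp_hol:
  assumes "i \<in> idx A" "g \<in> grp i" "x \<in> Dom A i"
  shows "hol_at (cdim A) g x"
proof -
  have "holomorphic_between (cdim A) (Dom A i) (Dom A i) g"
    using unif[OF assms(1)] assms(2) by (simp add: uniformizing_system_def)
  then show ?thesis using assms(3) unfolding holomorphic_between_iff[OF dom(1)[OF assms(1)]] by blast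
qed

lemma gemb_in [simp]:
  assumes i: "i \<in> idx A" and g: "g \<in> grp i"
  shows "gemb i g \<in> embs A"
  unfolding gemb_def
proof (rule embsI[OF atlas i i])
  let ?g' = "\<lambda>x\<in>Dom A i. inv_into (Dom A i) g x"
  have B: "g \<in> extensional (Dom A i)" "bij_betw g (Dom A i) (Dom A i)" using grp_Bij[OF i g] by (auto simp: Bij_def)
  show "g \<in> extensional (Dom A i)" by fact
  show "Proj A i (g x) = Proj A i x" if "x \<in> Dom A i" for x
    using unif[OF i] g that by (simp add: uniformizing_system_def)
  show 1: "g x \<in> Dom A i" if "x \<in> Dom A i" for x using B that by (auto simp: bij_betw_def)
  show "hol_at (cdim A) g x" if "x \<in> Dom A i" for x by (rule grp_hol[OF i g that])
  show "?g' (g x) = x" if "x \<in> Dom A i" for x using B 1[OF that] that by (auto simp: bij_betw_def)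
  show "hol_at (cdim A) ?g' (g x)" if "x \<in> Dom A i" for x by (rule grp_hol[OF i grp_inv[OF i g] 1[OF that]])
qed

text \<open>The projection induces an injective map on the orbit space.\<close>

lemma same_orbit:
  assumes i: "i \<in> idx A" and x: "x \<in> Dom A i" and y: "y \<in> Dom A i" and eq: "Proj A i x = Proj A i y"
  obtains g where "g \<in> grp i" "g x = y"
proof -
  let ?Q = "quotient_topology (top_of_set (Dom A i)) (unif_orbit (usys A i))"
  obtain h where h: "homeomorphic_map ?Q (subtopology (aspace A) (Supp A i)) h"
    "\<forall>x\<in>Dom A i. h (unif_orbit (usys A i) x) = Proj A i x"
    using unif[OF i] by (auto simp: uniformizing_system_def)
  have "topspace ?Q = unif_orbit (usys A i) ` Dom A i"
    using quotient_imp_surjective_map[OF quotient_map_quotient_topology[of "top_of_set (Dom A i)" "unif_orbit (usys A i)"]]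
    by simp
  moreover have "inj_on h (topspace ?Q)" using homeomorphic_imp_injective_map[OF h(1)] .
  ultimately have "unif_orbit (usys A i) x = unif_orbit (usys A i) y"
    using inj_onD[of h "topspace ?Q" "unif_orbit (usys A i) x" "unif_orbit (usys A i) y"] h(2) x y eq by simp
  moreover have "y \<in> unif_orbit (usys A i) y"
    unfolding unif_orbit_def using grp_one[OF i] y by (intro CollectI exI[of _ "\<lambda>x\<in>Dom A i. x"]) simp
  ultimately have "y \<in> unif_orbit (usys A i) x" by simp
  then show ?thesis using that by (auto simp: unif_orbit_def)
qed

lemma emb_image_open:
  assumes "l \<in> embs A" "Cn_open (cdim A) V" "V \<subseteq> Dom A (esrc l)"
  shows "Cn_open (cdim A) (emap l ` V)"
proof (rule invariance_of_domain_Cn[OF assms(2)])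
  show "continuous_on V (emap l)"
    by (rule hol_at_continuous_on) (use assms emb(6) openin_imp_subset in blast)+
  show "emap l \<in> V \<rightarrow> Cn (cdim A)" using assms(3) emb(2,4)[OF assms(1)] dom(2) by fast
  show "inj_on (emap l) V" using emb(8)[OF assms(1)] assms(3) inj_on_subset by blast
qed

lemma emb_continuous: "l \<in> embs A \<Longrightarrow> continuous_on (Dom A (esrc l)) (emap l)"
  by (rule hol_at_continuous_on[OF dom(2) emb(6)]) (auto simp: emb)

lemma emb_preimage_open:
  assumes "l \<in> embs A" "Cn_open (cdim A) V"
  shows "Cn_open (cdim A) {x \<in> Dom A (esrc l). emap l x \<in> V}"
proof -
  have "emap l \<in> Dom A (esrc l) \<rightarrow> Cn (cdim A)" using emb(2,4)[OF assms(1)] dom(2) by fast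
  then have "openin (top_of_set (Dom A (esrc l))) (Dom A (esrc l) \<inter> emap l -` V)"
    using continuous_openin_preimage[OF emb_continuous[OF assms(1)]] assms(2) by blast
  moreover have "Dom A (esrc l) \<inter> emap l -` V = {x \<in> Dom A (esrc l). emap l x \<in> V}" by blast
  ultimately show ?thesis using openin_trans dom(1)[OF emb(1)[OF assms(1)]] by metis
qed

lemma embeddings_eq_if_agree_on_open:
  assumes l: "l \<in> embs A" and m: "m \<in> embs A" and eq: "esrc l = esrc m" "etgt l = etgt m"
    and N: "Cn_open (cdim A) N" "N \<noteq> {}" "N \<subseteq> Dom A (esrc l)" "\<And>x. x \<in> N \<Longrightarrow> emap l x = emap m x"
  shows "l = m"
proof (rule eqI[OF l m eq])
  fix x assume x: "x \<in> Dom A (esrc l)"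
  show "emap l x = emap m x"
    by (rule identity_theorem[OF dom(1,3)[OF emb(1)[OF l]] _ _ N x]) (use emb(6)[OF l] emb(6)[OF m] eq in auto)
qed

text \<open>Embeddings are epimorphisms, by the identity theorem on the open image of \<open>c\<close>.\<close>

lemma emb_cancel_right:
  assumes "l \<in> embs A" "m \<in> embs A" "c \<in> embs A" "etgt c = esrc l" "etgt c = esrc m" "l \<cdot> c = m \<cdot> c"
  shows "l = m"
proof (rule embeddings_eq_if_agree_on_open[OF assms(1,2)])
  show "etgt l = etgt m" using arg_cong[OF assms(6), of etgt] by simp
  show "Cn_open (cdim A) (emap c ` Dom A (esrc c))" by (rule emb(9)[OF assms(3)])
  show "emap c ` Dom A (esrc c) \<noteq> {}" using dom(4)[OF emb(1)[OF assms(3)]] by simp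
  show "emap c ` Dom A (esrc c) \<subseteq> Dom A (esrc l)" using emb(4)[OF assms(3)] assms(4) by auto
  fix x assume "x \<in> emap c ` Dom A (esrc c)"
  then obtain z where "z \<in> Dom A (esrc c)" "x = emap c z" by blast
  then show "emap l x = emap m x" using arg_cong[OF assms(6), of "\<lambda>e. emap e z"] by simp
qed (use assms in simp)

lemma emb_cancel_left:
  assumes "l \<in> embs A" "c \<in> embs A" "d \<in> embs A" "etgt c = esrc l" "etgt d = esrc l" "l \<cdot> c = l \<cdot> d"
  shows "c = d"
proof (rule eqI[OF assms(2,3)])
  show s: "esrc c = esrc d" using arg_cong[OF assms(6), of esrc] by simp
  show "etgt c = etgt d" using assms by simp
  fix x assume x: "x \<in> Dom A (esrc c)"
  then have "emap l (emap c x) = emap l (emap d x)" using arg_cong[OF assms(6), of "\<lambda>e. emap e x"] s by simp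
  then show "emap c x = emap d x"
    using emb(8)[OF assms(1)] emb(4)[OF assms(2)] emb(4)[OF assms(3)] assms(4,5) x s by (auto dest: inj_onD)
qed

lemma emb_equation_closed:
  assumes "l \<in> embs A" "m \<in> embs A" "esrc l = k" "esrc m = k"
  shows "closedin (top_of_set (Dom A k)) {x \<in> Dom A k. emap l x = emap m x}"
proof -
  have "continuous_on (Dom A k) (\<lambda>x. emap l x - emap m x)"
    using emb_continuous[OF assms(1)] emb_continuous[OF assms(2)] assms by (auto intro: continuous_on_diff)
  from continuous_closedin_preimage_constant[OF this, of 0] show ?thesis by simp
qed

text \<open>For each \<open>x\<close> the points \<open>l x\<close> and \<open>m x\<close> lie in one orbit, so the closed sets \<open>{m = g \<circ> l}\<close>, with \<open>g\<close>
  in the finite group, cover the domain. On one of them \<open>m\<close> and \<open>g \<circ> l\<close> agree near some point, hence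
  everywhere.\<close>

lemma embeddings_differ_by_group:
  assumes l: "l \<in> embs A" and m: "m \<in> embs A" and eq: "esrc l = esrc m" "etgt l = etgt m"
  obtains g where "g \<in> grp (etgt l)" "m = gemb (etgt l) g \<cdot> l"
proof -
  let ?i = "etgt l" and ?k = "esrc l"
  have i: "?i \<in> idx A" and k: "?k \<in> idx A" using emb(1,2)[OF l] by auto
  let ?C = "\<lambda>g. {x \<in> Dom A ?k. emap m x = emap (gemb ?i g \<cdot> l) x}"
  have cl: "closedin (top_of_set (Dom A ?k)) (?C g)" if "g \<in> grp ?i" for g
    by (rule emb_equation_closed) (use l m eq i that in auto)
  have cov: "Dom A ?k \<subseteq> (\<Union>g\<in>grp ?i. ?C g)"
  proof
    fix x assume x: "x \<in> Dom A ?k"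
    have "Proj A ?i (emap l x) = Proj A ?i (emap m x)" "emap l x \<in> Dom A ?i" "emap m x \<in> Dom A ?i"
      using emb(4,5)[OF l] emb(4,5)[OF m] eq x by auto
    then obtain g where "g \<in> grp ?i" "g (emap l x) = emap m x" using same_orbit[OF i] by metis
    then show "x \<in> (\<Union>g\<in>grp ?i. ?C g)" using x by (intro UN_I[of g]) auto
  qed
  obtain g V where g: "g \<in> grp ?i" "openin (top_of_set (Dom A ?k)) V" "V \<noteq> {}" "V \<subseteq> ?C g"
    by (rule finite_closed_cover_interior[OF finite_grp[OF i] openin_subtopology_self _ cl cov])
      (use dom(4)[OF k] in auto)
  have V: "Cn_open (cdim A) V" using g(2) dom(1)[OF k] openin_trans by blast
  have "m = gemb ?i g \<cdot> l"
    by (rule embeddings_eq_if_agree_on_open[OF m _ _ _ V g(3)]) (use l m eq i g in auto)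
  then show ?thesis using that g(1) by blast
qed

text \<open>Where \<open>g (l z)\<close> lies in the open image of \<open>l\<close>, it equals \<open>l w\<close> for some \<open>w\<close> in the orbit of \<open>z\<close>. So
  the closed sets \<open>{g \<circ> l = l \<circ> h}\<close> cover a nonempty open set, and the identity theorem applies to one
  of them.\<close>

lemma group_element_lifts:
  assumes l: "l \<in> embs A" and g: "g \<in> grp (etgt l)" and x: "x \<in> Dom A (esrc l)" and y: "y \<in> Dom A (esrc l)"
    and gxy: "g (emap l x) = emap l y"
  obtains h where "h \<in> grp (esrc l)" "gemb (etgt l) g \<cdot> l = l \<cdot> gemb (esrc l) h"
proof -
  let ?i = "etgt l" and ?k = "esrc l"
  have i: "?i \<in> idx A" and k: "?k \<in> idx A" using emb(1,2)[OF l] by auto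
  let ?gl = "gemb ?i g \<cdot> l"
  have gl: "?gl \<in> embs A" using l g i by simp
  let ?N = "{z \<in> Dom A ?k. emap ?gl z \<in> emap l ` Dom A ?k}"
  have N: "Cn_open (cdim A) ?N"
    using emb_preimage_open[OF gl emb(9)[OF l]] by simp
  have "?N \<subseteq> Dom A ?k" by blast
  with N have N': "openin (top_of_set (Dom A ?k)) ?N"
    using dom(2)[OF k] openin_subset_trans by blast
  let ?C = "\<lambda>h. {z \<in> Dom A ?k. emap ?gl z = emap (l \<cdot> gemb ?k h) z}"
  have cl: "closedin (top_of_set (Dom A ?k)) (?C h)" if "h \<in> grp ?k" for h
    by (rule emb_equation_closed) (use l gl k that in auto)
  have cov: "?N \<subseteq> (\<Union>h\<in>grp ?k. ?C h)"
  proof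
    fix z assume "z \<in> ?N"
    then obtain w where z: "z \<in> Dom A ?k" and w: "w \<in> Dom A ?k" "emap ?gl z = emap l w" by blast
    have "Proj A ?k z = Proj A ?i (emap ?gl z)" using emb(5)[OF gl] z by simp
    also have "\<dots> = Proj A ?k w" using w emb(5)[OF l] by simp
    finally obtain h where "h \<in> grp ?k" "h z = w" using same_orbit[OF k z w(1)] by metis
    then show "z \<in> (\<Union>h\<in>grp ?k. ?C h)" using z w by (intro UN_I[of h]) auto
  qed
  have ne: "?N \<noteq> {}" using x y gxy by auto
  obtain h V where h: "h \<in> grp ?k" "openin (top_of_set (Dom A ?k)) V" "V \<noteq> {}" "V \<subseteq> ?C h"
    by (rule finite_closed_cover_interior[OF finite_grp[OF k] N' ne cl cov])
  have V: "Cn_open (cdim A) V" using h(2) dom(1)[OF k] openin_trans by blast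
  have "?gl = l \<cdot> gemb ?k h"
    by (rule embeddings_eq_if_agree_on_open[OF gl _ _ _ V h(3)]) (use l k h in auto)
  then show ?thesis using that h(1) by blast
qed

text \<open>The atlas condition provides embeddings into both systems near the given point of the space; group
  elements of the two targets correct them so that they hit \<open>x\<close> and \<open>y\<close>.\<close>

lemma common_chart:
  assumes i: "i \<in> idx A" and j: "j \<in> idx A" and x: "x \<in> Dom A i" and y: "y \<in> Dom A j"
    and eq: "Proj A i x = Proj A j y"
  obtains a b z where "a \<in> embs A" "b \<in> embs A" "esrc a = esrc b" "etgt a = i" "etgt b = j"
    "z \<in> Dom A (esrc a)" "emap a z = x" "emap b z = y"
proof -
  have "Proj A i x \<in> Supp A i" "Proj A i x \<in> Supp A j" using imageI[OF x, of "Proj A i"] imageI[OF y, of "Proj A j"] eq by simp_all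
  moreover have "\<forall>i\<in>idx A. \<forall>j\<in>idx A. \<forall>x \<in> Supp A i \<inter> Supp A j.
        \<exists>k\<in>idx A. x \<in> Supp A k \<and> Supp A k \<subseteq> Supp A i \<inter> Supp A j \<and>
          (\<exists>l. unif_embedding (cdim A) (usys A k) (usys A i) l) \<and>
          (\<exists>l. unif_embedding (cdim A) (usys A k) (usys A j) l)"
    using atlas unfolding orbifold_atlas_def by (elim conjE)
  ultimately have "\<exists>k\<in>idx A. Proj A i x \<in> Supp A k \<and> Supp A k \<subseteq> Supp A i \<inter> Supp A j \<and>
          (\<exists>l. unif_embedding (cdim A) (usys A k) (usys A i) l) \<and>
          (\<exists>l. unif_embedding (cdim A) (usys A k) (usys A j) l)"
    using i j by simp
  then obtain k a0 b0 where k: "k \<in> idx A" "Proj A i x \<in> Supp A k"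
    and ab: "unif_embedding (cdim A) (usys A k) (usys A i) a0" "unif_embedding (cdim A) (usys A k) (usys A j) b0"
    by (elim bexE exE conjE) (rule that)
  obtain z where z: "z \<in> Dom A k" "Proj A k z = Proj A i x" using k(2) by auto
  have a0: "Emb k a0 i \<in> embs A" and b0: "Emb k b0 j \<in> embs A" using ab k i j by (auto simp: embs_def)
  have "Proj A i (a0 z) = Proj A i x" "a0 z \<in> Dom A i" using emb(4,5)[OF a0, of z] z by auto
  then obtain g where g: "g \<in> grp i" "g (a0 z) = x" using same_orbit[OF i _ x] by metis
  have "Proj A j (b0 z) = Proj A j y" "b0 z \<in> Dom A j" using emb(4,5)[OF b0, of z] z eq by auto
  then obtain h where h: "h \<in> grp j" "h (b0 z) = y" using same_orbit[OF j _ y] by metis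
  show ?thesis
    by (rule that[of "gemb i g \<cdot> Emb k a0 i" "gemb j h \<cdot> Emb k b0 j" z]) (use a0 b0 g h z i j in auto)
qed

text \<open>Take a common chart \<open>c\<close>, \<open>d\<close> for \<open>x\<close> and \<open>y\<close>. The embeddings \<open>a \<circ> c\<close> and \<open>b \<circ> d\<close> differ by a group
  element \<open>g\<close>, which fixes \<open>a x\<close> and therefore lifts to an element \<open>h\<close> of the group of the common chart;
  then \<open>c \<circ> h\<close> and \<open>d\<close> complete the square.\<close>

lemma embeddings_pullback:
  assumes a: "a \<in> embs A" and b: "b \<in> embs A" and t: "etgt a = etgt b"
    and x: "x \<in> Dom A (esrc a)" and y: "y \<in> Dom A (esrc b)" and eq: "emap a x = emap b y"
  obtains c d z where "c \<in> embs A" "d \<in> embs A" "esrc c = esrc d" "etgt c = esrc a" "etgt d = esrc b"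
    "z \<in> Dom A (esrc c)" "emap c z = x" "emap d z = y" "a \<cdot> c = b \<cdot> d"
proof -
  have "Proj A (esrc a) x = Proj A (esrc b) y" using emb(5)[OF a x] emb(5)[OF b y] eq t by simp
  then obtain c d z where c: "c \<in> embs A" "d \<in> embs A" "esrc c = esrc d" "etgt c = esrc a" "etgt d = esrc b"
    "z \<in> Dom A (esrc c)" "emap c z = x" "emap d z = y"
    using common_chart[OF emb(1)[OF a] emb(1)[OF b] x y] by metis
  have ac: "a \<cdot> c \<in> embs A" and bd: "b \<cdot> d \<in> embs A" using a b c by auto
  obtain g where g: "g \<in> grp (etgt (a \<cdot> c))" "b \<cdot> d = gemb (etgt (a \<cdot> c)) g \<cdot> (a \<cdot> c)"
    by (rule embeddings_differ_by_group[OF ac bd]) (use c t in auto)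
  have z: "z \<in> Dom A (esrc (a \<cdot> c))" using c by simp
  have "emap (b \<cdot> d) z = emap b y" using c by simp
  then have "g (emap (a \<cdot> c) z) = emap b y" unfolding g(2) using c by simp
  then have gz: "g (emap (a \<cdot> c) z) = emap (a \<cdot> c) z" using c eq by simp
  obtain h where h: "h \<in> grp (esrc (a \<cdot> c))" "gemb (etgt (a \<cdot> c)) g \<cdot> (a \<cdot> c) = (a \<cdot> c) \<cdot> gemb (esrc (a \<cdot> c)) h"
    by (rule group_element_lifts[OF ac g(1) z z gz])
  have k: "esrc c \<in> idx A" "h \<in> grp (esrc c)" using emb(1)[OF c(1)] h(1) by auto
  let ?c = "c \<cdot> gemb (esrc c) h"
  have c': "?c \<in> embs A" using c k by simp
  have E: "a \<cdot> ?c = b \<cdot> d" using g(2) h(2) c k comp_assoc[of "gemb (esrc c) h" c a] by simp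
  have "emap a (emap ?c z) = emap (a \<cdot> ?c) z" using c(6) by simp
  also have "\<dots> = emap a x" unfolding E using c eq by simp
  finally have "emap ?c z = x"
    using emb(8)[OF a] emb(4)[OF c', of z] c x by (auto dest: inj_onD)
  then show ?thesis using that[of ?c d z] c c' E by simp
qed

end

section \<open>Arrows as equivalence classes\<close>

context orb
begin

definition valid :: "'i emb \<Rightarrow> 'i emb \<Rightarrow> cvec \<Rightarrow> bool" where
  "valid a b x \<longleftrightarrow> a \<in> embs A \<and> b \<in> embs A \<and> esrc a = esrc b \<and> x \<in> Dom A (esrc a)"

text \<open>The arrow \<open>[a, x, b]\<close> from \<open>a x\<close> to \<open>b x\<close>.\<close>

definition cls :: "'i emb \<Rightarrow> 'i emb \<Rightarrow> cvec \<Rightarrow> 'i rpoint set" where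
  "cls a b x = R_class A ((a, b), x)"

lemma validI: "a \<in> embs A \<Longrightarrow> b \<in> embs A \<Longrightarrow> esrc a = esrc b \<Longrightarrow> x \<in> Dom A (esrc a) \<Longrightarrow> valid a b x"
  by (simp add: valid_def)

lemma validD:
  assumes "valid a b x"
  shows "a \<in> embs A" "b \<in> embs A" "esrc b = esrc a" "x \<in> Dom A (esrc a)"
  using assms by (auto simp: valid_def)

lemma Rhat_iff: "((a, b), x) \<in> topspace (Rhat_top A) \<longleftrightarrow> valid a b x"
  by (auto simp: Rhat_top_def emb_pairs_def valid_def)

lemma R_rel_iff:
  "(((a, b), x), ((a', b'), x')) \<in> R_rel A \<longleftrightarrow> valid a b x \<and> valid a' b' x' \<and>
     (\<exists>k l z. k \<in> embs A \<and> l \<in> embs A \<and> esrc k = esrc l \<and> etgt k = esrc a \<and> etgt l = esrc a' \<and> z \<in> Dom A (esrc k) \<and>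
        a \<cdot> k = a' \<cdot> l \<and> b \<cdot> k = b' \<cdot> l \<and> emap k z = x \<and> emap l z = x')"
  unfolding R_rel_def by (auto simp: Rhat_iff)

lemma R_relE:
  assumes "(((a, b), x), ((a', b'), x')) \<in> R_rel A"
  obtains k l z where "valid a b x" "valid a' b' x'" "k \<in> embs A" "l \<in> embs A" "esrc k = esrc l"
    "etgt k = esrc a" "etgt l = esrc a'" "z \<in> Dom A (esrc k)"
    "a \<cdot> k = a' \<cdot> l" "b \<cdot> k = b' \<cdot> l" "emap k z = x" "emap l z = x'"
  using assms unfolding R_rel_iff by (elim conjE exE) (rule that)

lemma R_relI:
  assumes "valid a b x" "valid a' b' x'" "k \<in> embs A" "l \<in> embs A" "esrc k = esrc l"
    "etgt k = esrc a" "etgt l = esrc a'" "z \<in> Dom A (esrc k)"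
    "a \<cdot> k = a' \<cdot> l" "b \<cdot> k = b' \<cdot> l" "emap k z = x" "emap l z = x'"
  shows "(((a, b), x), ((a', b'), x')) \<in> R_rel A"
  unfolding R_rel_iff using assms by (intro conjI exI[of _ k] exI[of _ l] exI[of _ z])

text \<open>The two auxiliary embeddings into the middle system are completed to a commutative square.\<close>

lemma R_rel_trans:
  assumes 1: "(((a, b), x), ((a', b'), x')) \<in> R_rel A" and 2: "(((a', b'), x'), ((a'', b''), x'')) \<in> R_rel A"
  shows "(((a, b), x), ((a'', b''), x'')) \<in> R_rel A"
proof -
  obtain k l z where k: "valid a b x" "valid a' b' x'" "k \<in> embs A" "l \<in> embs A" "esrc k = esrc l"
    "etgt k = esrc a" "etgt l = esrc a'" "z \<in> Dom A (esrc k)"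
    "a \<cdot> k = a' \<cdot> l" "b \<cdot> k = b' \<cdot> l" "emap k z = x" "emap l z = x'" by (rule R_relE[OF 1])
  obtain m n w where m: "valid a' b' x'" "valid a'' b'' x''" "m \<in> embs A" "n \<in> embs A" "esrc m = esrc n"
    "etgt m = esrc a'" "etgt n = esrc a''" "w \<in> Dom A (esrc m)"
    "a' \<cdot> m = a'' \<cdot> n" "b' \<cdot> m = b'' \<cdot> n" "emap m w = x'" "emap n w = x''" by (rule R_relE[OF 2])
  note v = validD[OF k(1)] validD[OF k(2)] validD[OF m(2)]
  have zl: "z \<in> Dom A (esrc l)" using k(5,8) by simp
  obtain c d v where c: "c \<in> embs A" "d \<in> embs A" "esrc c = esrc d" "etgt c = esrc l" "etgt d = esrc m"
    "v \<in> Dom A (esrc c)" "emap c v = z" "emap d v = w" "l \<cdot> c = m \<cdot> d"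
    by (rule embeddings_pullback[OF k(4) m(3) _ zl m(8)]) (use k m in auto)
  have A: "p \<cdot> (k \<cdot> c) = q \<cdot> (n \<cdot> d)" if "p \<cdot> k = p' \<cdot> l" "p' \<cdot> m = q \<cdot> n" "esrc p = esrc a" "esrc p' = esrc a'" "esrc q = esrc a''" for p p' q
  proof -
    have "p \<cdot> (k \<cdot> c) = (p \<cdot> k) \<cdot> c" by (rule comp_assoc[symmetric]) (use c k in auto)
    also have "\<dots> = p' \<cdot> (l \<cdot> c)" unfolding that(1) by (rule comp_assoc) (use c in auto)
    also have "\<dots> = (p' \<cdot> m) \<cdot> d" unfolding c(9) by (rule comp_assoc[symmetric]) (use c in auto)
    also have "\<dots> = q \<cdot> (n \<cdot> d)" unfolding that(2) by (rule comp_assoc) (use c m in auto)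
    finally show ?thesis .
  qed
  show ?thesis
    by (rule R_relI[OF k(1) m(2), of "k \<cdot> c" "n \<cdot> d" v])
      (use k m c v A[OF k(9) m(9)] A[OF k(10) m(10)] in auto)
qed

lemma R_rel_refl: "valid a b x \<Longrightarrow> (((a, b), x), ((a, b), x)) \<in> R_rel A"
  using emb(1)[of a]
  by (intro R_relI[of a b x a b x "emb_id A (esrc a)" "emb_id A (esrc a)" x]) (auto simp: valid_def)

lemma R_rel_sym: "(p, q) \<in> R_rel A \<Longrightarrow> (q, p) \<in> R_rel A"
proof -
  assume pq: "(p, q) \<in> R_rel A"
  obtain a b x a' b' x' where [simp]: "p = ((a, b), x)" "q = ((a', b'), x')" by (metis surj_pair)
  obtain k l z where k: "valid a b x" "valid a' b' x'" "k \<in> embs A" "l \<in> embs A" "esrc k = esrc l"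
    "etgt k = esrc a" "etgt l = esrc a'" "z \<in> Dom A (esrc k)"
    "a \<cdot> k = a' \<cdot> l" "b \<cdot> k = b' \<cdot> l" "emap k z = x" "emap l z = x'"
    using pq by (auto elim: R_relE)
  have "(((a', b'), x'), ((a, b), x)) \<in> R_rel A"
    by (rule R_relI[OF k(2,1,4,3), of z]) (use k in simp_all)
  then show ?thesis by simp
qed

lemma mem_cls: "((a', b'), x') \<in> cls a b x \<longleftrightarrow> (((a, b), x), ((a', b'), x')) \<in> R_rel A"
  by (simp add: cls_def R_class_def)

lemma cls_self: "valid a b x \<Longrightarrow> ((a, b), x) \<in> cls a b x"
  by (simp add: mem_cls R_rel_refl)

lemma cls_eq_iff:
  assumes "valid a b x"
  shows "cls a b x = cls a' b' x' \<longleftrightarrow> (((a, b), x), ((a', b'), x')) \<in> R_rel A"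
proof
  assume "cls a b x = cls a' b' x'"
  then show "(((a, b), x), ((a', b'), x')) \<in> R_rel A"
    using cls_self[OF assms] by (simp add: mem_cls R_rel_sym)
next
  assume *: "(((a, b), x), ((a', b'), x')) \<in> R_rel A"
  show "cls a b x = cls a' b' x'"
  proof (rule Set.set_eqI)
    fix p :: "'i rpoint"
    obtain a'' b'' x'' where [simp]: "p = ((a'', b''), x'')" by (metis surj_pair)
    show "p \<in> cls a b x \<longleftrightarrow> p \<in> cls a' b' x'"
      using R_rel_trans[OF *] R_rel_trans[OF R_rel_sym[OF *]] by (auto simp: mem_cls)
  qed
qed

lemma cls_eqE:
  assumes "cls a b x = cls a' b' x'" "valid a b x"
  obtains k l z where "k \<in> embs A" "l \<in> embs A" "esrc k = esrc l"
    "etgt k = esrc a" "etgt l = esrc a'" "z \<in> Dom A (esrc k)"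
    "a \<cdot> k = a' \<cdot> l" "b \<cdot> k = b' \<cdot> l" "emap k z = x" "emap l z = x'"
  using assms(1) unfolding cls_eq_iff[OF assms(2)] by (rule R_relE) (rule that)

lemma valid_pull:
  assumes "valid a b x" "k \<in> embs A" "etgt k = esrc a" "z \<in> Dom A (esrc k)"
  shows "valid (a \<cdot> k) (b \<cdot> k) z"
  using assms by (auto simp: valid_def)

text \<open>Arrows may be restricted along an embedding. Conversely, equal arrows have a common restriction, by
  \<open>cls_eqE\<close>.\<close>

lemma cls_pull:
  assumes v: "valid a b x" and k: "k \<in> embs A" "etgt k = esrc a" "z \<in> Dom A (esrc k)" "emap k z = x"
  shows "cls a b x = cls (a \<cdot> k) (b \<cdot> k) z"
  unfolding cls_eq_iff[OF v]
  by (rule R_relI[OF v valid_pull[OF v k(1-3)] k(1), of "emb_id A (esrc k)" z])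
    (use v k emb(1)[OF k(1)] in \<open>auto simp: valid_def\<close>)

lemma quotient_R: "quotient_map (Rhat_top A) (mtop (R_mfd A)) (R_class A)"
  by (simp add: R_mfd_def quotient_map_quotient_topology)

lemma pts_R: "c \<in> pts (R_mfd A) \<longleftrightarrow> (\<exists>a b x. valid a b x \<and> c = cls a b x)"
proof -
  have "pts (R_mfd A) = R_class A ` topspace (Rhat_top A)"
    using quotient_imp_surjective_map[OF quotient_R] by simp
  then show ?thesis by (force simp: cls_def Rhat_iff)
qed

lemma pts_RE:
  assumes "c \<in> pts (R_mfd A)"
  obtains a b x where "valid a b x" "c = cls a b x"
  using assms unfolding pts_R by blast

lemma cls_in [simp]: "valid a b x \<Longrightarrow> cls a b x \<in> pts (R_mfd A)"
  unfolding pts_R by blast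

text \<open>Invariance under restriction is enough, as equivalent representatives have a common restriction.\<close>

lemma on_classes_cls:
  assumes h: "\<And>a b k z. \<lbrakk>a \<in> embs A; b \<in> embs A; esrc a = esrc b; k \<in> embs A; etgt k = esrc a; z \<in> Dom A (esrc k)\<rbrakk> \<Longrightarrow>
      h ((a \<cdot> k, b \<cdot> k), z) = h ((a, b), emap k z)"
    and v: "valid a b x"
  shows "on_classes A h (cls a b x) = h ((a, b), x)"
proof -
  have "h p = h ((a, b), x)" if "p \<in> cls a b x" for p
  proof -
    obtain a' b' x' where p: "p = ((a', b'), x')" by (metis surj_pair)
    obtain k l z where k: "valid a b x" "valid a' b' x'" "k \<in> embs A" "l \<in> embs A" "esrc k = esrc l"
      "etgt k = esrc a" "etgt l = esrc a'" "z \<in> Dom A (esrc k)"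
      "a \<cdot> k = a' \<cdot> l" "b \<cdot> k = b' \<cdot> l" "emap k z = x" "emap l z = x'"
      using \<open>p \<in> cls a b x\<close> unfolding p mem_cls by (rule R_relE)
    have "h ((a \<cdot> k, b \<cdot> k), z) = h ((a, b), x)" using h[of a b k z] k by (simp add: valid_def)
    moreover have "h ((a' \<cdot> l, b' \<cdot> l), z) = h ((a', b'), x')" using h[of a' b' l z] k by (simp add: valid_def)
    ultimately show ?thesis using k p by simp
  qed
  then have "h ` cls a b x = {h ((a, b), x)}" using cls_self[OF v] by blast
  then show ?thesis using v by (simp add: on_classes_def)
qed

lemma R_s_cls [simp]: "valid a b x \<Longrightarrow> R_s A (cls a b x) = (etgt a, emap a x)"
  unfolding R_s_def by (subst on_classes_cls) auto

lemma R_t_cls [simp]: "valid a b x \<Longrightarrow> R_t A (cls a b x) = (etgt b, emap b x)"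
  unfolding R_t_def by (subst on_classes_cls) auto

lemma valid_swap: "valid a b x \<Longrightarrow> valid b a x"
  by (auto simp: valid_def)

lemma R_i_cls [simp]:
  assumes v: "valid a b x"
  shows "R_i A (cls a b x) = cls b a x"
proof -
  let ?h = "\<lambda>((a, b), x). R_class A ((b, a), x)"
  have "on_classes A ?h (cls a b x) = ?h ((a, b), x)"
  proof (rule on_classes_cls[OF _ v])
    fix a b k z assume k: "a \<in> embs A" "b \<in> embs A" "esrc a = esrc b" "k \<in> embs A" "etgt k = esrc a" "z \<in> Dom A (esrc k)"
    have "cls b a (emap k z) = cls (b \<cdot> k) (a \<cdot> k) z"
      by (rule cls_pull) (use k emb(4)[OF k(4,6)] in \<open>auto simp: valid_def\<close>)
    then show "?h ((a \<cdot> k, b \<cdot> k), z) = ?h ((a, b), emap k z)" by (simp add: cls_def)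
  qed
  then show ?thesis by (simp add: R_i_def cls_def)
qed

lemma pts_U: "(i, x) \<in> pts (U_mfd A) \<longleftrightarrow> i \<in> idx A \<and> x \<in> Dom A i"
  by (simp add: U_mfd_def)

lemma R_e_cls [simp]: "i \<in> idx A \<Longrightarrow> x \<in> Dom A i \<Longrightarrow> R_e A (i, x) = cls (emb_id A i) (emb_id A i) x"
  by (simp add: R_e_def pts_U cls_def)

lemma valid_id [simp]: "i \<in> idx A \<Longrightarrow> x \<in> Dom A i \<Longrightarrow> valid (emb_id A i) (emb_id A i) x"
  by (simp add: valid_def)

text \<open>A commutative square over the common point \<open>b x = a' x'\<close> restricts both arrows to one source, where
  they share the middle embedding \<open>q\<close>.\<close>

lemma composable_normal_form:
  assumes "c \<in> pts (R_mfd A)" "d \<in> pts (R_mfd A)" "R_t A c = R_s A d"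
  obtains p q r z where "valid p q z" "valid q r z" "c = cls p q z" "d = cls q r z"
proof -
  obtain a b x where c: "valid a b x" "c = cls a b x" by (rule pts_RE[OF assms(1)])
  obtain a' b' x' where d: "valid a' b' x'" "d = cls a' b' x'" by (rule pts_RE[OF assms(2)])
  note v = validD[OF c(1)] validD[OF d(1)]
  have eq: "etgt b = etgt a'" "emap b x = emap a' x'" using assms(3) c d by auto
  have x: "x \<in> Dom A (esrc b)" using v by simp
  obtain k l z where k: "k \<in> embs A" "l \<in> embs A" "esrc k = esrc l" "etgt k = esrc b" "etgt l = esrc a'"
    "z \<in> Dom A (esrc k)" "emap k z = x" "emap l z = x'" "b \<cdot> k = a' \<cdot> l"
    by (rule embeddings_pullback[OF v(2) v(5) eq(1) x v(8) eq(2)])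
  show ?thesis
  proof (rule that[of "a \<cdot> k" "b \<cdot> k" z "b' \<cdot> l"])
    show "valid (a \<cdot> k) (b \<cdot> k) z" by (rule valid_pull[OF c(1)]) (use k v in auto)
    show "c = cls (a \<cdot> k) (b \<cdot> k) z" unfolding c(2) by (rule cls_pull[OF c(1)]) (use k v in auto)
    show "valid (b \<cdot> k) (b' \<cdot> l) z" unfolding k(9) by (rule valid_pull[OF d(1)]) (use k v in auto)
    show "d = cls (b \<cdot> k) (b' \<cdot> l) z" unfolding k(9) d(2) by (rule cls_pull[OF d(1)]) (use k v in auto)
  qed
qed

text \<open>Each of the two equations supplies a common restriction. The two are compatible on the middle
  embedding, which is a monomorphism, so after a further restriction they coincide.\<close>

lemma common_refinement:
  assumes eq: "cls p q z = cls p' q' z'" "cls q r z = cls q' r' z'"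
    and v: "valid p q z" "valid q r z" "valid p' q' z'" "valid q' r' z'"
  obtains k l w where "k \<in> embs A" "l \<in> embs A" "esrc k = esrc l" "etgt k = esrc p" "etgt l = esrc p'" "w \<in> Dom A (esrc k)"
    "p \<cdot> k = p' \<cdot> l" "q \<cdot> k = q' \<cdot> l" "r \<cdot> k = r' \<cdot> l" "emap k w = z" "emap l w = z'"
proof -
  note V = validD[OF v(1)] validD[OF v(2)] validD[OF v(3)] validD[OF v(4)]
  obtain e e' w where e: "e \<in> embs A" "e' \<in> embs A" "esrc e = esrc e'" "etgt e = esrc p" "etgt e' = esrc p'"
    "w \<in> Dom A (esrc e)" "p \<cdot> e = p' \<cdot> e'" "q \<cdot> e = q' \<cdot> e'" "emap e w = z" "emap e' w = z'"
    by (rule cls_eqE[OF eq(1) v(1)])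
  obtain u u' y where u: "u \<in> embs A" "u' \<in> embs A" "esrc u = esrc u'" "etgt u = esrc q" "etgt u' = esrc q'"
    "y \<in> Dom A (esrc u)" "q \<cdot> u = q' \<cdot> u'" "r \<cdot> u = r' \<cdot> u'" "emap u y = z" "emap u' y = z'"
    by (rule cls_eqE[OF eq(2) v(2)])
  obtain c d x where c: "c \<in> embs A" "d \<in> embs A" "esrc c = esrc d" "etgt c = esrc e" "etgt d = esrc u"
    "x \<in> Dom A (esrc c)" "emap c x = w" "emap d x = y" "e \<cdot> c = u \<cdot> d"
    by (rule embeddings_pullback[OF e(1) u(1) _ e(6) u(6)]) (use e u V in auto)
  have push: "a \<cdot> (f \<cdot> g) = a' \<cdot> (f' \<cdot> g)"
    if "a \<cdot> f = a' \<cdot> f'" "g \<in> embs A" "f \<in> embs A" "f' \<in> embs A" "etgt g = esrc f" "etgt g = esrc f'" "etgt f = esrc a" "etgt f' = esrc a'" for a a' f f' g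
    using that by (metis comp_assoc)
  have "q' \<cdot> (e' \<cdot> c) = q \<cdot> (e \<cdot> c)" by (rule push[OF e(8)[symmetric]]) (use c e V in auto)
  also have "\<dots> = q \<cdot> (u \<cdot> d)" using c by simp
  also have "\<dots> = q' \<cdot> (u' \<cdot> d)" by (rule push[OF u(7)]) (use c u V in auto)
  finally have "e' \<cdot> c = u' \<cdot> d"
    by (rule emb_cancel_left[rotated 5]) (use c e u V in auto)
  then show ?thesis
    using that[of "e \<cdot> c" "e' \<cdot> c" x] c e u V push[OF e(7), of c] push[OF e(8), of c] push[OF u(8), of d] by simp
qed

lemma pts_composable: "(c, d) \<in> pts (fiber_product (R_mfd A) (R_mfd A) (R_t A) (R_s A)) \<longleftrightarrow>
    c \<in> pts (R_mfd A) \<and> d \<in> pts (R_mfd A) \<and> R_t A c = R_s A d"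
  by (simp add: fiber_product_simps)

text \<open>Every choice of representatives and of auxiliary embeddings is a normal form of the same pair of
  arrows, and any two normal forms have a common refinement.\<close>

lemma R_m_cls [simp]:
  assumes v: "valid p q z" "valid q r z"
  shows "R_m A (cls p q z, cls q r z) = cls p r z"
proof -
  note V = validD[OF v(1)] validD[OF v(2)]
  have "P = cls p r z" if PR: "P \<in> R_products A (cls p q z) (cls q r z)" for P
  proof -
    obtain a b x a' b' x' k l w where P: "P = R_class A ((a \<cdot> k, b' \<cdot> l), w)"
      and m: "((a, b), x) \<in> cls p q z" "((a', b'), x') \<in> cls q r z"
      and k: "k \<in> embs A" "l \<in> embs A" "esrc k = esrc l" "etgt k = esrc b" "etgt l = esrc a'" "w \<in> Dom A (esrc k)"
        "b \<cdot> k = a' \<cdot> l" "emap k w = x" "emap l w = x'"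
      using PR unfolding R_products_def by blast
    have va: "valid a b x" "valid a' b' x'" using m unfolding mem_cls R_rel_iff by blast+
    note W = validD[OF va(1)] validD[OF va(2)]
    have "cls p q z = cls a b x" using m(1) unfolding mem_cls cls_eq_iff[OF v(1)] .
    also have "\<dots> = cls (a \<cdot> k) (b \<cdot> k) w" by (rule cls_pull[OF va(1)]) (use k W in auto)
    finally have e1: "cls p q z = cls (a \<cdot> k) (b \<cdot> k) w" .
    have "cls q r z = cls a' b' x'" using m(2) unfolding mem_cls cls_eq_iff[OF v(2)] .
    also have "\<dots> = cls (a' \<cdot> l) (b' \<cdot> l) w" by (rule cls_pull[OF va(2)]) (use k W in auto)
    finally have e2: "cls q r z = cls (b \<cdot> k) (b' \<cdot> l) w" using k by simp
    have v1: "valid (a \<cdot> k) (b \<cdot> k) w" by (rule valid_pull[OF va(1)]) (use k W in auto)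
    have v2: "valid (b \<cdot> k) (b' \<cdot> l) w" unfolding k(7) by (rule valid_pull[OF va(2)]) (use k W in auto)
    obtain e f y where e: "e \<in> embs A" "f \<in> embs A" "esrc e = esrc f" "etgt e = esrc p" "etgt f = esrc (a \<cdot> k)" "y \<in> Dom A (esrc e)"
      "p \<cdot> e = a \<cdot> k \<cdot> f" "q \<cdot> e = b \<cdot> k \<cdot> f" "r \<cdot> e = b' \<cdot> l \<cdot> f" "emap e y = z" "emap f y = w"
      by (rule common_refinement[OF e1 e2 v v1 v2])
    have "cls p r z = cls (p \<cdot> e) (r \<cdot> e) y" by (rule cls_pull) (use e V in \<open>auto simp: valid_def\<close>)
    also have "\<dots> = cls (a \<cdot> k) (b' \<cdot> l) w" unfolding e(7,9)
      by (rule cls_pull[symmetric]) (use e v1 v2 in \<open>auto simp: valid_def\<close>)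
    finally show ?thesis unfolding P cls_def by simp
  qed
  moreover have "cls p r z \<in> R_products A (cls p q z) (cls q r z)"
    unfolding R_products_def
  proof (intro CollectI exI conjI)
    let ?I = "emb_id A (esrc p)"
    have I: "?I \<in> embs A" using emb(1)[OF V(1)] by simp
    show "cls p r z = R_class A ((p \<cdot> ?I, r \<cdot> ?I), z)" using V by (simp add: cls_def)
    show "((p, q), z) \<in> cls p q z" "((q, r), z) \<in> cls q r z" using v cls_self by auto
    show "?I \<in> embs A" "?I \<in> embs A" by (fact I)+
  qed (use V in simp_all)
  ultimately have "R_products A (cls p q z) (cls q r z) = {cls p r z}" by blast
  moreover have "(cls p q z, cls q r z) \<in> pts (fiber_product (R_mfd A) (R_mfd A) (R_t A) (R_s A))"
    unfolding pts_composable using v by simp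
  ultimately show ?thesis by (simp add: R_m_def)
qed

lemma triple_normal_form:
  assumes "c \<in> pts (R_mfd A)" "d \<in> pts (R_mfd A)" "e \<in> pts (R_mfd A)" "R_t A c = R_s A d" "R_t A d = R_s A e"
  obtains p q r u z where "valid p q z" "valid q r z" "valid r u z" "c = cls p q z" "d = cls q r z" "e = cls r u z"
proof -
  obtain p q r z where 1: "valid p q z" "valid q r z" "c = cls p q z" "d = cls q r z"
    by (rule composable_normal_form[OF assms(1,2,4)])
  obtain q' r' u' z' where 2: "valid q' r' z'" "valid r' u' z'" "d = cls q' r' z'" "e = cls r' u' z'"
    by (rule composable_normal_form[OF assms(2,3,5)])
  note V = validD[OF 1(1)] validD[OF 1(2)] validD[OF 2(1)] validD[OF 2(2)]
  have eq: "cls q r z = cls q' r' z'" using 1 2 by simp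
  obtain k l w where k: "k \<in> embs A" "l \<in> embs A" "esrc k = esrc l" "etgt k = esrc q" "etgt l = esrc q'" "w \<in> Dom A (esrc k)"
    "q \<cdot> k = q' \<cdot> l" "r \<cdot> k = r' \<cdot> l" "emap k w = z" "emap l w = z'"
    by (rule cls_eqE[OF eq 1(2)])
  show ?thesis
  proof (rule that)
    show "valid (p \<cdot> k) (q \<cdot> k) w" by (rule valid_pull[OF 1(1)]) (use k V in auto)
    show "c = cls (p \<cdot> k) (q \<cdot> k) w" unfolding 1(3) by (rule cls_pull[OF 1(1)]) (use k V in auto)
    show "valid (q \<cdot> k) (r \<cdot> k) w" by (rule valid_pull[OF 1(2)]) (use k V in auto)
    show "d = cls (q \<cdot> k) (r \<cdot> k) w" unfolding 1(4) by (rule cls_pull[OF 1(2)]) (use k V in auto)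
    show "valid (r \<cdot> k) (u' \<cdot> l) w" unfolding k(8) by (rule valid_pull[OF 2(2)]) (use k V in auto)
    show "e = cls (r \<cdot> k) (u' \<cdot> l) w" unfolding k(8) 2(4) by (rule cls_pull[OF 2(2)]) (use k V in auto)
  qed
qed

section \<open>The topology and the complex structure of the space of arrows\<close>

lemma Rhat_open_iff:
  "openin (Rhat_top A) V \<longleftrightarrow> V \<subseteq> topspace (Rhat_top A) \<and>
     (\<forall>a b. a \<in> embs A \<and> b \<in> embs A \<and> esrc a = esrc b \<longrightarrow> Cn_open (cdim A) {x \<in> Dom A (esrc a). ((a, b), x) \<in> V})"
  (is "_ \<longleftrightarrow> ?V \<and> ?R")
proof -
  have *: "openin (top_of_set (Dom A (esrc a))) {x. ((a, b), x) \<in> V} \<longleftrightarrow> Cn_open (cdim A) {x \<in> Dom A (esrc a). ((a, b), x) \<in> V}"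
    if V: ?V and ab: "a \<in> embs A" "b \<in> embs A" "esrc a = esrc b" for a b
  proof -
    have eq: "{x. ((a, b), x) \<in> V} = {x \<in> Dom A (esrc a). ((a, b), x) \<in> V}"
      using V ab by (auto simp: Rhat_iff valid_def subset_eq)
    show ?thesis unfolding eq
      using dom(1)[OF emb(1)[OF ab(1)]] by (metis (no_types, lifting) openin_trans dom(2)[OF emb(1)[OF ab(1)]] openin_subset_trans mem_Collect_eq subsetI)
  qed
  show ?thesis
  proof (cases ?V)
    case True
    have "openin (Rhat_top A) V \<longleftrightarrow>
        (\<forall>p\<in>emb_pairs A. openin ((\<lambda>(a, b). top_of_set (Dom A (esrc a))) p) {x. (p, x) \<in> V})"
      using True by (simp add: Rhat_top_def openin_sum_topology)
    also have "\<dots> \<longleftrightarrow> (\<forall>a b. a \<in> embs A \<and> b \<in> embs A \<and> esrc a = esrc b \<longrightarrow>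
        openin (top_of_set (Dom A (esrc a))) {x. ((a, b), x) \<in> V})"
      by (auto simp: emb_pairs_def)
    also have "\<dots> \<longleftrightarrow> ?R" using *[OF True] by blast
    finally show ?thesis using True by simp
  qed (use openin_subset in blast)
qed

lemma R_open_iff:
  "openin (mtop (R_mfd A)) V \<longleftrightarrow> V \<subseteq> pts (R_mfd A) \<and>
     (\<forall>a b. a \<in> embs A \<and> b \<in> embs A \<and> esrc a = esrc b \<longrightarrow> Cn_open (cdim A) {x \<in> Dom A (esrc a). cls a b x \<in> V})"
proof (cases "V \<subseteq> pts (R_mfd A)")
  case True
  have "openin (mtop (R_mfd A)) V \<longleftrightarrow> openin (Rhat_top A) {p \<in> topspace (Rhat_top A). R_class A p \<in> V}"
    using quotient_R True unfolding quotient_map_def by simp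
  also have "\<dots> \<longleftrightarrow> (\<forall>a b. a \<in> embs A \<and> b \<in> embs A \<and> esrc a = esrc b \<longrightarrow>
      Cn_open (cdim A) {x \<in> Dom A (esrc a). cls a b x \<in> V})"
  proof -
    have "{x \<in> Dom A (esrc a). ((a, b), x) \<in> {p \<in> topspace (Rhat_top A). R_class A p \<in> V}} = {x \<in> Dom A (esrc a). cls a b x \<in> V}"
      if "a \<in> embs A" "b \<in> embs A" "esrc a = esrc b" for a b
      using that by (auto simp: Rhat_iff valid_def cls_def)
    then show ?thesis unfolding Rhat_open_iff by auto
  qed
  finally show ?thesis using True by simp
qed (use openin_subset in blast)

text \<open>The image in \<open>R\<close> of a part \<open>V\<close> of the copy of the domain that belongs to the pair \<open>(a, b)\<close>.\<close>

definition sheet :: "'i emb \<Rightarrow> 'i emb \<Rightarrow> cvec set \<Rightarrow> 'i rpoint set set" where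
  "sheet a b V = cls a b ` V"

text \<open>If \<open>[a', x', b'] = [a, x, b]\<close> with common restriction along \<open>k\<close> and \<open>l\<close>, the points \<open>k w\<close> with \<open>l w \<in> V\<close>
  form a neighbourhood of \<open>x'\<close>, because \<open>k\<close> is an open map, and each of them represents an arrow of the
  sheet.\<close>

lemma sheet_open:
  assumes ab: "a \<in> embs A" "b \<in> embs A" "esrc a = esrc b"
    and V: "Cn_open (cdim A) V" "V \<subseteq> Dom A (esrc a)"
  shows "openin (mtop (R_mfd A)) (sheet a b V)"
  unfolding R_open_iff
proof (intro conjI allI impI)
  show "sheet a b V \<subseteq> pts (R_mfd A)" using ab V(2) by (auto simp: sheet_def intro!: cls_in validI)
  fix a' b' assume ab': "a' \<in> embs A \<and> b' \<in> embs A \<and> esrc a' = esrc b'"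
  show "Cn_open (cdim A) {x \<in> Dom A (esrc a'). cls a' b' x \<in> sheet a b V}"
  proof (subst openin_subopen, intro ballI)
    fix x' assume "x' \<in> {x \<in> Dom A (esrc a'). cls a' b' x \<in> sheet a b V}"
    then obtain x where x: "x \<in> V" "x' \<in> Dom A (esrc a')" "cls a' b' x' = cls a b x" by (auto simp: sheet_def)
    have v': "valid a' b' x'" using ab' x by (simp add: valid_def)
    obtain k l z where k: "k \<in> embs A" "l \<in> embs A" "esrc k = esrc l"
      "etgt k = esrc a'" "etgt l = esrc a" "z \<in> Dom A (esrc k)"
      "a' \<cdot> k = a \<cdot> l" "b' \<cdot> k = b \<cdot> l" "emap k z = x'" "emap l z = x" by (rule cls_eqE[OF x(3) v'])
    let ?T = "{w \<in> Dom A (esrc l). emap l w \<in> V}"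
    have "Cn_open (cdim A) (emap k ` ?T)"
      by (rule emb_image_open[OF k(1) emb_preimage_open[OF k(2) V(1)]]) (use k in auto)
    moreover have "x' \<in> emap k ` ?T" using k x by auto
    moreover have "emap k ` ?T \<subseteq> {x \<in> Dom A (esrc a'). cls a' b' x \<in> sheet a b V}"
    proof clarify
      fix w assume w: "w \<in> Dom A (esrc l)" "emap l w \<in> V"
      have kw: "emap k w \<in> Dom A (esrc a')" using emb(4)[OF k(1)] k w by auto
      have "cls a' b' (emap k w) = cls (a' \<cdot> k) (b' \<cdot> k) w"
        by (rule cls_pull) (use ab' k kw w in \<open>auto simp: valid_def\<close>)
      also have "\<dots> = cls a b (emap l w)" unfolding k(7,8)
        by (rule cls_pull[symmetric]) (use ab k w V in \<open>auto simp: valid_def\<close>)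
      finally show "emap k w \<in> Dom A (esrc a') \<and> cls a' b' (emap k w) \<in> sheet a b V"
        using kw w by (simp add: sheet_def)
    qed
    ultimately show "\<exists>T. Cn_open (cdim A) T \<and> x' \<in> T \<and> T \<subseteq> {x \<in> Dom A (esrc a'). cls a' b' x \<in> sheet a b V}"
      by blast
  qed
qed

lemma cls_inj:
  assumes "cls a b x = cls a b x'" "valid a b x" "valid a b x'"
  shows "x = x'"
proof -
  have "emap a x = emap a x'" using assms by (metis R_s_cls snd_conv)
  then show ?thesis using emb(8)[of a] assms(2,3) by (auto simp: valid_def dest: inj_onD)
qed

text \<open>The chart of the sheet of \<open>(a, b)\<close>.\<close>

definition coord :: "'i emb \<Rightarrow> 'i emb \<Rightarrow> 'i rpoint set \<Rightarrow> cvec" where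
  "coord a b c = the_elem {x. ((a, b), x) \<in> c}"

lemma coord_cls [simp]:
  assumes v: "valid a b x"
  shows "coord a b (cls a b x) = x"
proof -
  have "{x'. ((a, b), x') \<in> cls a b x} = {x}"
  proof (intro equalityI subsetI)
    fix x' assume "x' \<in> {x'. ((a, b), x') \<in> cls a b x}"
    then have r: "(((a, b), x), ((a, b), x')) \<in> R_rel A" by (simp add: mem_cls)
    then have "valid a b x'" by (simp add: R_rel_iff)
    then show "x' \<in> {x}" using cls_inj[of a b x x'] r v by (simp add: cls_eq_iff)
  qed (use cls_self[OF v] in simp)
  then show ?thesis by (simp add: coord_def)
qed

lemma R_charts: "mcharts (R_mfd A) =
    {(sheet a b (Dom A (esrc a)), coord a b) | a b. a \<in> embs A \<and> b \<in> embs A \<and> esrc a = esrc b}"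
proof -
  have "R_class A ` ({(a, b)} \<times> Dom A (esrc a)) = sheet a b (Dom A (esrc a))" for a b
    unfolding sheet_def cls_def by (auto simp: image_iff)
  moreover have "(\<lambda>c. the_elem {x. ((a, b), x) \<in> c}) = coord a b" for a b
    by (simp add: coord_def fun_eq_iff)
  ultimately show ?thesis by (simp add: R_mfd_def emb_pairs_def)
qed

lemma dim_R [simp]: "mdim (R_mfd A) = cdim A" by (simp add: R_mfd_def)

lemma sheet_homeomorphic:
  assumes ab: "a \<in> embs A" "b \<in> embs A" "esrc a = esrc b"
  shows "homeomorphic_maps (subtopology (mtop (R_mfd A)) (sheet a b (Dom A (esrc a)))) (top_of_set (Dom A (esrc a)))
     (coord a b) (cls a b)"
proof -
  let ?D = "Dom A (esrc a)" and ?S = "sheet a b (Dom A (esrc a))"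
  have D: "Cn_open (cdim A) ?D" using dom(1)[OF emb(1)[OF ab(1)]] .
  have v: "valid a b x" if "x \<in> ?D" for x using ab that by (simp add: valid_def)
  have S: "openin (mtop (R_mfd A)) ?S" by (rule sheet_open[OF ab D]) simp
  have Ssub: "?S \<subseteq> pts (R_mfd A)" using S openin_subset by blast
  have "continuous_map (top_of_set ?D) (mtop (R_mfd A)) (cls a b)"
    unfolding continuous_map_def
  proof (intro conjI allI impI)
    fix V assume "openin (mtop (R_mfd A)) V"
    then have "Cn_open (cdim A) {x \<in> ?D. cls a b x \<in> V}" using ab by (simp add: R_open_iff)
    moreover have "{x \<in> ?D. cls a b x \<in> V} \<subseteq> ?D" by blast
    ultimately have "openin (top_of_set ?D) {x \<in> ?D. cls a b x \<in> V}"
      using dom(2)[OF emb(1)[OF ab(1)]] openin_subset_trans by blast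
    then show "openin (top_of_set ?D) {x \<in> topspace (top_of_set ?D). cls a b x \<in> V}" by simp
  qed (use v in auto)
  then have 1: "continuous_map (top_of_set ?D) (subtopology (mtop (R_mfd A)) ?S) (cls a b)"
    by (auto simp: continuous_map_in_subtopology sheet_def)
  have top: "topspace (subtopology (mtop (R_mfd A)) ?S) = ?S" using Ssub by auto
  have "continuous_map (subtopology (mtop (R_mfd A)) ?S) (top_of_set ?D) (coord a b)"
    unfolding continuous_map_def top
  proof (intro conjI allI impI)
    show "coord a b \<in> ?S \<rightarrow> topspace (top_of_set ?D)" using v by (auto simp: sheet_def)
    fix V assume V: "openin (top_of_set ?D) V"
    then have V': "V \<subseteq> ?D" "Cn_open (cdim A) V" using D openin_imp_subset openin_trans by blast+
    have "{c \<in> ?S. coord a b c \<in> V} = sheet a b V" using v V'(1) by (auto simp: sheet_def)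
    moreover have "openin (mtop (R_mfd A)) (sheet a b V)" by (rule sheet_open[OF ab V'(2,1)])
    moreover have "sheet a b V \<subseteq> ?S" using V' by (auto simp: sheet_def)
    ultimately show "openin (subtopology (mtop (R_mfd A)) ?S) {c \<in> ?S. coord a b c \<in> V}"
      using S by (simp add: openin_open_subtopology)
  qed
  then show ?thesis using 1 v unfolding homeomorphic_maps_def top by (auto simp: sheet_def)
qed

lemma coord_image:
  assumes "a \<in> embs A" "b \<in> embs A" "esrc a = esrc b"
  shows "coord a b ` sheet a b (Dom A (esrc a)) = Dom A (esrc a)"
proof -
  have "coord a b (cls a b x) = x" if "x \<in> Dom A (esrc a)" for x using assms that by (simp add: valid_def)
  then show ?thesis by (simp add: sheet_def image_image)
qed

text \<open>Where two sheets have a common restriction along \<open>k\<close> and \<open>l\<close>, the coordinate change is \<open>l \<circ> k\<inverse>\<close>.\<close>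

lemma holo_atlas_R: "holo_atlas (R_mfd A)"
proof (rule holo_atlasI, goal_cases)
  case (1 c)
  then obtain a b x where c: "valid a b x" "c = cls a b x" by (rule pts_RE)
  then have "(sheet a b (Dom A (esrc a)), coord a b) \<in> mcharts (R_mfd A)" unfolding R_charts valid_def by blast
  moreover have "c \<in> sheet a b (Dom A (esrc a))" using c by (auto simp: sheet_def valid_def)
  ultimately show ?case by blast
next
  case (2 W \<phi>)
  then obtain a b where c: "W = sheet a b (Dom A (esrc a))" "\<phi> = coord a b" "a \<in> embs A" "b \<in> embs A" "esrc a = esrc b"
    unfolding R_charts by blast
  show ?case unfolding c(1) by (rule sheet_open[OF c(3-5) dom(1)[OF emb(1)[OF c(3)]]]) simp
next
  case (3 W \<phi>)
  then obtain a b where c: "W = sheet a b (Dom A (esrc a))" "\<phi> = coord a b" "a \<in> embs A" "b \<in> embs A" "esrc a = esrc b"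
    unfolding R_charts by blast
  show ?case unfolding c(1,2) coord_image[OF c(3-5)] using dom(1)[OF emb(1)[OF c(3)]] by simp
next
  case (4 W \<phi>)
  then obtain a b where c: "W = sheet a b (Dom A (esrc a))" "\<phi> = coord a b" "a \<in> embs A" "b \<in> embs A" "esrc a = esrc b"
    unfolding R_charts by blast
  show ?case unfolding c(1,2) coord_image[OF c(3-5)]
    using sheet_homeomorphic[OF c(3-5)] homeomorphic_maps_map by blast
next
  case (5 W \<phi> W' \<phi>' c)
  obtain a b where ab: "W = sheet a b (Dom A (esrc a))" "\<phi> = coord a b" "a \<in> embs A" "b \<in> embs A" "esrc a = esrc b"
    using 5(1) unfolding R_charts by blast
  obtain a' b' where ab': "W' = sheet a' b' (Dom A (esrc a'))" "\<phi>' = coord a' b'" "a' \<in> embs A" "b' \<in> embs A" "esrc a' = esrc b'"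
    using 5(2) unfolding R_charts by blast
  obtain x x' where x: "x \<in> Dom A (esrc a)" "c = cls a b x" "x' \<in> Dom A (esrc a')" "c = cls a' b' x'"
    using 5(3,4) ab ab' by (auto simp: sheet_def)
  have v: "valid a b x" using ab x by (simp add: valid_def)
  have eq: "cls a b x = cls a' b' x'" using x by simp
  obtain k l z where k: "k \<in> embs A" "l \<in> embs A" "esrc k = esrc l"
    "etgt k = esrc a" "etgt l = esrc a'" "z \<in> Dom A (esrc k)"
    "a \<cdot> k = a' \<cdot> l" "b \<cdot> k = b' \<cdot> l" "emap k z = x" "emap l z = x'" by (rule cls_eqE[OF eq v])
  let ?K = "Dom A (esrc k)" let ?inv = "inv_into ?K (emap k)"
  let ?V = "sheet a b (emap k ` ?K)" and ?F = "emap l \<circ> ?inv"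
  have kK: "emap k ` ?K \<subseteq> Dom A (esrc a)" using emb(4)[OF k(1)] k(4) by auto
  have inv: "?inv (emap k w) = w" if "w \<in> ?K" for w using emb(8)[OF k(1)] that by simp
  have "\<phi>' v = ?F (\<phi> v)" if vV: "v \<in> ?V" for v
  proof -
    obtain w where w: "w \<in> ?K" "v = cls a b (emap k w)" using vV by (auto simp: sheet_def)
    have va: "valid a b (emap k w)" using ab kK w by (auto simp: valid_def)
    have va': "valid a' b' (emap l w)" using ab' emb(4)[OF k(2)] k w by (auto simp: valid_def)
    have "v = cls (a \<cdot> k) (b \<cdot> k) w" unfolding w(2) by (rule cls_pull[OF va]) (use k w in auto)
    also have "\<dots> = cls a' b' (emap l w)" unfolding k(7,8) by (rule cls_pull[OF va', symmetric]) (use k w in auto)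
    finally have "\<phi>' v = emap l w" using ab'(2) va' by simp
    moreover have "\<phi> v = emap k w" using ab(2) w(2) va by simp
    ultimately show ?thesis using inv[OF w(1)] by simp
  qed
  moreover have "hol_at (cdim A) ?F (\<phi> c)"
  proof -
    have "hol_at (cdim A) ?F (emap k z)"
    proof (rule hol_at_compose[OF emb(7)[OF k(1,6)] _ emb(9)[OF k(1)]])
      show "hol_at (cdim A) (emap l) (?inv (emap k z))" using inv[OF k(6)] emb(6)[OF k(2)] k by simp
      show "?inv \<in> emap k ` ?K \<rightarrow> Cn (cdim A)" using inv dom(2)[OF emb(1)[OF k(1)]] by auto
    qed (use k in auto)
    then show ?thesis using ab(2) x(2) v k by simp
  qed
  moreover have "openin (mtop (R_mfd A)) ?V" by (rule sheet_open[OF ab(3-5) emb(9)[OF k(1)] kK])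
  moreover have "c \<in> ?V" using x k by (auto simp: sheet_def)
  moreover have "?V \<subseteq> W" using kK ab(1) by (auto simp: sheet_def)
  ultimately show ?case by (intro exI[of _ ?V] exI[of _ ?F]) simp
qed

end

section \<open>The base, and the structure maps as holomorphic maps\<close>

lemma second_countable_prod_topology:
  assumes "second_countable X" "second_countable Y"
  shows "second_countable (prod_topology X Y)"
proof -
  obtain B where B: "countable B" "\<forall>V\<in>B. openin X V"
      "\<forall>U x. openin X U \<and> x \<in> U \<longrightarrow> (\<exists>V\<in>B. x \<in> V \<and> V \<subseteq> U)"
    using assms(1) unfolding second_countable_def by (elim exE conjE) (rule that)
  obtain C where C: "countable C" "\<forall>V\<in>C. openin Y V"
      "\<forall>U x. openin Y U \<and> x \<in> U \<longrightarrow> (\<exists>V\<in>C. x \<in> V \<and> V \<subseteq> U)"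
    using assms(2) unfolding second_countable_def by (elim exE conjE) (rule that)
  let ?D = "(\<lambda>(V, W). V \<times> W) ` (B \<times> C)"
  have "countable ?D" using B C by blast
  moreover have "\<forall>V\<in>?D. openin (prod_topology X Y) V" using B(2) C(2) by (auto simp: openin_prod_Times_iff)
  moreover have "\<exists>V\<in>?D. p \<in> V \<and> V \<subseteq> U" if U: "openin (prod_topology X Y) U" "p \<in> U" for U p
  proof -
    obtain x y where p: "p = (x, y)" by (cases p)
    obtain S T where S: "openin X S" "openin Y T" "x \<in> S" "y \<in> T" "S \<times> T \<subseteq> U"
      using U unfolding p openin_prod_topology_alt by metis
    obtain V where V: "V \<in> B" "x \<in> V" "V \<subseteq> S" using B(3) S(1,3) by blast
    obtain W where W: "W \<in> C" "y \<in> W" "W \<subseteq> T" using C(3) S(2,4) by blast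
    have "V \<times> W \<subseteq> U" using V W S(5) by blast
    then show ?thesis using V W p by (intro bexI[of _ "V \<times> W"]) auto
  qed
  ultimately show ?thesis unfolding second_countable_def by (intro exI[of _ ?D] conjI allI impI) auto
qed

context orb
begin

lemma R_openD:
  assumes "openin (mtop (R_mfd A)) V" "a \<in> embs A" "b \<in> embs A" "esrc a = esrc b"
  shows "Cn_open (cdim A) {x \<in> Dom A (esrc a). cls a b x \<in> V}"
  using assms by (simp add: R_open_iff)

lemma U_open_iff:
  "openin (mtop (U_mfd A)) V \<longleftrightarrow> V \<subseteq> pts (U_mfd A) \<and> (\<forall>i\<in>idx A. Cn_open (cdim A) {x \<in> Dom A i. (i, x) \<in> V})"
proof (cases "V \<subseteq> pts (U_mfd A)")
  case True
  have "openin (top_of_set (Dom A i)) {x. (i, x) \<in> V} \<longleftrightarrow> Cn_open (cdim A) {x \<in> Dom A i. (i, x) \<in> V}"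
    if i: "i \<in> idx A" for i
  proof -
    have "{x. (i, x) \<in> V} = {x \<in> Dom A i. (i, x) \<in> V}" using True by (auto simp: pts_U subset_eq)
    moreover have "openin (top_of_set (Dom A i)) S \<longleftrightarrow> Cn_open (cdim A) S" if "S \<subseteq> Dom A i" for S
      using dom(1,2)[OF i] that openin_trans openin_subset_trans by metis
    ultimately show ?thesis by simp
  qed
  then show ?thesis using True by (simp add: U_mfd_def openin_sum_topology)
qed (use openin_subset in blast)

lemma U_charts: "mcharts (U_mfd A) = {({i} \<times> Dom A i, snd) | i. i \<in> idx A}"
  by (simp add: U_mfd_def)

lemma dim_U [simp]: "mdim (U_mfd A) = cdim A" by (simp add: U_mfd_def)

lemma U_piece_open:
  assumes "i \<in> idx A" "Cn_open (cdim A) V" "V \<subseteq> Dom A i"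
  shows "openin (mtop (U_mfd A)) ({i} \<times> V)"
  unfolding U_open_iff
proof (intro conjI ballI)
  fix j assume "j \<in> idx A"
  have "{x \<in> Dom A j. (j, x) \<in> {i} \<times> V} = (if j = i then V else {})" using assms(3) by auto
  then show "Cn_open (cdim A) {x \<in> Dom A j. (j, x) \<in> {i} \<times> V}" using assms by simp
qed (use assms in \<open>auto simp: pts_U\<close>)

lemma U_piece_homeomorphic:
  assumes i: "i \<in> idx A"
  shows "homeomorphic_maps (subtopology (mtop (U_mfd A)) ({i} \<times> Dom A i)) (top_of_set (Dom A i)) snd (Pair i)"
proof -
  let ?D = "Dom A i" and ?S = "{i} \<times> Dom A i"
  have S: "openin (mtop (U_mfd A)) ?S" by (rule U_piece_open[OF i dom(1)[OF i]]) simp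
  have top: "topspace (subtopology (mtop (U_mfd A)) ?S) = ?S" using openin_subset[OF S] by auto
  have "continuous_map (top_of_set ?D) (mtop (U_mfd A)) (Pair i)"
    unfolding continuous_map_def
  proof (intro conjI allI impI)
    fix V assume "openin (mtop (U_mfd A)) V"
    then have "Cn_open (cdim A) {x \<in> ?D. (i, x) \<in> V}" using i by (simp add: U_open_iff)
    moreover have "{x \<in> ?D. (i, x) \<in> V} \<subseteq> ?D" by blast
    ultimately have "openin (top_of_set ?D) {x \<in> ?D. (i, x) \<in> V}"
      using dom(2)[OF i] openin_subset_trans by blast
    then show "openin (top_of_set ?D) {x \<in> topspace (top_of_set ?D). (i, x) \<in> V}" by simp
  qed (use i in \<open>auto simp: pts_U\<close>)
  then have 1: "continuous_map (top_of_set ?D) (subtopology (mtop (U_mfd A)) ?S) (Pair i)"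
    by (auto simp: continuous_map_in_subtopology)
  have "continuous_map (subtopology (mtop (U_mfd A)) ?S) (top_of_set ?D) snd"
    unfolding continuous_map_def top
  proof (intro conjI allI impI)
    fix V assume V: "openin (top_of_set ?D) V"
    then have V': "V \<subseteq> ?D" "Cn_open (cdim A) V" using dom(1)[OF i] openin_imp_subset openin_trans by blast+
    have "{c \<in> ?S. snd c \<in> V} = {i} \<times> V" using V'(1) by auto
    moreover have "{i} \<times> V \<subseteq> ?S" using V' by auto
    ultimately show "openin (subtopology (mtop (U_mfd A)) ?S) {c \<in> ?S. snd c \<in> V}"
      using S U_piece_open[OF i V'(2,1)] by (simp add: openin_open_subtopology)
  qed auto
  then show ?thesis using 1 unfolding homeomorphic_maps_def top by auto
qed

lemma holo_atlas_U: "holo_atlas (U_mfd A)"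
proof (rule holo_atlasI, goal_cases)
  case (1 x)
  then show ?case unfolding U_charts by (cases x) (auto simp: pts_U)
next
  case (2 W \<phi>)
  then show ?case unfolding U_charts using U_piece_open[OF _ dom(1)] by blast
next
  case (3 W \<phi>)
  then obtain i where "W = {i} \<times> Dom A i" "\<phi> = snd" "i \<in> idx A" unfolding U_charts by blast
  then show ?case using dom(1)[of i] by simp
next
  case (4 W \<phi>)
  then obtain i where i: "W = {i} \<times> Dom A i" "\<phi> = snd" "i \<in> idx A" unfolding U_charts by blast
  have "\<phi> ` W = Dom A i" using i by simp
  then show ?case using U_piece_homeomorphic[OF i(3)] homeomorphic_maps_map i by metis
next
  case (5 W \<phi> W' \<phi>' x)
  then obtain i where i: "W = {i} \<times> Dom A i" "\<phi> = snd" "i \<in> idx A" "\<phi>' = snd" unfolding U_charts by blast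
  then show ?case using U_piece_open[OF i(3) dom(1)[OF i(3)]] 5(3)
    by (intro exI[of _ W] exI[of _ "\<lambda>y. y"]) (simp add: hol_at_id)
qed

lemma Hausdorff_U: "Hausdorff_space (mtop (U_mfd A))"
  unfolding Hausdorff_space_def
proof (intro allI impI)
  fix p q assume "p \<in> pts (U_mfd A) \<and> q \<in> pts (U_mfd A) \<and> p \<noteq> q"
  then obtain i x j y where p: "p = (i, x)" "q = (j, y)" "i \<in> idx A" "x \<in> Dom A i" "j \<in> idx A" "y \<in> Dom A j" "(i, x) \<noteq> (j, y)"
    by (cases p; cases q) (auto simp: pts_U)
  show "\<exists>U V. openin (mtop (U_mfd A)) U \<and> openin (mtop (U_mfd A)) V \<and> p \<in> U \<and> q \<in> V \<and> disjnt U V"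
  proof (cases "i = j")
    case False
    then show ?thesis using p U_piece_open[OF _ dom(1)]
      by (intro exI[of _ "{i} \<times> Dom A i"] exI[of _ "{j} \<times> Dom A j"]) (auto simp: disjnt_def)
  next
    case True
    then have "x \<noteq> y" using p by simp
    then obtain S T where S: "open S" "open T" "x \<in> S" "y \<in> T" "S \<inter> T = {}" using hausdorff[of x y] by metis
    have o: "Cn_open (cdim A) (Dom A i \<inter> S)" if "open S" for S
      using dom(1)[OF p(3)] that by (simp add: openin_Int_open)
    show ?thesis using p S True U_piece_open[OF p(3) o]
      by (intro exI[of _ "{i} \<times> (Dom A i \<inter> S)"] exI[of _ "{i} \<times> (Dom A i \<inter> T)"]) (auto simp: disjnt_def)
  qed
qed

lemma second_countable_piece:
  assumes "i \<in> idx A"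
  shows "second_countable (subtopology (mtop (U_mfd A)) ({i} \<times> Dom A i))"
  using homeomorphic_space_second_countability[OF homeomorphic_maps_imp_homeomorphic_space[OF U_piece_homeomorphic[OF assms]]]
    second_countable_Cn[OF dom(2)[OF assms]] by simp

lemma paracompact_empty: "topspace X = {} \<Longrightarrow> paracompact_space X"
  unfolding paracompact_space_def by (intro allI impI exI[of _ "{}"]) (auto simp: locally_finite_in_def)

lemma paracompact_U: "paracompact_space (mtop (U_mfd A))"
proof (rule paracompact_space_clopen_partition[of _ fst])
  fix i
  let ?S = "{x \<in> pts (U_mfd A). fst x = i}"
  have S: "?S = (if i \<in> idx A then {i} \<times> Dom A i else {})" by (auto simp: pts_U)
  show "openin (mtop (U_mfd A)) ?S" unfolding S using U_piece_open[OF _ dom(1)] by auto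
  show "paracompact_space (subtopology (mtop (U_mfd A)) ?S)"
  proof (cases "i \<in> idx A")
    case True
    have "regular_space (top_of_set (Dom A i))"
      by (rule regular_space_subtopology[OF regular_space_euclidean])
    then have "regular_space (subtopology (mtop (U_mfd A)) ({i} \<times> Dom A i))"
      using homeomorphic_regular_space[OF homeomorphic_maps_imp_homeomorphic_space[OF U_piece_homeomorphic[OF True]]] by simp
    then show ?thesis unfolding S
      using regular_Lindelof_imp_paracompact second_countable_imp_Lindelof_space[OF second_countable_piece[OF True]] True by simp
  qed (simp add: S paracompact_empty)
qed

lemma manifold_U: "complex_manifold (U_mfd A)"
  using holo_atlas_U Hausdorff_U paracompact_U by (simp add: complex_manifold_iff)

lemma sheet_chart:
  assumes "a \<in> embs A" "b \<in> embs A" "esrc a = esrc b"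
  shows "(sheet a b (Dom A (esrc a)), coord a b) \<in> mcharts (R_mfd A)"
  unfolding R_charts using assms by blast

lemma sheet_openin:
  assumes "a \<in> embs A" "b \<in> embs A" "esrc a = esrc b"
  shows "openin (mtop (R_mfd A)) (sheet a b (Dom A (esrc a)))"
  by (rule sheet_open[OF assms dom(1)[OF emb(1)[OF assms(1)]]]) simp

text \<open>Source and target are treated together. In the chart of the pair \<open>(a, b)\<close> the endpoint map is the
  embedding \<open>sel a b\<close>, which is \<open>a\<close> or \<open>b\<close> and has a holomorphic inverse on its open image.\<close>

lemma endpoint_local_biholomorphism:
  assumes ext: "h \<in> extensional (pts (R_mfd A))"
    and h: "\<And>a b x. valid a b x \<Longrightarrow> h (cls a b x) = (etgt (sel a b), emap (sel a b) x)"
    and sel: "\<And>a b. a \<in> embs A \<Longrightarrow> b \<in> embs A \<Longrightarrow> esrc a = esrc b \<Longrightarrow> sel a b \<in> embs A \<and> esrc (sel a b) = esrc a"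
  shows "local_biholomorphism (R_mfd A) (U_mfd A) h"
proof (rule local_biholomorphismI[OF holo_atlas_R holo_atlas_U])
  show "h \<in> holomorphic_maps (R_mfd A) (U_mfd A)"
  proof (rule holomorphic_mapsI[OF holo_atlas_R holo_atlas_U ext])
    fix c assume "c \<in> pts (R_mfd A)"
    then obtain a b x where c: "valid a b x" "c = cls a b x" by (rule pts_RE)
    note v = validD[OF c(1)] have ab: "esrc a = esrc b" using v by simp
    let ?l = "sel a b"
    have l: "?l \<in> embs A" "esrc ?l = esrc a" using sel[OF v(1,2) ab] by auto
    note hs = h
    show "hol_near (R_mfd A) (U_mfd A) h c"
    proof (rule hol_nearI[OF sheet_chart[OF v(1,2) ab] _ sheet_openin[OF v(1,2) ab], where W' = "{etgt ?l} \<times> Dom A (etgt ?l)" and \<phi>' = snd and F = "emap ?l"])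
      show "({etgt ?l} \<times> Dom A (etgt ?l), snd) \<in> mcharts (U_mfd A)" unfolding U_charts using emb(2)[OF l(1)] by blast
      show "c \<in> sheet a b (Dom A (esrc a))" using c v by (simp add: sheet_def)
      fix r assume "r \<in> sheet a b (Dom A (esrc a))"
      then obtain y where y: "y \<in> Dom A (esrc a)" "r = cls a b y" by (auto simp: sheet_def)
      have vy: "valid a b y" using v(1,2) ab y(1) by (simp add: valid_def)
      show "h r \<in> {etgt ?l} \<times> Dom A (etgt ?l)" using h[OF vy] y l emb(4)[OF l(1)] by simp
      show "snd (h r) = emap ?l (coord a b r)" using h[OF vy] vy y by simp
      show "hol_at (mdim (R_mfd A)) (emap ?l) (coord a b r)" using vy y emb(6)[OF l(1)] l by simp
    qed simp
  qed
next
  fix c assume "c \<in> pts (R_mfd A)"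
  then obtain a b x where c: "valid a b x" "c = cls a b x" by (rule pts_RE)
  note v = validD[OF c(1)] have ab: "esrc a = esrc b" using v by simp
  let ?l = "sel a b" let ?D = "Dom A (esrc a)" let ?W = "sheet a b ?D"
  have l: "?l \<in> embs A" "esrc ?l = esrc a" using sel[OF v(1,2) ab] by auto
  have valid': "valid a b y" if "y \<in> ?D" for y using v(1,2) ab that by (simp add: valid_def)
  let ?inv = "inv_into ?D (emap ?l)"
  have inv: "?inv (emap ?l y) = y" if "y \<in> ?D" for y using emb(8)[OF l(1)] l that by simp
  have W: "openin (mtop (R_mfd A)) ?W" by (rule sheet_openin[OF v(1,2) ab])
  have "h ` ?W = (\<lambda>y. (etgt ?l, emap ?l y)) ` ?D"
    unfolding sheet_def image_image by (intro image_cong refl h valid')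
  then have hW: "h ` ?W = {etgt ?l} \<times> emap ?l ` ?D" by auto
  have lD: "emap ?l ` ?D \<subseteq> Dom A (etgt ?l)" using emb(4)[OF l(1)] l by auto
  have hWo: "openin (mtop (U_mfd A)) (h ` ?W)"
    unfolding hW by (rule U_piece_open[OF emb(2)[OF l(1)] _ lD]) (use emb(9)[OF l(1)] l in simp)
  let ?M = "open_submanifold (R_mfd A) ?W" and ?N = "open_submanifold (U_mfd A) (h ` ?W)"
  have pN: "pts ?N = h ` ?W" using openin_subset[OF hWo] by auto
  let ?g = "\<lambda>p\<in>pts ?N. cls a b (?inv (snd p))"
  have "?g \<in> holomorphic_maps ?N ?M"
  proof (rule holomorphic_mapsI[OF holo_atlas_open_submanifold[OF holo_atlas_U hWo] holo_atlas_open_submanifold[OF holo_atlas_R W]])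
    fix p assume p: "p \<in> pts ?N"
    show "hol_near ?N ?M ?g p"
    proof (rule hol_nearI[of "({etgt ?l} \<times> Dom A (etgt ?l)) \<inter> h ` ?W" snd _ "?W \<inter> ?W" "coord a b" _ "h ` ?W" _ _ ?inv])
      show "(({etgt ?l} \<times> Dom A (etgt ?l)) \<inter> h ` ?W, snd) \<in> mcharts ?N"
        unfolding open_submanifold_simps U_charts using emb(2)[OF l(1)] by blast
      show "(?W \<inter> ?W, coord a b) \<in> mcharts ?M"
        unfolding open_submanifold_simps using sheet_chart[OF v(1,2) ab] by blast
      show "openin (mtop ?N) (h ` ?W)" using hWo by (simp add: openin_open_subtopology)
      show "p \<in> h ` ?W" using p pN by simp
      show "h ` ?W \<subseteq> ({etgt ?l} \<times> Dom A (etgt ?l)) \<inter> h ` ?W" using hW lD by auto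
      fix q assume q: "q \<in> h ` ?W"
      then obtain y where y: "y \<in> ?D" "q = (etgt ?l, emap ?l y)" unfolding hW by auto
      have gq: "?g q = cls a b y" using q pN y inv by simp
      show "?g q \<in> ?W \<inter> ?W" unfolding gq using y by (simp add: sheet_def)
      show "coord a b (?g q) = ?inv (snd q)" unfolding gq using y inv valid' by simp
      show "hol_at (mdim ?N) ?inv (snd q)" using emb(7)[OF l(1)] l y by simp
    qed
  qed simp
  moreover have "\<forall>r\<in>?W. ?g (h r) = r"
  proof
    fix r assume r: "r \<in> ?W"
    then obtain y where y: "y \<in> ?D" "r = cls a b y" by (auto simp: sheet_def)
    have "h r = (etgt ?l, emap ?l y)" using h[OF valid'[OF y(1)]] y by simp
    moreover have "h r \<in> pts ?N" unfolding pN using r by blast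
    ultimately show "?g (h r) = r" using y inv by simp
  qed
  ultimately show "\<exists>W g. openin (mtop (R_mfd A)) W \<and> c \<in> W \<and> openin (mtop (U_mfd A)) (h ` W) \<and>
        g \<in> holomorphic_maps (open_submanifold (U_mfd A) (h ` W)) (open_submanifold (R_mfd A) W) \<and> (\<forall>y\<in>W. g (h y) = y)"
    using W hWo c v by (intro exI[of _ ?W] exI[of _ ?g]) (simp add: sheet_def)
qed

lemma local_biholomorphism_s: "local_biholomorphism (R_mfd A) (U_mfd A) (R_s A)"
proof (rule endpoint_local_biholomorphism[of _ "\<lambda>a b. a"])
  show "R_s A \<in> extensional (pts (R_mfd A))" by (simp add: R_s_def on_classes_def)
qed auto

lemma local_biholomorphism_t: "local_biholomorphism (R_mfd A) (U_mfd A) (R_t A)"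
proof (rule endpoint_local_biholomorphism[of _ "\<lambda>a b. b"])
  show "R_t A \<in> extensional (pts (R_mfd A))" by (simp add: R_t_def on_classes_def)
qed auto

lemma endpoints_continuous:
  "continuous_map (mtop (R_mfd A)) (mtop (U_mfd A)) (R_s A)" "continuous_map (mtop (R_mfd A)) (mtop (U_mfd A)) (R_t A)"
  using local_biholomorphism_s local_biholomorphism_t by (auto simp: local_biholomorphism_def holomorphic_maps_def)

lemma holomorphic_inverse: "R_i A \<in> holomorphic_maps (R_mfd A) (R_mfd A)"
proof (rule holomorphic_mapsI[OF holo_atlas_R holo_atlas_R])
  fix c assume "c \<in> pts (R_mfd A)"
  then obtain a b x where c: "valid a b x" "c = cls a b x" by (rule pts_RE)
  note v = validD[OF c(1)] have ab: "esrc a = esrc b" using v by simp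
  show "hol_near (R_mfd A) (R_mfd A) (R_i A) c"
  proof (rule hol_nearI[OF sheet_chart[OF v(1,2) ab] sheet_chart[OF v(2,1) ab[symmetric]] sheet_openin[OF v(1,2) ab], where F = "\<lambda>y. y"])
    show "c \<in> sheet a b (Dom A (esrc a))" using c v by (simp add: sheet_def)
    fix r assume "r \<in> sheet a b (Dom A (esrc a))"
    then obtain y where y: "y \<in> Dom A (esrc a)" "r = cls a b y" by (auto simp: sheet_def)
    have vy: "valid a b y" using v(1,2) ab y(1) by (simp add: valid_def)
    show "R_i A r \<in> sheet b a (Dom A (esrc b))" using vy y ab by (simp add: sheet_def)
    show "coord b a (R_i A r) = coord a b r" using vy y valid_swap[OF vy] by simp
  qed (auto simp: hol_at_id)
qed (simp add: R_i_def on_classes_def)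

lemma holomorphic_unit: "R_e A \<in> holomorphic_maps (U_mfd A) (R_mfd A)"
proof (rule holomorphic_mapsI[OF holo_atlas_U holo_atlas_R])
  fix p assume "p \<in> pts (U_mfd A)"
  then obtain i x where p: "p = (i, x)" "i \<in> idx A" "x \<in> Dom A i" by (cases p) (auto simp: pts_U)
  let ?I = "emb_id A i"
  have I: "?I \<in> embs A" using p by simp
  show "hol_near (U_mfd A) (R_mfd A) (R_e A) p"
  proof (rule hol_nearI[OF _ sheet_chart[OF I I refl] U_piece_open[OF p(2) dom(1)[OF p(2)] order_refl], where W = "{i} \<times> Dom A i" and \<phi> = snd and F = "\<lambda>y. y"])
    show "({i} \<times> Dom A i, snd) \<in> mcharts (U_mfd A)" unfolding U_charts using p by blast
  qed (use p in \<open>auto simp: hol_at_id sheet_def\<close>)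
qed (auto simp: R_e_def)

text \<open>Near a pair \<open>[p, z, q]\<close>, \<open>[q, z, r]\<close> the factors stay in the sheets of \<open>(p, q)\<close> and \<open>(q, r)\<close>. Being
  composable, they have equal coordinates because \<open>q\<close> is injective, so the product has the same
  coordinate in the sheet of \<open>(p, r)\<close>.\<close>

lemma holomorphic_mult: "R_m A \<in> holomorphic_maps (fiber_product (R_mfd A) (R_mfd A) (R_t A) (R_s A)) (R_mfd A)"
proof (rule holomorphic_mapsI[OF holo_atlas_fiber_product[OF holo_atlas_R endpoints_continuous(2) local_biholomorphism_s] holo_atlas_R])
  let ?P = "fiber_product (R_mfd A) (R_mfd A) (R_t A) (R_s A)"
  fix w assume wP: "w \<in> pts ?P"
  then obtain c d where w: "w = (c, d)" "c \<in> pts (R_mfd A)" "d \<in> pts (R_mfd A)" "R_t A c = R_s A d"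
    by (cases w) (auto simp: pts_composable)
  obtain p q r z where n: "valid p q z" "valid q r z" "c = cls p q z" "d = cls q r z"
    by (rule composable_normal_form[OF w(2-4)])
  note V = validD[OF n(1)] validD[OF n(2)]
  have pq: "esrc p = esrc q" and qr: "esrc q = esrc r" and pr: "esrc p = esrc r" using V by auto
  let ?S = "sheet p q (Dom A (esrc p))" and ?T = "sheet q r (Dom A (esrc q))"
  let ?O = "pts ?P \<inter> (?S \<times> ?T)"
  have opST: "openin (prod_topology (mtop (R_mfd A)) (mtop (R_mfd A))) (?S \<times> ?T)"
    using sheet_openin[OF V(1,2) pq] sheet_openin[OF V(5,6) qr] by (simp add: openin_prod_Times_iff)
  have "?O = (?S \<times> ?T) \<inter> {(x, y). R_t A x = R_s A y}"
    using openin_subset[OF opST] by (auto simp: fiber_product_simps)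
  then have O: "openin (mtop ?P) ?O"
    using opST unfolding fiber_product_simps(1) openin_subtopology by blast
  have wO: "(c, d) \<in> ?O" using wP w n V by (auto simp: sheet_def)
  obtain N where N: "(N, coord p q \<circ> fst) \<in> mcharts ?P" "(c, d) \<in> N" "N \<subseteq> ?O"
    by (rule fiber_product_chart_at[OF holo_atlas_R endpoints_continuous(2) local_biholomorphism_s _ sheet_chart[OF V(1,2) pq] _ O wO])
      (use wP w n V in \<open>auto simp: sheet_def\<close>)
  have No: "openin (mtop ?P) N"
    using chart_facts(1)[OF holo_atlas_fiber_product[OF holo_atlas_R endpoints_continuous(2) local_biholomorphism_s] N(1)] .
  show "hol_near ?P (R_mfd A) (R_m A) w"
  proof (rule hol_nearI[OF N(1) sheet_chart[OF V(1,6) pr] No _ order_refl, where F = "\<lambda>y. y"])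
    fix v assume "v \<in> N"
    then have v: "v \<in> pts ?P" "v \<in> ?S \<times> ?T" using N(3) by auto
    obtain y y' where y: "v = (cls p q y, cls q r y')" "y \<in> Dom A (esrc p)" "y' \<in> Dom A (esrc q)"
      using v(2) by (auto simp: sheet_def)
    have vy: "valid p q y" "valid q r y'" "valid q r y" "valid p r y" using V y by (auto simp: valid_def)
    have "R_t A (cls p q y) = R_s A (cls q r y')" using v(1) y by (simp add: pts_composable)
    then have "emap q y = emap q y'" using vy by simp
    then have "y = y'" using emb(8)[OF V(2)] vy by (auto simp: valid_def dest: inj_onD)
    then have m: "R_m A v = cls p r y" using y vy by simp
    show "R_m A v \<in> sheet p r (Dom A (esrc p))" unfolding m using y by (simp add: sheet_def)
    show "coord p r (R_m A v) = (coord p q \<circ> fst) v" unfolding m using y vy by simp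
  qed (use N w in \<open>auto simp: hol_at_id\<close>)
qed (auto simp: R_m_def)

section \<open>The arrows over a chart, and properness\<close>

text \<open>After restriction, \<open>c\<close> and \<open>[a, z, b]\<close> have the same first embedding, and their second embeddings
  differ by a group element.\<close>

lemma arrow_over_chart:
  assumes v: "valid a b z" and c: "c \<in> pts (R_mfd A)" "R_s A c = (etgt a, emap a z)" "fst (R_t A c) = etgt b"
  obtains g where "g \<in> grp (etgt b)" "c = cls a (gemb (etgt b) g \<cdot> b) z"
proof -
  note V = validD[OF v]
  obtain a1 b1 x1 where c1: "valid a1 b1 x1" "c = cls a1 b1 x1" by (rule pts_RE[OF c(1)])
  note V1 = validD[OF c1(1)]
  have e: "etgt a1 = etgt a" "emap a1 x1 = emap a z" "etgt b1 = etgt b" using c(2,3) c1 by auto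
  obtain u w y where u: "u \<in> embs A" "w \<in> embs A" "esrc u = esrc w" "etgt u = esrc a1" "etgt w = esrc a"
    "y \<in> Dom A (esrc u)" "emap u y = x1" "emap w y = z" "a1 \<cdot> u = a \<cdot> w"
    by (rule embeddings_pullback[OF V1(1) V(1) e(1) V1(4) V(4) e(2)])
  have bw: "b \<cdot> w \<in> embs A" and bu: "b1 \<cdot> u \<in> embs A" using V V1 u by auto
  obtain g where g: "g \<in> grp (etgt (b \<cdot> w))" "b1 \<cdot> u = gemb (etgt (b \<cdot> w)) g \<cdot> (b \<cdot> w)"
    by (rule embeddings_differ_by_group[OF bw bu]) (use u e in auto)
  have j: "etgt b \<in> idx A" "g \<in> grp (etgt b)" using emb(2)[OF V(2)] g by auto
  let ?gb = "gemb (etgt b) g \<cdot> b"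
  have v': "valid a ?gb z" using V j by (auto simp: valid_def)
  have "c = cls (a1 \<cdot> u) (b1 \<cdot> u) y" unfolding c1(2) by (rule cls_pull[OF c1(1)]) (use u in auto)
  also have "\<dots> = cls (a \<cdot> w) (?gb \<cdot> w) y"
    unfolding u(9) using g(2) u V j comp_assoc[of w b "gemb (etgt b) g"] by simp
  also have "\<dots> = cls a ?gb z" by (rule cls_pull[OF v', symmetric]) (use u in auto)
  finally show ?thesis using that j by blast
qed

lemma endpoints_project:
  assumes "c \<in> pts (R_mfd A)" "R_s A c = (i, x)" "R_t A c = (j, y)"
  shows "i \<in> idx A" "j \<in> idx A" "x \<in> Dom A i" "y \<in> Dom A j" "Proj A i x = Proj A j y"
proof -
  obtain a b z where c: "valid a b z" "c = cls a b z" by (rule pts_RE[OF assms(1)])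
  note V = validD[OF c(1)]
  have "i = etgt a" "x = emap a z" "j = etgt b" "y = emap b z" using assms c by auto
  then show "i \<in> idx A" "j \<in> idx A" "x \<in> Dom A i" "y \<in> Dom A j" "Proj A i x = Proj A j y"
    using emb(2,4,5)[OF V(1)] emb(2,4,5)[OF V(2)] V by auto
qed

text \<open>The fibers are finite by \<open>arrow_over_chart\<close>. For closedness, consider \<open>(x, y)\<close> outside the image of
  a closed set \<open>C\<close>. If \<open>x\<close> and \<open>y\<close> lie over different points of the space, these are separated there.
  Otherwise \<open>x = a z\<close> and \<open>y = b z\<close> in a common chart, and the arrows with source in the image of \<open>a\<close>
  and target of index \<open>j\<close> lie in the finitely many sheets of \<open>(a, g \<circ> b)\<close>; each sheet excludes \<open>C\<close> on
  some neighbourhood, and finitely many neighbourhoods are intersected.\<close>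

lemma proper_endpoints:
  "proper_map (mtop (R_mfd A)) (prod_topology (mtop (U_mfd A)) (mtop (U_mfd A))) (\<lambda>c. (R_s A c, R_t A c))"
  (is "proper_map ?R ?UU ?f")
  unfolding proper_map_def
proof (intro conjI ballI)
  fix p assume p: "p \<in> topspace ?UU"
  show "compactin ?R {c \<in> topspace ?R. ?f c = p}"
  proof (cases "{c \<in> topspace ?R. ?f c = p} = {}")
    case False
    then obtain c0 where c0: "c0 \<in> pts (R_mfd A)" "?f c0 = p" by blast
    obtain a b z where c: "valid a b z" "c0 = cls a b z" by (rule pts_RE[OF c0(1)])
    have "{c \<in> topspace ?R. ?f c = p} \<subseteq> (\<lambda>g. cls a (gemb (etgt b) g \<cdot> b) z) ` grp (etgt b)"
    proof
      fix c' assume "c' \<in> {c \<in> topspace ?R. ?f c = p}"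
      then have c': "c' \<in> pts (R_mfd A)" "R_s A c' = (etgt a, emap a z)" "fst (R_t A c') = etgt b"
        using c0 c by auto
      show "c' \<in> (\<lambda>g. cls a (gemb (etgt b) g \<cdot> b) z) ` grp (etgt b)"
        by (rule arrow_over_chart[OF c(1) c']) auto
    qed
    then have "finite {c \<in> topspace ?R. ?f c = p}"
      using finite_grp[OF emb(2)[OF validD(2)[OF c(1)]]] finite_surj by blast
    then show ?thesis by (intro finite_imp_compactin) auto
  qed (simp only: compactin_empty)
next
  show "closed_map ?R ?UU ?f"
    unfolding closed_map_def
  proof (intro allI impI)
    fix C assume C: "closedin ?R C"
    have Csub: "C \<subseteq> pts (R_mfd A)" using C closedin_subset by blast
    have fUU: "?f c \<in> topspace ?UU" if "c \<in> pts (R_mfd A)" for c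
      using endpoints_continuous that by (auto simp: continuous_map_def)
    have nbhd: "\<exists>T. openin ?UU T \<and> ((i, x), (j, y)) \<in> T \<and> T \<subseteq> topspace ?UU - ?f ` C"
      if ix: "i \<in> idx A" "x \<in> Dom A i" and jy: "j \<in> idx A" "y \<in> Dom A j" and nC: "((i, x), (j, y)) \<notin> ?f ` C" for i x j y
    proof -
      have "\<exists>S T. Cn_open (cdim A) S \<and> Cn_open (cdim A) T \<and> S \<subseteq> Dom A i \<and> T \<subseteq> Dom A j \<and>
          x \<in> S \<and> y \<in> T \<and> (\<forall>c\<in>C. \<forall>x'\<in>S. \<forall>y'\<in>T. \<not> (R_s A c = (i, x') \<and> R_t A c = (j, y')))"
      proof (cases "Proj A i x = Proj A j y")
        case False
        have Pi: "continuous_map (top_of_set (Dom A i)) (aspace A) (Proj A i)" if "i \<in> idx A" for i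
          using unif[OF that] by (auto simp: uniformizing_system_def continuous_map_in_subtopology)
        have pre: "Cn_open (cdim A) {u \<in> Dom A i. Proj A i u \<in> N}" if i: "i \<in> idx A" and N: "openin (aspace A) N" for i N
        proof -
          have "openin (top_of_set (Dom A i)) {u \<in> topspace (top_of_set (Dom A i)). Proj A i u \<in> N}"
            by (rule openin_continuous_map_preimage[OF Pi[OF i] N])
          then show ?thesis using dom(1)[OF i] openin_trans by simp
        qed
        have "Hausdorff_space (aspace A)" using atlas by (simp add: orbifold_atlas_def)
        moreover have "Proj A i x \<in> topspace (aspace A)" "Proj A j y \<in> topspace (aspace A)"
          using Pi ix jy by (auto simp: continuous_map_def)
        ultimately obtain N N' where N: "openin (aspace A) N" "openin (aspace A) N'" "Proj A i x \<in> N" "Proj A j y \<in> N'" "disjnt N N'"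
          using False unfolding Hausdorff_space_def by metis
        show ?thesis
          by (rule exI[of _ "{u \<in> Dom A i. Proj A i u \<in> N}"], rule exI[of _ "{u \<in> Dom A j. Proj A j u \<in> N'}"])
            (use pre[OF ix(1) N(1)] pre[OF jy(1) N(2)] ix jy N(3-5) endpoints_project(5) Csub in \<open>fastforce simp: disjnt_iff\<close>)
      next
        case True
        obtain a b z where ab: "a \<in> embs A" "b \<in> embs A" "esrc a = esrc b" "etgt a = i" "etgt b = j"
          "z \<in> Dom A (esrc a)" "emap a z = x" "emap b z = y"
          by (rule common_chart[OF ix(1) jy(1) ix(2) jy(2) True])
        let ?D = "Dom A (esrc a)"
        have D: "Cn_open (cdim A) ?D" by (rule dom(1)[OF emb(1)[OF ab(1)]])
        define gb where "gb g = gemb j g \<cdot> b" for g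
        have gb: "gb g \<in> embs A" "esrc (gb g) = esrc a" "etgt (gb g) = j" if "g \<in> grp j" for g
          using that ab jy by (auto simp: gb_def)
        have "\<exists>Z N. Cn_open (cdim A) Z \<and> Cn_open (cdim A) N \<and> Z \<subseteq> ?D \<and> N \<subseteq> Dom A j \<and>
            z \<in> Z \<and> y \<in> N \<and> (\<forall>z'\<in>Z. cls a (gb g) z' \<in> C \<longrightarrow> emap (gb g) z' \<notin> N)" if g: "g \<in> grp j" for g
        proof (cases "emap (gb g) z = y")
          case True
          have v: "valid a (gb g) z" using gb[OF g] ab by (simp add: valid_def)
          have "?f (cls a (gb g) z) = ((i, x), (j, y))" using v True gb[OF g] ab by simp
          with nC have nz: "cls a (gb g) z \<notin> C" using imageI[of "cls a (gb g) z" C ?f] by auto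
          have "openin ?R (pts (R_mfd A) - C)" using C by blast
          then have "Cn_open (cdim A) {u \<in> ?D. cls a (gb g) u \<in> pts (R_mfd A) - C}"
            by (rule R_openD[OF _ ab(1) gb(1)[OF g] gb(2)[OF g, symmetric]])
          then show ?thesis
            by (intro exI[of _ "{u \<in> ?D. cls a (gb g) u \<in> pts (R_mfd A) - C}"] exI[of _ "Dom A j"] conjI)
              (use nz v ab jy dom(1) in auto)
        next
          case False
          then obtain S T where S: "open S" "open T" "emap (gb g) z \<in> S" "y \<in> T" "S \<inter> T = {}"
            using hausdorff by metis
          have "Cn_open (cdim A) (Dom A j \<inter> S)"
            using dom(1)[OF jy(1)] S(1) by (simp add: openin_Int_open)
          then have "Cn_open (cdim A) {u \<in> Dom A (esrc (gb g)). emap (gb g) u \<in> Dom A j \<inter> S}"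
            by (rule emb_preimage_open[OF gb(1)[OF g]])
          moreover have "Cn_open (cdim A) (Dom A j \<inter> T)"
            using dom(1)[OF jy(1)] S(2) by (simp add: openin_Int_open)
          moreover have "emap (gb g) z \<in> Dom A j" using emb(4)[OF gb(1)[OF g]] gb[OF g] ab by simp
          ultimately show ?thesis
            by (intro exI[of _ "{u \<in> Dom A (esrc (gb g)). emap (gb g) u \<in> Dom A j \<inter> S}"] exI[of _ "Dom A j \<inter> T"] conjI)
              (use S ab jy gb[OF g] in auto)
        qed
        then obtain Z N where Z: "\<And>g. g \<in> grp j \<Longrightarrow> Cn_open (cdim A) (Z g)"
          and N: "\<And>g. g \<in> grp j \<Longrightarrow> Cn_open (cdim A) (N g)"
          and ZN: "\<And>g. g \<in> grp j \<Longrightarrow> Z g \<subseteq> ?D \<and> N g \<subseteq> Dom A j \<and> z \<in> Z g \<and> y \<in> N g"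
          and sep: "\<And>g z'. g \<in> grp j \<Longrightarrow> z' \<in> Z g \<Longrightarrow> cls a (gb g) z' \<in> C \<Longrightarrow> emap (gb g) z' \<notin> N g"
          by metis
        \<comment> \<open>The group is nonempty, so the intersections over it stay within the two domains.\<close>
        have fin: "finite (grp j)" "grp j \<noteq> {}" using finite_grp[OF jy(1)] grp_one[OF jy(1)] by auto
        let ?Z = "\<Inter>g\<in>grp j. Z g" and ?N = "\<Inter>g\<in>grp j. N g"
        have oZ: "Cn_open (cdim A) ?Z" "Cn_open (cdim A) ?N"
          using Z N fin by (auto intro!: openin_Inter)
        have Zsub: "?Z \<subseteq> ?D" "?N \<subseteq> Dom A j" using ZN fin(2) by blast+
        have oS: "Cn_open (cdim A) (emap a ` ?Z)"
          by (rule emb_image_open[OF ab(1) oZ(1) Zsub(1)])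
        have "\<not> (R_s A c = (i, x') \<and> R_t A c = (j, y'))" if c: "c \<in> C" and x': "x' \<in> emap a ` ?Z" and y': "y' \<in> ?N" for c x' y'
        proof
          assume st: "R_s A c = (i, x') \<and> R_t A c = (j, y')"
          obtain z' where z': "z' \<in> ?Z" "x' = emap a z'" using x' by blast
          have v: "valid a b z'" using ab z' Zsub by (auto simp: valid_def)
          have "R_s A c = (etgt a, emap a z')" "fst (R_t A c) = etgt b" using st z' ab by auto
          then obtain g where g: "g \<in> grp (etgt b)" "c = cls a (gemb (etgt b) g \<cdot> b) z'"
            using arrow_over_chart[OF v] c Csub by blast
          have g': "g \<in> grp j" "c = cls a (gb g) z'" using g ab by (auto simp: gb_def)
          have "valid a (gb g) z'" using gb[OF g'(1)] v by (auto simp: valid_def)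
          then have "y' = emap (gb g) z'" using st g'(2) by simp
          then show False using sep[OF g'(1), of z'] z'(1) y' c g' by blast
        qed
        moreover have "x \<in> emap a ` ?Z" "y \<in> ?N" using ZN ab by auto
        moreover have "emap a ` ?Z \<subseteq> Dom A i" using Zsub emb(4)[OF ab(1)] ab by blast
        ultimately show ?thesis using oS oZ(2) Zsub(2)
          by (intro exI[of _ "emap a ` ?Z"] exI[of _ ?N] conjI ballI) simp_all
      qed
      then obtain S T where S: "Cn_open (cdim A) S" "Cn_open (cdim A) T" "S \<subseteq> Dom A i" "T \<subseteq> Dom A j"
          "x \<in> S" "y \<in> T" "\<forall>c\<in>C. \<forall>x'\<in>S. \<forall>y'\<in>T. \<not> (R_s A c = (i, x') \<and> R_t A c = (j, y'))"
        by (elim exE conjE) (rule that)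
      let ?B = "({i} \<times> S) \<times> ({j} \<times> T)"
      have B: "openin ?UU ?B"
        using U_piece_open[OF ix(1) S(1,3)] U_piece_open[OF jy(1) S(2,4)] by (simp add: openin_prod_Times_iff)
      have nB: "q \<notin> ?f ` C" if "q \<in> ?B" for q
      proof
        assume "q \<in> ?f ` C"
        then obtain c where c: "c \<in> C" "q = (R_s A c, R_t A c)" by blast
        obtain x' y' where "x' \<in> S" "y' \<in> T" "q = ((i, x'), (j, y'))" using \<open>q \<in> ?B\<close> by blast
        then have "x' \<in> S" "y' \<in> T" "R_s A c = (i, x')" "R_t A c = (j, y')" using c(2) by simp_all
        then show False using S(7) c(1) by blast
      qed
      have "?B \<subseteq> topspace ?UU - ?f ` C" by (intro subsetI DiffI subsetD[OF openin_subset[OF B]] nB)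
      moreover have "((i, x), (j, y)) \<in> ?B" using S(5,6) by simp
      ultimately show ?thesis using B by (intro exI[of _ ?B] conjI)
    qed
    show "closedin ?UU (?f ` C)"
      unfolding closedin_def
    proof
      show "?f ` C \<subseteq> topspace ?UU" using fUU Csub by blast
      show "openin ?UU (topspace ?UU - ?f ` C)"
      proof (subst openin_subopen, intro ballI)
        fix p assume p: "p \<in> topspace ?UU - ?f ` C"
        obtain i x j y where e: "p = ((i, x), (j, y))" by (metis surj_pair)
        have "i \<in> idx A" "x \<in> Dom A i" "j \<in> idx A" "y \<in> Dom A j" "((i, x), (j, y)) \<notin> ?f ` C"
          using p unfolding e by (simp_all add: pts_U)
        then show "\<exists>T. openin ?UU T \<and> p \<in> T \<and> T \<subseteq> topspace ?UU - ?f ` C" unfolding e by (rule nbhd)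
      qed
    qed
  qed
qed

end

section \<open>The groupoid of an atlas\<close>

context orb
begin

text \<open>A common restriction along \<open>k\<close> and \<open>l\<close> has \<open>a \<circ> k = a \<circ> l\<close>, so \<open>k = l\<close>, and \<open>b\<close> and \<open>b'\<close> agree on
  the image of \<open>k\<close>.\<close>

lemma sheets_disjoint:
  assumes v: "valid a b x" "valid a b' x'" and eq: "cls a b x = cls a b' x'" "etgt b = etgt b'"
  shows "b = b'"
proof -
  note V = validD[OF v(1)] validD[OF v(2)]
  obtain k l z where k: "k \<in> embs A" "l \<in> embs A" "esrc k = esrc l" "etgt k = esrc a" "etgt l = esrc a" "z \<in> Dom A (esrc k)"
    "a \<cdot> k = a \<cdot> l" "b \<cdot> k = b' \<cdot> l" "emap k z = x" "emap l z = x'"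
    by (rule cls_eqE[OF eq(1) v(1)])
  have "k = l" by (rule emb_cancel_left[OF V(1) k(1,2,4,5,7)])
  then have "b \<cdot> k = b' \<cdot> k" using k(8) by simp
  then show ?thesis by (intro emb_cancel_right[of b b' k]) (use V k in auto)
qed

text \<open>Arrows with different endpoints are separated in the base. Arrows with the same endpoints lie in the
  sheets of \<open>(a, b)\<close> and \<open>(a, g \<circ> b)\<close>, which are disjoint unless \<open>b = g \<circ> b\<close>.\<close>

lemma Hausdorff_R: "Hausdorff_space (mtop (R_mfd A))"
  unfolding Hausdorff_space_def
proof (intro allI impI)
  let ?R = "mtop (R_mfd A)"
  fix c c' assume cc: "c \<in> pts (R_mfd A) \<and> c' \<in> pts (R_mfd A) \<and> c \<noteq> c'"
  have sep: "\<exists>S T. openin ?R S \<and> openin ?R T \<and> c \<in> S \<and> c' \<in> T \<and> disjnt S T"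
    if h: "continuous_map ?R (mtop (U_mfd A)) h" and ne: "h c \<noteq> h c'" for h
  proof -
    have "h c \<in> pts (U_mfd A)" "h c' \<in> pts (U_mfd A)" using h cc by (auto simp: continuous_map_def)
    then obtain S T where S: "openin (mtop (U_mfd A)) S" "openin (mtop (U_mfd A)) T" "h c \<in> S" "h c' \<in> T" "disjnt S T"
      using Hausdorff_U ne unfolding Hausdorff_space_def by metis
    have o: "openin ?R {r \<in> pts (R_mfd A). h r \<in> S}" "openin ?R {r \<in> pts (R_mfd A). h r \<in> T}"
      using openin_continuous_map_preimage[OF h] S(1,2) by blast+
    have dis: "disjnt {r \<in> pts (R_mfd A). h r \<in> S} {r \<in> pts (R_mfd A). h r \<in> T}"
      using S(5) unfolding disjnt_def by blast
    show ?thesis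
      by (rule exI[of _ "{r \<in> pts (R_mfd A). h r \<in> S}"], rule exI[of _ "{r \<in> pts (R_mfd A). h r \<in> T}"])
        (intro conjI o CollectI S(3,4) conjunct1[OF cc] conjunct1[OF conjunct2[OF cc]] dis)
  qed
  show "\<exists>S T. openin ?R S \<and> openin ?R T \<and> c \<in> S \<and> c' \<in> T \<and> disjnt S T"
  proof (cases "R_s A c = R_s A c' \<and> R_t A c = R_t A c'")
    case False
    then show ?thesis using sep endpoints_continuous by blast
  next
    case True
    obtain a b z where c: "valid a b z" "c = cls a b z" using cc pts_RE by metis
    note V = validD[OF c(1)]
    have "R_s A (cls a b z) = R_s A c'" "R_t A (cls a b z) = R_t A c'" using True unfolding c(2) by blast+
    then have "R_s A c' = (etgt a, emap a z)" "R_t A c' = (etgt b, emap b z)" using c(1) by simp_all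
    then have c': "c' \<in> pts (R_mfd A)" "R_s A c' = (etgt a, emap a z)" "fst (R_t A c') = etgt b"
      using cc by simp_all
    obtain g where g: "g \<in> grp (etgt b)" "c' = cls a (gemb (etgt b) g \<cdot> b) z"
      by (rule arrow_over_chart[OF c(1) c'])
    let ?b = "gemb (etgt b) g \<cdot> b"
    have b: "?b \<in> embs A" "esrc a = esrc ?b" "etgt b = etgt ?b" using g V emb(2)[OF V(2)] by auto
    have ne: "b \<noteq> ?b"
    proof
      assume "b = ?b"
      then have "c = c'" using c(2) g(2) by metis
      then show False using cc by blast
    qed
    have ab: "esrc a = esrc b" using V by simp
    have "disjnt (sheet a b (Dom A (esrc a))) (sheet a ?b (Dom A (esrc a)))"
    proof (rule ccontr)
      assume "\<not> disjnt (sheet a b (Dom A (esrc a))) (sheet a ?b (Dom A (esrc a)))"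
      then obtain x x' where x: "x \<in> Dom A (esrc a)" "x' \<in> Dom A (esrc a)" "cls a b x = cls a ?b x'"
        by (auto simp: disjnt_iff sheet_def)
      have "valid a b x" "valid a ?b x'"
        by (rule validI[OF V(1,2) ab x(1)], rule validI[OF V(1) b(1,2) x(2)])
      then show False using sheets_disjoint[OF _ _ x(3) b(3)] ne by blast
    qed
    moreover have "c \<in> sheet a b (Dom A (esrc a))" "c' \<in> sheet a ?b (Dom A (esrc a))"
      using c g V by (auto simp: sheet_def)
    ultimately show ?thesis using sheet_openin[OF V(1,2) ab] sheet_openin[OF V(1) b(1,2)] by blast
  qed
qed

lemma locally_compact_R: "locally_compact_space (mtop (R_mfd A))"
  unfolding locally_compact_space_def
proof
  let ?R = "mtop (R_mfd A)"
  fix c assume "c \<in> pts (R_mfd A)"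
  then obtain a b z where c: "valid a b z" "c = cls a b z" by (rule pts_RE)
  note V = validD[OF c(1)] have ab: "esrc a = esrc b" using V by simp
  let ?S = "sheet a b (Dom A (esrc a))"
  have i: "esrc a \<in> idx A" using emb(1)[OF V(1)] .
  have S: "openin ?R ?S" by (rule sheet_openin[OF V(1,2) ab])
  have "regular_space (top_of_set (Cn (cdim A)))" by (rule regular_space_subtopology[OF regular_space_euclidean])
  then have "locally_compact_space (subtopology (top_of_set (Cn (cdim A))) (Dom A (esrc a)))"
    using locally_compact_space_open_subset[OF _ locally_compact_Cn dom(1)[OF i]] by blast
  then have "locally_compact_space (top_of_set (Dom A (esrc a)))"
    using dom(2)[OF i] by (simp add: subtopology_subtopology Int_absorb1)
  then have lc: "locally_compact_space (subtopology ?R ?S)"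
    using homeomorphic_locally_compact_space[OF homeomorphic_maps_imp_homeomorphic_space[OF sheet_homeomorphic[OF V(1,2) ab]]] by simp
  have "c \<in> topspace (subtopology ?R ?S)" using c V by (auto simp: sheet_def)
  then obtain N K where "openin (subtopology ?R ?S) N" "compactin (subtopology ?R ?S) K" "c \<in> N" "N \<subseteq> K"
    using lc unfolding locally_compact_space_def by blast
  then show "\<exists>U K. openin ?R U \<and> compactin ?R K \<and> c \<in> U \<and> U \<subseteq> K"
    using S openin_trans_full compactin_subtopology by metis
qed

lemma regular_R: "regular_space (mtop (R_mfd A))"
  by (rule locally_compact_Hausdorff_imp_regular_space[OF locally_compact_R Hausdorff_R])

text \<open>The indices of the two endpoints split \<open>R\<close> into open pieces. Each piece is a Lindelof space, as the
  preimage of a second countable space under a proper map, and regular, as \<open>R\<close> is locally compact and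
  Hausdorff.\<close>

lemma paracompact_R: "paracompact_space (mtop (R_mfd A))"
proof (rule paracompact_space_clopen_partition[of _ "\<lambda>c. (fst (R_s A c), fst (R_t A c))"])
  let ?R = "mtop (R_mfd A)" and ?U = "mtop (U_mfd A)" and ?f = "\<lambda>c. (R_s A c, R_t A c)"
  fix p :: "'i \<times> 'i"
  obtain i j where p: "p = (i, j)" by (cases p)
  let ?P = "{c \<in> pts (R_mfd A). (fst (R_s A c), fst (R_t A c)) = p}"
  show "openin ?R ?P" and "paracompact_space (subtopology ?R ?P)"
  proof -
    consider "?P = {}" | "i \<in> idx A" "j \<in> idx A"
    proof -
      have "i \<in> idx A \<and> j \<in> idx A" if "c \<in> ?P" for c
        using that endpoints_project(1,2)[of c i "snd (R_s A c)" j "snd (R_t A c)"] p by auto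
      then show ?thesis using that by blast
    qed
    then have "openin ?R ?P \<and> paracompact_space (subtopology ?R ?P)"
    proof cases
      case 1
      show ?thesis unfolding 1 by (simp add: paracompact_empty)
    next
      case 2
      let ?I = "{i} \<times> Dom A i" and ?J = "{j} \<times> Dom A j"
      have P: "?P = {c \<in> pts (R_mfd A). ?f c \<in> ?I \<times> ?J}"
      proof -
        have "?f c \<in> ?I \<times> ?J" if "c \<in> pts (R_mfd A)" "fst (R_s A c) = i" "fst (R_t A c) = j" for c
          using endpoints_project(3,4)[of c i "snd (R_s A c)" j "snd (R_t A c)"] that
          by (cases "R_s A c"; cases "R_t A c") auto
        then show ?thesis unfolding p by auto
      qed
      have cf: "continuous_map ?R (prod_topology ?U ?U) ?f"
        using endpoints_continuous by (simp add: continuous_map_pairwise o_def)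
      have "openin (prod_topology ?U ?U) (?I \<times> ?J)"
        using U_piece_open[OF _ dom(1)] 2 by (simp add: openin_prod_Times_iff)
      then have 1: "openin ?R ?P" unfolding P by (rule openin_continuous_map_preimage[OF cf])
      have "second_countable (prod_topology (subtopology ?U ?I) (subtopology ?U ?J))"
        by (rule second_countable_prod_topology[OF second_countable_piece[OF 2(1)] second_countable_piece[OF 2(2)]])
      then have "Lindelof_space (subtopology (prod_topology ?U ?U) (?I \<times> ?J))"
        unfolding subtopology_Times by (rule second_countable_imp_Lindelof_space)
      then have "Lindelof_space (subtopology ?R ?P)"
        by (rule Lindelof_space_proper_map_preimage[OF proper_map_restriction[OF proper_endpoints P[symmetric]]])
      then show ?thesis using 1 regular_Lindelof_imp_paracompact[OF regular_space_subtopology[OF regular_R]] by blast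
    qed
    then show "openin ?R ?P" "paracompact_space (subtopology ?R ?P)" by blast+
  qed
qed

lemma manifold_R: "complex_manifold (R_mfd A)"
  using holo_atlas_R Hausdorff_R paracompact_R by (simp add: complex_manifold_iff)

lemma F_obj_simps [simp]:
  "Arr (F_obj A) = R_mfd A" "Base (F_obj A) = U_mfd A" "gs (F_obj A) = R_s A" "gt (F_obj A) = R_t A"
  "gm (F_obj A) = R_m A" "gi (F_obj A) = R_i A" "ge (F_obj A) = R_e A"
  by (simp_all add: F_obj_def)

text \<open>With two or three composable arrows in normal form, the groupoid laws compare triples literally.\<close>

lemma etale_F_obj: "etale_groupoid (F_obj A)"
  unfolding etale_groupoid_def F_obj_simps
proof (intro conjI ballI impI)
  fix p assume "p \<in> pts (U_mfd A)"
  then obtain i x where p: "p = (i, x)" "i \<in> idx A" "x \<in> Dom A i" by (cases p) (auto simp: pts_U)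
  show "R_s A (R_e A p) = p" "R_t A (R_e A p) = p" using p by simp_all
next
  fix c d assume cd: "c \<in> pts (R_mfd A)" "d \<in> pts (R_mfd A)" "R_t A c = R_s A d"
  obtain p q r z where n: "valid p q z" "valid q r z" "c = cls p q z" "d = cls q r z"
    by (rule composable_normal_form[OF cd])
  have "valid p r z" using n by (auto simp: valid_def)
  then show "R_s A (R_m A (c, d)) = R_s A c" "R_t A (R_m A (c, d)) = R_t A d" using n by simp_all
next
  fix c d e assume cde: "c \<in> pts (R_mfd A)" "d \<in> pts (R_mfd A)" "e \<in> pts (R_mfd A)" "R_t A c = R_s A d \<and> R_t A d = R_s A e"
  obtain p q r u z where n: "valid p q z" "valid q r z" "valid r u z" "c = cls p q z" "d = cls q r z" "e = cls r u z"
    by (rule triple_normal_form[OF cde(1-3)]) (use cde in auto)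
  have "valid p r z" "valid q u z" using n by (auto simp: valid_def)
  then show "R_m A (c, R_m A (d, e)) = R_m A (R_m A (c, d), e)" using n by simp
next
  fix c assume "c \<in> pts (R_mfd A)"
  then obtain a b z where c: "valid a b z" "c = cls a b z" by (rule pts_RE)
  note V = validD[OF c(1)]
  have w: "valid b a z" "valid a a z" "valid b b z" using V by (auto simp: valid_def)
  have unit: "R_e A (etgt l, emap l z) = cls l l z" if l: "valid l l z" for l
  proof -
    note L = validD[OF l]
    have i: "etgt l \<in> idx A" "emap l z \<in> Dom A (etgt l)" using emb(2,4)[OF L(1)] L by auto
    have "R_e A (etgt l, emap l z) = cls (emb_id A (etgt l)) (emb_id A (etgt l)) (emap l z)" using i by simp
    also have "\<dots> = cls (emb_id A (etgt l) \<cdot> l) (emb_id A (etgt l) \<cdot> l) z"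
      by (rule cls_pull[OF valid_id[OF i]]) (use L in auto)
    finally show ?thesis using L by simp
  qed
  show "R_m A (R_e A (R_s A c), c) = c" "R_m A (c, R_e A (R_t A c)) = c" using c w unit by simp_all
  show "R_i A (R_i A c) = c" "R_s A (R_i A c) = R_t A c" "R_t A (R_i A c) = R_s A c" using c w by simp_all
  show "R_m A (c, R_i A c) = R_e A (R_s A c)" "R_m A (R_i A c, c) = R_e A (R_t A c)" using c w unit by simp_all
qed (fact manifold_R manifold_U local_biholomorphism_s local_biholomorphism_t holomorphic_mult holomorphic_inverse holomorphic_unit)+

lemma proper_F_obj: "proper_groupoid (F_obj A)"
  using proper_endpoints by (simp add: proper_groupoid_def)

text \<open>Two arrows with the same endpoints are \<open>[a, z, b]\<close> and \<open>[a, z, b']\<close>, with germs \<open>b \<circ> a\<inverse>\<close> and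
  \<open>b' \<circ> a\<inverse>\<close> at \<open>a z\<close>. If the germs are equal, \<open>b\<close> and \<open>b'\<close> agree near \<open>z\<close>, hence everywhere.\<close>

lemma effective_F_obj: "effective_groupoid (F_obj A)"
  unfolding effective_groupoid_def F_obj_simps
proof (intro ballI inj_onI)
  fix p c c' assume c0: "c \<in> {g \<in> pts (R_mfd A). R_s A g = p \<and> R_t A g = p}" and c0': "c' \<in> {g \<in> pts (R_mfd A). R_s A g = p \<and> R_t A g = p}"
    and germ: "arrow_germ (F_obj A) c = arrow_germ (F_obj A) c'"
  obtain a b z where c: "valid a b z" "c = cls a b z" using c0 pts_RE by (metis (no_types, lifting) mem_Collect_eq)
  note V = validD[OF c(1)] have ab: "esrc a = esrc b" using V by simp
  have st: "etgt a = etgt b" using c c0 by auto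
  have c': "c' \<in> pts (R_mfd A)" "R_s A c' = (etgt a, emap a z)" "fst (R_t A c') = etgt b" using c0 c0' c by auto
  obtain g where g: "g \<in> grp (etgt b)" "c' = cls a (gemb (etgt b) g \<cdot> b) z"
    by (rule arrow_over_chart[OF c(1) c'])
  define b' where "b' = gemb (etgt b) g \<cdot> b"
  have b': "b' \<in> embs A" "esrc a = esrc b'" "etgt b' = etgt b" "c' = cls a b' z"
    using g V emb(2)[OF V(2)] by (auto simp: b'_def)
  let ?D = "Dom A (esrc a)"
  have val: "valid a b w" "valid a b' w" if "w \<in> ?D" for w using that V b' ab by (auto simp: valid_def)
  let ?W = "sheet a b ?D"
  \<comment> \<open>the representative of the germ of \<open>c\<close> that the sheet of \<open>(a, b)\<close> defines\<close>
  define \<tau> where "\<tau> y = R_t A (inv_into ?W (R_s A) y)" for y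
  have injs: "inj_on (R_s A) ?W" and injt: "inj_on (R_t A) ?W"
  proof -
    show "inj_on (R_s A) ?W"
    proof (rule inj_onI)
      fix r r' assume "r \<in> ?W" "r' \<in> ?W" and eq: "R_s A r = R_s A r'"
      then obtain w w' where w: "w \<in> ?D" "w' \<in> ?D" "r = cls a b w" "r' = cls a b w'" by (auto simp: sheet_def)
      then show "r = r'" using eq val emb(8)[OF V(1)] by (auto dest: inj_onD)
    qed
    show "inj_on (R_t A) ?W"
    proof (rule inj_onI)
      fix r r' assume "r \<in> ?W" "r' \<in> ?W" and eq: "R_t A r = R_t A r'"
      then obtain w w' where w: "w \<in> ?D" "w' \<in> ?D" "r = cls a b w" "r' = cls a b w'" by (auto simp: sheet_def)
      then show "r = r'" using eq val emb(8)[OF V(2)] ab by (auto dest: inj_onD)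
    qed
  qed
  have sW: "R_s A ` ?W = {etgt a} \<times> emap a ` ?D"
  proof -
    have "R_s A ` ?W = (\<lambda>w. (etgt a, emap a w)) ` ?D"
      unfolding sheet_def image_image by (intro image_cong refl R_s_cls val)
    then show ?thesis by auto
  qed
  have "openin (mtop (U_mfd A)) (R_s A ` ?W)"
    unfolding sW by (rule U_piece_open[OF emb(2)[OF V(1)] emb(9)[OF V(1)]]) (use emb(4)[OF V(1)] in auto)
  moreover have cW: "c \<in> ?W" using c V by (simp add: sheet_def)
  ultimately have "\<tau> \<in> arrow_germ (F_obj A) c"
    unfolding arrow_germ_def F_obj_simps using sheet_openin[OF V(1,2) ab] injs injt
    by (intro CollectI exI[of _ ?W] exI[of _ "R_s A ` ?W"]) (simp add: \<tau>_def)
  then have "\<tau> \<in> arrow_germ (F_obj A) c'" using germ by simp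
  then obtain W N where W: "openin (mtop (R_mfd A)) W" "c' \<in> W" "inj_on (R_s A) W"
    and N: "openin (mtop (U_mfd A)) N" "R_s A c' \<in> N" "\<forall>y\<in>N. \<tau> y = R_t A (inv_into W (R_s A) y)"
    unfolding arrow_germ_def F_obj_simps by blast
  let ?S = "{w \<in> ?D. cls a b' w \<in> W} \<inter> {w \<in> ?D. emap a w \<in> {y \<in> Dom A (etgt a). (etgt a, y) \<in> N}}"
  have oN: "Cn_open (cdim A) {y \<in> Dom A (etgt a). (etgt a, y) \<in> N}"
    using N(1) emb(2)[OF V(1)] by (simp add: U_open_iff)
  have oS: "Cn_open (cdim A) ?S"
    by (intro openin_Int R_openD[OF W(1) V(1) b'(1,2)] emb_preimage_open[OF V(1) oN])
  have zS: "z \<in> ?S" using W(2) N(2) b' c'(2) V emb(4)[OF V(1)] by auto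
  have "emap b w = emap b' w" if w: "w \<in> ?S" for w
  proof -
    let ?y = "(etgt a, emap a w)"
    have wD: "w \<in> ?D" and yN: "?y \<in> N" and wW: "cls a b' w \<in> W" using w by auto
    note vw = val[OF wD]
    have "inv_into ?W (R_s A) (R_s A (cls a b w)) = cls a b w"
      by (rule inv_into_f_f[OF injs]) (use wD in \<open>simp add: sheet_def\<close>)
    then have "\<tau> ?y = (etgt b, emap b w)" using vw by (simp add: \<tau>_def)
    moreover have "inv_into W (R_s A) (R_s A (cls a b' w)) = cls a b' w"
      by (rule inv_into_f_f[OF W(3) wW])
    then have "R_t A (inv_into W (R_s A) ?y) = (etgt b', emap b' w)" using vw by simp
    ultimately show ?thesis using N(3) yN by auto
  qed
  then have "b = b'"
    by (intro embeddings_eq_if_agree_on_open[OF V(2) b'(1) _ _ oS]) (use zS ab b' in auto)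
  then show "c = c'" using c b' by simp
qed

lemma F_obj_in_Grp: "F_obj A \<in> Obj Grp"
  using etale_F_obj proper_F_obj effective_F_obj by (simp add: Grp_simps)

end

section \<open>Compatible systems and their natural transformations\<close>

lemma F_mor_base [simp]: "i \<in> idx A \<Longrightarrow> x \<in> Dom A i \<Longrightarrow> fst (F_mor A B f) (i, x) = (fobj f i, lift f i x)"
  by (simp add: F_mor_def U_mfd_def)

locale comp_sys = A: orb A + B: orb B for A B :: "('x, 'i) atlas" +
  fixes f :: "('x, 'i) comp_sys"
  assumes compatible: "compatible_system A B f"
begin

lemmas compat = compatible_systemD[OF compatible]

lemma valid_image [simp]:
  assumes "A.valid a b x"
  shows "B.valid (fmor f a) (fmor f b) (lift f (esrc a) x)"
  using A.validD[OF assms] compat(4,7,15) A.emb(1) by (auto simp: B.valid_def)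

text \<open>Functoriality on embeddings and compatibility of the liftings turn a restriction along \<open>k\<close> into a
  restriction along the image of \<open>k\<close>.\<close>

lemma Psi_cls [simp]:
  assumes v: "A.valid a b x"
  shows "snd (F_mor A B f) (A.cls a b x) = B.cls (fmor f a) (fmor f b) (lift f (esrc a) x)"
proof -
  let ?h = "\<lambda>((a, b), x). R_class B ((fmor f a, fmor f b), lift f (esrc a) x)"
  have "on_classes A ?h (A.cls a b x) = ?h ((a, b), x)"
  proof (rule A.on_classes_cls[OF _ v])
    fix a b k z assume k: "a \<in> embs A" "b \<in> embs A" "esrc a = esrc b" "k \<in> embs A" "etgt k = esrc a" "z \<in> Dom A (esrc k)"
    have i: "esrc k \<in> idx A" "lift f (esrc k) z \<in> Dom B (fobj f (esrc k))" using A.emb(1)[OF k(4)] compat(15) k by auto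
    have vab: "A.valid a b (emap k z)" using k A.emb(4)[OF k(4,6)] by (simp add: A.valid_def)
    have "B.cls (fmor f a) (fmor f b) (lift f (esrc a) (emap k z)) =
        B.cls (emb_comp B (fmor f a) (fmor f k)) (emb_comp B (fmor f b) (fmor f k)) (lift f (esrc k) z)"
      by (rule B.cls_pull[OF valid_image[OF vab] compat(4)[OF k(4)]])
        (use k i compat(7,8) compat(17)[OF k(4,6)] in simp_all)
    also have "\<dots> = B.cls (fmor f (emb_comp A a k)) (fmor f (emb_comp A b k)) (lift f (esrc k) z)"
      using k compat(10) by simp
    finally show "?h ((emb_comp A a k, emb_comp A b k), z) = ?h ((a, b), emap k z)" by (simp add: B.cls_def)
  qed
  then show ?thesis by (simp add: F_mor_def B.cls_def)
qed

lemma hol_lift: "i \<in> idx A \<Longrightarrow> x \<in> Dom A i \<Longrightarrow> hol_at (cdim A) (lift f i) x"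
  by (rule hol_at_lift[OF A.atlas compatible])

lemma psi_holomorphic: "fst (F_mor A B f) \<in> holomorphic_maps (U_mfd A) (U_mfd B)"
proof (rule holomorphic_mapsI[OF A.holo_atlas_U B.holo_atlas_U])
  fix p assume "p \<in> pts (U_mfd A)"
  then obtain i x where p: "p = (i, x)" "i \<in> idx A" "x \<in> Dom A i" by (cases p) (auto simp: A.pts_U)
  show "hol_near (U_mfd A) (U_mfd B) (fst (F_mor A B f)) p"
  proof (rule hol_nearI[OF _ _ A.U_piece_open[OF p(2) A.dom(1)[OF p(2)] order_refl], where W = "{i} \<times> Dom A i" and \<phi> = snd
        and W' = "{fobj f i} \<times> Dom B (fobj f i)" and \<phi>' = snd and F = "lift f i"])
    show "({i} \<times> Dom A i, snd) \<in> mcharts (U_mfd A)" unfolding A.U_charts using p by blast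
    show "({fobj f i} \<times> Dom B (fobj f i), snd) \<in> mcharts (U_mfd B)" unfolding B.U_charts using compat(3)[OF p(2)] by blast
  qed (use p compat(15) hol_lift in auto)
qed (auto simp: F_mor_def)

lemma Psi_holomorphic: "snd (F_mor A B f) \<in> holomorphic_maps (R_mfd A) (R_mfd B)"
proof (rule holomorphic_mapsI[OF A.holo_atlas_R B.holo_atlas_R])
  fix c assume "c \<in> pts (R_mfd A)"
  then obtain a b x where c: "A.valid a b x" "c = A.cls a b x" by (rule A.pts_RE)
  note v = A.validD[OF c(1)] have ab: "esrc a = esrc b" using v by simp
  have fab: "fmor f a \<in> embs B" "fmor f b \<in> embs B" "esrc (fmor f a) = esrc (fmor f b)" using v compat(4,7) by auto
  show "hol_near (R_mfd A) (R_mfd B) (snd (F_mor A B f)) c"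
  proof (rule hol_nearI[OF A.sheet_chart[OF v(1,2) ab] B.sheet_chart[OF fab] A.sheet_openin[OF v(1,2) ab], where F = "lift f (esrc a)"])
    show "c \<in> A.sheet a b (Dom A (esrc a))" using c v by (simp add: A.sheet_def)
    fix r assume "r \<in> A.sheet a b (Dom A (esrc a))"
    then obtain y where y: "y \<in> Dom A (esrc a)" "r = A.cls a b y" by (auto simp: A.sheet_def)
    have vy: "A.valid a b y" using v(1,2) ab y(1) by (simp add: A.valid_def)
    have fy: "lift f (esrc a) y \<in> Dom B (esrc (fmor f a))" using compat(7,15) y(1) v A.emb(1) by simp
    show "snd (F_mor A B f) r \<in> B.sheet (fmor f a) (fmor f b) (Dom B (esrc (fmor f a)))"
      using vy y fy by (simp add: B.sheet_def)
    show "B.coord (fmor f a) (fmor f b) (snd (F_mor A B f) r) = lift f (esrc a) (A.coord a b r)"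
      using vy y by simp
    show "hol_at (mdim (R_mfd A)) (lift f (esrc a)) (A.coord a b r)"
      using vy y hol_lift A.emb(1)[OF v(1)] by simp
  qed simp
qed (simp add: F_mor_def on_classes_def)

lemma morphism_F_mor: "groupoid_morphism (F_obj A) (F_obj B) (F_mor A B f)"
proof -
  let ?\<psi> = "fst (F_mor A B f)" and ?\<Psi> = "snd (F_mor A B f)"
  have "groupoid_morphism (F_obj A) (F_obj B) (?\<psi>, ?\<Psi>)"
    unfolding groupoid_morphism_def prod.case A.F_obj_simps B.F_obj_simps
  proof (intro conjI ballI impI psi_holomorphic Psi_holomorphic)
    fix c assume "c \<in> pts (R_mfd A)"
    then obtain a b x where c: "A.valid a b x" "c = A.cls a b x" by (rule A.pts_RE)
    note v = A.validD[OF c(1)]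
    have i: "etgt a \<in> idx A" "etgt b \<in> idx A" "emap a x \<in> Dom A (etgt a)" "emap b x \<in> Dom A (etgt b)"
      using A.emb(2,4)[OF v(1)] A.emb(2,4)[OF v(2)] v by auto
    have vb: "B.valid (fmor f a) (fmor f b) (lift f (esrc a) x)" by (rule valid_image[OF c(1)])
    show "R_s B (?\<Psi> c) = ?\<psi> (R_s A c)" using c vb i compat(8,17) v by simp
    show "R_t B (?\<Psi> c) = ?\<psi> (R_t A c)" using c vb i compat(8) compat(17)[OF v(2), of x] v by simp
    show "?\<Psi> (R_i A c) = R_i B (?\<Psi> c)" using c vb A.valid_swap[OF c(1)] v by simp
  next
    fix p assume "p \<in> pts (U_mfd A)"
    then obtain i x where p: "p = (i, x)" "i \<in> idx A" "x \<in> Dom A i" by (cases p) (auto simp: A.pts_U)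
    then show "?\<Psi> (R_e A p) = R_e B (?\<psi> p)" using compat(3,9,15) by simp
  next
    fix c d assume cd: "c \<in> pts (R_mfd A)" "d \<in> pts (R_mfd A)" "R_t A c = R_s A d"
    obtain p q r z where n: "A.valid p q z" "A.valid q r z" "c = A.cls p q z" "d = A.cls q r z"
      by (rule A.composable_normal_form[OF cd])
    have pr: "A.valid p r z" and s: "esrc q = esrc p" using n by (auto simp: A.valid_def)
    have "B.valid (fmor f p) (fmor f q) (lift f (esrc p) z)" "B.valid (fmor f q) (fmor f r) (lift f (esrc p) z)"
      using valid_image[OF n(1)] valid_image[OF n(2)] s by simp_all
    then show "?\<Psi> (R_m A (c, d)) = R_m B (?\<Psi> c, ?\<Psi> d)" using n pr s by simp
  qed
  then show ?thesis by simp
qed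

end

locale comp_sys_cell = f1: comp_sys A B f1 + f2: comp_sys A B f2
  for A B :: "('x, 'i) atlas" and f1 f2 +
  fixes \<delta> :: "'i \<Rightarrow> 'i emb"
  assumes nat: "cs_nat_trans A B f1 f2 \<delta>"
begin

lemmas natural = cs_nat_transD[OF nat]

lemma valid_cell:
  assumes "i \<in> idx A" "x \<in> Dom A i"
  shows "f1.B.valid (emb_id B (fobj f1 i)) (\<delta> i) (lift f1 i x)"
  using assms natural(3,4) f1.compat(3,15) by (simp add: f1.B.valid_def)

lemma alpha_eq: "i \<in> idx A \<Longrightarrow> x \<in> Dom A i \<Longrightarrow>
    F_cell A B f1 f2 \<delta> (i, x) = f1.B.cls (emb_id B (fobj f1 i)) (\<delta> i) (lift f1 i x)"
  by (simp add: F_cell_def f1.A.pts_U f1.B.cls_def)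

lemma alpha_holomorphic: "F_cell A B f1 f2 \<delta> \<in> holomorphic_maps (U_mfd A) (R_mfd B)"
proof (rule holomorphic_mapsI[OF f1.A.holo_atlas_U f1.B.holo_atlas_R])
  fix p assume "p \<in> pts (U_mfd A)"
  then obtain i x where p: "p = (i, x)" "i \<in> idx A" "x \<in> Dom A i" by (cases p) (auto simp: f1.A.pts_U)
  let ?I = "emb_id B (fobj f1 i)"
  have j: "fobj f1 i \<in> idx B" using f1.compat(3) p by simp
  have I: "?I \<in> embs B" "\<delta> i \<in> embs B" "esrc ?I = esrc (\<delta> i)" using j p natural(1-7) by auto
  show "hol_near (U_mfd A) (R_mfd B) (F_cell A B f1 f2 \<delta>) p"
  proof (rule hol_nearI[OF _ f1.B.sheet_chart[OF I] f1.A.U_piece_open[OF p(2) f1.A.dom(1)[OF p(2)] order_refl],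
        where W = "{i} \<times> Dom A i" and \<phi> = snd and F = "lift f1 i"])
    show "({i} \<times> Dom A i, snd) \<in> mcharts (U_mfd A)" unfolding f1.A.U_charts using p by blast
    fix v assume "v \<in> {i} \<times> Dom A i"
    then obtain y where y: "v = (i, y)" "y \<in> Dom A i" by blast
    have vy: "f1.B.valid ?I (\<delta> i) (lift f1 i y)" by (rule valid_cell[OF p(2) y(2)])
    show "F_cell A B f1 f2 \<delta> v \<in> f1.B.sheet ?I (\<delta> i) (Dom B (esrc ?I))"
      using y p alpha_eq f1.compat(15) by (simp add: f1.B.sheet_def)
    show "f1.B.coord ?I (\<delta> i) (F_cell A B f1 f2 \<delta> v) = lift f1 i (snd v)"
      using y p vy by (simp add: alpha_eq)
    show "hol_at (mdim (U_mfd A)) (lift f1 i) (snd v)" using y p f1.hol_lift by simp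
  qed (use p in auto)
qed (auto simp: F_cell_def)

text \<open>For an arrow \<open>[a, z, b]\<close> with \<open>k\<close> the index of its source, all four sides of the naturality square are
  restricted to the lifting of \<open>z\<close> under \<open>f1\<close>; both composites are then
  \<open>[f1 a, f1 z, f2 b \<circ> \<delta> k]\<close>.\<close>

lemma nat_trans_F_cell: "groupoid_nat_trans (F_obj A) (F_obj B) (F_mor A B f1) (F_mor A B f2) (F_cell A B f1 f2 \<delta>)"
proof -
  let ?\<alpha> = "F_cell A B f1 f2 \<delta>"
  have "groupoid_nat_trans (F_obj A) (F_obj B) (fst (F_mor A B f1), snd (F_mor A B f1)) (fst (F_mor A B f2), snd (F_mor A B f2)) ?\<alpha>"
    unfolding groupoid_nat_trans_def prod.case f1.A.F_obj_simps f1.B.F_obj_simps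
  proof (intro conjI ballI alpha_holomorphic)
    fix p assume "p \<in> pts (U_mfd A)"
    then obtain i x where p: "p = (i, x)" "i \<in> idx A" "x \<in> Dom A i" by (cases p) (auto simp: f1.A.pts_U)
    note v = valid_cell[OF p(2,3)]
    show "R_s B (?\<alpha> p) = fst (F_mor A B f1) p" using p v f1.compat(15) by (simp add: alpha_eq)
    show "R_t B (?\<alpha> p) = fst (F_mor A B f2) p" using p v natural(5,6) by (simp add: alpha_eq)
  next
    fix c assume "c \<in> pts (R_mfd A)"
    then obtain a b z where c: "f1.A.valid a b z" "c = f1.A.cls a b z" by (rule f1.A.pts_RE)
    note v = f1.A.validD[OF c(1)]
    let ?k = "esrc a" let ?z = "lift f1 ?k z"
    have i: "etgt a \<in> idx A" "etgt b \<in> idx A" "emap a z \<in> Dom A (etgt a)" "emap b z \<in> Dom A (etgt b)" "?k \<in> idx A"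
      using f1.A.emb(1,2,4)[OF v(1)] f1.A.emb(2,4)[OF v(2)] v by auto
    let ?a1 = "fmor f1 a" and ?b1 = "fmor f1 b" and ?a2 = "fmor f2 a" and ?b2 = "fmor f2 b" and ?d = "\<delta> ?k"
    have m: "?a1 \<in> embs B" "?b1 \<in> embs B" "?a2 \<in> embs B" "?b2 \<in> embs B" "?d \<in> embs B"
      "esrc ?a1 = fobj f1 ?k" "esrc ?b1 = fobj f1 ?k" "esrc ?a2 = fobj f2 ?k" "esrc ?b2 = fobj f2 ?k" "esrc ?d = fobj f1 ?k" "etgt ?d = fobj f2 ?k"
      "etgt ?a1 = fobj f1 (etgt a)" "etgt ?b1 = fobj f1 (etgt b)" "\<delta> (etgt a) \<in> embs B" "\<delta> (etgt b) \<in> embs B"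
      "esrc (\<delta> (etgt a)) = fobj f1 (etgt a)" "esrc (\<delta> (etgt b)) = fobj f1 (etgt b)"
      using v f1.compat(4,7,8) f2.compat(4,7,8) natural(3-5) i by auto
    have z: "?z \<in> Dom B (fobj f1 ?k)" using f1.compat(15) i v by simp
    have n: "emb_comp B ?a2 ?d = emb_comp B (\<delta> (etgt a)) ?a1" "emb_comp B ?b2 ?d = emb_comp B (\<delta> (etgt b)) ?b1"
      using natural(7)[OF v(1)] natural(7)[OF v(2)] v by simp_all
    have z2: "lift f2 ?k z = emap ?d ?z" using natural(6) i v by simp
    have l1: "lift f1 (etgt a) (emap a z) = emap ?a1 ?z" "lift f1 (etgt b) (emap b z) = emap ?b1 ?z"
      using f1.compat(17)[OF v(1), of z] f1.compat(17)[OF v(2), of z] v by simp_all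
    have e1: "?\<alpha> (R_s A c) = f1.B.cls ?a1 (emb_comp B ?a2 ?d) ?z"
    proof -
      have "?\<alpha> (R_s A c) = f1.B.cls (emb_id B (fobj f1 (etgt a))) (\<delta> (etgt a)) (emap ?a1 ?z)"
        using c i by (simp add: alpha_eq l1)
      also have "\<dots> = f1.B.cls (emb_comp B (emb_id B (fobj f1 (etgt a))) ?a1) (emb_comp B (\<delta> (etgt a)) ?a1) ?z"
        by (rule f1.B.cls_pull[OF valid_cell[OF i(1,3), unfolded l1] m(1)]) (use m z in simp_all)
      finally show ?thesis using m n by simp
    qed
    have e2: "?\<alpha> (R_t A c) = f1.B.cls ?b1 (emb_comp B ?b2 ?d) ?z"
    proof -
      have "?\<alpha> (R_t A c) = f1.B.cls (emb_id B (fobj f1 (etgt b))) (\<delta> (etgt b)) (emap ?b1 ?z)"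
        using c i by (simp add: alpha_eq l1)
      also have "\<dots> = f1.B.cls (emb_comp B (emb_id B (fobj f1 (etgt b))) ?b1) (emb_comp B (\<delta> (etgt b)) ?b1) ?z"
        by (rule f1.B.cls_pull[OF valid_cell[OF i(2,4), unfolded l1] m(2)]) (use m z in simp_all)
      finally show ?thesis using m n by simp
    qed
    have e3: "snd (F_mor A B f2) c = f1.B.cls (emb_comp B ?a2 ?d) (emb_comp B ?b2 ?d) ?z"
    proof -
      have "snd (F_mor A B f2) c = f1.B.cls ?a2 ?b2 (emap ?d ?z)" using c z2 by simp
      also have "\<dots> = f1.B.cls (emb_comp B ?a2 ?d) (emb_comp B ?b2 ?d) ?z"
        by (rule f1.B.cls_pull[OF f2.valid_image[OF c(1), unfolded z2] m(5)]) (use m z in simp_all)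
      finally show ?thesis .
    qed
    have e4: "snd (F_mor A B f1) c = f1.B.cls ?a1 ?b1 ?z" using c by simp
    show "R_m B (?\<alpha> (R_s A c), snd (F_mor A B f2) c) = R_m B (snd (F_mor A B f1) c, ?\<alpha> (R_t A c))"
      unfolding e1 e2 e3 e4
      by (subst f1.B.R_m_cls, use m z in \<open>simp add: f1.B.valid_def\<close>, use m z in \<open>simp add: f1.B.valid_def\<close>)+ simp
  qed
  then show ?thesis by simp
qed

end

text \<open>Maps into and between these manifolds are extensional, so it suffices to compare them on points
  \<open>(i, x)\<close> and on arrows \<open>[a, x, b]\<close>.\<close>

lemma F_mor_eqI:
  assumes "p \<in> holomorphic_maps (U_mfd A) M \<times> holomorphic_maps (R_mfd A) M'"
    "q \<in> holomorphic_maps (U_mfd A) M \<times> holomorphic_maps (R_mfd A) M'" and orb: "orb A"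
    and "\<And>i x. i \<in> idx A \<Longrightarrow> x \<in> Dom A i \<Longrightarrow> fst p (i, x) = fst q (i, x)"
    and "\<And>a b x. orb.valid A a b x \<Longrightarrow> snd p (orb.cls A a b x) = snd q (orb.cls A a b x)"
  shows "p = q"
proof -
  interpret orb A by fact
  have "fst p = fst q"
    by (rule holomorphic_maps_ext[of _ "U_mfd A" M]) (use assms in \<open>auto simp: pts_U\<close>)
  moreover have "snd p = snd q"
    by (rule holomorphic_maps_ext[of _ "R_mfd A" M']) (use assms in \<open>auto simp: pts_R\<close>)
  ultimately show ?thesis by (simp add: prod_eq_iff)
qed

theorem theorem3p19:
  shows "strict_two_functor
           (PreOrb :: (('x, 'i) atlas, ('x, 'i) comp_sys, 'i \<Rightarrow> 'i emb) two_cat)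
           (Grp :: (('i rpoint set, 'i \<times> cvec) groupoid,
                    ('i \<times> cvec \<Rightarrow> 'i \<times> cvec) \<times> ('i rpoint set \<Rightarrow> 'i rpoint set),
                    'i \<times> cvec \<Rightarrow> 'i rpoint set) two_cat)
           F_obj F_mor F_cell"
proof -
  interpret C: strict_two_category "PreOrb :: (('x, 'i) atlas, ('x, 'i) comp_sys, 'i \<Rightarrow> 'i emb) two_cat"
    by (rule strict_two_category_PreOrb)
  interpret D: strict_two_category "Grp :: (('i rpoint set, 'i \<times> cvec) groupoid,
                    ('i \<times> cvec \<Rightarrow> 'i \<times> cvec) \<times> ('i rpoint set \<Rightarrow> 'i rpoint set),
                    'i \<times> cvec \<Rightarrow> 'i rpoint set) two_cat"
    by (rule strict_two_category_Grp)
  have orb: "orb X" if "X \<in> Obj PreOrb" for X :: "('x, 'i) atlas"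
    using that by (simp add: PreOrb_simps orb_def)
  have cs: "comp_sys X Y f" if "X \<in> Obj PreOrb" "Y \<in> Obj PreOrb" "f \<in> Hom PreOrb X Y" for X Y :: "('x, 'i) atlas" and f
    using that orb by (auto simp: PreOrb_simps comp_sys_def comp_sys_axioms_def)
  have cell: "comp_sys_cell X Y f g \<sigma>"
    if "X \<in> Obj PreOrb" "Y \<in> Obj PreOrb" "f \<in> Hom PreOrb X Y" "g \<in> Hom PreOrb X Y" "\<sigma> \<in> Cell PreOrb X Y f g"
    for X Y :: "('x, 'i) atlas" and f g \<sigma>
    using that(5) cs[OF that(1,2,3)] cs[OF that(1,2,4)]
    by (simp add: PreOrb_simps comp_sys_cell_def comp_sys_cell_axioms_def)
  have pairs: "F_mor X Y f = (fst (F_mor X Y f), snd (F_mor X Y f))" for X Y :: "('x, 'i) atlas" and f by simp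
  show ?thesis
  proof (unfold_locales, goal_cases)
    case (1 X)
    then show ?case by (rule orb.F_obj_in_Grp[OF orb])
  next
    case (2 X Y f)
    then show ?case unfolding Grp_simps by (rule comp_sys.morphism_F_mor[OF cs])
  next
    case (3 X Y f g \<sigma>)
    then show ?case unfolding Grp_simps by (rule comp_sys_cell.nat_trans_F_cell[OF cell])
  next
    case (4 X)
    interpret orb X by (rule orb[OF 4])
    have c: "cs_id X \<in> Hom PreOrb X X" using C.Id1_in[OF 4] by (simp add: PreOrb_simps)
    interpret i: comp_sys X X "cs_id X" by (rule cs[OF 4 4 c])
    show ?case unfolding PreOrb_simps Grp_simps F_obj_simps
      by (rule F_mor_eqI[of _ X "U_mfd X" "R_mfd X"])
        (use i.psi_holomorphic i.Psi_holomorphic holomorphic_maps_id[OF holo_atlas_U] holomorphic_maps_id[OF holo_atlas_R] orb_axioms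
          in \<open>auto simp: mem_Times_iff pts_U valid_def emb(1)\<close>)
  next
    case (5 X Y Z f g)
    interpret f: comp_sys X Y f by (rule cs[OF 5(1,2,4)])
    interpret g: comp_sys Y Z g by (rule cs[OF 5(2,3,5)])
    have c: "cs_comp X g f \<in> Hom PreOrb X Z" using C.Comp_in[OF 5] by (simp add: PreOrb_simps)
    interpret gf: comp_sys X Z "cs_comp X g f" by (rule cs[OF 5(1,3) c])
    show ?case unfolding PreOrb_simps by (subst (2 3) pairs, unfold Grp_simps f.A.F_obj_simps,
        rule F_mor_eqI[of _ X "U_mfd Z" "R_mfd Z"])
      (use gf.psi_holomorphic gf.Psi_holomorphic f.A.orb_axioms
        holomorphic_maps_compose[OF f.A.holo_atlas_U f.B.holo_atlas_U g.B.holo_atlas_U f.psi_holomorphic g.psi_holomorphic]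
        holomorphic_maps_compose[OF f.A.holo_atlas_R f.B.holo_atlas_R g.B.holo_atlas_R f.Psi_holomorphic g.Psi_holomorphic]
        f.compat(3,7,15) f.A.validD(1,2,4) f.A.emb(1)
        in \<open>auto simp: mem_Times_iff f.A.pts_U compose_eq\<close>)
  next
    case (6 X Y f)
    interpret f: comp_sys X Y f by (rule cs[OF 6])
    interpret i: comp_sys_cell X Y f f "Id2 PreOrb X Y f" by (rule cell[OF 6 6(3) C.Id2_in[OF 6]])
    have "F_cell X Y f f (Id2 PreOrb X Y f) p = R_e Y (fst (F_mor X Y f) p)" if "p \<in> pts (U_mfd X)" for p
      using that f.compat(3,15) by (cases p) (simp add: i.alpha_eq f.A.pts_U, simp add: PreOrb_simps)
    then show ?case
      by (subst pairs, unfold Grp_simps f.A.F_obj_simps f.B.F_obj_simps)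
        (intro extensionalityI[of _ "pts (U_mfd X)"], use i.alpha_holomorphic in \<open>auto simp: holomorphic_maps_def\<close>)
  next
    case (7 X Y f g h \<sigma> \<tau>)
    interpret s: comp_sys_cell X Y f g \<sigma> by (rule cell[OF 7(1,2,3,4,6)])
    interpret t: comp_sys_cell X Y g h \<tau> by (rule cell[OF 7(1,2,4,5,7)])
    interpret v: comp_sys_cell X Y f h "VComp PreOrb X Y f g h \<tau> \<sigma>"
      by (rule cell[OF 7(1,2,3,5) C.VComp_in[OF 7]])
    have eq: "F_cell X Y f h (VComp PreOrb X Y f g h \<tau> \<sigma>) p = R_m Y (F_cell X Y f g \<sigma> p, F_cell X Y g h \<tau> p)"
      if pU: "p \<in> pts (U_mfd X)" for p
    proof -
      obtain i x where p: "p = (i, x)" "i \<in> idx X" "x \<in> Dom X i" using pU by (cases p) (auto simp: s.f1.A.pts_U)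
      let ?I = "emb_id Y (fobj f i)" and ?z = "lift f i x"
      have z: "?z \<in> Dom Y (fobj f i)" and j: "fobj f i \<in> idx Y" using s.f1.compat(3,15) p by auto
      have e: "lift g i x = emap (\<sigma> i) ?z" using s.natural(6) p by simp
      \<comment> \<open>The second factor is restricted along \<open>\<sigma> i\<close> to the source of the first.\<close>
      have "F_cell X Y g h \<tau> p = s.f1.B.cls (emb_id Y (fobj g i)) (\<tau> i) (emap (\<sigma> i) ?z)"
        using p e by (simp add: t.alpha_eq)
      also have "\<dots> = s.f1.B.cls (emb_comp Y (emb_id Y (fobj g i)) (\<sigma> i)) (emb_comp Y (\<tau> i) (\<sigma> i)) ?z"
        by (rule s.f1.B.cls_pull[OF t.valid_cell[OF p(2,3), unfolded e]]) (use p s.natural(3-5) z in simp_all)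
      finally have t: "F_cell X Y g h \<tau> p = s.f1.B.cls (\<sigma> i) (emb_comp Y (\<tau> i) (\<sigma> i)) ?z"
        using s.natural(3,5) p by simp
      have s: "F_cell X Y f g \<sigma> p = s.f1.B.cls ?I (\<sigma> i) ?z" using p by (simp add: s.alpha_eq)
      have "s.f1.B.valid (\<sigma> i) (emb_comp Y (\<tau> i) (\<sigma> i)) ?z"
        using p s.natural(3-5) t.natural(3,4) z by (simp add: s.f1.B.valid_def)
      then show ?thesis
        unfolding t s using s.valid_cell[OF p(2,3)] p by (simp add: v.alpha_eq) (simp add: PreOrb_simps)
    qed
    show ?case
      unfolding Grp_simps s.f1.A.F_obj_simps s.f1.B.F_obj_simps
      by (intro extensionalityI[of _ "pts (U_mfd X)"])
        (use eq v.alpha_holomorphic in \<open>auto simp: holomorphic_maps_def\<close>)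
  next
    case (8 X Y Z f1 f2 g1 g2 \<delta> \<eta>)
    interpret d: comp_sys_cell X Y f1 f2 \<delta> by (rule cell[OF 8(1,2,4,5,8)])
    interpret n: comp_sys_cell Y Z g1 g2 \<eta> by (rule cell[OF 8(2,3,6,7,9)])
    have g1f1: "Comp PreOrb X Y Z g1 f1 \<in> Hom PreOrb X Z" and g2f2: "Comp PreOrb X Y Z g2 f2 \<in> Hom PreOrb X Z"
      using C.Comp_in 8 by blast+
    interpret h: comp_sys_cell X Z "Comp PreOrb X Y Z g1 f1" "Comp PreOrb X Y Z g2 f2" "HComp PreOrb X Y Z f1 f2 g1 g2 \<eta> \<delta>"
      by (rule cell[OF 8(1,3) g1f1 g2f2 C.HComp_in[OF 8]])
    have eq: "F_cell X Z (Comp PreOrb X Y Z g1 f1) (Comp PreOrb X Y Z g2 f2) (HComp PreOrb X Y Z f1 f2 g1 g2 \<eta> \<delta>) p =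
        R_m Z (snd (F_mor Y Z g1) (F_cell X Y f1 f2 \<delta> p), F_cell Y Z g1 g2 \<eta> (fst (F_mor X Y f2) p))"
      if pU: "p \<in> pts (U_mfd X)" for p
    proof -
      obtain i x where p: "p = (i, x)" "i \<in> idx X" "x \<in> Dom X i" using pU by (cases p) (auto simp: d.f1.A.pts_U)
      let ?z = "lift g1 (fobj f1 i) (lift f1 i x)" and ?d = "fmor g1 (\<delta> i)" and ?j = "fobj f2 i"
      have j: "fobj f1 i \<in> idx Y" "?j \<in> idx Y" "lift f1 i x \<in> Dom Y (fobj f1 i)" "lift f2 i x \<in> Dom Y ?j"
        using d.f1.compat(3,15) d.f2.compat(3,15) p by auto
      have z: "?z \<in> Dom Z (fobj g1 (fobj f1 i))" using n.f1.compat(15) j by simp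
      have dm: "\<delta> i \<in> embs Y" "esrc (\<delta> i) = fobj f1 i" "etgt (\<delta> i) = ?j" using d.natural(3-5) p by auto
      have gd: "?d \<in> embs Z" "esrc ?d = fobj g1 (fobj f1 i)" "etgt ?d = fobj g1 ?j" using n.f1.compat(4,7,8) dm by auto
      have e: "lift g1 ?j (lift f2 i x) = emap ?d ?z"
        using n.f1.compat(17)[OF dm(1), of "lift f1 i x"] d.natural(6) p dm j by simp
      \<comment> \<open>The second factor is restricted along the image of \<open>\<delta> i\<close> to the source of the first.\<close>
      have 1: "snd (F_mor Y Z g1) (F_cell X Y f1 f2 \<delta> p) = n.f1.B.cls (emb_id Z (fobj g1 (fobj f1 i))) ?d ?z"
        using p d.valid_cell[OF p(2,3)] n.f1.compat(9) j by (simp add: d.alpha_eq)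
      have v: "n.f1.B.valid (emb_id Z (fobj g1 ?j)) (\<eta> ?j) (emap ?d ?z)"
        using n.valid_cell[OF j(2,4)] e by simp
      have "F_cell Y Z g1 g2 \<eta> (fst (F_mor X Y f2) p) = n.f1.B.cls (emb_id Z (fobj g1 ?j)) (\<eta> ?j) (emap ?d ?z)"
        using p j e by (simp add: n.alpha_eq)
      also have "\<dots> = n.f1.B.cls (emb_comp Z (emb_id Z (fobj g1 ?j)) ?d) (emb_comp Z (\<eta> ?j) ?d) ?z"
        by (rule n.f1.B.cls_pull[OF v gd(1)]) (use gd z in simp_all)
      finally have 2: "F_cell Y Z g1 g2 \<eta> (fst (F_mor X Y f2) p) = n.f1.B.cls ?d (emb_comp Z (\<eta> ?j) ?d) ?z"
        using gd by simp
      have "n.f1.B.valid (emb_id Z (fobj g1 (fobj f1 i))) ?d ?z" "n.f1.B.valid ?d (emb_comp Z (\<eta> ?j) ?d) ?z"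
        using gd z j n.f1.compat(3) n.natural(3,4) by (simp_all add: n.f1.B.valid_def)
      then show ?thesis
        unfolding 1 2 using p by (simp add: h.alpha_eq) (simp add: PreOrb_simps)
    qed
    show ?case
      by (subst pairs[of X Y f1], subst pairs[of X Y f2], subst pairs[of Y Z g1], subst pairs[of Y Z g2],
          unfold Grp_simps d.f1.A.F_obj_simps n.f1.B.F_obj_simps)
        (intro extensionalityI[of _ "pts (U_mfd X)"], use eq h.alpha_holomorphic in \<open>auto simp: holomorphic_maps_def\<close>)
  qed
qed

end
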